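(* Every $2$-connected cubic graph $G$ with $\mathrm{df}(G)=3$ and $\pi(G)=5$ is either isomorphic to the Petersen graph $Pg$ or arises from the Petersen graph with a fixed $6$-cycle $C$ by combining the following two operations: (O1) insertion of connected $3$-edge-colourable edge-deleted cubic graphs into any number of edges from $E(Pg)-E(C)$; (O2) correct substitution of any number of vertices from $V(Pg)-V(C)$ with connected vertex-deleted $3$-edge-colourable quasi-bipartite cubic graphs. Conversely, every cubic graph constructed from the Petersen graph with a fixed $6$-cycle $C$ by means of operations (O1) and (O2) has $\mathrm{df}=3$ and perfect matching index $5$, and $C$ is a hexagonal core of the resulting graph.
   Context: Graphs are finite; loops and multiple edges are allowed. A $3$-array of a bridgeless cubic graph $H$ is a set of three perfect matchings; an edge is uncovered if in none of them and simply covered if in exactly one. The colouring defect $\mathrm{df}(H)$ is the minimum number of uncovered edges over all $3$-arrays; a $3$-array attaining it is optimal; its core is the subgraph formed by all edges not simply covered. If $\mathrm{df}(H)=3$ the core of every optimal $3$-array is an induced $6$-cycle, called a hexagonal core. The perfect matching index $\pi(G)$ is the smallest number of perfect matchings whose union is $E(G)$. For $2$-connected cubic graphs $H,K$: a $2$-sum $H\oplus_2 K$ with distinguished edges $e\in E(H)$, $f\in E(K)$ deletes $e,f$ and joins the $2$-valent vertices of $H-e$ to those of $K-f$ by two new independent edges; a $3$-sum $H\oplus_3 K$ with distinguished vertices $u,v$ deletes $u,v$ and joins the three dangling edge-ends formerly at $u$ bijectively to those formerly at $v$. Inserting the edge-deleted graph $K-f$ into an edge $e$ of $H$ means forming $H\oplus_2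 K$ with distinguished edges $e,f$ ($K$ $2$-connected cubic). Substituting a vertex $u$ of $H$ with $K-v$ means forming $H\oplus_3 K$ with distinguished vertices $u,v$ ($K$ $2$-connected cubic). A $2$-connected cubic graph $K$ is quasi-bipartite if it has an independent vertex set $U$ with $|U|\ge 2$ such that contracting each component of $K-U$ to a vertex gives a bipartite cubic graph (possibly with multiple edges) with partite sets $U$ and the contracted vertices; $U$ is a bipartising set. A substitution of $u$ with $K-v$, $K$ quasi-bipartite, is correct if $K$ has a bipartising set $U$ such that $\{v\}$ is a component of $K-U$. In the operations, the edges and vertices of $Pg$ outside $C$ are kept (with their identity) in the intermediate graphs, so that subsequent operations may be applied to them. *)

theory Defs
  imports Main
begin

section \<open>Finite multigraphs (loops and parallel edges allowed)\<close>

text \<open>A graph is given by a vertex set, an edge set, and for every edge its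
  (unordered) pair of end-vertices, stored as an ordered pair.  A loop has
  equal ends and contributes 2 to the degree.\<close>

record ('v, 'e) graph =
  verts :: "'v set"
  edges :: "'e set"
  ends  :: "'e \<Rightarrow> 'v \<times> 'v"

definition endpts :: "('v,'e) graph \<Rightarrow> 'e \<Rightarrow> 'v set" where
  "endpts G e = {fst (ends G e), snd (ends G e)}"

definition wf_graph :: "('v,'e) graph \<Rightarrow> bool" where
  "wf_graph G \<longleftrightarrow> finite (verts G) \<and> finite (edges G) \<and>
     (\<forall>e\<in>edges G. fst (ends G e) \<in> verts G \<and> snd (ends G e) \<in> verts G)"

definition degree :: "('v,'e) graph \<Rightarrow> 'v \<Rightarrow> nat" where
  "degree G v = card {e\<in>edges G. fst (ends G e) = v} + card {e\<in>edges G. snd (ends G e) = v}"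

definition cubic :: "('v,'e) graph \<Rightarrow> bool" where
  "cubic G \<longleftrightarrow> wf_graph G \<and> (\<forall>v\<in>verts G. degree G v = 3)"

definition del_edge :: "('v,'e) graph \<Rightarrow> 'e \<Rightarrow> ('v,'e) graph" where
  "del_edge G e = G\<lparr>edges := edges G - {e}\<rparr>"

definition del_vert :: "('v,'e) graph \<Rightarrow> 'v \<Rightarrow> ('v,'e) graph" where
  "del_vert G v = G\<lparr>verts := verts G - {v}, edges := {e\<in>edges G. v \<notin> endpts G e}\<rparr>"

definition adj :: "('v,'e) graph \<Rightarrow> ('v \<times> 'v) set" where
  "adj G = {(x,y). \<exists>e\<in>edges G. ends G e = (x,y) \<or> ends G e = (y,x)}"

definition connected :: "('v,'e) graph \<Rightarrow> bool" where
  "connected G \<longleftrightarrow> verts G \<noteq> {} \<and> (\<forall>x\<in>verts G. \<forall>y\<in>verts G. (x,y) \<in> (adj G)\<^sup>*)"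

text \<open>2-connected: connected, and stays connected after deleting any single
  vertex or any single edge (for cubic graphs: connected and bridgeless,
  without cut vertices).\<close>
definition two_connected :: "('v,'e) graph \<Rightarrow> bool" where
  "two_connected G \<longleftrightarrow> connected G \<and> (\<forall>v\<in>verts G. connected (del_vert G v))
     \<and> (\<forall>e\<in>edges G. connected (del_edge G e))"

definition isomorphic :: "('v,'e) graph \<Rightarrow> ('w,'f) graph \<Rightarrow> bool" where
  "isomorphic G H \<longleftrightarrow> (\<exists>f g. bij_betw f (verts G) (verts H) \<and> bij_betw g (edges G) (edges H) \<and>
     (\<forall>e\<in>edges G. ends H (g e) = map_prod f f (ends G e) \<or>
                   ends H (g e) = prod.swap (map_prod f f (ends G e))))"

section \<open>Perfect matchings, 3-arrays, colouring defect, perfect matching index\<close>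

definition perfect_matching :: "('v,'e) graph \<Rightarrow> 'e set \<Rightarrow> bool" where
  "perfect_matching G M \<longleftrightarrow> M \<subseteq> edges G \<and> (\<forall>e\<in>M. fst (ends G e) \<noteq> snd (ends G e)) \<and>
     (\<forall>v\<in>verts G. card {e\<in>M. v \<in> endpts G e} = 1)"

text \<open>A 3-array: three perfect matchings (as an ordered triple).\<close>
definition three_array :: "('v,'e) graph \<Rightarrow> 'e set \<times> 'e set \<times> 'e set \<Rightarrow> bool" where
  "three_array G A \<longleftrightarrow> perfect_matching G (fst A) \<and> perfect_matching G (fst (snd A)) \<and>
     perfect_matching G (snd (snd A))"

definition cover_count :: "'e set \<times> 'e set \<times> 'e set \<Rightarrow> 'e \<Rightarrow> nat" where
  "cover_count A e = (if e \<in> fst A then 1 else 0) + (if e \<in> fst (snd A) then 1 else 0)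
     + (if e \<in> snd (snd A) then 1 else 0)"

definition uncovered :: "('v,'e) graph \<Rightarrow> 'e set \<times> 'e set \<times> 'e set \<Rightarrow> 'e set" where
  "uncovered G A = {e\<in>edges G. cover_count A e = 0}"

definition df :: "('v,'e) graph \<Rightarrow> nat" where
  "df G = Min ((\<lambda>A. card (uncovered G A)) ` {A. three_array G A})"

definition optimal_array :: "('v,'e) graph \<Rightarrow> 'e set \<times> 'e set \<times> 'e set \<Rightarrow> bool" where
  "optimal_array G A \<longleftrightarrow> three_array G A \<and> card (uncovered G A) = df G"

text \<open>Core of a 3-array: (the subgraph formed by) the edges not simply covered.\<close>
definition core :: "('v,'e) graph \<Rightarrow> 'e set \<times> 'e set \<times> 'e set \<Rightarrow> 'e set" where
  "core G A = {e\<in>edges G. cover_count A e \<noteq> 1}"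

text \<open>An edge set is a hexagonal core of G (df G = 3) if it is the core of some
  optimal 3-array.\<close>
definition hexagonal_core :: "('v,'e) graph \<Rightarrow> 'e set \<Rightarrow> bool" where
  "hexagonal_core G S \<longleftrightarrow> (\<exists>A. optimal_array G A \<and> core G A = S)"

definition pm_index :: "('v,'e) graph \<Rightarrow> nat" where
  "pm_index G = (LEAST n. \<exists>Ms. length Ms = n \<and> (\<forall>M\<in>set Ms. perfect_matching G M) \<and>
      \<Union>(set Ms) = edges G)"

definition three_edge_colourable :: "('v,'e) graph \<Rightarrow> bool" where
  "three_edge_colourable G \<longleftrightarrow> (\<exists>c :: 'e \<Rightarrow> nat.
     (\<forall>e\<in>edges G. c e < 3 \<and> fst (ends G e) \<noteq> snd (ends G e)) \<and>
     (\<forall>e\<in>edges G. \<forall>e'\<in>edges G. e \<noteq> e' \<and> endpts G e \<inter> endpts G e' \<noteq> {} \<longrightarrow> c e \<noteq> c e'))"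

section \<open>Quasi-bipartite graphs\<close>

definition induced :: "('v,'e) graph \<Rightarrow> 'v set \<Rightarrow> ('v,'e) graph" where
  "induced G S = G\<lparr>verts := S, edges := {e\<in>edges G. endpts G e \<subseteq> S}\<rparr>"

text \<open>Components of the subgraph induced by S (e.g. S = V(K) - U gives K - U).\<close>
definition comps :: "('v,'e) graph \<Rightarrow> 'v set \<Rightarrow> 'v set set" where
  "comps G S = {{y\<in>S. (x,y) \<in> (adj (induced G S))\<^sup>*} | x. x \<in> S}"

definition block :: "('v,'e) graph \<Rightarrow> 'v set \<Rightarrow> 'v \<Rightarrow> 'v set" where
  "block G U x = (if x \<in> U then {x} else {y\<in>verts G - U. (x,y) \<in> (adj (induced G (verts G - U)))\<^sup>*})"

text \<open>Contract each component of G - U to a single vertex (vertices of U are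
  represented by singletons, components by themselves).\<close>
definition contract :: "('v,'e) graph \<Rightarrow> 'v set \<Rightarrow> ('v set, 'e) graph" where
  "contract G U = \<lparr>verts = (\<lambda>u. {u}) ` U \<union> comps G (verts G - U),
     edges = {e\<in>edges G. block G U (fst (ends G e)) \<noteq> block G U (snd (ends G e))},
     ends = (\<lambda>e. (block G U (fst (ends G e)), block G U (snd (ends G e))))\<rparr>"

definition bipartite_cubic_parts :: "('v,'e) graph \<Rightarrow> 'v set \<Rightarrow> 'v set \<Rightarrow> bool" where
  "bipartite_cubic_parts H P Q \<longleftrightarrow> cubic H \<and> P \<inter> Q = {} \<and> P \<union> Q = verts H \<and>
     (\<forall>e\<in>edges H. (fst (ends H e) \<in> P \<and> snd (ends H e) \<in> Q) \<or>
                   (fst (ends H e) \<in> Q \<and> snd (ends H e) \<in> P))"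

definition independent :: "('v,'e) graph \<Rightarrow> 'v set \<Rightarrow> bool" where
  "independent G U \<longleftrightarrow> U \<subseteq> verts G \<and> (\<forall>e\<in>edges G. \<not> endpts G e \<subseteq> U)"

definition bipartising_set :: "('v,'e) graph \<Rightarrow> 'v set \<Rightarrow> bool" where
  "bipartising_set K U \<longleftrightarrow> independent K U \<and> card U \<ge> 2 \<and>
     bipartite_cubic_parts (contract K U) ((\<lambda>u. {u}) ` U) (comps K (verts K - U))"

definition quasi_bipartite :: "('v,'e) graph \<Rightarrow> bool" where
  "quasi_bipartite K \<longleftrightarrow> cubic K \<and> two_connected K \<and> (\<exists>U. bipartising_set K U)"

text \<open>Correctness condition of a substitution with K - v.\<close>
definition correct_for :: "('v,'e) graph \<Rightarrow> 'v \<Rightarrow> bool" where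
  "correct_for K v \<longleftrightarrow> (\<exists>U. bipartising_set K U \<and> {v} \<in> comps K (verts K - U))"

section \<open>2-sums and 3-sums keeping the identity of the elements of the host graph\<close>

text \<open>insertion G e K f G': G' is H (+)_2 K with distinguished edges e, f, where the
  vertices and the edges other than e of G keep their names, and a copy of
  K - f (via phi, psi) together with two new edges a, b is added.\<close>
definition insertion :: "('v,'e) graph \<Rightarrow> 'e \<Rightarrow> ('w,'f) graph \<Rightarrow> 'f \<Rightarrow> ('v,'e) graph \<Rightarrow> bool" where
  "insertion G e K f G' \<longleftrightarrow> e \<in> edges G \<and> f \<in> edges K \<and>
    (\<exists>(\<phi> :: 'w \<Rightarrow> 'v) (\<psi> :: 'f \<Rightarrow> 'e) a b.
       inj_on \<phi> (verts K) \<and> \<phi> ` verts K \<inter> verts G = {} \<and>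
       inj_on \<psi> (edges K - {f}) \<and> \<psi> ` (edges K - {f}) \<inter> edges G = {} \<and>
       a \<noteq> b \<and> a \<notin> edges G \<union> \<psi> ` (edges K - {f}) \<and> b \<notin> edges G \<union> \<psi> ` (edges K - {f}) \<and>
       verts G' = verts G \<union> \<phi> ` verts K \<and>
       edges G' = (edges G - {e}) \<union> \<psi> ` (edges K - {f}) \<union> {a, b} \<and>
       (\<forall>x\<in>edges G - {e}. ends G' x = ends G x) \<and>
       (\<forall>x\<in>edges K - {f}. ends G' (\<psi> x) = map_prod \<phi> \<phi> (ends K x)) \<and>
       ((ends G' a = (fst (ends G e), \<phi> (fst (ends K f))) \<and>
         ends G' b = (snd (ends G e), \<phi> (snd (ends K f)))) \<or>
        (ends G' a = (fst (ends G e), \<phi> (snd (ends K f))) \<and>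
         ends G' b = (snd (ends G e), \<phi> (fst (ends K f))))))"

definition other_end :: "('v,'e) graph \<Rightarrow> 'e \<Rightarrow> 'v \<Rightarrow> 'v" where
  "other_end G e x = (if fst (ends G e) = x then snd (ends G e) else fst (ends G e))"

definition repl_end :: "'v \<Rightarrow> 'v \<Rightarrow> 'v \<times> 'v \<Rightarrow> 'v \<times> 'v" where
  "repl_end u w p = (if fst p = u then (w, snd p) else (fst p, w))"

text \<open>substitution G u K v G': G' is G (+)_3 K with distinguished vertices u, v;
  the vertices other than u and all edges of G keep their names (the three edges
  formerly at u get their u-end re-attached, via the bijection sigma, to the
  neighbours of v in the copy of K - v).\<close>
definition substitution :: "('v,'e) graph \<Rightarrow> 'v \<Rightarrow> ('w,'f) graph \<Rightarrow> 'w \<Rightarrow> ('v,'e) graph \<Rightarrow> bool" where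
  "substitution G u K v G' \<longleftrightarrow> u \<in> verts G \<and> v \<in> verts K \<and>
    (let A = {a\<in>edges G. u \<in> endpts G a}; B = {b\<in>edges K. v \<in> endpts K b} in
     card A = 3 \<and> card B = 3 \<and>
     (\<forall>a\<in>A. fst (ends G a) \<noteq> snd (ends G a)) \<and> (\<forall>b\<in>B. fst (ends K b) \<noteq> snd (ends K b)) \<and>
     (\<exists>(\<sigma> :: 'e \<Rightarrow> 'f) (\<phi> :: 'w \<Rightarrow> 'v) (\<psi> :: 'f \<Rightarrow> 'e).
        bij_betw \<sigma> A B \<and>
        inj_on \<phi> (verts K - {v}) \<and> \<phi> ` (verts K - {v}) \<inter> verts G = {} \<and>
        inj_on \<psi> (edges K - B) \<and> \<psi> ` (edges K - B) \<inter> edges G = {} \<and>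
        verts G' = (verts G - {u}) \<union> \<phi> ` (verts K - {v}) \<and>
        edges G' = edges G \<union> \<psi> ` (edges K - B) \<and>
        (\<forall>x\<in>edges G - A. ends G' x = ends G x) \<and>
        (\<forall>a\<in>A. ends G' a = repl_end u (\<phi> (other_end K (\<sigma> a) v)) (ends G a)) \<and>
        (\<forall>x\<in>edges K - B. ends G' (\<psi> x) = map_prod \<phi> \<phi> (ends K x))))"

section \<open>The Petersen graph with a fixed 6-cycle C\<close>

text \<open>Vertices 0..4 outer 5-cycle, 5..9 inner pentagram; edges 0..4 outer,
  5..9 spokes, 10..14 inner.\<close>
definition Pg :: "(nat, nat) graph" where
  "Pg = \<lparr>verts = {0..<10}, edges = {0..<15},
         ends = (\<lambda>e. if e < 5 then (e, (e + 1) mod 5)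
                     else if e < 10 then (e - 5, e)
                     else (e - 5, 5 + ((e - 10 + 2) mod 5)))\<rparr>"

text \<open>The 6-cycle C = 0-1-2-7-9-4-0.\<close>
definition C_verts :: "nat set" where "C_verts = {0, 1, 2, 7, 9, 4}"
definition C_edges :: "nat set" where "C_edges = {0, 1, 7, 12, 9, 4}"

section \<open>Graphs constructed from Pg by operations (O1) and (O2)\<close>

inductive pg_constr :: "(nat, nat) graph \<Rightarrow> bool" where
  base: "pg_constr Pg"
| O1: "\<lbrakk> pg_constr G; cubic G; two_connected G;
         e \<in> edges Pg - C_edges;
         cubic K; two_connected K; connected K; three_edge_colourable K;
         insertion G e (K :: (nat, nat) graph) f G';
         (verts G' - verts G) \<inter> verts Pg = {}; (edges G' - edges G) \<inter> edges Pg = {} \<rbrakk>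
       \<Longrightarrow> pg_constr G'"
| O2: "\<lbrakk> pg_constr G; cubic G; two_connected G;
         u \<in> verts Pg - C_verts;
         cubic K; two_connected K; connected K; three_edge_colourable K;
         quasi_bipartite K; correct_for K v;
         substitution G u (K :: (nat, nat) graph) v G';
         (verts G' - verts G) \<inter> verts Pg = {}; (edges G' - edges G) \<inter> edges Pg = {} \<rbrakk>
       \<Longrightarrow> pg_constr G'"

end

theory Submission
  imports Defs
begin

text \<open>
  Necessity. The core of an optimal array is an induced hexagon \<open>T\<close>, the array colours the edges off \<open>T\<close>
  properly, and \<open>\<pi> = 5\<close> forces that \<open>G - T\<close> has no perfect matching. Only six edges leave \<open>T\<close>, so a Tutte
  barrier \<open>S\<close> of \<open>G - T\<close> is tight: \<open>S\<close> is independent, and \<open>G - T - S\<close> has exactly \<open>|S| + 2\<close> components, all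
  with 3-edge cuts. A matching and colouring argument on this bipartite structure finds, for each pair of
  opposite edges of \<open>cut(T)\<close>, a 3-edge cut that contains this pair; uncrossing these cuts
  partitions the vertices into ten parts that are joined like the
  vertices of the Petersen graph, those on \<open>C\<close> being single vertices.

  Consider a part with more than one vertex. If two edges of its cut meet in the part, then the rest of the part
  has a 2-edge cut and arises by insertion. Otherwise it arises by substitution, and the substitution is correct:
  a set of edges that contains the whole cut of the part and covers every vertex of the part once would yield four
  perfect matchings covering \<open>G\<close>, so the tight barrier of the part without the three attaching vertices
  is a bipartising set. Contracting the part and induction give the construction.

  Sufficiency. Correctness means that a perfect matching meets the cut of a substituted part once, not three
  times. Hence perfect matchings of the constructed graph project to the Petersen graph, which gives the lower bounds
  on the defect and on the perfect matching index; optimal arrays and covers lift by the 3-edge-colourings.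
\<close>

section \<open>Cuts and incidence counts\<close>

text \<open>The uncovered edges match \<open>T\<close> perfectly, so with a perfect matching of
  \<open>G - T\<close> they would form a fourth perfect matching containing exactly what the array
  misses; this is where \<open>\<pi> = 5\<close> enters. From the defect, only the hexagon and the
  lack of a 3-edge-colouring are used afterwards. For opposite edges of \<open>cut(T)\<close>,
  Hall's condition on the barrier decides. A violator yields a 3-edge cut through both edges. A
  system of distinct representatives is a colour class whose complement becomes 2-regular once the
  other four edges leaving \<open>T\<close> are paired up, and the resulting colouring would extend
  to \<open>T\<close>. The constants come from one fact: the Petersen graph has six perfect
  matchings, any two share exactly one edge, and each edge lies in exactly two. It gives the bounds
  3 and 5, the optimal array, the 5-cover and the patterns behind the four perfect matchings. What
  shapes the reassembly is naming: the operations act on elements named as in \<open>Pg\<close>, so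
  the induction must promise which names survive. Charging each edge outside \<open>C\<close> to one
  part prevents two insertions into the same edge.\<close>

definition star :: "('v,'e) graph \<Rightarrow> 'v \<Rightarrow> 'e set" where
  "star G v = {e\<in>edges G. v \<in> endpts G e}"

definition inside :: "('v,'e) graph \<Rightarrow> 'v set \<Rightarrow> 'e set" where
  "inside G W = {e\<in>edges G. endpts G e \<subseteq> W}"

definition cut :: "('v,'e) graph \<Rightarrow> 'v set \<Rightarrow> 'e set" where
  "cut G W = {e\<in>edges G. (fst (ends G e) \<in> W) \<noteq> (snd (ends G e) \<in> W)}"

text \<open>Edges of \<open>F\<close> that leave \<open>W\<close> count too, so a perfect matching
  of the whole graph restricts to such a set; demanding \<open>F \<subseteq> inside G W\<close> in
  addition gives a perfect matching of the part itself.\<close>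

definition covers_once :: "('v,'e) graph \<Rightarrow> 'e set \<Rightarrow> 'v set \<Rightarrow> bool" where
  "covers_once G F W \<longleftrightarrow> (\<forall>v\<in>W. card (F \<inter> star G v) = 1)"

text \<open>Properness with the colours 0, 1, 2 at vertices of degree three. An edge of the cut is
  constrained only at its end in \<open>W\<close>, so disjoint parts can be recoloured
  separately.\<close>

definition proper_on :: "('v,'e) graph \<Rightarrow> ('e \<Rightarrow> nat) \<Rightarrow> 'v set \<Rightarrow> bool" where
  "proper_on G c W \<longleftrightarrow> (\<forall>v\<in>W. bij_betw c (star G v) {..<3})"

lemma star_subset: "star G v \<subseteq> edges G"
  by (auto simp: star_def)

lemma cut_subset: "cut G W \<subseteq> edges G"
  by (auto simp: cut_def)

lemma inside_subset: "inside G W \<subseteq> edges G"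
  by (auto simp: inside_def)

lemma in_star_iff: "e \<in> star G v \<longleftrightarrow> e \<in> edges G \<and> (fst (ends G e) = v \<or> snd (ends G e) = v)"
  by (auto simp: star_def endpts_def)

lemma in_inside_iff:
  "e \<in> inside G W \<longleftrightarrow> e \<in> edges G \<and> fst (ends G e) \<in> W \<and> snd (ends G e) \<in> W"
  by (auto simp: inside_def endpts_def)

lemma in_cut_iff:
  "e \<in> cut G W \<longleftrightarrow> e \<in> edges G \<and> (fst (ends G e) \<in> W) \<noteq> (snd (ends G e) \<in> W)"
  by (auto simp: cut_def)

lemma cut_inside_disjoint: "cut G W \<inter> inside G W = {}"
  by (auto simp: in_cut_iff in_inside_iff)

lemma star_subset_cut_inside: "v \<in> W \<Longrightarrow> star G v \<subseteq> cut G W \<union> inside G W"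
  by (auto simp: in_cut_iff in_inside_iff in_star_iff)

lemma cut_starE:
  assumes "e \<in> cut G W"
  obtains v w where "v \<in> W" "w \<notin> W" "e \<in> star G v" "e \<in> star G w" "endpts G e = {v, w}"
  using assms by (cases "fst (ends G e) \<in> W") (auto simp: in_cut_iff in_star_iff endpts_def)

lemma covers_once_mono: "covers_once G F W \<Longrightarrow> X \<subseteq> W \<Longrightarrow> covers_once G F X"
  by (auto simp: covers_once_def)

lemma proper_on_mono: "proper_on G c W \<Longrightarrow> X \<subseteq> W \<Longrightarrow> proper_on G c X"
  by (auto simp: proper_on_def)

lemma adj_sym: "(x, y) \<in> adj G \<Longrightarrow> (y, x) \<in> adj G"
  by (auto simp: adj_def)

lemma adj_rtrancl_sym: "(x, y) \<in> (adj G)\<^sup>* \<Longrightarrow> (y, x) \<in> (adj G)\<^sup>*"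
  by (meson adj_sym symI sym_rtrancl symD)

lemma adj_rtrancl_cut:
  assumes "(x, y) \<in> (adj G)\<^sup>*" "x \<in> W" "y \<notin> W"
  shows "cut G W \<noteq> {}"
  using assms
proof (induction rule: rtrancl_induct)
  case base then show ?case by simp
next
  case (step y z)
  show ?case
  proof (cases "y \<in> W")
    case True
    have "cut G W \<noteq> {}" if "e \<in> edges G" "ends G e = (y, z) \<or> ends G e = (z, y)" for e
    proof -
      have "e \<in> cut G W" using that True step.prems by (auto simp: in_cut_iff)
      then show ?thesis by blast
    qed
    then show ?thesis using step.hyps(2) by (auto simp: adj_def)
  qed (use step in auto)
qed

lemma connected_cut:
  assumes "connected G" "W \<subseteq> verts G" "W \<noteq> {}" "W \<noteq> verts G"
  shows "cut G W \<noteq> {}"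
proof -
  obtain x y where "x \<in> W" "y \<in> verts G" "y \<notin> W" using assms by blast
  moreover have "(x, y) \<in> (adj G)\<^sup>*" using assms calculation by (auto simp: connected_def)
  ultimately show ?thesis by (metis adj_rtrancl_cut)
qed

lemma connectedI_cut:
  assumes "wf_graph G" "verts G \<noteq> {}"
    and c: "\<And>W. W \<subseteq> verts G \<Longrightarrow> W \<noteq> {} \<Longrightarrow> W \<noteq> verts G \<Longrightarrow> cut G W \<noteq> {}"
  shows "connected G"
  unfolding connected_def
proof (intro conjI ballI)
  fix x y assume x: "x \<in> verts G" and y: "y \<in> verts G"
  define W where "W = {z\<in>verts G. (x, z) \<in> (adj G)\<^sup>*}"
  show "(x, y) \<in> (adj G)\<^sup>*"
  proof (rule ccontr)
    assume "(x, y) \<notin> (adj G)\<^sup>*"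
    then have "y \<notin> W" by (simp add: W_def)
    moreover have "x \<in> W" using x by (simp add: W_def)
    ultimately have "cut G W \<noteq> {}" using y by (intro c) (auto simp: W_def)
    then obtain e where e: "e \<in> cut G W" by blast
    then obtain v w where vw: "v \<in> W" "w \<notin> W" "endpts G e = {v, w}" by (metis cut_starE)
    have ee: "e \<in> edges G" using e by (simp add: in_cut_iff)
    have "(v, w) \<in> adj G" using vw ee
      by (auto simp: adj_def endpts_def doubleton_eq_iff prod_eq_iff)
    moreover have "w \<in> verts G" using vw ee assms(1)
      by (auto simp: wf_graph_def endpts_def doubleton_eq_iff)
    ultimately have "w \<in> W" using vw by (auto simp: W_def intro: rtrancl_into_rtrancl)
    then show False using vw by simp
  qed
qed (use assms in auto)

section \<open>Double counting of incidences in loopless graphs\<close>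

locale loopless_graph =
  fixes G :: "('v, 'e) graph"
  assumes wf: "wf_graph G"
    and loopless: "e \<in> edges G \<Longrightarrow> fst (ends G e) \<noteq> snd (ends G e)"
begin

lemma finite_verts: "finite (verts G)" and finite_edges: "finite (edges G)"
  using wf by (auto simp: wf_graph_def)

lemma ends_in_verts: "e \<in> edges G \<Longrightarrow> fst (ends G e) \<in> verts G \<and> snd (ends G e) \<in> verts G"
  using wf by (auto simp: wf_graph_def)

lemma endpts_subset: "e \<in> edges G \<Longrightarrow> endpts G e \<subseteq> verts G"
  using ends_in_verts by (auto simp: endpts_def)

lemma finite_star: "finite (star G v)"
  using finite_edges star_subset by (metis finite_subset)

lemma finite_cut: "finite (cut G W)"
  using finite_edges cut_subset by (metis finite_subset)

lemma finite_inside: "finite (inside G W)"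
  using finite_edges inside_subset by (metis finite_subset)

lemma card_endpts: "e \<in> edges G \<Longrightarrow> card (endpts G e) = 2"
  using loopless by (auto simp: endpts_def)

lemma degree_star: "degree G v = card (star G v)"
proof -
  have "star G v = {e\<in>edges G. fst (ends G e) = v} \<union> {e\<in>edges G. snd (ends G e) = v}"
    by (auto simp: in_star_iff)
  moreover have "{e\<in>edges G. fst (ends G e) = v} \<inter> {e\<in>edges G. snd (ends G e) = v} = {}"
    using loopless by (auto dest!: loopless)
  ultimately show ?thesis unfolding degree_def
    using finite_edges by (simp add: card_Un_disjoint)
qed

text \<open>Each edge of \<open>F\<close> is counted once per end in \<open>W\<close>. With
  \<open>F\<close> a perfect matching, a colour class or the whole edge set, this is the source of
  the parity arguments below.\<close>

lemma incidence_count: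
  assumes "finite W" "F \<subseteq> edges G"
  shows "(\<Sum>v\<in>W. card (F \<inter> star G v)) = 2 * card (F \<inter> inside G W) + card (F \<inter> cut G W)"
proof -
  have F: "finite F" using assms finite_edges finite_subset by blast
  have "(\<Sum>v\<in>W. card (F \<inter> star G v)) = (\<Sum>v\<in>W. \<Sum>e\<in>F. if v \<in> endpts G e then 1 else 0)"
  proof (rule sum.cong[OF refl])
    fix v
    have "F \<inter> star G v = {e\<in>F. v \<in> endpts G e}" using assms by (auto simp: star_def)
    then show "card (F \<inter> star G v) = (\<Sum>e\<in>F. if v \<in> endpts G e then 1 else 0)"
      using F by (simp add: sum.If_cases Int_def)
  qed
  also have "\<dots> = (\<Sum>e\<in>F. \<Sum>v\<in>W. if v \<in> endpts G e then 1 else 0)" by (rule sum.swap)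
  also have "\<dots> = (\<Sum>e\<in>F. 2 * (if e \<in> inside G W then 1 else 0) + (if e \<in> cut G W then 1 else 0))"
  proof (rule sum.cong[OF refl])
    fix e assume "e \<in> F"
    then have e: "e \<in> edges G" "fst (ends G e) \<noteq> snd (ends G e)" using assms loopless by auto
    have "(\<Sum>v\<in>W. if v \<in> endpts G e then 1 else 0) = card (W \<inter> endpts G e)"
      using assms(1) by (simp add: sum.If_cases Int_def)
    also have "\<dots> = 2 * (if e \<in> inside G W then 1 else 0) + (if e \<in> cut G W then 1 else 0)"
      using e by (cases "fst (ends G e) \<in> W"; cases "snd (ends G e) \<in> W")
        (auto simp: in_inside_iff in_cut_iff endpts_def Int_insert_right)
    finally show "(\<Sum>v\<in>W. if v \<in> endpts G e then 1 else 0)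
        = 2 * (if e \<in> inside G W then 1 else 0) + (if e \<in> cut G W then 1 else (0::nat))" .
  qed
  also have "\<dots> = 2 * card (F \<inter> inside G W) + card (F \<inter> cut G W)"
    using F by (simp add: sum.distrib sum_distrib_left[symmetric] sum.If_cases)
  finally show ?thesis .
qed

lemma covers_once_count:
  assumes "finite W" "F \<subseteq> edges G" "covers_once G F W"
  shows "card W = 2 * card (F \<inter> inside G W) + card (F \<inter> cut G W)"
proof -
  have "card W = (\<Sum>v\<in>W. card (F \<inter> star G v))"
    using assms(3) by (simp add: covers_once_def)
  then show ?thesis using incidence_count[OF assms(1,2)] by simp
qed

lemma perfect_matching_iff:
  "perfect_matching G M \<longleftrightarrow> M \<subseteq> edges G \<and> covers_once G M (verts G)"
proof -
  have "M \<subseteq> edges G \<Longrightarrow> {e\<in>M. v \<in> endpts G e} = M \<inter> star G v" for v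
    by (auto simp: star_def)
  then show ?thesis using loopless by (auto simp: perfect_matching_def covers_once_def)
qed

lemma colour_class_covers_once:
  assumes "proper_on G c W" "i < 3"
  shows "covers_once G {e\<in>edges G. c e = i} W"
  unfolding covers_once_def
proof
  fix v assume "v \<in> W"
  then have b: "bij_betw c (star G v) {..<3}" using assms by (auto simp: proper_on_def)
  then obtain e where e: "e \<in> star G v" "c e = i" using assms(2)
    by (metis bij_betw_iff_bijections lessThan_iff)
  have "{e\<in>edges G. c e = i} \<inter> star G v = {e}"
    using e b star_subset[of G v] by (auto simp: bij_betw_def dest: inj_onD)
  then show "card ({e\<in>edges G. c e = i} \<inter> star G v) = 1" by simp
qed

lemma endpts_other_end:
  "e \<in> star G v \<Longrightarrow> endpts G e = {v, other_end G e v} \<and> other_end G e v \<noteq> v \<and> other_end G e v \<in> verts G"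
  using loopless ends_in_verts by (fastforce simp: in_star_iff endpts_def other_end_def)

lemma covers_once_unique:
  assumes "covers_once G F W" "v \<in> W" "e \<in> F" "e' \<in> F" "e \<in> star G v" "e' \<in> star G v"
  shows "e = e'"
proof -
  have "card (F \<inter> star G v) = 1" using assms by (auto simp: covers_once_def)
  then show ?thesis using assms(3-) by (metis IntI card_1_singletonE singletonD)
qed

lemma covers_once_ex:
  assumes "covers_once G F W" "v \<in> W"
  obtains e where "e \<in> F" "e \<in> star G v"
proof -
  have "card (F \<inter> star G v) = 1" using assms by (auto simp: covers_once_def)
  then show ?thesis using that by (metis IntE card_1_singletonE singletonI)
qed

end

text \<open>Two-connectedness in the form that the counting arguments need, a lower bound on cuts.
  For cubic graphs it agrees with \<open>two_connected\<close>: one direction is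
  \<open>bridgeless_cubicI\<close>, the other is proved inside this locale.\<close>

locale bridgeless_cubic =
  fixes G :: "('v, 'e) graph"
  assumes cubic: "cubic G" and nonempty: "verts G \<noteq> {}"
    and cut_ge2: "\<lbrakk>W \<subseteq> verts G; W \<noteq> {}; W \<noteq> verts G\<rbrakk> \<Longrightarrow> 2 \<le> card (cut G W)"

sublocale bridgeless_cubic \<subseteq> loopless_graph
proof
  show wf: "wf_graph G" using cubic by (simp add: cubic_def)
  fix e assume e: "e \<in> edges G"
  show "fst (ends G e) \<noteq> snd (ends G e)"
  proof
    \<comment> \<open>A loop uses two of the three incidences at \<open>v\<close>, so at most one
      edge leaves \<open>v\<close>. If \<open>v\<close> is the only vertex, its degree is twice the
      number of edges and cannot be 3.\<close>
    assume loop: "fst (ends G e) = snd (ends G e)"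
    define v where "v = fst (ends G e)"
    define A where "A = {e\<in>edges G. fst (ends G e) = v}"
    define B where "B = {e\<in>edges G. snd (ends G e) = v}"
    have v: "v \<in> verts G" using e wf by (auto simp: wf_graph_def v_def)
    have fin: "finite A" "finite B" using wf by (auto simp: A_def B_def wf_graph_def)
    have deg: "card A + card B = 3"
      using cubic v by (auto simp: cubic_def degree_def A_def B_def)
    have cut: "cut G {v} = (A - B) \<union> (B - A)" by (auto simp: in_cut_iff A_def B_def)
    have "e \<in> A \<inter> B" using e loop by (auto simp: A_def B_def v_def)
    then have "card (A \<inter> B) \<ge> 1" using fin by (metis card_gt_0_iff empty_iff finite_Int less_eq_Suc_le One_nat_def)
    moreover have "card A = card (A - B) + card (A \<inter> B)" "card B = card (B - A) + card (A \<inter> B)"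
      using fin by (metis card_Int_Diff add.commute, metis card_Int_Diff add.commute Int_commute)
    moreover have "card (cut G {v}) = card (A - B) + card (B - A)"
      unfolding cut using fin by (intro card_Un_disjoint) auto
    ultimately have le: "card (cut G {v}) \<le> 1" using deg by simp
    show False
    proof (cases "verts G = {v}")
      case True
      then have "A = edges G" "B = edges G" using wf by (auto simp: A_def B_def wf_graph_def)
      then show False using deg by simp presburger
    next
      case False
      then show False using cut_ge2[of "{v}"] v le by auto
    qed
  qed
qed

context bridgeless_cubic
begin

lemma card_star: "v \<in> verts G \<Longrightarrow> card (star G v) = 3"
  using cubic degree_star by (simp add: cubic_def)

lemma degree_count:
  assumes "W \<subseteq> verts G"
  shows "3 * card W = 2 * card (inside G W) + card (cut G W)"
proof -
  have fin: "finite W" using assms finite_verts finite_subset by blast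
  have "(\<Sum>v\<in>W. card (edges G \<inter> star G v)) = (\<Sum>v\<in>W. 3)"
  proof (rule sum.cong[OF refl])
    fix v assume "v \<in> W"
    moreover have "edges G \<inter> star G v = star G v" by (rule Int_absorb1[OF star_subset])
    ultimately show "card (edges G \<inter> star G v) = 3" using assms card_star by auto
  qed
  moreover have "edges G \<inter> inside G W = inside G W" "edges G \<inter> cut G W = cut G W"
    by (rule Int_absorb1[OF inside_subset], rule Int_absorb1[OF cut_subset])
  ultimately show ?thesis using incidence_count[OF fin subset_refl] by simp
qed

lemma even_cut_iff: "W \<subseteq> verts G \<Longrightarrow> even (card (cut G W)) \<longleftrightarrow> even (card W)"
  using degree_count[of W] by presburger

lemma cut_verts: "cut G (verts G) = {}"
  using ends_in_verts by (auto simp: in_cut_iff)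

lemma even_verts: "even (card (verts G))"
  using even_cut_iff[OF subset_refl] by (simp add: cut_verts)

lemma cut_compl: "cut G (verts G - W) = cut G W"
  using ends_in_verts by (auto simp: in_cut_iff)

lemma odd_cut_ge3:
  assumes "W \<subseteq> verts G" "odd (card W)"
  shows "3 \<le> card (cut G W)"
proof -
  have "W \<noteq> {}" "W \<noteq> verts G" using assms even_verts by auto
  then have "2 \<le> card (cut G W)" using cut_ge2 assms by simp
  moreover have "odd (card (cut G W))" using assms even_cut_iff by simp
  ultimately show ?thesis by (metis One_nat_def Suc_1 Suc_leI even_numeral le_neq_implies_less numeral_3_eq_3)
qed

text \<open>Each colour class covers \<open>W\<close> once, so the number of its edges in the cut
  has the parity of \<open>card W\<close>, as does the cut. Hence a 3-edge cut shows every colour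
  once (\<open>cut3_bij\<close>) and a 2-edge cut only one colour (\<open>cut2_eq\<close>).\<close>

lemma colour_count_parity:
  assumes "proper_on G c W" "W \<subseteq> verts G" "i < 3"
  shows "even (card {e\<in>cut G W. c e = i}) \<longleftrightarrow> even (card (cut G W))"
proof -
  have fin: "finite W" using assms finite_verts finite_subset by blast
  have "{e\<in>edges G. c e = i} \<inter> cut G W = {e\<in>cut G W. c e = i}" using cut_subset by fastforce
  then have "card W = 2 * card ({e\<in>edges G. c e = i} \<inter> inside G W) + card {e\<in>cut G W. c e = i}"
    using covers_once_count[OF fin _ colour_class_covers_once[OF assms(1,3)]] by fastforce
  then have "even (card {e\<in>cut G W. c e = i}) \<longleftrightarrow> even (card W)" by simp
  then show ?thesis using even_cut_iff assms(2) by simp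
qed

lemma proper_cut_colours:
  assumes "proper_on G c W" "W \<subseteq> verts G" "e \<in> cut G W"
  shows "c e < 3"
  using assms by (metis bij_betwE cut_starE lessThan_iff proper_on_def)

lemma cut3_bij:
  assumes "proper_on G c W" "W \<subseteq> verts G" "card (cut G W) = 3"
  shows "bij_betw c (cut G W) {..<3}"
proof -
  have "\<exists>e\<in>cut G W. c e = i" if "i < 3" for i
  proof -
    have "odd (card {e\<in>cut G W. c e = i})" using colour_count_parity[OF assms(1,2) that] assms(3) by simp
    then have "{e\<in>cut G W. c e = i} \<noteq> {}" by (metis card.empty even_zero)
    then show ?thesis by blast
  qed
  then have "{..<3} \<subseteq> c ` cut G W" by force
  moreover have "c ` cut G W \<subseteq> {..<3}" using proper_cut_colours assms by auto
  ultimately have im: "c ` cut G W = {..<3}" by blast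
  then have "inj_on c (cut G W)" using assms(3) finite_cut by (intro eq_card_imp_inj_on) auto
  then show ?thesis using im by (simp add: bij_betw_def)
qed

lemma cut2_eq:
  assumes "proper_on G c W" "W \<subseteq> verts G" "cut G W = {a, b}"
  shows "c a = c b"
proof (rule ccontr)
  assume n: "c a \<noteq> c b"
  then have "a \<noteq> b" by auto
  then have "card (cut G W) = 2" using assms by simp
  moreover have "c a < 3" using proper_cut_colours assms by auto
  ultimately have "even (card {e\<in>cut G W. c e = c a})"
    using colour_count_parity[OF assms(1,2), of "c a"] by simp
  moreover have "{e\<in>cut G W. c e = c a} = {a}" using n assms by auto
  ultimately show False by simp
qed

lemma two_connected: "two_connected G"
  unfolding two_connected_def
proof (intro conjI ballI)
  show "connected G"
  proof (rule connectedI_cut[OF wf nonempty])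
    fix W assume "W \<subseteq> verts G" "W \<noteq> {}" "W \<noteq> verts G"
    then have "2 \<le> card (cut G W)" by (rule cut_ge2)
    then show "cut G W \<noteq> {}" by auto
  qed
next
  fix e assume "e \<in> edges G"
  have wf': "wf_graph (del_edge G e)" using wf by (auto simp: wf_graph_def del_edge_def)
  show "connected (del_edge G e)"
  proof (rule connectedI_cut[OF wf'])
    show "verts (del_edge G e) \<noteq> {}" using nonempty by (simp add: del_edge_def)
    fix W assume W: "W \<subseteq> verts (del_edge G e)" "W \<noteq> {}" "W \<noteq> verts (del_edge G e)"
    have "cut (del_edge G e) W = cut G W - {e}" by (auto simp: in_cut_iff del_edge_def)
    moreover have "2 \<le> card (cut G W)" using W by (intro cut_ge2) (auto simp: del_edge_def)
    moreover have "card (cut G W) \<le> 1" if "cut G W - {e} = {}"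
      using that card_mono[of "{e}" "cut G W"] by auto
    ultimately show "cut (del_edge G e) W \<noteq> {}" by fastforce
  qed
next
  fix v assume v: "v \<in> verts G"
  have wf': "wf_graph (del_vert G v)" using wf by (auto simp: wf_graph_def del_vert_def endpts_def)
  show "connected (del_vert G v)"
  proof (rule connectedI_cut[OF wf'])
    have "verts G \<noteq> {v}" using even_verts by auto
    then show "verts (del_vert G v) \<noteq> {}" using nonempty v by (auto simp: del_vert_def)
    fix W assume W: "W \<subseteq> verts (del_vert G v)" "W \<noteq> {}" "W \<noteq> verts (del_vert G v)"
    define X where "X = verts G - {v} - W"
    have W': "W \<subseteq> verts G - {v}" "X \<noteq> {}" using W by (auto simp: del_vert_def X_def)
    \<comment> \<open>If \<open>v\<close> separated \<open>W\<close> from the remaining vertices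
      \<open>X\<close>, the two cuts would be disjoint subsets of the three edges at
      \<open>v\<close>, but each has at least two edges.\<close>
    show "cut (del_vert G v) W \<noteq> {}"
    proof
      assume em: "cut (del_vert G v) W = {}"
      have sub: "cut G W \<union> cut G X \<subseteq> star G v"
      proof
        fix e assume e: "e \<in> cut G W \<union> cut G X"
        then have "e \<in> edges G" by (auto simp: in_cut_iff)
        show "e \<in> star G v"
        proof (rule ccontr)
          assume "e \<notin> star G v"
          then have "e \<in> cut (del_vert G v) W"
            using e \<open>e \<in> edges G\<close> ends_in_verts by (auto simp: in_cut_iff in_star_iff del_vert_def X_def endpts_def)
          then show False using em by simp
        qed
      qed
      moreover have "cut G W \<inter> cut G X = {}"
      proof -
        have False if "e \<in> cut G W" "e \<in> cut G X" for e
        proof -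
          have "e \<in> star G v" using that sub by blast
          then show False using that W'(1) by (auto simp: in_cut_iff in_star_iff X_def)
        qed
        then show ?thesis by blast
      qed
      moreover have "card (cut G W \<union> cut G X) \<le> 3"
        using card_mono[OF finite_star sub] card_star[OF v] by simp
      ultimately have "card (cut G W) + card (cut G X) \<le> 3"
        using finite_cut by (simp add: card_Un_disjoint)
      moreover have "2 \<le> card (cut G W)" using W' W v by (intro cut_ge2) auto
      moreover have "2 \<le> card (cut G X)" using W' W v by (intro cut_ge2) (auto simp: X_def)
      ultimately show False by simp
    qed
  qed
qed

end

lemma bridgeless_cubicI:
  assumes "cubic G" "two_connected G"
  shows "bridgeless_cubic G"
proof
  show "cubic G" by fact
  show "verts G \<noteq> {}" using assms by (auto simp: two_connected_def connected_def)
  fix W assume W: "W \<subseteq> verts G" "W \<noteq> {}" "W \<noteq> verts G"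
  have fin: "finite (cut G W)"
    using assms cut_subset by (metis cubic_def finite_subset wf_graph_def)
  have "cut G W \<noteq> {}" using W assms by (intro connected_cut) (auto simp: two_connected_def)
  then obtain e where e: "e \<in> cut G W" by blast
  have "connected (del_edge G e)" using assms e by (auto simp: two_connected_def in_cut_iff)
  then have "cut (del_edge G e) W \<noteq> {}" using W by (intro connected_cut) (auto simp: del_edge_def)
  moreover have "cut (del_edge G e) W \<subseteq> cut G W - {e}" by (auto simp: in_cut_iff del_edge_def)
  ultimately obtain e' where "e' \<in> cut G W" "e' \<noteq> e" by blast
  then have "card {e, e'} \<le> card (cut G W)" using e fin by (intro card_mono) auto
  then show "2 \<le> card (cut G W)" using \<open>e' \<noteq> e\<close> by simp
qed

section \<open>Isomorphisms\<close>

text \<open>The isomorphism with its two maps exposed: the reassembly has to state which vertices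
  and edges carry their Petersen names.\<close>

definition iso_by :: "('v \<Rightarrow> 'w) \<Rightarrow> ('e \<Rightarrow> 'f) \<Rightarrow> ('v,'e) graph \<Rightarrow> ('w,'f) graph \<Rightarrow> bool" where
  "iso_by f g G H \<longleftrightarrow> bij_betw f (verts G) (verts H) \<and> bij_betw g (edges G) (edges H) \<and>
     (\<forall>e\<in>edges G. ends H (g e) = map_prod f f (ends G e) \<or>
                   ends H (g e) = prod.swap (map_prod f f (ends G e)))"

lemma isomorphic_iff: "isomorphic G H \<longleftrightarrow> (\<exists>f g. iso_by f g G H)"
  by (simp add: isomorphic_def iso_by_def)

lemma iso_by_trans:
  assumes "iso_by f g G H" "iso_by f' g' H K"
  shows "iso_by (f' \<circ> f) (g' \<circ> g) G K"
  unfolding iso_by_def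
proof (intro conjI ballI)
  show "bij_betw (f' \<circ> f) (verts G) (verts K)" "bij_betw (g' \<circ> g) (edges G) (edges K)"
    using assms by (auto simp: iso_by_def intro: bij_betw_trans)
  fix e assume e: "e \<in> edges G"
  then have "g e \<in> edges H" using assms(1) by (auto simp: iso_by_def bij_betw_def)
  then show "ends K ((g' \<circ> g) e) = map_prod (f' \<circ> f) (f' \<circ> f) (ends G e) \<or>
       ends K ((g' \<circ> g) e) = prod.swap (map_prod (f' \<circ> f) (f' \<circ> f) (ends G e))"
    using assms e by (cases "ends G e") (fastforce simp: iso_by_def)
qed

lemma iso_by_endpts:
  assumes "iso_by f g G H" "e \<in> edges G"
  shows "endpts H (g e) = f ` endpts G e"
  using assms by (cases "ends G e") (fastforce simp: iso_by_def endpts_def)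

lemma image_eqI_subset:
  assumes "A \<subseteq> g ` E" "B \<subseteq> E" "\<And>e. e \<in> E \<Longrightarrow> g e \<in> A \<longleftrightarrow> e \<in> B"
  shows "A = g ` B"
proof
  show "A \<subseteq> g ` B"
  proof
    fix x assume "x \<in> A"
    moreover then obtain e where "e \<in> E" "x = g e" using assms(1) by blast
    ultimately show "x \<in> g ` B" using assms(3) by simp
  qed
  show "g ` B \<subseteq> A" using assms(2,3) by blast
qed

lemma iso_by_cut:
  assumes "iso_by f g G H" "wf_graph G" "W \<subseteq> verts G"
  shows "cut H (f ` W) = g ` cut G W"
proof -
  have inj: "inj_on f (verts G)" and g: "edges H = g ` edges G"
    using assms(1) by (auto simp: iso_by_def bij_betw_def)
  have mem: "f x \<in> f ` W \<longleftrightarrow> x \<in> W" if "x \<in> verts G" for x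
    using inj that assms(3) by (meson inj_on_image_mem_iff)
  have "g e \<in> cut H (f ` W) \<longleftrightarrow> e \<in> cut G W" if e: "e \<in> edges G" for e
  proof -
    have "ends H (g e) = map_prod f f (ends G e) \<or> ends H (g e) = prod.swap (map_prod f f (ends G e))"
      using assms(1) e by (auto simp: iso_by_def)
    moreover have "fst (ends G e) \<in> verts G" "snd (ends G e) \<in> verts G"
      using assms(2) e by (auto simp: wf_graph_def)
    ultimately show ?thesis using e g mem[of "fst (ends G e)"] mem[of "snd (ends G e)"]
      by (elim disjE) (simp_all add: in_cut_iff, blast)
  qed
  then show ?thesis using g cut_subset[of H "f ` W"] by (intro image_eqI_subset[OF _ cut_subset]) simp_all
qed

lemma iso_by_star:
  assumes "iso_by f g G H" "wf_graph G" "v \<in> verts G"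
  shows "star H (f v) = g ` star G v"
proof -
  have inj: "inj_on f (verts G)" and g: "edges H = g ` edges G"
    using assms(1) by (auto simp: iso_by_def bij_betw_def)
  have "g e \<in> star H (f v) \<longleftrightarrow> e \<in> star G v" if e: "e \<in> edges G" for e
  proof -
    have "endpts G e \<subseteq> verts G" using assms(2) e by (auto simp: wf_graph_def endpts_def)
    then show ?thesis using iso_by_endpts[OF assms(1) e] e g inj assms(3)
      by (auto simp: star_def inj_on_image_mem_iff)
  qed
  then show ?thesis using g star_subset[of H "f v"] by (intro image_eqI_subset[OF _ star_subset]) simp_all
qed

lemma bridgeless_cubic_iso:
  assumes "bridgeless_cubic G" "iso_by f g G H"
  shows "bridgeless_cubic H"
proof -
  interpret G: bridgeless_cubic G by fact
  have bf: "bij_betw f (verts G) (verts H)" and bg: "bij_betw g (edges G) (edges H)"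
    using assms(2) by (auto simp: iso_by_def)
  have injg: "inj_on g (edges G)" using bg by (simp add: bij_betw_def)
  have ee: "ends H (g e) = map_prod f f (ends G e) \<or> ends H (g e) = prod.swap (map_prod f f (ends G e))"
    if "e \<in> edges G" for e using assms(2) that by (auto simp: iso_by_def)
  have ends: "fst (ends H e) \<in> verts H \<and> snd (ends H e) \<in> verts H \<and> fst (ends H e) \<noteq> snd (ends H e)"
    if eH: "e \<in> edges H" for e
  proof -
    obtain e0 where e0: "e0 \<in> edges G" "e = g e0"
      using eH bg unfolding bij_betw_def by blast
    have "fst (ends G e0) \<in> verts G" "snd (ends G e0) \<in> verts G" "fst (ends G e0) \<noteq> snd (ends G e0)"
      using G.ends_in_verts[OF e0(1)] G.loopless[OF e0(1)] by blast+
    then have "f (fst (ends G e0)) \<in> verts H" "f (snd (ends G e0)) \<in> verts H"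
        "f (fst (ends G e0)) \<noteq> f (snd (ends G e0))"
      using bf unfolding bij_betw_def by (blast, blast, metis inj_on_eq_iff)
    then show ?thesis using ee[OF e0(1)] unfolding e0(2) by (elim disjE) simp_all
  qed
  have wf: "wf_graph H"
    unfolding wf_graph_def
  proof (intro conjI ballI)
    show "finite (verts H)" "finite (edges H)"
      using bf bg G.finite_verts G.finite_edges bij_betw_finite by blast+
  qed (use ends in auto)
  interpret H: loopless_graph H by standard (use wf ends in auto)
  have "degree H w = 3" if wH: "w \<in> verts H" for w
  proof -
    obtain v where v: "v \<in> verts G" "w = f v" using wH bf unfolding bij_betw_def by blast
    then have "star H w = g ` star G v" using iso_by_star assms(2) G.wf by metis
    moreover have "card (g ` star G v) = card (star G v)"
      using injg star_subset by (metis card_image inj_on_subset)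
    ultimately show ?thesis using G.card_star v H.degree_star by simp
  qed
  then have "cubic H" using wf by (simp add: cubic_def)
  moreover have "verts H \<noteq> {}" using bf G.nonempty by (auto simp: bij_betw_def)
  moreover have "2 \<le> card (cut H W)" if W: "W \<subseteq> verts H" "W \<noteq> {}" "W \<noteq> verts H" for W
  proof -
    obtain X where X: "X \<subseteq> verts G" "W = f ` X"
      using W(1) bf by (metis bij_betw_def subset_image_iff)
    then have "cut H W = g ` cut G X" using iso_by_cut assms(2) G.wf by metis
    moreover have "card (g ` cut G X) = card (cut G X)"
      using injg cut_subset by (metis card_image inj_on_subset)
    moreover have "2 \<le> card (cut G X)"
      using X W bf by (intro G.cut_ge2) (auto simp: bij_betw_def)
    ultimately show ?thesis by simp
  qed
  ultimately show ?thesis by (simp add: bridgeless_cubic_def)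
qed

lemma perfect_matching_iso:
  assumes "iso_by f g G H" "loopless_graph G" "loopless_graph H" "M \<subseteq> edges G"
  shows "perfect_matching H (g ` M) \<longleftrightarrow> perfect_matching G M"
proof -
  interpret G: loopless_graph G by fact
  interpret H: loopless_graph H by fact
  have bf: "verts H = f ` verts G" and bg: "edges H = g ` edges G" and inj: "inj_on g (edges G)"
    using assms(1) by (auto simp: iso_by_def bij_betw_def)
  have "card (g ` M \<inter> star H (f v)) = card (M \<inter> star G v)" if "v \<in> verts G" for v
  proof -
    have "star H (f v) = g ` star G v" using iso_by_star assms(1) G.wf that by metis
    then have "g ` M \<inter> star H (f v) = g ` (M \<inter> star G v)"
      using inj assms(4) star_subset[of G v] by (simp add: inj_on_image_Int)
    moreover have "card (g ` (M \<inter> star G v)) = card (M \<inter> star G v)"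
      using inj assms(4) by (meson card_image inf.coboundedI1 inj_on_subset)
    ultimately show ?thesis by simp
  qed
  then show ?thesis using assms(4) bf bg
    by (auto simp: H.perfect_matching_iff G.perfect_matching_iff covers_once_def)
qed

section \<open>Components\<close>

lemma adj_induced:
  "(x, y) \<in> adj (induced G S) \<longleftrightarrow> (\<exists>e\<in>edges G. endpts G e = {x, y} \<and> x \<in> S \<and> y \<in> S)"
  by (fastforce simp: adj_def induced_def endpts_def doubleton_eq_iff prod_eq_iff)

lemma rtrancl_induced_mem: "(x, y) \<in> (adj (induced G S))\<^sup>* \<Longrightarrow> x \<in> S \<Longrightarrow> y \<in> S"
  by (induction rule: rtrancl_induct) (auto simp: adj_induced)

lemma compsE:
  assumes "D \<in> comps G S"
  obtains x where "x \<in> S" "D = {y\<in>S. (x, y) \<in> (adj (induced G S))\<^sup>*}"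
  using assms by (auto simp: comps_def)

lemma comps_mem_eq:
  assumes "D \<in> comps G S" "x \<in> D"
  shows "D = {y\<in>S. (x, y) \<in> (adj (induced G S))\<^sup>*}"
proof -
  obtain z where z: "z \<in> S" "D = {y\<in>S. (z, y) \<in> (adj (induced G S))\<^sup>*}"
    using assms(1) by (rule compsE)
  then have zx: "(z, x) \<in> (adj (induced G S))\<^sup>*" using assms by simp
  then have xz: "(x, z) \<in> (adj (induced G S))\<^sup>*" by (rule adj_rtrancl_sym)
  show ?thesis unfolding z(2) by (auto intro: rtrancl_trans[OF zx] rtrancl_trans[OF xz])
qed

lemma comps_subset: "D \<in> comps G S \<Longrightarrow> D \<subseteq> S"
  by (auto simp: comps_def)

lemma comps_nonempty: "D \<in> comps G S \<Longrightarrow> D \<noteq> {}"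
  by (auto simp: comps_def)

lemma Union_comps: "\<Union>(comps G S) = S"
  by (auto simp: comps_def)

lemma finite_comps: "finite S \<Longrightarrow> finite (comps G S)"
  using finite_subset[of "comps G S" "Pow S"] comps_subset by auto

lemma comps_disjoint: "D \<in> comps G S \<Longrightarrow> D' \<in> comps G S \<Longrightarrow> x \<in> D \<Longrightarrow> x \<in> D' \<Longrightarrow> D = D'"
  using comps_mem_eq[of D G S x] comps_mem_eq[of D' G S x] by simp

lemma comps_closed:
  assumes "D \<in> comps G S" "e \<in> edges G" "endpts G e = {x, y}" "x \<in> D" "y \<in> S"
  shows "y \<in> D"
proof -
  have "(x, y) \<in> adj (induced G S)" using assms comps_subset[OF assms(1)] by (auto simp: adj_induced)
  then show ?thesis using comps_mem_eq[OF assms(1,4)] assms(5) by blast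
qed

lemma cut_comps_subset:
  assumes "D \<in> comps G S"
  shows "cut G D \<subseteq> cut G S"
proof
  fix e assume e: "e \<in> cut G D"
  then obtain v w where vw: "v \<in> D" "w \<notin> D" "endpts G e = {v, w}" by (metis cut_starE)
  have ee: "e \<in> edges G" using e by (simp add: in_cut_iff)
  have "w \<notin> S" using comps_closed assms ee vw by metis
  moreover have "v \<in> S" using comps_subset assms vw by blast
  ultimately show "e \<in> cut G S" using vw(3) ee by (auto simp: in_cut_iff endpts_def doubleton_eq_iff)
qed

lemma cut_comps_disjoint:
  assumes "D \<in> comps G S" "D' \<in> comps G S" "e \<in> cut G D" "e \<in> cut G D'"
  shows "D = D'"
proof -
  obtain v w where vw: "v \<in> S" "w \<notin> S" "endpts G e = {v, w}"
    using cut_comps_subset[OF assms(1)] assms(3) by (metis cut_starE subsetD)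
  have "v \<in> D" "v \<in> D'"
    using assms(3,4) vw comps_subset[OF assms(1)] comps_subset[OF assms(2)]
    by (auto simp: in_cut_iff endpts_def doubleton_eq_iff)
  then show ?thesis using comps_disjoint assms by metis
qed

lemma cut_comps_Union: "cut G S = (\<Union>D\<in>comps G S. cut G D)"
proof
  show "(\<Union>D\<in>comps G S. cut G D) \<subseteq> cut G S" using cut_comps_subset by blast
  show "cut G S \<subseteq> (\<Union>D\<in>comps G S. cut G D)"
  proof
    fix e assume e: "e \<in> cut G S"
    then obtain v w where vw: "v \<in> S" "w \<notin> S" "endpts G e = {v, w}" by (metis cut_starE)
    then obtain D where D: "D \<in> comps G S" "v \<in> D" using Union_comps by (metis UnionE)
    then have "w \<notin> D" using comps_subset vw by blast
    then have "e \<in> cut G D" using D vw e by (auto simp: in_cut_iff endpts_def doubleton_eq_iff)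
    then show "e \<in> (\<Union>D\<in>comps G S. cut G D)" using D by blast
  qed
qed

lemma (in loopless_graph) card_cut_comps:
  assumes "finite S"
  shows "card (cut G S) = (\<Sum>D\<in>comps G S. card (cut G D))"
  unfolding cut_comps_Union[of G S]
proof (rule card_UN_disjoint)
  show "\<forall>D\<in>comps G S. \<forall>D'\<in>comps G S. D \<noteq> D' \<longrightarrow> cut G D \<inter> cut G D' = {}"
    using cut_comps_disjoint[of _ G S] by blast
qed (auto simp: finite_comps[OF assms] finite_cut)

lemma card_comps_sum:
  assumes "finite S"
  shows "card S = (\<Sum>D\<in>comps G S. card D)"
proof -
  have "card (\<Union>(comps G S)) = (\<Sum>D\<in>comps G S. card D)"
  proof (rule card_Union_disjoint)
    show "pairwise disjnt (comps G S)"
      using comps_disjoint by (fastforce simp: pairwise_def disjnt_iff)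
    show "\<And>D. D \<in> comps G S \<Longrightarrow> finite D" using assms comps_subset finite_subset by metis
  qed
  then show ?thesis by (simp add: Union_comps)
qed

section \<open>The Tutte-Berge formula\<close>

definition odd_comps :: "('v,'e) graph \<Rightarrow> 'v set \<Rightarrow> 'v set set" where
  "odd_comps G S = {D\<in>comps G S. odd (card D)}"

definition matching_in :: "('v,'e) graph \<Rightarrow> 'v set \<Rightarrow> 'e set \<Rightarrow> bool" where
  "matching_in G W F \<longleftrightarrow> F \<subseteq> inside G W \<and> (\<forall>v\<in>W. card (F \<inter> star G v) \<le> 1)"

definition max_matching_in :: "('v,'e) graph \<Rightarrow> 'v set \<Rightarrow> 'e set \<Rightarrow> bool" where
  "max_matching_in G W F \<longleftrightarrow> matching_in G W F \<and> (\<forall>F'. matching_in G W F' \<longrightarrow> card F' \<le> card F)"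

context loopless_graph
begin

lemma matching_in_finite: "matching_in G W F \<Longrightarrow> finite F"
  using finite_inside by (auto simp: matching_in_def intro: finite_subset)

lemma matching_in_unique:
  assumes "matching_in G W F" "v \<in> W" "e \<in> F" "e' \<in> F" "e \<in> star G v" "e' \<in> star G v"
  shows "e = e'"
proof -
  have "card (F \<inter> star G v) \<le> Suc 0" using assms by (auto simp: matching_in_def)
  moreover have "finite (F \<inter> star G v)" using finite_star by blast
  ultimately show ?thesis using assms(3-) by (auto simp: card_le_Suc0_iff_eq)
qed

lemma card_covered:
  assumes "finite W" "matching_in G W F"
  shows "card {v\<in>W. F \<inter> star G v \<noteq> {}} = 2 * card F"
proof -
  have F: "F \<subseteq> edges G" "F \<inter> inside G W = F" "F \<inter> cut G W = {}"
    using assms inside_subset cut_inside_disjoint by (fastforce simp: matching_in_def)+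
  have "card (F \<inter> star G v) = (if F \<inter> star G v \<noteq> {} then 1 else 0)" if "v \<in> W" for v
  proof -
    have "card (F \<inter> star G v) \<le> 1" using assms that by (auto simp: matching_in_def)
    moreover have "F \<inter> star G v = {} \<longleftrightarrow> card (F \<inter> star G v) = 0"
      using finite_star by simp
    ultimately have "F \<inter> star G v \<noteq> {} \<Longrightarrow> card (F \<inter> star G v) = 1" by linarith
    then show ?thesis by auto
  qed
  then have "(\<Sum>v\<in>W. card (F \<inter> star G v)) = (\<Sum>v\<in>W. if F \<inter> star G v \<noteq> {} then 1 else 0)"
    by (intro sum.cong) auto
  also have "\<dots> = card {v\<in>W. F \<inter> star G v \<noteq> {}}"
    using assms(1) by (simp add: sum.If_cases Int_def)
  finally show ?thesis using incidence_count[OF assms(1) F(1)] F by simp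
qed

lemma matching_in_insert:
  assumes m: "matching_in G W F" and e: "e \<in> edges G" "endpts G e = {x, y}" "x \<in> W" "y \<in> W"
    and miss: "F \<inter> star G x = {}" "F \<inter> star G y = {}"
  shows "matching_in G W (insert e F)" "card (insert e F) = Suc (card F)"
proof -
  have "e \<in> star G x" using e by (auto simp: star_def)
  then have "e \<notin> F" using miss by blast
  then show "card (insert e F) = Suc (card F)" using matching_in_finite[OF m] by simp
  have "card (insert e F \<inter> star G v) \<le> 1" if v: "v \<in> W" for v
  proof (cases "v = x \<or> v = y")
    case True
    then have "insert e F \<inter> star G v \<subseteq> {e}" using miss by blast
    then have "card (insert e F \<inter> star G v) \<le> card {e}" by (intro card_mono) auto
    then show ?thesis by simp
  next
    case False
    then have "insert e F \<inter> star G v = F \<inter> star G v" using e by (auto simp: star_def)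
    then show ?thesis using m v by (simp add: matching_in_def)
  qed
  then show "matching_in G W (insert e F)" using m e by (auto simp: matching_in_def inside_def)
qed

lemma matching_in_subset: "matching_in G W F \<Longrightarrow> F' \<subseteq> F \<Longrightarrow> matching_in G W F'"
  unfolding matching_in_def
proof (intro conjI ballI; elim conjE)
  fix v assume "F' \<subseteq> F" "\<forall>v\<in>W. card (F \<inter> star G v) \<le> 1" "v \<in> W"
  moreover have "card (F' \<inter> star G v) \<le> card (F \<inter> star G v)"
    using \<open>F' \<subseteq> F\<close> finite_star by (intro card_mono) auto
  ultimately show "card (F' \<inter> star G v) \<le> 1" by force
qed auto

lemma max_matching_in_ex:
  assumes "matching_in G W F"
  shows "\<exists>M. max_matching_in G W M \<and> card F \<le> card M"
proof -
  have fin: "finite {F. matching_in G W F}"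
    by (rule finite_subset[of _ "Pow (inside G W)"]) (auto simp: matching_in_def finite_inside)
  then have f: "finite (card ` {F. matching_in G W F})" by simp
  have ne: "card ` {F. matching_in G W F} \<noteq> {}" using assms by blast
  obtain M where M: "matching_in G W M" "card M = Max (card ` {F. matching_in G W F})"
    using Max_in[OF f ne] by auto
  then have "card F' \<le> card M" if "matching_in G W F'" for F'
    using Max_ge[OF f] that by simp
  then show ?thesis using M assms by (auto simp: max_matching_in_def)
qed

lemma max_matching_in_adjacent:
  assumes "max_matching_in G W M" "e \<in> edges G" "endpts G e = {x, y}" "x \<in> W" "y \<in> W"
    "M \<inter> star G x = {}" "M \<inter> star G y = {}"
  shows False
  using matching_in_insert[OF _ assms(2-7)] assms(1) unfolding max_matching_in_def
  by (metis not_less_eq_eq order_refl)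

text \<open>Gallai's exchange argument. Among the maximum matchings avoiding \<open>w\<close>, one that agrees with
  \<open>M\<close> as much as possible can still be brought closer to \<open>M\<close>.\<close>

lemma gallai_exchange:
  assumes W: "finite W" "u \<in> W" "v \<in> W" "w \<in> W" "u \<noteq> v"
    and M: "max_matching_in G W M" "M \<inter> star G u = {}" "M \<inter> star G v = {}"
    and N0: "max_matching_in G W N0" "N0 \<inter> star G w = {}"
    and uw: "\<And>F. max_matching_in G W F \<Longrightarrow> F \<inter> star G w = {} \<Longrightarrow> F \<inter> star G u \<noteq> {}"
    and vw: "\<And>F. max_matching_in G W F \<Longrightarrow> F \<inter> star G w = {} \<Longrightarrow> F \<inter> star G v \<noteq> {}"
  shows False
proof -
  define P where "P N \<longleftrightarrow> max_matching_in G W N \<and> N \<inter> star G w = {}" for N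
  have Mm: "matching_in G W M" and finM: "finite M"
    using M matching_in_finite by (auto simp: max_matching_in_def)
  have b: "\<forall>N. P N \<longrightarrow> card (M \<inter> N) < Suc (card M)"
    using finM by (auto simp: less_Suc_eq_le intro: card_mono)
  obtain N where N: "P N" "\<And>N'. P N' \<Longrightarrow> card (M \<inter> N') \<le> card (M \<inter> N)"
    using ex_has_greatest_nat[of P N0 "\<lambda>N. card (M \<inter> N)" "Suc (card M)"] b N0
    by (auto simp: P_def less_imp_le)
  have Nm: "max_matching_in G W N" "matching_in G W N" "N \<inter> star G w = {}" "finite N"
    using N matching_in_finite by (auto simp: P_def max_matching_in_def)
  have cards: "card M = card N" using M Nm by (auto simp: max_matching_in_def intro: le_antisym)
  define A where "A = {x\<in>W. M \<inter> star G x \<noteq> {}}"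
  define B where "B = {x\<in>W. N \<inter> star G x \<noteq> {}}"
  have fin: "finite A" "finite B" using W by (auto simp: A_def B_def)
  \<comment> \<open>Both matchings cover equally many vertices, and \<open>N\<close> covers
    \<open>u\<close> and \<open>v\<close>, which \<open>M\<close> misses. So \<open>M\<close> covers
    at least two vertices missed by \<open>N\<close>, one of them different from
    \<open>w\<close>.\<close>
  have "card A = card B" using card_covered[OF W(1)] Mm Nm cards by (simp add: A_def B_def)
  moreover have "card A = card (A \<inter> B) + card (A - B)" "card B = card (A \<inter> B) + card (B - A)"
    using fin by (metis card_Int_Diff, metis card_Int_Diff Int_commute)
  moreover have "{u, v} \<subseteq> B - A" using W M uw[OF Nm(1,3)] vw[OF Nm(1,3)] by (auto simp: A_def B_def)
  then have "card {u, v} \<le> card (B - A)" using fin by (intro card_mono) auto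
  ultimately have "2 \<le> card (A - B)" using W by simp
  then have "\<not> A - B \<subseteq> {w}" using card_mono[of "{w}" "A - B"] by auto
  then obtain x where x: "x \<in> A" "x \<notin> B" "x \<noteq> w" by blast
  then obtain e where e: "e \<in> M" "e \<in> star G x" by (auto simp: A_def)
  define y where "y = other_end G e x"
  have ends: "endpts G e = {x, y}" using endpts_other_end[OF e(2)] by (simp add: y_def)
  have ee: "e \<in> edges G" using e by (simp add: star_def)
  have xyW: "x \<in> W" "y \<in> W" using Mm e ends by (auto simp: matching_in_def inside_def)
  have Nx: "N \<inter> star G x = {}" using x xyW by (simp add: B_def)
  have "N \<inter> star G y \<noteq> {}" using max_matching_in_adjacent[OF Nm(1) ee ends xyW Nx] by blast
  then obtain f where f: "f \<in> N" "f \<in> star G y" by blast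
  have ey: "e \<in> star G y" using ends ee by (simp add: star_def)
  have fM: "f \<notin> M"
    using matching_in_unique[OF Mm xyW(2) e(1) _ ey f(2)] f(1) e(2) Nx by blast
  have m': "matching_in G W (N - {f})" using Nm(2) matching_in_subset by blast
  have Ny: "(N - {f}) \<inter> star G y = {}" using matching_in_unique[OF Nm(2) xyW(2) f(1) _ f(2)] by blast
  \<comment> \<open>Trading \<open>f\<close> for \<open>e\<close> keeps the size and still misses
    \<open>w\<close>, and it gains one edge of \<open>M\<close>, because \<open>e \<in> M\<close>
    while \<open>f \<notin> M\<close>.\<close>
  define N' where "N' = insert e (N - {f})"
  have N'm: "matching_in G W N'" "card N' = Suc (card (N - {f}))"
    using matching_in_insert[OF m' ee ends xyW _ Ny] Nx by (auto simp: N'_def)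
  then have "card N' = card N" using f Nm(4) by (metis card_Suc_Diff1)
  then have max': "max_matching_in G W N'" using N'm Nm(1) by (auto simp: max_matching_in_def)
  have "y \<noteq> w" using f Nm(3) by blast
  then have "e \<notin> star G w" using x ends by (auto simp: star_def)
  then have "P N'" using max' Nm(3) by (auto simp: P_def N'_def)
  then have le: "card (M \<inter> N') \<le> card (M \<inter> N)" using N by blast
  have "M \<inter> N' = insert e (M \<inter> N)" using e fM by (auto simp: N'_def)
  moreover have "e \<notin> N" using e Nx by blast
  ultimately have "card (M \<inter> N') = Suc (card (M \<inter> N))" using finM by simp
  then show False using le by simp
qed

text \<open>Gallai's lemma: if every vertex can be missed, no maximum matching misses two vertices
  of one component. In the induction along a path, the last vertex \<open>y\<close> plays the role
  of \<open>w\<close> in the exchange: by induction no maximum matching misses both \<open>u\<close>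
  and \<open>y\<close>, and by adjacency none misses both \<open>y\<close> and
  \<open>z\<close>.\<close>

lemma max_matching_in_component:
  assumes W: "finite W" and all: "\<And>w. w \<in> W \<Longrightarrow> \<exists>N. max_matching_in G W N \<and> N \<inter> star G w = {}"
    and path: "(u, v) \<in> (adj (induced G W))\<^sup>*" and u: "u \<in> W"
  shows "u \<noteq> v \<Longrightarrow> max_matching_in G W M \<Longrightarrow> M \<inter> star G u = {} \<Longrightarrow> M \<inter> star G v \<noteq> {}"
  using path
proof (induction arbitrary: M rule: rtrancl_induct)
  case base then show ?case by simp
next
  case (step y z)
  have yW: "y \<in> W" using step u rtrancl_induced_mem by metis
  obtain e where e: "e \<in> edges G" "endpts G e = {y, z}" "z \<in> W"
    using step.hyps(2) by (auto simp: adj_induced)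
  have yz: "M \<inter> star G y \<noteq> {} \<or> M \<inter> star G z \<noteq> {}" if "max_matching_in G W M" for M
    using max_matching_in_adjacent[OF that e(1,2) yW e(3)] by blast
  show ?case
  proof (cases "u = y")
    case True then show ?thesis using yz step.prems by blast
  next
    case False
    show ?thesis
    proof
      assume Mz: "M \<inter> star G z = {}"
      obtain N where N: "max_matching_in G W N" "N \<inter> star G y = {}" using all yW by blast
      show False
        by (rule gallai_exchange[OF W u e(3) yW step.prems(1,2,3) Mz N])
          (use step.IH[OF False] yz in blast)+
    qed
  qed
qed

theorem tutte_berge:
  assumes "finite W"
  shows "\<exists>F S. matching_in G W F \<and> S \<subseteq> W \<and> card W + card S \<le> 2 * card F + card (odd_comps G (W - S))"
  using assms
proof (induction "card W" arbitrary: W rule: less_induct)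
  case less
  have "matching_in G W {}" by (simp add: matching_in_def)
  then obtain M where M: "max_matching_in G W M" using max_matching_in_ex by blast
  show ?case
  proof (cases "\<exists>v\<in>W. \<forall>F. max_matching_in G W F \<longrightarrow> F \<inter> star G v \<noteq> {}")
    case True
    \<comment> \<open>A vertex covered by every maximum matching goes into \<open>S\<close>. The
      matching found in \<open>W - {v}\<close> misses \<open>v\<close>, so it is not maximum in
      \<open>W\<close>; the extra edge pays for the increase of both \<open>card W\<close> and
      \<open>card S\<close>.\<close>
    then obtain v where v: "v \<in> W" "\<And>F. max_matching_in G W F \<Longrightarrow> F \<inter> star G v \<noteq> {}" by blast
    have cW: "card W = Suc (card (W - {v}))" using v less.prems by (metis card_Suc_Diff1)
    obtain F' S' where F: "matching_in G (W - {v}) F'" "S' \<subseteq> W - {v}"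
      "card (W - {v}) + card S' \<le> 2 * card F' + card (odd_comps G (W - {v} - S'))"
      using less.hyps[of "W - {v}"] less.prems cW by auto
    have miss: "F' \<inter> star G v = {}" using F by (auto simp: matching_in_def inside_def star_def)
    have "matching_in G W F'" unfolding matching_in_def
    proof (intro conjI ballI)
      show "F' \<subseteq> inside G W" using F(1) by (auto simp: matching_in_def inside_def)
      fix x assume "x \<in> W"
      then show "card (F' \<inter> star G x) \<le> 1" using F(1) miss by (cases "x = v") (auto simp: matching_in_def)
    qed
    moreover have "\<not> max_matching_in G W F'" using v miss by blast
    ultimately obtain F where F1: "matching_in G W F" "card F' < card F"
      by (auto simp: max_matching_in_def not_le)
    have "finite S'" "v \<notin> S'" using F(2) less.prems by (auto intro: finite_subset)
    then have "card (insert v S') = Suc (card S')" by simp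
    moreover have "W - insert v S' = W - {v} - S'" by blast
    ultimately have "card W + card (insert v S') \<le> 2 * card F + card (odd_comps G (W - insert v S'))"
      using F(3) F1(2) cW by simp
    moreover have "insert v S' \<subseteq> W" using F v by blast
    ultimately show ?thesis using F1 by blast
  next
    case False
    \<comment> \<open>Here \<open>S = {}\<close> works: distinct vertices missed by \<open>M\<close>
      lie in distinct components, and a component with exactly one missed vertex is odd.\<close>
    then have all: "\<And>w. w \<in> W \<Longrightarrow> \<exists>N. max_matching_in G W N \<and> N \<inter> star G w = {}" by blast
    define U where "U = {v\<in>W. M \<inter> star G v = {}}"
    define comp where "comp v = {y\<in>W. (v, y) \<in> (adj (induced G W))\<^sup>*}" for v
    have Mm: "matching_in G W M" using M by (simp add: max_matching_in_def)
    have "W = U \<union> {v\<in>W. M \<inter> star G v \<noteq> {}}" "U \<inter> {v\<in>W. M \<inter> star G v \<noteq> {}} = {}"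
      by (auto simp: U_def)
    moreover have "finite U" using less.prems by (simp add: U_def)
    ultimately have cW: "card W = card U + 2 * card M"
      using card_covered[OF less.prems Mm] less.prems by (metis (no_types, lifting) card_Un_disjoint finite_Un)
    have other: "M \<inter> star G y \<noteq> {}" if "v \<in> U" "y \<in> comp v" "y \<noteq> v" for v y
      using max_matching_in_component[OF less.prems all, of v y M] that M by (auto simp: U_def comp_def)
    have "inj_on comp U"
    proof
      fix v y assume vy: "v \<in> U" "y \<in> U" "comp v = comp y"
      then have "y \<in> comp v" by (auto simp: U_def comp_def)
      then show "v = y" using other[of v y] vy by (auto simp: U_def)
    qed
    moreover have "comp ` U \<subseteq> odd_comps G W"
    proof (clarsimp simp: odd_comps_def, intro conjI)
      fix v assume v: "v \<in> U"
      then show D: "comp v \<in> comps G W" by (auto simp: U_def comps_def comp_def)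
      have sub: "comp v \<subseteq> W" and finD: "finite (comp v)" using less.prems by (auto simp: comp_def)
      have vD: "v \<in> comp v" using v by (auto simp: comp_def U_def)
      have cut: "M \<inter> cut G (comp v) = {}"
        using cut_comps_subset[OF D] cut_inside_disjoint Mm by (fastforce simp: matching_in_def)
      have ME: "M \<subseteq> edges G" using Mm inside_subset by (fastforce simp: matching_in_def)
      have "(\<Sum>y\<in>comp v. card (M \<inter> star G y)) = (\<Sum>y\<in>comp v. if y = v then 0 else 1)"
      proof (rule sum.cong[OF refl])
        fix y assume y: "y \<in> comp v"
        have "card (M \<inter> star G y) \<le> 1" using Mm y sub by (auto simp: matching_in_def)
        moreover have "card (M \<inter> star G y) \<noteq> 0" if "y \<noteq> v" using other[OF v y that] finite_star by simp
        ultimately show "card (M \<inter> star G y) = (if y = v then 0 else 1)" using v by (auto simp: U_def)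
      qed
      also have "\<dots> = card (comp v - {v})" using finD
        by (subst sum.If_cases) (auto simp: Diff_eq)
      finally have "card (comp v - {v}) = 2 * card (M \<inter> inside G (comp v))"
        using incidence_count[OF finD ME] cut by simp
      then show "odd (card (comp v))" using vD finD by (metis card_Suc_Diff1 dvd_triv_left even_Suc)
    qed
    moreover have "finite (odd_comps G W)"
      unfolding odd_comps_def by (rule finite_subset[OF _ finite_comps[OF less.prems]]) auto
    ultimately have "card U \<le> card (odd_comps G W)" by (meson card_inj_on_le)
    then have "card W + card {} \<le> 2 * card M + card (odd_comps G (W - {}))" using cW by simp
    then show ?thesis using Mm by blast
  qed
qed

corollary tutte:
  assumes "finite W" "\<nexists>F. F \<subseteq> inside G W \<and> covers_once G F W"
  shows "\<exists>S\<subseteq>W. card S < card (odd_comps G (W - S))"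
proof -
  obtain F S where FS: "matching_in G W F" "S \<subseteq> W" "card W + card S \<le> 2 * card F + card (odd_comps G (W - S))"
    using tutte_berge[OF assms(1)] by blast
  have cov: "card {v\<in>W. F \<inter> star G v \<noteq> {}} = 2 * card F" using card_covered assms FS by blast
  have "2 * card F < card W"
  proof (rule ccontr)
    assume "\<not> 2 * card F < card W"
    then have "{v\<in>W. F \<inter> star G v \<noteq> {}} = W"
      using cov assms(1) by (intro card_seteq) auto
    then have "card (F \<inter> star G v) = 1" if "v \<in> W" for v
    proof -
      have "F \<inter> star G v \<noteq> {}" using that \<open>_ = W\<close> by blast
      then have "card (F \<inter> star G v) \<noteq> 0" using finite_star by simp
      moreover have "card (F \<inter> star G v) \<le> 1" using FS that by (auto simp: matching_in_def)
      ultimately show ?thesis by simp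
    qed
    then show False using assms(2) FS by (auto simp: matching_in_def covers_once_def)
  qed
  then show ?thesis using FS by (intro exI[of _ S]) auto
qed

end

lemma even_sum_card_odd:
  "finite A \<Longrightarrow> even (\<Sum>a\<in>A. f a :: nat) \<longleftrightarrow> even (card {a\<in>A. odd (f a)})"
proof (induction rule: finite_induct)
  case (insert x F)
  have "{a\<in>insert x F. odd (f a)} = (if odd (f x) then insert x {a\<in>F. odd (f a)} else {a\<in>F. odd (f a)})"
    by auto
  then show ?case using insert by auto
qed simp

context bridgeless_cubic
begin

lemma card_cut_Un:
  assumes "S \<inter> T = {}"
  shows "card (cut G (S \<union> T)) + 2 * card (cut G S \<inter> cut G T) = card (cut G S) + card (cut G T)"
proof -
  have "cut G (S \<union> T) = (cut G S - cut G T) \<union> (cut G T - cut G S)"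
    using assms by (auto simp: in_cut_iff)
  then have "card (cut G (S \<union> T)) = card (cut G S - cut G T) + card (cut G T - cut G S)"
    using finite_cut[of S] finite_cut[of T]
    by (simp only:) (rule card_Un_disjoint, auto)
  moreover have "card (cut G S) = card (cut G S \<inter> cut G T) + card (cut G S - cut G T)"
    "card (cut G T) = card (cut G S \<inter> cut G T) + card (cut G T - cut G S)"
    using finite_cut by (metis card_Int_Diff, metis card_Int_Diff Int_commute)
  ultimately show ?thesis by simp
qed

text \<open>A Tutte set of \<open>G - T\<close> has at least two odd components in excess, each of which sends out at
  least three edges; the bound on the cut of \<open>T\<close> leaves no slack in this count.\<close>

theorem tight_barrier:
  assumes T: "T \<subseteq> verts G" "even (card T)" "card (cut G T) \<le> 6"
    and no: "\<nexists>F. F \<subseteq> inside G (verts G - T) \<and> covers_once G F (verts G - T)"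
  shows "card (cut G T) = 6 \<and> (\<exists>S. S \<subseteq> verts G - T \<and>
    (\<forall>D\<in>comps G (verts G - T - S). card (cut G D) = 3) \<and>
    card (comps G (verts G - T - S)) = card S + 2 \<and> inside G S = {} \<and> cut G S \<inter> cut G T = {})"
proof -
  obtain S where S: "S \<subseteq> verts G - T" "card S < card (odd_comps G (verts G - T - S))"
    using tutte[OF _ no] finite_verts by auto
  define X where "X = verts G - T - S"
  define Q where "Q = comps G X"
  define Q1 where "Q1 = odd_comps G X"
  have fin: "finite X" "finite S" "finite T" using finite_verts S T by (auto simp: X_def intro: finite_subset)
  have finQ: "finite Q" "Q1 \<subseteq> Q" using finite_comps[OF fin(1)] by (auto simp: Q_def Q1_def odd_comps_def)
  have XV: "X \<subseteq> verts G" and ST: "S \<inter> T = {}" using S by (auto simp: X_def)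
  have "verts G = X \<union> (S \<union> T)" "X \<inter> (S \<union> T) = {}" using S T by (auto simp: X_def)
  then have "card (verts G) = card X + (card S + card T)"
    using fin ST by (metis card_Un_disjoint finite_Un)
  then have par: "even (card X) \<longleftrightarrow> even (card S)" using even_verts T(2) by presburger
  have "card X = (\<Sum>D\<in>Q. card D)" using card_comps_sum[OF fin(1)] by (simp add: Q_def)
  then have "even (card X) \<longleftrightarrow> even (card Q1)"
    using even_sum_card_odd[OF finQ(1), of card] by (simp add: Q1_def odd_comps_def Q_def)
  \<comment> \<open>The number of odd components has the parity of \<open>card S\<close>, which
    raises the excess from one to two.\<close>
  then have "card S + 1 \<noteq> card Q1" using par by presburger
  then have Q1: "card S + 2 \<le> card Q1" using S(2) by (simp add: Q1_def X_def)
  have DV: "D \<subseteq> verts G" if "D \<in> Q" for D using that comps_subset XV by (metis Q_def subset_trans)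
  have ge3: "3 \<le> card (cut G D)" if "D \<in> Q1" for D
    using that DV finQ(2) by (intro odd_cut_ge3) (auto simp: Q1_def odd_comps_def)
  have "cut G X = cut G (S \<union> T)"
    using cut_compl[of "S \<union> T"] by (metis Diff_Diff_Int Diff_eq Un_commute X_def set_diff_eq Diff_Un Int_commute Int_Diff)
  then have sumQ: "(\<Sum>D\<in>Q. card (cut G D)) = card (cut G (S \<union> T))"
    using card_cut_comps[OF fin(1)] by (simp add: Q_def)
  have cS: "3 * card S = 2 * card (inside G S) + card (cut G S)" using degree_count S by blast
  have split: "(\<Sum>D\<in>Q. card (cut G D)) = (\<Sum>D\<in>Q1. card (cut G D)) + (\<Sum>D\<in>Q - Q1. card (cut G D))"
    using finQ by (metis add.commute sum.subset_diff)
  have low: "3 * card Q1 \<le> (\<Sum>D\<in>Q1. card (cut G D))"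
    using sum_mono[of Q1 "\<lambda>_. 3" "\<lambda>D. card (cut G D)"] ge3 by simp
  note facts = card_cut_Un[OF ST] sumQ cS split low Q1 T(3)
  \<comment> \<open>The chain is \<open>3 * (card S + 2) \<le> 3 * card Q1 \<le> card (cut G (S
    \<union> T)) \<le> 3 * card S + 6\<close>; hence equality holds everywhere and all error terms
    vanish.\<close>
  have eqs: "card (cut G T) = 6" "card Q1 = card S + 2" "card (inside G S) = 0"
    "card (cut G S \<inter> cut G T) = 0" "(\<Sum>D\<in>Q - Q1. card (cut G D)) = 0"
    "(\<Sum>D\<in>Q1. card (cut G D)) = 3 * card Q1"
    using facts by linarith+
  \<comment> \<open>An even component would have an empty cut and so be the whole vertex set, which
    leaves no room for the odd components.\<close>
  have QQ1: "Q = Q1"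
  proof (rule ccontr)
    assume "Q \<noteq> Q1"
    then obtain D where D: "D \<in> Q" "D \<notin> Q1" using finQ by blast
    then have "card (cut G D) = 0" using eqs(5) finQ(1) by auto
    moreover have "D \<noteq> {}" using D comps_nonempty by (auto simp: Q_def)
    ultimately have "D = verts G" using cut_ge2[of D] DV[OF D(1)] by auto
    obtain D' where D': "D' \<in> Q1" using eqs(2) by fastforce
    then have "D' \<in> Q" "D' \<noteq> {}" using finQ(2) comps_nonempty by (auto simp: Q_def)
    then have "D' = D" using DV[of D'] \<open>D = verts G\<close> comps_disjoint D(1) by (metis Q_def all_not_in_conv subsetD)
    then show False using D D' by blast
  qed
  have "card (cut G D) = 3" if "D \<in> Q" for D
  proof (rule ccontr)
    assume "card (cut G D) \<noteq> 3"
    then have "3 < card (cut G D)" using ge3 that QQ1 by force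
    then have "(\<Sum>D\<in>Q1. 3) < (\<Sum>D\<in>Q1. card (cut G D))"
      using ge3 that QQ1 finQ by (intro sum_strict_mono_ex1) auto
    then show False using eqs(6) by simp
  qed
  moreover have "inside G S = {}" "cut G S \<inter> cut G T = {}"
    using eqs(3,4) finite_inside finite_cut by auto
  ultimately show ?thesis using eqs QQ1 S(1) unfolding Q_def X_def by blast
qed

text \<open>Petersen's theorem as the case \<open>T = {}\<close>: a tight barrier would force the
  empty cut to have six edges.\<close>

corollary perfect_matching_exists: "\<exists>M. perfect_matching G M"
proof (rule ccontr)
  assume no: "\<nexists>M. perfect_matching G M"
  have "inside G (verts G) \<subseteq> edges G" by (rule inside_subset)
  then have "\<nexists>F. F \<subseteq> inside G (verts G - {}) \<and> covers_once G F (verts G - {})"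
    using no unfolding perfect_matching_iff Diff_empty by blast
  then have "card (cut G {}) = 6" using tight_barrier[of "{}"] by (auto simp: in_cut_iff cut_def)
  then show False by (simp add: cut_def)
qed

end

section \<open>Hall's theorem\<close>

text \<open>Induction after Halmos and Vaughan: a nonempty proper subfamily that is tight is
  represented first and its elements are removed; if there is none, every such union has an element
  to spare, so one index may take any of its elements.\<close>

theorem hall:
  assumes "finite I" "\<And>i. i \<in> I \<Longrightarrow> finite (A i)"
    and "\<And>J. J \<subseteq> I \<Longrightarrow> card J \<le> card (\<Union>(A ` J))"
  shows "\<exists>R. (\<forall>i\<in>I. R i \<in> A i) \<and> inj_on R I"
  using assms
proof (induction "card I" arbitrary: I A rule: less_induct)
  case less
  note fin = less.prems(1,2) and cond = less.prems(3)
  have finU: "finite (\<Union>(A ` J))" if "J \<subseteq> I" for J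
    using fin that by (meson finite_UN_I finite_subset subsetD)
  show ?case
  proof (cases "I = {}")
    case True then show ?thesis by simp
  next
    case False
    show ?thesis
    proof (cases "\<exists>J. J \<subset> I \<and> J \<noteq> {} \<and> card (\<Union>(A ` J)) = card J")
      case True
      then obtain J where J: "J \<subset> I" "J \<noteq> {}" "card (\<Union>(A ` J)) = card J" by blast
      have finJ: "finite J" using J fin finite_subset by blast
      have "card J < card I" using J fin by (simp add: psubset_card_mono)
      then obtain R1 where R1: "\<forall>i\<in>J. R1 i \<in> A i" "inj_on R1 J"
        using less.hyps[of J A] J(1) fin finJ cond by (metis psubsetE subset_iff subset_trans)
      define B where "B k = A k - \<Union>(A ` J)" for k
      have "card (I - J) < card I"
        using J fin by (intro psubset_card_mono) auto
      moreover have "card K \<le> card (\<Union>(B ` K))" if K: "K \<subseteq> I - J" for K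
      proof -
        have finK: "finite K" using K fin finite_subset by blast
        have "card K + card J = card (K \<union> J)" using K finK finJ by (subst card_Un_disjoint) auto
        also have "\<dots> \<le> card (\<Union>(A ` (K \<union> J)))" using K J by (intro cond) auto
        also have "\<Union>(A ` (K \<union> J)) = \<Union>(B ` K) \<union> \<Union>(A ` J)" by (auto simp: B_def)
        also have "card \<dots> \<le> card (\<Union>(B ` K)) + card (\<Union>(A ` J))" by (rule card_Un_le)
        finally show ?thesis using J(3) by simp
      qed
      ultimately obtain R2 where R2: "\<forall>i\<in>I-J. R2 i \<in> B i" "inj_on R2 (I - J)"
        using less.hyps[of "I - J" B] fin by (auto simp: B_def)
      define R where "R i = (if i \<in> J then R1 i else R2 i)" for i
      have sep: "R2 i \<noteq> R1 j" if "i \<in> I - J" "j \<in> J" for i j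
        using R1(1) R2(1) that unfolding B_def by (metis DiffD2 UN_I)
      have "inj_on R I"
      proof
        fix x y assume "x \<in> I" "y \<in> I" "R x = R y"
        then show "x = y" using R1(2) R2(2) sep[of x y] sep[of y x]
          by (auto simp: R_def inj_on_def split: if_splits)
      qed
      moreover have "\<forall>i\<in>I. R i \<in> A i" using R1 R2 by (auto simp: R_def B_def)
      ultimately show ?thesis by blast
    next
      case noTight: False
      obtain i where i: "i \<in> I" using False by blast
      have "card {i} \<le> card (\<Union>(A ` {i}))" using i by (intro cond) auto
      then obtain a where a: "a \<in> A i" by fastforce
      define B where "B k = A k - {a}" for k
      have "card (I - {i}) < card I" using i fin by (intro psubset_card_mono) auto
      moreover have "card K \<le> card (\<Union>(B ` K))" if K: "K \<subseteq> I - {i}" for K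
      proof (cases "K = {}")
        case False
        have "card K \<le> card (\<Union>(A ` K))" "card (\<Union>(A ` K)) \<noteq> card K"
          using K i False noTight cond by blast+
        moreover have "\<Union>(B ` K) = \<Union>(A ` K) - {a}" by (auto simp: B_def)
        moreover have "card (\<Union>(A ` K)) - 1 \<le> card (\<Union>(A ` K) - {a})"
          by (metis card_Diff_singleton_if diff_le_self order_refl)
        ultimately show ?thesis by simp
      qed simp
      ultimately obtain R where R: "\<forall>k\<in>I - {i}. R k \<in> B k" "inj_on R (I - {i})"
        using less.hyps[of "I - {i}" B] fin by (auto simp: B_def)
      define R' where "R' = R(i := a)"
      have "inj_on R' I"
      proof
        fix x y assume "x \<in> I" "y \<in> I" "R' x = R' y"
        then show "x = y" using R by (fastforce simp: R'_def B_def inj_on_def split: if_splits)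
      qed
      moreover have "\<forall>k\<in>I. R' k \<in> A k" using R a by (auto simp: R'_def B_def)
      ultimately show ?thesis by blast
    qed
  qed
qed

lemma card_fibres:
  assumes "finite F" "finite J" "\<And>j. j \<in> J \<Longrightarrow> card {e\<in>F. g e = j} = k"
  shows "card {e\<in>F. g e \<in> J} = k * card J"
proof -
  have "{e\<in>F. g e \<in> J} = (\<Union>j\<in>J. {e\<in>F. g e = j})" by auto
  also have "card \<dots> = (\<Sum>j\<in>J. card {e\<in>F. g e = j})"
    using assms by (intro card_UN_disjoint) auto
  finally show ?thesis using assms(3) by (simp add: mult.commute)
qed

text \<open>The elements of \<open>F\<close> are the edges of a bipartite multigraph, \<open>l\<close> and \<open>r\<close> give their ends.\<close>

theorem regular_bipartite_factor:
  assumes F: "finite F" and k: "k > 0"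
    and l: "\<And>e. e \<in> F \<Longrightarrow> card {e'\<in>F. l e' = l e} = k"
    and r: "\<And>e. e \<in> F \<Longrightarrow> card {e'\<in>F. r e' = r e} = k"
  shows "\<exists>N\<subseteq>F. bij_betw l N (l ` F) \<and> bij_betw r N (r ` F)"
proof -
  define A where "A x = r ` {e\<in>F. l e = x}" for x
  have all: "{e\<in>F. l e \<in> l ` F} = F" "{e\<in>F. r e \<in> r ` F} = F" by auto
  have cl: "card {e\<in>F. l e \<in> J} = k * card J" if "J \<subseteq> l ` F" for J
    using that F l by (intro card_fibres) (auto intro: finite_subset)
  have cr: "card {e\<in>F. r e \<in> J} = k * card J" if "J \<subseteq> r ` F" for J
    using that F r by (intro card_fibres) (auto intro: finite_subset)
  have "\<exists>R. (\<forall>i\<in>l ` F. R i \<in> A i) \<and> inj_on R (l ` F)"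
  proof (rule hall)
    fix J assume J: "J \<subseteq> l ` F"
    have "k * card J = card {e\<in>F. l e \<in> J}" using cl[OF J] by simp
    also have "\<dots> \<le> card {e\<in>F. r e \<in> \<Union>(A ` J)}"
      using F by (intro card_mono) (auto simp: A_def)
    also have "\<dots> = k * card (\<Union>(A ` J))" by (intro cr) (auto simp: A_def)
    finally show "card J \<le> card (\<Union>(A ` J))" using k by simp
  qed (use F in \<open>auto simp: A_def\<close>)
  then obtain R where R: "\<And>i. i \<in> l ` F \<Longrightarrow> R i \<in> A i" "inj_on R (l ` F)" by blast
  have "\<forall>i\<in>l ` F. \<exists>e. e \<in> F \<and> l e = i \<and> r e = R i"
  proof
    fix i assume "i \<in> l ` F"
    then show "\<exists>e. e \<in> F \<and> l e = i \<and> r e = R i" using R(1)[of i] by (auto simp: A_def)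
  qed
  then obtain E where E: "\<And>i. i \<in> l ` F \<Longrightarrow> E i \<in> F \<and> l (E i) = i \<and> r (E i) = R i" by metis
  define N where "N = E ` (l ` F)"
  have lN: "bij_betw l N (l ` F)"
    by (rule bij_betw_byWitness[where f' = E]) (use E in \<open>auto simp: N_def\<close>)
  have injr: "inj_on r N"
    unfolding N_def
  proof (rule inj_onI)
    fix x y assume xy: "x \<in> E ` l ` F" "y \<in> E ` l ` F" "r x = r y"
    then obtain i j where "i \<in> l ` F" "j \<in> l ` F" "x = E i" "y = E j" by blast
    moreover then have "R i = R j" using E xy(3) by simp
    ultimately show "x = y" using R(2) by (simp add: inj_on_eq_iff)
  qed
  have NF: "N \<subseteq> F" using E by (auto simp: N_def)
  have "k * card (l ` F) = card F" "k * card (r ` F) = card F"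
    using cl[OF subset_refl] cr[OF subset_refl] unfolding all by (blast intro: sym)+
  then have "card (l ` F) = card (r ` F)" using k by (metis mult_cancel1 not_gr_zero)
  moreover have "card N = card (l ` F)" using lN by (rule bij_betw_same_card)
  ultimately have "card (r ` N) = card (r ` F)" using injr by (simp add: card_image)
  then have "r ` N = r ` F" using NF F by (intro card_seteq) auto
  then show ?thesis using NF lN injr by (auto simp: bij_betw_def)
qed

section \<open>The Petersen graph\<close>

definition Pg_ends :: "(nat \<times> nat) list" where
  "Pg_ends = [(0,1),(1,2),(2,3),(3,4),(4,0),(0,5),(1,6),(2,7),(3,8),(4,9),(5,7),(6,8),(7,9),(8,5),(9,6)]"

definition Pg_stars :: "nat set list" where
  "Pg_stars = [{0,4,5},{0,1,6},{1,2,7},{2,3,8},{3,4,9},{5,10,13},{6,11,14},{7,10,12},{8,11,13},{9,12,14}]"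

text \<open>The complete list of perfect matchings. Two of them share exactly one edge and each edge
  lies in exactly two, so the 15 edges correspond to the 15 pairs; \<open>common_edge\<close>
  tabulates this correspondence, with an arbitrary diagonal.\<close>

definition Pg_matchings :: "nat set list" where
  "Pg_matchings = [{0,2,9,10,11},{0,3,7,13,14},{1,3,5,11,12},{1,4,8,10,14},{2,4,6,12,13},{5,6,7,8,9}]"

lemma less_10_cases: "(i::nat) < 10 \<Longrightarrow> i = 0 \<or> i = 1 \<or> i = 2 \<or> i = 3 \<or> i = 4 \<or> i = 5 \<or> i = 6 \<or> i = 7 \<or> i = 8 \<or> i = 9"
  by presburger

lemma less_15_cases: "(i::nat) < 15 \<Longrightarrow> i = 0 \<or> i = 1 \<or> i = 2 \<or> i = 3 \<or> i = 4 \<or> i = 5 \<or> i = 6 \<or> i = 7 \<or> i = 8 \<or> i = 9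
    \<or> i = 10 \<or> i = 11 \<or> i = 12 \<or> i = 13 \<or> i = 14"
  by presburger

lemma verts_Pg [simp]: "verts Pg = {0..<10}" and edges_Pg [simp]: "edges Pg = {0..<15}"
  by (simp_all add: Pg_def)

lemma ends_Pg: "e < 15 \<Longrightarrow> ends Pg e = Pg_ends ! e"
  by (drule less_15_cases, elim disjE) (simp_all add: Pg_def Pg_ends_def)

lemma star_Pg: "v < 10 \<Longrightarrow> star Pg v = Pg_stars ! v"
proof -
  have "e \<in> star Pg v \<longleftrightarrow> e \<in> Pg_stars ! v" if "v < 10" "e < 15" for v e
    using less_10_cases[OF that(1)] less_15_cases[OF that(2)]
    by (elim disjE) (simp_all add: in_star_iff ends_Pg Pg_ends_def Pg_stars_def)
  moreover have "e < 15" if "v < 10" "e \<in> Pg_stars ! v" for v e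
    using less_10_cases[OF that(1)] that(2) by (elim disjE) (auto simp: Pg_stars_def)
  moreover have "e < 15" if "e \<in> star Pg v" for e v using that by (simp add: in_star_iff)
  ultimately show "v < 10 \<Longrightarrow> star Pg v = Pg_stars ! v" by blast
qed

lemma loopless_Pg: "loopless_graph Pg"
proof
  have *: "fst (ends Pg e) < 10 \<and> snd (ends Pg e) < 10 \<and> fst (ends Pg e) \<noteq> snd (ends Pg e)" if "e < 15" for e
    using less_15_cases[OF that] by (elim disjE) (simp_all add: ends_Pg Pg_ends_def)
  then show "wf_graph Pg" by (simp add: wf_graph_def)
  show "e \<in> edges Pg \<Longrightarrow> fst (ends Pg e) \<noteq> snd (ends Pg e)" for e using * by simp
qed

lemma card_Int_triple_eq_1:
  assumes "a \<noteq> b" "a \<noteq> c" "b \<noteq> c"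
  shows "card (M \<inter> {a, b, c}) = 1 \<longleftrightarrow>
    (a \<in> M \<and> b \<notin> M \<and> c \<notin> M) \<or> (a \<notin> M \<and> b \<in> M \<and> c \<notin> M) \<or> (a \<notin> M \<and> b \<notin> M \<and> c \<in> M)"
  using assms by (cases "a \<in> M"; cases "b \<in> M"; cases "c \<in> M") (simp_all add: Int_insert_right)

lemma perfect_matching_Pg_iff:
  "perfect_matching Pg M \<longleftrightarrow> M \<subseteq> {0..<15} \<and> (\<forall>S\<in>set Pg_stars. card (M \<inter> S) = 1)"
proof -
  interpret loopless_graph Pg by (rule loopless_Pg)
  have "(\<forall>v\<in>{0..<10}. card (M \<inter> star Pg v) = 1) \<longleftrightarrow> (\<forall>v<length Pg_stars. card (M \<inter> Pg_stars ! v) = 1)"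
    by (auto simp: star_Pg Pg_stars_def)
  also have "\<dots> \<longleftrightarrow> (\<forall>S\<in>set Pg_stars. card (M \<inter> S) = 1)"
    by (metis in_set_conv_nth)
  finally show ?thesis by (simp add: perfect_matching_iff covers_once_def)
qed

lemma Pg_matchings_perfect: "k < 6 \<Longrightarrow> perfect_matching Pg (Pg_matchings ! k)"
proof -
  assume "k < 6"
  then have "k = 0 \<or> k = 1 \<or> k = 2 \<or> k = 3 \<or> k = 4 \<or> k = 5" by presburger
  then show "perfect_matching Pg (Pg_matchings ! k)"
    by (elim disjE) (simp_all add: perfect_matching_Pg_iff Pg_stars_def Pg_matchings_def card_Int_triple_eq_1)
qed

lemma Pg_matchings_complete:
  assumes "perfect_matching Pg M"
  shows "\<exists>k<6. M = Pg_matchings ! k"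
proof -
  have sub: "M \<subseteq> {0..<15}" and s: "\<And>S. S \<in> set Pg_stars \<Longrightarrow> card (M \<inter> S) = 1"
    using assms by (auto simp: perfect_matching_Pg_iff)
  define T where "T a b c \<longleftrightarrow>
    (a \<in> M \<and> b \<notin> M \<and> c \<notin> M) \<or> (a \<notin> M \<and> b \<in> M \<and> c \<notin> M) \<or> (a \<notin> M \<and> b \<notin> M \<and> c \<in> M)" for a b c
  have t: "T a b c" if "Pg_stars ! v = {a, b, c}" "v < 10" "a \<noteq> b \<and> a \<noteq> c \<and> b \<noteq> c" for v a b c
  proof -
    have "Pg_stars ! v \<in> set Pg_stars" using that(2) by (intro nth_mem) (simp add: Pg_stars_def)
    then have "card (M \<inter> {a, b, c}) = 1" unfolding that(1) by (rule s)

    then show ?thesis using card_Int_triple_eq_1[of a b c M] that(3) unfolding T_def by blast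
  qed
  have s': "T 0 4 5" "T 0 1 6" "T 1 2 7" "T 2 3 8" "T 3 4 9" "T 5 10 13" "T 6 11 14" "T 7 10 12" "T 8 11 13" "T 9 12 14"
    using t[of 0 0 4 5] t[of 1 0 1 6] t[of 2 1 2 7] t[of 3 2 3 8] t[of 4 3 4 9] t[of 5 5 10 13] t[of 6 6 11 14]
      t[of 7 7 10 12] t[of 8 8 11 13] t[of 9 9 12 14]
    by (simp_all add: Pg_stars_def)
  have "\<exists>k<6. \<forall>e<15. e \<in> M \<longleftrightarrow> e \<in> Pg_matchings ! k"
  proof -
    have ex: "(\<exists>k<6. Q k) \<longleftrightarrow> Q 0 \<or> Q 1 \<or> Q 2 \<or> Q 3 \<or> Q 4 \<or> Q (5::nat)" for Q
      by (auto simp: eval_nat_numeral less_Suc_eq)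
    have all: "(\<forall>e<15. Q e) \<longleftrightarrow> Q 0 \<and> Q 1 \<and> Q 2 \<and> Q 3 \<and> Q 4 \<and> Q (5::nat) \<and> Q 6 \<and> Q 7 \<and> Q 8 \<and> Q 9
        \<and> Q 10 \<and> Q 11 \<and> Q 12 \<and> Q 13 \<and> Q 14" for Q
      using less_15_cases by (intro iffI) (simp, blast)
    \<comment> \<open>What remains is propositional in the fifteen memberships
      \<open>e \<in> M\<close>, with one exactly-one condition per vertex.
      \<open>One_nat_def\<close> is kept from rewriting the numeral 1, so that the atoms agree with
      those in \<open>s'\<close>.\<close>
    show ?thesis using s' unfolding ex all T_def by (simp (no_asm) add: Pg_matchings_def del: One_nat_def, sat)
  qed
  then obtain k where k: "k < 6" "\<And>e. e < 15 \<Longrightarrow> e \<in> M \<longleftrightarrow> e \<in> Pg_matchings ! k" by blast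
  moreover have "Pg_matchings ! k \<subseteq> {0..<15}"
    using Pg_matchings_perfect[OF k(1)] by (simp add: perfect_matching_Pg_iff)
  ultimately have "M = Pg_matchings ! k" using sub by fastforce
  then show ?thesis using k by blast
qed

definition common_edge :: "nat \<Rightarrow> nat \<Rightarrow> nat" where
  "common_edge i j = [[0,0,11,10,2,9],[0,0,3,14,13,7],[11,3,0,1,12,5],[10,14,1,0,4,8],[2,13,12,4,0,6],[9,7,5,8,6,0]] ! i ! j"

lemma common_edge:
  assumes "i < 6" "j < 6" "i \<noteq> j"
  shows "common_edge i j < 15" "k < 6 \<Longrightarrow> common_edge i j \<in> Pg_matchings ! k \<longleftrightarrow> k = i \<or> k = j"
proof -
  have c: "n < 6 \<Longrightarrow> n = 0 \<or> n = 1 \<or> n = 2 \<or> n = 3 \<or> n = 4 \<or> n = 5" for n :: nat by presburger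
  show "common_edge i j < 15" using c[OF assms(1)] c[OF assms(2)] assms(3)
    by (elim disjE) (simp_all add: common_edge_def)
  assume k: "k < 6"
  have "\<forall>k\<in>{0,1,2,3,4,5}. common_edge i j \<in> Pg_matchings ! k \<longleftrightarrow> k = i \<or> k = j"
    using c[OF assms(1)] c[OF assms(2)] assms(3)
    by (elim disjE) (simp_all add: common_edge_def Pg_matchings_def)
  then show "common_edge i j \<in> Pg_matchings ! k \<longleftrightarrow> k = i \<or> k = j"
    using c[OF k] by blast
qed

lemma Pg_matching_index:
  fixes n :: nat
  assumes "\<forall>i<n. perfect_matching Pg (m i)"
  obtains g where "\<And>i. i < n \<Longrightarrow> g i < 6 \<and> m i = Pg_matchings ! g i"
proof
  fix i assume "i < n"
  then have "\<exists>k. k < 6 \<and> m i = Pg_matchings ! k" using assms Pg_matchings_complete by blast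
  then show "(SOME k. k < 6 \<and> m i = Pg_matchings ! k) < 6 \<and> m i = Pg_matchings ! (SOME k. k < 6 \<and> m i = Pg_matchings ! k)"
    by (rule someI_ex)
qed

lemma Pg_four_matchings:
  fixes m :: "nat \<Rightarrow> nat set"
  assumes "\<forall>i<4. perfect_matching Pg (m i)"
  shows "\<exists>e<15. \<forall>i<4. e \<notin> m i"
proof -
  obtain g where g: "\<And>i. i < 4 \<Longrightarrow> g i < 6 \<and> m i = Pg_matchings ! g i"
    using Pg_matching_index[OF assms] by metis
  have "card (g ` {..<4}) \<le> 4" using card_image_le[of "{..<4::nat}" g] by simp
  moreover have "card ({..<6} - g ` {..<4}) \<ge> card {..<6::nat} - card (g ` {..<4})"
    by (rule diff_card_le_card_Diff) simp
  ultimately have "card ({..<6} - g ` {..<4}) \<ge> 2" by simp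
  then obtain i j where ij: "i \<in> {..<6} - g ` {..<4}" "j \<in> {..<6} - g ` {..<4}" "i \<noteq> j"
    by (metis card_le_Suc0_iff_eq finite_Diff finite_lessThan not_less_eq_eq numeral_2_eq_2)
  have "common_edge i j \<notin> m l" if "l < 4" for l
  proof -
    have "g l \<noteq> i" "g l \<noteq> j" using ij that by auto
    then show ?thesis using common_edge(2)[of i j "g l"] ij g[OF that] by auto
  qed
  then show ?thesis using common_edge(1)[of i j] ij by auto
qed

lemma Pg_three_matchings:
  fixes m :: "nat \<Rightarrow> nat set"
  assumes "\<forall>i<3. perfect_matching Pg (m i)"
  shows "3 \<le> card {e\<in>edges Pg. \<forall>i<3. e \<notin> m i}"
proof -
  obtain g where g: "\<And>i. i < 3 \<Longrightarrow> g i < 6 \<and> m i = Pg_matchings ! g i"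
    using Pg_matching_index[OF assms] by metis
  have "card (g ` {..<3}) \<le> 3" using card_image_le[of "{..<3::nat}" g] by simp
  moreover have "card ({..<6} - g ` {..<3}) \<ge> card {..<6::nat} - card (g ` {..<3})"
    by (rule diff_card_le_card_Diff) simp
  ultimately have "card ({..<6} - g ` {..<3}) \<ge> 3" by simp
  then obtain T where T: "T \<subseteq> {..<6} - g ` {..<3}" "card T = 3"
    by (metis obtain_subset_with_card_n)
  then obtain x y z where xyz: "T = {x, y, z}" "x \<noteq> y" "y \<noteq> z" "x \<noteq> z" by (metis card_3_iff)
  have mem: "common_edge i j \<in> {e\<in>edges Pg. \<forall>i<3. e \<notin> m i}" if ij: "i \<in> T" "j \<in> T" "i \<noteq> j" for i j
  proof -
    have b: "i < 6" "j < 6" "i \<notin> g ` {..<3}" "j \<notin> g ` {..<3}" using ij T by auto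
    have "common_edge i j \<notin> m l" if "l < 3" for l
    proof -
      have "g l \<noteq> i" "g l \<noteq> j" using b that by auto
      then show ?thesis using common_edge(2)[of i j "g l"] b ij g[OF that] by auto
    qed
    then show ?thesis using common_edge(1)[of i j] b ij by auto
  qed
  have b: "x < 6" "y < 6" "z < 6" using xyz T by auto
  have "common_edge x y \<noteq> common_edge x z" "common_edge x y \<noteq> common_edge y z" "common_edge x z \<noteq> common_edge y z"
    using common_edge(2)[of x y z] common_edge(2)[of x z z] common_edge(2)[of y z z]
      common_edge(2)[of x z x] common_edge(2)[of y z x] b xyz by auto
  then have "card {common_edge x y, common_edge x z, common_edge y z} = 3" by simp
  moreover have "card {common_edge x y, common_edge x z, common_edge y z} \<le> card {e\<in>edges Pg. \<forall>i<3. e \<notin> m i}"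
    using mem xyz by (intro card_mono) auto
  ultimately show ?thesis by simp
qed

section \<open>The invariant of the constructions\<close>

text \<open>0, 7, 9 are every second edge of the hexagon. They are uncovered and the other three are
  doubly covered, so that the core is exactly \<open>C_edges\<close>.\<close>

definition hexagon_array :: "(nat, nat) graph \<Rightarrow> (nat \<Rightarrow> nat set) \<Rightarrow> bool" where
  "hexagon_array H m \<longleftrightarrow> (\<forall>i<3. perfect_matching H (m i)) \<and> (\<forall>e\<in>edges H. card {i. i < 3 \<and> e \<in> m i} =
     (if e \<in> {0, 7, 9} then 0 else if e \<in> C_edges then 2 else 1))"

text \<open>Lifting a cover to an insertion needs two matchings that avoid the distinguished edge.\<close>

definition five_cover :: "(nat, nat) graph \<Rightarrow> (nat \<Rightarrow> nat set) \<Rightarrow> bool" where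
  "five_cover H m \<longleftrightarrow> (\<forall>i<5. perfect_matching H (m i)) \<and> (\<forall>e\<in>edges H. \<exists>i<5. e \<in> m i) \<and>
     (\<forall>e\<in>edges H \<inter> edges Pg - C_edges. \<exists>i<5. \<exists>j<5. i \<noteq> j \<and> e \<notin> m i \<and> e \<notin> m j)"

text \<open>The two universally quantified bounds are the lower bounds on the defect and on the
  index, and the two witnesses make them sharp. The condition on \<open>endpts\<close> keeps
  \<open>C_edges\<close> away from every vertex that is substituted.\<close>

definition petersen_like :: "(nat, nat) graph \<Rightarrow> bool" where
  "petersen_like H \<longleftrightarrow> finite (edges H) \<and> C_edges \<subseteq> edges H \<and> (\<forall>e\<in>C_edges. endpts H e \<subseteq> C_verts) \<and>
    (\<forall>m. (\<forall>i<3. perfect_matching H (m i)) \<longrightarrow> 3 \<le> card {e\<in>edges H. \<forall>i<3::nat. e \<notin> m i}) \<and>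
    (\<forall>m. (\<forall>i<4. perfect_matching H (m i)) \<longrightarrow> (\<exists>e\<in>edges H. \<forall>i<4::nat. e \<notin> m i)) \<and>
    (\<exists>m. hexagon_array H m) \<and> (\<exists>m. five_cover H m)"

lemma petersen_likeD:
  assumes "petersen_like H"
  shows "finite (edges H)" "C_edges \<subseteq> edges H" "\<forall>e\<in>C_edges. endpts H e \<subseteq> C_verts"
    and "\<forall>i<3. perfect_matching H (m i) \<Longrightarrow> 3 \<le> card {e\<in>edges H. \<forall>i<3::nat. e \<notin> m i}"
    and "\<forall>i<4. perfect_matching H (m i) \<Longrightarrow> \<exists>e\<in>edges H. \<forall>i<4::nat. e \<notin> m i"
    and "\<exists>m. hexagon_array H m" "\<exists>m. five_cover H m"
  using assms unfolding petersen_like_def by (elim conjE; simp)+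

lemma card_filter_3: "card {i. i < (3::nat) \<and> P i} = (if P 0 then 1 else 0) + (if P 1 then 1 else 0) + (if P 2 then 1 else 0)"
proof -
  have "{i. i < (3::nat) \<and> P i} = {..<3} \<inter> {i. P i}" by auto
  then have "card {i. i < (3::nat) \<and> P i} = (\<Sum>i<3. if P i then 1 else 0)"
    by (simp add: sum.If_cases)
  then show ?thesis by (simp add: eval_nat_numeral)
qed

lemma petersen_like_Pg: "petersen_like Pg"
  unfolding petersen_like_def
proof (intro conjI allI impI)
  show "\<forall>e\<in>C_edges. endpts Pg e \<subseteq> C_verts"
    by (simp add: C_edges_def C_verts_def endpts_def ends_Pg Pg_ends_def)
  show "\<exists>m. hexagon_array Pg m"
    unfolding hexagon_array_def
  proof (intro exI conjI)
    show "\<forall>i<3. perfect_matching Pg (Pg_matchings ! (i + 2))" using Pg_matchings_perfect by simp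
    show "\<forall>e\<in>edges Pg. card {i. i < (3::nat) \<and> e \<in> Pg_matchings ! (i + 2)} =
       (if e \<in> {0, 7, 9} then 0 else if e \<in> C_edges then 2 else 1)"
    proof
      fix e assume "e \<in> edges Pg"
      then have "e < 15" by simp
      from less_15_cases[OF this] show "card {i. i < (3::nat) \<and> e \<in> Pg_matchings ! (i + 2)} =
       (if e \<in> {0, 7, 9} then 0 else if e \<in> C_edges then 2 else 1)"
        by (elim disjE) (simp_all add: card_filter_3 Pg_matchings_def C_edges_def)
    qed
  qed
  show "\<exists>m. five_cover Pg m"
    unfolding five_cover_def
  proof (intro exI conjI)
    \<comment> \<open>Each edge lies in two of the six matchings, so dropping the last one leaves it
      covered, and at least three of the remaining five avoid it.\<close>
    show "\<forall>i<5. perfect_matching Pg (Pg_matchings ! i)" using Pg_matchings_perfect by simp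
    have ex: "(\<exists>k<5. Q k) \<longleftrightarrow> Q 0 \<or> Q 1 \<or> Q 2 \<or> Q 3 \<or> Q (4::nat)" for Q
      by (auto simp: eval_nat_numeral less_Suc_eq)
    have "(\<exists>i<5. e \<in> Pg_matchings ! i) \<and> (\<exists>i<5. \<exists>j<5. i \<noteq> j \<and> e \<notin> Pg_matchings ! i \<and> e \<notin> Pg_matchings ! j)"
      if "e < 15" for e
      unfolding ex using less_15_cases[OF that] by (elim disjE) (simp_all add: Pg_matchings_def)
    then show "\<forall>e\<in>edges Pg. \<exists>i<5. e \<in> Pg_matchings ! i"
      "\<forall>e\<in>edges Pg \<inter> edges Pg - C_edges. \<exists>i<5. \<exists>j<5. i \<noteq> j \<and> e \<notin> Pg_matchings ! i \<and> e \<notin> Pg_matchings ! j"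
      by auto
  qed
next
  fix m :: "nat \<Rightarrow> nat set" assume "\<forall>i<4. perfect_matching Pg (m i)"
  then show "\<exists>e\<in>edges Pg. \<forall>i<4. e \<notin> m i" using Pg_four_matchings[of m] by auto
next
  fix m :: "nat \<Rightarrow> nat set" assume "\<forall>i<3. perfect_matching Pg (m i)"
  then show "3 \<le> card {e\<in>edges Pg. \<forall>i<3. e \<notin> m i}" by (rule Pg_three_matchings)
qed (auto simp: C_edges_def)

lemma cover_count_eq:
  "cover_count (m 0, m 1, m (2::nat)) e = card {i. i < 3 \<and> e \<in> m i}"
  by (simp add: cover_count_def card_filter_3)

lemma three_array_fun:
  assumes "three_array G A"
  obtains m where "A = (m 0, m 1, m (2::nat))" "\<forall>i<3. perfect_matching G (m i)"
proof
  show "A = ((\<lambda>i::nat. if i = 0 then fst A else if i = 1 then fst (snd A) else snd (snd A)) 0,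
      (\<lambda>i::nat. if i = 0 then fst A else if i = 1 then fst (snd A) else snd (snd A)) 1,
      (\<lambda>i::nat. if i = 0 then fst A else if i = 1 then fst (snd A) else snd (snd A)) 2)" by simp
qed (use assms in \<open>simp add: three_array_def\<close>)

lemma three_array_iff:
  "three_array G (m 0, m 1, m (2::nat)) \<longleftrightarrow> (\<forall>i<3. perfect_matching G (m i))"
  by (auto simp: three_array_def eval_nat_numeral less_Suc_eq)

lemma uncovered_eq:
  "uncovered G (m 0, m 1, m (2::nat)) = {e\<in>edges G. \<forall>i<3. e \<notin> m i}"
  unfolding uncovered_def cover_count_eq by auto

lemma finite_df_image:
  assumes "finite (edges G)"
  shows "finite ((\<lambda>A. card (uncovered G A)) ` {A. three_array G A})"
proof (rule finite_subset)
  have "card (uncovered G A) \<le> card (edges G)" for A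
    using assms by (intro card_mono) (auto simp: uncovered_def)
  then show "(\<lambda>A. card (uncovered G A)) ` {A. three_array G A} \<subseteq> {..card (edges G)}" by blast
qed simp

lemma petersen_like_result:
  assumes H: "petersen_like H"
  shows "df H = 3 \<and> pm_index H = 5 \<and> hexagonal_core H C_edges"
proof -
  have fin: "finite (edges H)" and CE: "C_edges \<subseteq> edges H"
    and low: "\<And>m. (\<forall>i<3. perfect_matching H (m i)) \<Longrightarrow> 3 \<le> card {e\<in>edges H. \<forall>i<3::nat. e \<notin> m i}"
    and no4: "\<And>m. (\<forall>i<4. perfect_matching H (m i)) \<Longrightarrow> (\<exists>e\<in>edges H. \<forall>i<4::nat. e \<notin> m i)"
    by (fact petersen_likeD[OF H])+
  obtain m where m: "hexagon_array H m" using petersen_likeD(6)[OF H] by blast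
  have m: "\<forall>i<3. perfect_matching H (m i)" "\<And>e. e \<in> edges H \<Longrightarrow> card {i. i < (3::nat) \<and> e \<in> m i} =
       (if e \<in> {0, 7, 9} then 0 else if e \<in> C_edges then 2 else 1)"
    using m unfolding hexagon_array_def by blast+
  obtain M5 where M5: "five_cover H M5" using petersen_likeD(7)[OF H] by blast
  have M5: "\<forall>i<5. perfect_matching H (M5 i)" "\<forall>e\<in>edges H. \<exists>i<5::nat. e \<in> M5 i"
    using M5 unfolding five_cover_def by blast+
  let ?A = "(m 0, m 1, m 2)"
  have arr: "three_array H ?A" using m(1) three_array_iff[of H m] by blast
  have C: "{0, 7, 9} \<subseteq> C_edges" by (simp add: C_edges_def)
  have "uncovered H ?A = {0, 7, 9}"
  proof -
    have "card {i. i < (3::nat) \<and> e \<in> m i} = 0 \<longleftrightarrow> e \<in> {0, 7, 9}" if "e \<in> edges H" for e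
      using m(2)[OF that] by (simp split: if_split)
    then have "e \<in> uncovered H ?A \<longleftrightarrow> e \<in> {0, 7, 9}" for e
      using CE C unfolding uncovered_def cover_count_eq[of m] mem_Collect_eq by (metis subsetD)
    then show ?thesis by (rule set_eqI)
  qed
  then have unc: "card (uncovered H ?A) = 3" by simp
  have "df H = 3" unfolding df_def
  proof (rule Min_eqI[OF finite_df_image[OF fin]])
    show "3 \<in> (\<lambda>A. card (uncovered H A)) ` {A. three_array H A}" using arr unc by (metis imageI mem_Collect_eq)
    fix y assume "y \<in> (\<lambda>A. card (uncovered H A)) ` {A. three_array H A}"
    then obtain A where A: "three_array H A" "y = card (uncovered H A)" by blast
    obtain m' where "A = (m' 0, m' 1, m' (2::nat))" "\<forall>i<3. perfect_matching H (m' i)"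
      using three_array_fun[OF A(1)] .
    then show "3 \<le> y" using low[of m'] A(2) uncovered_eq[of H m'] by simp
  qed
  moreover have "core H ?A = C_edges"
  proof -
    have "card {i. i < (3::nat) \<and> e \<in> m i} \<noteq> 1 \<longleftrightarrow> e \<in> C_edges" if "e \<in> edges H" for e
      using m(2)[OF that] C by (simp split: if_split)
    then have "e \<in> core H ?A \<longleftrightarrow> e \<in> C_edges" for e
      using CE unfolding core_def cover_count_eq[of m] mem_Collect_eq by (metis subsetD)
    then show ?thesis by (rule set_eqI)
  qed
  then have "hexagonal_core H C_edges"
    using arr unc calculation unfolding hexagonal_core_def optimal_array_def by metis
  moreover have "pm_index H = 5" unfolding pm_index_def
  proof (rule Least_equality)
    have "set (map M5 [0..<5]) = M5 ` {..<5}" by auto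
    then have "(\<forall>M\<in>set (map M5 [0..<5]). perfect_matching H M)" "\<Union>(set (map M5 [0..<5])) = edges H"
      using M5 by (auto simp: perfect_matching_def)
    then show "\<exists>Ms. length Ms = 5 \<and> (\<forall>M\<in>set Ms. perfect_matching H M) \<and> \<Union>(set Ms) = edges H"
      by (intro exI[of _ "map M5 [0..<5]"]) simp
    fix n assume "\<exists>Ms. length Ms = n \<and> (\<forall>M\<in>set Ms. perfect_matching H M) \<and> \<Union>(set Ms) = edges H"
    then obtain Ms where Ms: "length Ms = n" "\<forall>M\<in>set Ms. perfect_matching H M" "\<Union>(set Ms) = edges H" by blast
    show "5 \<le> n"
    proof (rule ccontr)
      assume "\<not> 5 \<le> n"
      then have n: "n \<le> 4" by simp
      \<comment> \<open>A cover by fewer than four matchings is padded with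
        \<open>m 0\<close>.\<close>
      define m' where "m' i = (if i < n then Ms ! i else m 0)" for i
      have "\<forall>i<4. perfect_matching H (m' i)" using Ms m by (simp add: m'_def)
      then obtain e where e: "e \<in> edges H" "\<forall>i<4. e \<notin> m' i" using no4 by blast
      then obtain M where "M \<in> set Ms" "e \<in> M" using Ms by blast
      then obtain i where "i < n" "e \<in> Ms ! i" using Ms(1) by (auto simp: in_set_conv_nth)
      then show False using e(2)[rule_format, of i] n by (simp add: m'_def)
    qed
  qed
  ultimately show ?thesis by blast
qed

lemma three_edge_colourable_proper:
  assumes "bridgeless_cubic G" "three_edge_colourable G"
  obtains c where "proper_on G c (verts G)"
proof -
  interpret bridgeless_cubic G by fact
  obtain c :: "'b \<Rightarrow> nat" where c: "\<And>e. e \<in> edges G \<Longrightarrow> c e < 3"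
    "\<And>e e'. e \<in> edges G \<Longrightarrow> e' \<in> edges G \<Longrightarrow> e \<noteq> e' \<Longrightarrow> endpts G e \<inter> endpts G e' \<noteq> {} \<Longrightarrow> c e \<noteq> c e'"
    using assms(2) unfolding three_edge_colourable_def by blast
  have "proper_on G c (verts G)" unfolding proper_on_def
  proof
    fix v assume v: "v \<in> verts G"
    have inj: "inj_on c (star G v)"
      by (rule inj_onI) (use c(2) in \<open>fastforce simp: star_def\<close>)
    have "c ` star G v \<subseteq> {..<3}" using c(1) by (auto simp: star_def)
    moreover have "card (c ` star G v) = 3" using inj card_star[OF v] by (simp add: card_image)
    ultimately have "c ` star G v = {..<3}" by (intro card_seteq) auto
    then show "bij_betw c (star G v) {..<3}" using inj by (simp add: bij_betw_def)
  qed
  then show ?thesis using that by blast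
qed

text \<open>Counts at a single vertex are moved along a renaming of its star only; the renaming may
  differ from vertex to vertex.\<close>

lemma card_image_Int:
  assumes "inj_on r S" "\<And>x. x \<in> S \<Longrightarrow> r x \<in> M' \<longleftrightarrow> x \<in> M"
  shows "card (M' \<inter> r ` S) = card (M \<inter> S)"
proof -
  have "M' \<inter> r ` S = r ` (M \<inter> S)" using assms(2) by auto
  then show ?thesis using assms(1) by (metis card_image inf_le2 inj_on_subset)
qed

lemma third_colours:
  assumes "c0 < (3::nat)"
  obtains c1 c2 where "{..<3} = {c0, c1, c2}" "c1 \<noteq> c0" "c2 \<noteq> c0" "c1 \<noteq> c2"
proof -
  have "c0 = 0 \<or> c0 = 1 \<or> c0 = 2" using assms by linarith
  then show ?thesis
    using that[of 1 2] that[of 0 2] that[of 0 1] by (auto simp: lessThan_def eval_nat_numeral less_Suc_eq)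
qed

text \<open>Both operations induce a projection of perfect matchings; the bounds from below are transferred
  along it.\<close>

lemma petersen_like_lower_bounds:
  assumes G: "petersen_like G" and fin: "finite (edges G')"
    and \<iota>: "inj_on \<iota> (edges G)" "\<iota> ` edges G \<subseteq> edges G'"
    and proj: "\<And>M'. perfect_matching G' M' \<Longrightarrow> perfect_matching G {e\<in>edges G. \<iota> e \<in> M'}"
  shows "\<forall>i<3. perfect_matching G' (m i) \<Longrightarrow> 3 \<le> card {e\<in>edges G'. \<forall>i<3::nat. e \<notin> m i}"
    and "\<forall>i<4. perfect_matching G' (m i) \<Longrightarrow> \<exists>e\<in>edges G'. \<forall>i<4::nat. e \<notin> m i"
proof -
  let ?p = "\<lambda>M'. {e\<in>edges G. \<iota> e \<in> M'}"
  assume "\<forall>i<3. perfect_matching G' (m i)"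
  then have "\<forall>i<3. perfect_matching G (?p (m i))" using proj by blast
  then have "3 \<le> card {e\<in>edges G. \<forall>i<3::nat. e \<notin> ?p (m i)}"
    by (rule petersen_likeD(4)[OF G])
  also have "\<dots> = card (\<iota> ` {e\<in>edges G. \<forall>i<3::nat. e \<notin> ?p (m i)})"
    using \<iota>(1) by (intro card_image[symmetric]) (auto intro: inj_on_subset)
  also have "\<dots> \<le> card {e\<in>edges G'. \<forall>i<3::nat. e \<notin> m i}"
    using \<iota>(2) fin by (intro card_mono) auto
  finally show "3 \<le> card {e\<in>edges G'. \<forall>i<3::nat. e \<notin> m i}" .
next
  let ?p = "\<lambda>M'. {e\<in>edges G. \<iota> e \<in> M'}"
  assume "\<forall>i<4. perfect_matching G' (m i)"
  then have "\<forall>i<4. perfect_matching G (?p (m i))" using proj by blast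
  then have "\<exists>e\<in>edges G. \<forall>i<4::nat. e \<notin> ?p (m i)"
    by (rule petersen_likeD(5)[OF G])
  then show "\<exists>e\<in>edges G'. \<forall>i<4::nat. e \<notin> m i" using \<iota>(2) by blast
qed

section \<open>Insertion\<close>

text \<open>The ends of \<open>f\<close> are called \<open>p\<close> and \<open>q\<close> in the
  order in which they are joined to the ends of \<open>e\<close>; this merges the two alternatives
  of \<open>insertion\<close>.\<close>

locale two_sum = G: bridgeless_cubic G + K: bridgeless_cubic K
  for G :: "('v, 'e) graph" and K :: "('w, 'f) graph" +
  fixes e :: 'e and f :: 'f and G' :: "('v, 'e) graph" and \<phi> :: "'w \<Rightarrow> 'v" and \<psi> :: "'f \<Rightarrow> 'e"
    and a b :: 'e and p q :: 'w
  assumes e: "e \<in> edges G" and f: "f \<in> edges K" "endpts K f = {p, q}"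
    and \<phi>: "inj_on \<phi> (verts K)" "\<phi> ` verts K \<inter> verts G = {}"
    and \<psi>: "inj_on \<psi> (edges K - {f})" "\<psi> ` (edges K - {f}) \<inter> edges G = {}"
    and ab: "a \<noteq> b" "a \<notin> edges G \<union> \<psi> ` (edges K - {f})" "b \<notin> edges G \<union> \<psi> ` (edges K - {f})"
    and verts': "verts G' = verts G \<union> \<phi> ` verts K"
    and edges': "edges G' = (edges G - {e}) \<union> \<psi> ` (edges K - {f}) \<union> {a, b}"
    and ends_old: "\<And>x. x \<in> edges G - {e} \<Longrightarrow> ends G' x = ends G x"
    and ends_new: "\<And>x. x \<in> edges K - {f} \<Longrightarrow> ends G' (\<psi> x) = map_prod \<phi> \<phi> (ends K x)"
    and ends_ab: "ends G' a = (fst (ends G e), \<phi> p)" "ends G' b = (snd (ends G e), \<phi> q)"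
begin

lemma pq: "p \<in> verts K" "q \<in> verts K" "p \<noteq> q"
  using f K.card_endpts[OF f(1)] K.endpts_subset[OF f(1)] by (auto simp: card_2_iff)

lemma \<phi>_notin: "y \<in> verts K \<Longrightarrow> \<phi> y \<notin> verts G"
  using \<phi>(2) by blast

lemma loopless': "loopless_graph G'"
proof
  have *: "fst (ends G' x) \<in> verts G' \<and> snd (ends G' x) \<in> verts G' \<and> fst (ends G' x) \<noteq> snd (ends G' x)"
    if "x \<in> edges G'" for x
  proof -
    consider "x \<in> edges G - {e}" | y where "y \<in> edges K - {f}" "x = \<psi> y" | "x = a" | "x = b"
      using \<open>x \<in> edges G'\<close> edges' by auto
    then show ?thesis
    proof cases
      case 1 then show ?thesis using G.ends_in_verts[of x] G.loopless[of x] ends_old verts' by simp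
    next
      case 2 then show ?thesis
        using K.ends_in_verts[of y] K.loopless[of y] ends_new verts' \<phi>(1) by (simp add: inj_on_eq_iff)
    next
      case 3 then show ?thesis using ends_ab pq \<phi>_notin G.ends_in_verts[OF e] verts' by auto
    next
      case 4 then show ?thesis using ends_ab pq \<phi>_notin G.ends_in_verts[OF e] verts' by auto
    qed
  qed
  show "wf_graph G'" unfolding wf_graph_def
    using * G.finite_verts K.finite_verts G.finite_edges K.finite_edges verts' edges' by simp
  show "x \<in> edges G' \<Longrightarrow> fst (ends G' x) \<noteq> snd (ends G' x)" for x using * by blast
qed

sublocale G': loopless_graph G' by (rule loopless')

text \<open>The name of an edge as seen from \<open>v\<close>: the edge \<open>e\<close> turns into
  \<open>a\<close> at its first end and into \<open>b\<close> at its second. With \<open>rK\<close>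
  as the analogue for \<open>f\<close>, every star of \<open>G'\<close> is an injective image of a
  star of \<open>G\<close> or of \<open>K\<close>.\<close>

definition rG :: "'v \<Rightarrow> 'e \<Rightarrow> 'e" where
  "rG v x = (if x = e then (if v = fst (ends G e) then a else b) else x)"

definition rK :: "'w \<Rightarrow> 'f \<Rightarrow> 'e" where
  "rK y x = (if x = f then (if y = p then a else b) else \<psi> x)"

lemma star_old:
  assumes v: "v \<in> verts G"
  shows "star G' v = rG v ` star G v"
proof (intro set_eqI iffI)
  fix x assume x: "x \<in> star G' v"
  then have "x \<in> edges G'" by (simp add: in_star_iff)
  then consider "x \<in> edges G - {e}" | y where "y \<in> edges K - {f}" "x = \<psi> y" | "x = a" | "x = b"
    using edges' by auto
  then show "x \<in> rG v ` star G v"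
  proof cases
    case 1
    then have "x \<in> star G v" "rG v x = x" using x ends_old by (auto simp: in_star_iff rG_def)
    then show ?thesis by (metis imageI)
  next
    case 2
    then show ?thesis using x ends_new K.ends_in_verts[of y] \<phi>_notin v by (auto simp: in_star_iff)
  next
    case 3
    then have "v = fst (ends G e)" using x ends_ab pq \<phi>_notin v by (auto simp: in_star_iff)
    then have "e \<in> star G v" "rG v e = x" using e 3 by (auto simp: in_star_iff rG_def)
    then show ?thesis by blast
  next
    case 4
    then have "v = snd (ends G e)" using x ends_ab pq \<phi>_notin v by (auto simp: in_star_iff)
    then have "e \<in> star G v" "rG v e = x" using e 4 G.loopless[OF e] by (auto simp: in_star_iff rG_def)
    then show ?thesis by blast
  qed
next
  fix x assume "x \<in> rG v ` star G v"
  then obtain y where y: "y \<in> star G v" "x = rG v y" by blast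
  show "x \<in> star G' v"
  proof (cases "y = e")
    case True
    then show ?thesis using y ends_ab edges' by (auto simp: in_star_iff rG_def)
  next
    case False
    then show ?thesis using y ends_old edges' by (auto simp: in_star_iff rG_def)
  qed
qed

lemma star_new:
  assumes y: "y \<in> verts K"
  shows "star G' (\<phi> y) = rK y ` star K y"
proof (intro set_eqI iffI)
  have eq: "\<phi> z = \<phi> y \<longleftrightarrow> z = y" if "z \<in> verts K" for z using \<phi>(1) y that by (simp add: inj_on_eq_iff)

  {
  fix x assume x: "x \<in> star G' (\<phi> y)"
  then have "x \<in> edges G'" by (simp add: in_star_iff)
  then consider "x \<in> edges G - {e}" | z where "z \<in> edges K - {f}" "x = \<psi> z" | "x = a" | "x = b"
    using edges' by auto
  then show "x \<in> rK y ` star K y"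
  proof cases
    case 1
    then show ?thesis using x ends_old G.ends_in_verts[of x] \<phi>_notin[OF y] by (auto simp: in_star_iff)
  next
    case 2
    then have "z \<in> star K y" using x ends_new K.ends_in_verts[of z] eq by (auto simp: in_star_iff)
    moreover have "rK y z = x" using 2 by (simp add: rK_def)
    ultimately show ?thesis by blast
  next
    case 3
    then have "y = p" using x ends_ab pq eq[of p] \<phi>_notin[OF y] G.ends_in_verts[OF e] by (auto simp: in_star_iff)
    then have "f \<in> star K y" "rK y f = x" using f 3 by (auto simp: star_def rK_def)
    then show ?thesis by blast
  next
    case 4
    then have "y = q" using x ends_ab pq eq[of q] \<phi>_notin[OF y] G.ends_in_verts[OF e] by (auto simp: in_star_iff)
    then have "f \<in> star K y" "rK y f = x" using f 4 pq by (auto simp: star_def rK_def)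
    then show ?thesis by blast
  qed
  }
  fix x assume "x \<in> rK y ` star K y"
  then obtain z where z: "z \<in> star K y" "x = rK y z" by blast
  show "x \<in> star G' (\<phi> y)"
  proof (cases "z = f")
    case True
    then have "y = p \<or> y = q" using z f by (auto simp: star_def)
    then show ?thesis using True z ends_ab edges' by (auto simp: in_star_iff rK_def)
  next
    case False
    then show ?thesis using z ends_new[of z] edges' by (auto simp: in_star_iff rK_def)
  qed
qed

lemma inj_rG: "inj_on (rG v) (star G v)"
  using ab star_subset[of G v] by (auto simp: inj_on_def rG_def)

lemma inj_rK: "inj_on (rK y) (star K y)"
proof (rule inj_onI)
  fix x z assume xz: "x \<in> star K y" "z \<in> star K y" "rK y x = rK y z"
  then have "x \<in> edges K" "z \<in> edges K" by (auto simp: star_def)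
  then show "x = z" using xz(3) ab inj_onD[OF \<psi>(1), of x z]
    by (auto simp: rK_def split: if_splits)
qed

lemma perfect_matchingI:
  assumes sub: "M' \<subseteq> edges G'"
    and G: "\<And>v x. v \<in> verts G \<Longrightarrow> x \<in> star G v \<Longrightarrow> rG v x \<in> M' \<longleftrightarrow> x \<in> M" "covers_once G M (verts G)"
    and K: "\<And>y x. y \<in> verts K \<Longrightarrow> x \<in> star K y \<Longrightarrow> rK y x \<in> M' \<longleftrightarrow> x \<in> F" "covers_once K F (verts K)"
  shows "perfect_matching G' M'"
  unfolding G'.perfect_matching_iff covers_once_def verts'
proof (intro conjI ballI sub)
  fix w assume "w \<in> verts G \<union> \<phi> ` verts K"
  then consider "w \<in> verts G" | y where "y \<in> verts K" "w = \<phi> y" by blast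
  then show "card (M' \<inter> star G' w) = 1"
  proof cases
    case 1
    then have "card (M' \<inter> star G' w) = card (M \<inter> star G w)"
      unfolding star_old[OF 1] by (intro card_image_Int inj_rG G(1))
    then show ?thesis using G(2) 1 by (simp add: covers_once_def)
  next
    case 2
    then have "card (M' \<inter> star G' w) = card (F \<inter> star K y)"
      unfolding 2(2) star_new[OF 2(1)] by (intro card_image_Int inj_rK K(1))
    then show ?thesis using K(2) 2 by (simp add: covers_once_def)
  qed
qed

lemma cut_copy: "cut G' (\<phi> ` verts K) = {a, b}"
proof (intro set_eqI iffI)
  fix x assume x: "x \<in> cut G' (\<phi> ` verts K)"
  then have "x \<in> edges G'" by (simp add: in_cut_iff)
  then consider "x \<in> edges G - {e}" | y where "y \<in> edges K - {f}" "x = \<psi> y" | "x = a" | "x = b"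
    using edges' by auto
  then show "x \<in> {a, b}"
  proof cases
    case 1
    then show ?thesis using x ends_old[OF 1] G.ends_in_verts[of x] \<phi>(2) by (auto simp: in_cut_iff)
  next
    case 2
    then show ?thesis using x ends_new K.ends_in_verts[of y] by (auto simp: in_cut_iff)
  qed auto
next
  fix x assume "x \<in> {a, b}"
  then show "x \<in> cut G' (\<phi> ` verts K)"
    using ends_ab edges' pq G.ends_in_verts[OF e] \<phi>(2) by (auto simp: in_cut_iff)
qed

text \<open>The copy of \<open>K\<close> has even order and its cut is \<open>{a, b}\<close>, so a
  perfect matching uses both edges or neither. Hence \<open>a\<close> can stand for \<open>e\<close>
  in the projection.\<close>

lemma matching_ab:
  assumes "perfect_matching G' M'"
  shows "a \<in> M' \<longleftrightarrow> b \<in> M'"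
proof -
  have M: "M' \<subseteq> edges G'" "covers_once G' M' (\<phi> ` verts K)"
    using assms verts' by (auto simp: G'.perfect_matching_iff intro: covers_once_mono)
  have "card (\<phi> ` verts K) = 2 * card (M' \<inter> inside G' (\<phi> ` verts K)) + card (M' \<inter> {a, b})"
    using G'.covers_once_count[OF _ M] K.finite_verts cut_copy by simp
  moreover have "even (card (\<phi> ` verts K))" using K.even_verts \<phi>(1) by (simp add: card_image)
  ultimately have "even (card (M' \<inter> {a, b}))" by presburger
  then show ?thesis using ab(1) by (cases "a \<in> M'"; cases "b \<in> M'") (auto simp: Int_insert_right)
qed

lemma project:
  assumes M': "perfect_matching G' M'"
  shows "perfect_matching G {x\<in>edges G. (if x = e then a else x) \<in> M'}"
  unfolding G.perfect_matching_iff covers_once_def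
proof (intro conjI ballI)
  fix v assume v: "v \<in> verts G"
  have "card (M' \<inter> star G' v) = card ({x\<in>edges G. (if x = e then a else x) \<in> M'} \<inter> star G v)"
    unfolding star_old[OF v] using matching_ab[OF M']
    by (intro card_image_Int inj_rG) (auto simp: rG_def star_def)
  then show "card ({x\<in>edges G. (if x = e then a else x) \<in> M'} \<inter> star G v) = 1"
    using M' v verts' by (simp add: G'.perfect_matching_iff covers_once_def)
qed auto

text \<open>A colour class of \<open>K\<close> continues \<open>M\<close> into the copy. The result
  is perfect if the colour \<open>j\<close> is that of \<open>f\<close> exactly when
  \<open>M\<close> contains \<open>e\<close>.\<close>

definition lift_matching :: "('f \<Rightarrow> nat) \<Rightarrow> nat \<Rightarrow> 'e set \<Rightarrow> 'e set" where
  "lift_matching c j M = (M - {e}) \<union> \<psi> ` {x\<in>edges K - {f}. c x = j} \<union> (if e \<in> M then {a, b} else {})"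

lemma lift_mem:
  assumes "M \<subseteq> edges G"
  shows "x \<in> edges G \<Longrightarrow> x \<noteq> e \<Longrightarrow> x \<in> lift_matching c j M \<longleftrightarrow> x \<in> M"
    and "a \<in> lift_matching c j M \<longleftrightarrow> e \<in> M" "b \<in> lift_matching c j M \<longleftrightarrow> e \<in> M"
    and "z \<in> edges K - {f} \<Longrightarrow> \<psi> z \<in> lift_matching c j M \<longleftrightarrow> c z = j"
proof -
  have \<psi>': "\<psi> z \<notin> edges G" "\<psi> z \<noteq> a" "\<psi> z \<noteq> b" if "z \<in> edges K - {f}" for z
    using \<psi>(2) ab that by blast+
  show "x \<in> edges G \<Longrightarrow> x \<noteq> e \<Longrightarrow> x \<in> lift_matching c j M \<longleftrightarrow> x \<in> M"
    using \<psi>(2) ab by (auto simp: lift_matching_def)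
  show "a \<in> lift_matching c j M \<longleftrightarrow> e \<in> M" "b \<in> lift_matching c j M \<longleftrightarrow> e \<in> M"
    using ab assms by (auto simp: lift_matching_def)
  show "z \<in> edges K - {f} \<Longrightarrow> \<psi> z \<in> lift_matching c j M \<longleftrightarrow> c z = j"
    using \<psi>'[of z] assms inj_onD[OF \<psi>(1), of z] unfolding lift_matching_def by auto
qed

lemma lift_perfect:
  assumes M: "perfect_matching G M" and c: "proper_on K c (verts K)" "j < 3" "e \<in> M \<longleftrightarrow> c f = j"
  shows "perfect_matching G' (lift_matching c j M)"
proof (rule perfect_matchingI)
  have ME: "M \<subseteq> edges G" and "covers_once G M (verts G)" using M by (auto simp: G.perfect_matching_iff)
  then show "covers_once G M (verts G)" "lift_matching c j M \<subseteq> edges G'"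
    using edges' by (auto simp: lift_matching_def)
  show "covers_once K {x\<in>edges K. c x = j} (verts K)"
    using K.colour_class_covers_once c by blast
  show "rG v x \<in> lift_matching c j M \<longleftrightarrow> x \<in> M" if "x \<in> star G v" for v x
    using lift_mem[OF ME] that by (auto simp: rG_def star_def)
  show "rK y x \<in> lift_matching c j M \<longleftrightarrow> x \<in> {x\<in>edges K. c x = j}" if "x \<in> star K y" for y x
    using lift_mem[OF ME] that c(3) by (auto simp: rK_def star_def)
qed

end

lemma insertion_two_sum:
  assumes "insertion G e K f G'" "bridgeless_cubic G" "bridgeless_cubic K"
  shows "\<exists>\<phi> \<psi> a b p q. two_sum G K e f G' \<phi> \<psi> a b p q"
proof -
  obtain \<phi> \<psi> a b where *: "e \<in> edges G" "f \<in> edges K" "inj_on \<phi> (verts K)" "\<phi> ` verts K \<inter> verts G = {}"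
    "inj_on \<psi> (edges K - {f})" "\<psi> ` (edges K - {f}) \<inter> edges G = {}"
    "a \<noteq> b" "a \<notin> edges G \<union> \<psi> ` (edges K - {f})" "b \<notin> edges G \<union> \<psi> ` (edges K - {f})"
    "verts G' = verts G \<union> \<phi> ` verts K"
    "edges G' = (edges G - {e}) \<union> \<psi> ` (edges K - {f}) \<union> {a, b}"
    "\<forall>x\<in>edges G - {e}. ends G' x = ends G x"
    "\<forall>x\<in>edges K - {f}. ends G' (\<psi> x) = map_prod \<phi> \<phi> (ends K x)"
    and or: "(ends G' a = (fst (ends G e), \<phi> (fst (ends K f))) \<and> ends G' b = (snd (ends G e), \<phi> (snd (ends K f)))) \<or>
        (ends G' a = (fst (ends G e), \<phi> (snd (ends K f))) \<and> ends G' b = (snd (ends G e), \<phi> (fst (ends K f))))"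
    using assms(1) unfolding insertion_def by (elim conjE exE) (rule that)
  have "two_sum G K e f G' \<phi> \<psi> a b (fst (ends K f)) (snd (ends K f)) \<or>
        two_sum G K e f G' \<phi> \<psi> a b (snd (ends K f)) (fst (ends K f))"
    using or
  proof
    assume "ends G' a = (fst (ends G e), \<phi> (fst (ends K f))) \<and> ends G' b = (snd (ends G e), \<phi> (snd (ends K f)))"
    then show ?thesis using * assms(2,3)
      by (intro disjI1 two_sum.intro two_sum_axioms.intro) (auto simp: endpts_def)
  next
    assume "ends G' a = (fst (ends G e), \<phi> (snd (ends K f))) \<and> ends G' b = (snd (ends G e), \<phi> (fst (ends K f)))"
    then show ?thesis using * assms(2,3)
      by (intro disjI2 two_sum.intro two_sum_axioms.intro) (auto simp: endpts_def)
  qed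
  then show ?thesis by blast
qed

lemma petersen_like_insertion:
  fixes K :: "(nat, nat) graph"
  assumes G: "petersen_like G" "bridgeless_cubic G" and K: "bridgeless_cubic K" "three_edge_colourable K"
    and ePg: "e \<in> edges Pg - C_edges" and ins: "insertion G e K f G'"
    and new: "(edges G' - edges G) \<inter> edges Pg = {}"
  shows "petersen_like G'"
proof -
  obtain \<phi> \<psi> a b p q where "two_sum G K e f G' \<phi> \<psi> a b p q"
    using insertion_two_sum[OF ins G(2) K(1)] by blast
  then interpret two_sum G K e f G' \<phi> \<psi> a b p q .
  note eG = e
  obtain c where c: "proper_on K c (verts K)" using three_edge_colourable_proper[OF K] .
  have cf: "c f < 3" using c pq f by (auto simp: proper_on_def bij_betw_def star_def)
  have cK: "c x < 3" if "x \<in> edges K" for x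
  proof -
    have "x \<in> star K (fst (ends K x))" "fst (ends K x) \<in> verts K"
      using that K.ends_in_verts by (auto simp: in_star_iff)
    then show ?thesis using c by (auto simp: proper_on_def bij_betw_def)
  qed
  let ?\<iota> = "\<lambda>x. if x = e then a else x"
  have \<iota>: "inj_on ?\<iota> (edges G)" "?\<iota> ` edges G \<subseteq> edges G'" using ab edges' by (auto simp: inj_on_def)
  note low = petersen_like_lower_bounds[OF G(1) G'.finite_edges \<iota> project]
  have CG: "C_edges \<subseteq> edges G" "\<forall>e\<in>C_edges. endpts G e \<subseteq> C_verts" using petersen_likeD[OF G(1)] by blast+
  have eC: "e \<notin> C_edges" using ePg by simp
  have C0: "{0, 7, 9} \<subseteq> C_edges" by (simp add: C_edges_def)
  have edge_cases: "x \<in> edges G' \<Longrightarrow> (x \<in> edges G - {e} \<Longrightarrow> P) \<Longrightarrow> (\<And>z. z \<in> edges K - {f} \<Longrightarrow> x = \<psi> z \<Longrightarrow> P)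
    \<Longrightarrow> (x \<in> {a, b} \<Longrightarrow> P) \<Longrightarrow> P" for x P using edges' by blast
  have newC: "\<psi> z \<notin> C_edges" if "z \<in> edges K - {f}" for z using CG \<psi>(2) that by blast
  have abC: "a \<notin> C_edges" "b \<notin> C_edges" using ab CG by auto
  obtain m where m: "hexagon_array G m" using petersen_likeD(6,7)[OF G(1)] by blast
  have m: "\<forall>i<3. perfect_matching G (m i)" "\<And>x. x \<in> edges G \<Longrightarrow> card {i. i < (3::nat) \<and> x \<in> m i} =
       (if x \<in> {0, 7, 9} then 0 else if x \<in> C_edges then 2 else 1)"
    using m unfolding hexagon_array_def by blast+
  have three: "\<exists>m. hexagon_array G' m"
  proof -
    have "card {i. i < (3::nat) \<and> e \<in> m i} = 1" using m(2)[OF eG] eC C0 by (auto split: if_splits)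
    then obtain i0 where "{i. i < (3::nat) \<and> e \<in> m i} = {i0}" by (metis card_1_singletonE)
    then have i0: "i < 3 \<and> e \<in> m i \<longleftrightarrow> i = i0" for i by blast
    then have i03: "i0 < 3" by blast
    \<comment> \<open>\<open>\<kappa>\<close> transposes \<open>i0\<close> and \<open>c f\<close>:
      the only matching through \<open>e\<close> receives the colour of \<open>f\<close>, and since
      \<open>\<kappa>\<close> permutes the colours, every edge of the copy is covered exactly
      once.\<close>
    define \<kappa> where "\<kappa> i = (if i = i0 then c f else if i = c f then i0 else i)" for i
    have \<kappa>3: "\<kappa> i < 3" if "i < 3" for i using that i03 cf by (simp add: \<kappa>_def)
    have \<kappa>f: "e \<in> m i \<longleftrightarrow> c f = \<kappa> i" if "i < 3" for i using i0[of i] that by (auto simp: \<kappa>_def)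
    have \<kappa>\<kappa>: "\<kappa> (\<kappa> i) = i" for i by (simp add: \<kappa>_def)
    let ?m = "\<lambda>i. lift_matching c (\<kappa> i) (m i)"
    have ME: "m i \<subseteq> edges G" if "i < 3" for i using m(1) that by (auto simp: perfect_matching_def)
    have "perfect_matching G' (?m i)" if "i < 3" for i
      using lift_perfect[OF _ c \<kappa>3[OF that] \<kappa>f[OF that]] m(1) that by blast
    moreover have "card {i. i < 3 \<and> x \<in> ?m i} =
       (if x \<in> {0, 7, 9} then 0 else if x \<in> C_edges then 2 else 1)" if "x \<in> edges G'" for x
      using that
    proof (rule edge_cases)
      assume x: "x \<in> edges G - {e}"
      then have "{i. i < 3 \<and> x \<in> ?m i} = {i. i < 3 \<and> x \<in> m i}" using lift_mem(1)[OF ME] by blast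
      then show ?thesis using m(2) x by simp
    next
      fix z assume z: "z \<in> edges K - {f}" "x = \<psi> z"
      have "i < 3 \<and> x \<in> ?m i \<longleftrightarrow> i = \<kappa> (c z)" for i
      proof (cases "i < 3")
        case True
        have "x \<in> ?m i \<longleftrightarrow> c z = \<kappa> i" unfolding z(2) by (rule lift_mem(4)[OF ME[OF True] z(1)])
        then show ?thesis using True \<kappa>\<kappa>[of i] \<kappa>\<kappa>[of "c z"] by auto
      next
        case False
        then show ?thesis using \<kappa>3[of "c z"] cK[of z] z(1) by blast
      qed
      then have "{i. i < 3 \<and> x \<in> ?m i} = {\<kappa> (c z)}" by simp
      moreover have xC: "x \<notin> C_edges" unfolding z(2) by (rule newC[OF z(1)])
      moreover have "x \<notin> {0, 7, 9}" using xC C0 by blast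
      ultimately show ?thesis by simp

    next
      assume x: "x \<in> {a, b}"
      have "i < 3 \<and> x \<in> ?m i \<longleftrightarrow> i = i0" for i
        using x lift_mem(2,3)[OF ME, of i c "\<kappa> i"] i0[of i] by (cases "i < 3") auto
      then have "{i. i < 3 \<and> x \<in> ?m i} = {i0}" by simp
      moreover have xC: "x \<notin> C_edges" using x abC by blast
      moreover have "x \<notin> {0, 7, 9}" using xC C0 by blast
      ultimately show ?thesis by simp
    qed
    ultimately have "hexagon_array G' ?m" unfolding hexagon_array_def by blast
    then show ?thesis by blast
  qed
  obtain m5 where m5: "five_cover G m5" using petersen_likeD(6,7)[OF G(1)] by blast
  have m5: "\<forall>i<5. perfect_matching G (m5 i)" "\<forall>e\<in>edges G. \<exists>i<5::nat. e \<in> m5 i"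
    "\<And>e. e \<in> edges G \<inter> edges Pg - C_edges \<Longrightarrow> \<exists>i<5. \<exists>j<5. i \<noteq> j \<and> e \<notin> m5 i \<and> e \<notin> m5 j"
    using m5 unfolding five_cover_def by blast+
  have five: "\<exists>m. five_cover G' m"
  proof -
    obtain i0 where i0: "i0 < 5" "e \<in> m5 i0" using m5(2) eG by blast
    obtain i1 i2 where i12: "i1 < 5" "i2 < 5" "i1 \<noteq> i2" "e \<notin> m5 i1" "e \<notin> m5 i2"
      using m5(3)[of e] ePg eG by blast
    obtain c1 c2 where c12: "{..<3} = {c f, c1, c2}" "c1 \<noteq> c f" "c2 \<noteq> c f" using third_colours[OF cf] by metis
    have c3: "c1 < 3" "c2 < 3" using c12(1) by auto
    \<comment> \<open>Matchings through \<open>e\<close> must use the colour of \<open>f\<close>.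
      Two matchings that avoid \<open>e\<close> supply the two other colours, so that all edges of
      the copy are covered.\<close>
    define \<kappa> where "\<kappa> i = (if e \<in> m5 i then c f else if i = i1 then c1 else c2)" for i
    have \<kappa>3: "\<kappa> i < 3" for i using c3 cf by (simp add: \<kappa>_def)
    have \<kappa>f: "e \<in> m5 i \<longleftrightarrow> c f = \<kappa> i" for i using c12 by (auto simp: \<kappa>_def)
    let ?m = "\<lambda>i. lift_matching c (\<kappa> i) (m5 i)"
    have ME: "m5 i \<subseteq> edges G" if "i < 5" for i using m5(1) that by (auto simp: perfect_matching_def)
    have "perfect_matching G' (?m i)" if "i < 5" for i
      using lift_perfect[OF _ c \<kappa>3 \<kappa>f] m5(1) that by blast
    moreover have "\<exists>i<5. x \<in> ?m i" if "x \<in> edges G'" for x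
      using that
    proof (rule edge_cases)
      assume x: "x \<in> edges G - {e}"
      then obtain i where "i < 5" "x \<in> m5 i" using m5(2) by blast
      then show ?thesis using lift_mem(1)[OF ME, of i x] x by blast
    next
      fix z assume z: "z \<in> edges K - {f}" "x = \<psi> z"
      have "c z \<in> {c f, c1, c2}" using cK z(1) c12(1) by blast
      then obtain i where i: "i < 5" "c z = \<kappa> i" using i0 i12 unfolding \<kappa>_def by auto
      have "x \<in> ?m i" unfolding z(2) using lift_mem(4)[OF ME[OF i(1)] z(1)] i(2) by blast
      then show ?thesis using i(1) by blast
    next
      assume "x \<in> {a, b}"
      then have "x \<in> ?m i0" using lift_mem(2,3)[OF ME[OF i0(1)]] i0(2) by blast
      then show ?thesis using i0(1) by blast
    qed
    moreover have "\<exists>i<5. \<exists>j<5. i \<noteq> j \<and> x \<notin> ?m i \<and> x \<notin> ?m j" if x: "x \<in> edges G' \<inter> edges Pg - C_edges" for x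
    proof -
      have "x \<in> edges G" using x new by blast
      moreover have "x \<noteq> e" using x edges' ab eG \<psi>(2) by auto
      moreover obtain i j where ij: "i < 5" "j < 5" "i \<noteq> j" "x \<notin> m5 i" "x \<notin> m5 j"
        using m5(3)[of x] x calculation(1) by blast
      ultimately have "x \<notin> ?m i" "x \<notin> ?m j" using lift_mem(1)[OF ME] by blast+
      then show ?thesis using ij by blast
    qed
    ultimately have "five_cover G' ?m" unfolding five_cover_def by blast
    then show ?thesis by blast
  qed
  have "C_edges \<subseteq> edges G'" using CG eC edges' by auto
  moreover have "\<forall>x\<in>C_edges. endpts G' x \<subseteq> C_verts"
  proof
    fix x assume x: "x \<in> C_edges"
    then have "x \<in> edges G - {e}" using CG(1) eC by blast
    then have "endpts G' x = endpts G x" by (simp add: endpts_def ends_old)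
    then show "endpts G' x \<subseteq> C_verts" using CG(2) x by simp
  qed
  ultimately show ?thesis unfolding petersen_like_def using G'.finite_edges low three five by blast
qed

section \<open>Correct substitution\<close>

context bridgeless_cubic
begin

lemma cut_singleton: "cut G {v} = star G v"
proof (rule set_eqI)
  show "e \<in> cut G {v} \<longleftrightarrow> e \<in> star G v" for e
    using loopless[of e] by (auto simp: in_cut_iff in_star_iff)
qed

lemma block_eq_iff:
  assumes "D \<in> comps G (verts G - U)" "x \<in> verts G"
  shows "block G U x = D \<longleftrightarrow> x \<in> D"
proof (cases "x \<in> U")
  case True
  then have "x \<notin> D" using comps_subset[OF assms(1)] by blast
  then show ?thesis using True by (auto simp: block_def)
next
  case False
  then have b: "block G U x = {y\<in>verts G - U. (x, y) \<in> (adj (induced G (verts G - U)))\<^sup>*}"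
    by (simp add: block_def)
  show ?thesis
  proof
    assume "block G U x = D"
    then show "x \<in> D" using b False assms(2) by auto
  next
    assume "x \<in> D"
    then show "block G U x = D" using comps_mem_eq[OF assms(1)] b by simp
  qed
qed

lemma degree_contract:
  assumes D: "D \<in> comps G (verts G - U)"
  shows "degree (contract G U) D = card (cut G D)"
proof -
  let ?A = "{e\<in>edges (contract G U). fst (ends (contract G U) e) = D}"
  let ?B = "{e\<in>edges (contract G U). snd (ends (contract G U) e) = D}"
  have "?A \<inter> ?B = {}" by (auto simp: contract_def)
  moreover have "?A \<union> ?B = cut G D"
  proof (rule set_eqI)
    fix e
    show "e \<in> ?A \<union> ?B \<longleftrightarrow> e \<in> cut G D"
    proof (cases "e \<in> edges G")
      case True
      then have "block G U (fst (ends G e)) = D \<longleftrightarrow> fst (ends G e) \<in> D"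
        "block G U (snd (ends G e)) = D \<longleftrightarrow> snd (ends G e) \<in> D"
        using block_eq_iff[OF D] ends_in_verts[OF True] by blast+
      then show ?thesis using True by (simp add: contract_def in_cut_iff) metis
    qed (simp add: contract_def in_cut_iff)
  qed
  moreover have "finite ?A" "finite ?B" using finite_edges by (auto simp: contract_def)
  then have "?A \<inter> ?B = {} \<Longrightarrow> card (?A \<union> ?B) = card ?A + card ?B" by (rule card_Un_disjoint)
  ultimately show ?thesis unfolding degree_def by simp
qed

lemma independent_iff_inside: "independent G U \<longleftrightarrow> U \<subseteq> verts G \<and> inside G U = {}"
  by (auto simp: independent_def inside_def)

text \<open>Both \<open>U\<close> and the components send out three edges per element, and these are
  the same edges; hence there are as many components as vertices in \<open>U\<close>.\<close>

lemma bipartising_set_counts: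
  assumes "bipartising_set G U"
  shows "U \<subseteq> verts G" "inside G U = {}" "card (comps G (verts G - U)) = card U"
    and "D \<in> comps G (verts G - U) \<Longrightarrow> card (cut G D) = 3"
proof -
  show U: "U \<subseteq> verts G" "inside G U = {}"
    using assms by (auto simp: bipartising_set_def independent_iff_inside)
  have cub: "cubic (contract G U)" using assms by (simp add: bipartising_set_def bipartite_cubic_parts_def)
  show c3: "card (cut G D) = 3" if D: "D \<in> comps G (verts G - U)" for D
  proof -
    have "D \<in> verts (contract G U)" using D by (simp add: contract_def)
    then show ?thesis using cub degree_contract[OF D] by (simp add: cubic_def)
  qed
  have "3 * card U = card (cut G U)" using degree_count[OF U(1)] U(2) by simp
  also have "\<dots> = card (cut G (verts G - U))" by (simp add: cut_compl)
  also have "\<dots> = (\<Sum>D\<in>comps G (verts G - U). card (cut G D))"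
    by (rule card_cut_comps) (simp add: finite_verts)
  also have "\<dots> = 3 * card (comps G (verts G - U))" by (simp add: c3)
  finally show "card (comps G (verts G - U)) = card U" by simp
qed

text \<open>Each component other than \<open>{v}\<close> is odd, hence uses up a vertex of \<open>U\<close>; only one remains for \<open>v\<close>.\<close>

lemma correct_meets_once:
  assumes corr: "correct_for G v" and v: "v \<in> verts G"
    and F: "F \<subseteq> edges G" "covers_once G F (verts G - {v})"
  shows "card (F \<inter> star G v) = 1"
proof -
  obtain U where U: "bipartising_set G U" "{v} \<in> comps G (verts G - U)"
    using corr by (auto simp: correct_for_def)
  note b = bipartising_set_counts[OF U(1)]
  define Q where "Q = comps G (verts G - U)"
  have finU: "finite U" using b(1) finite_verts finite_subset by blast
  have finQ: "finite Q" unfolding Q_def by (intro finite_comps) (simp add: finite_verts)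
  have vU: "v \<notin> U" using comps_subset[OF U(2)] by blast
  have "covers_once G F U" using covers_once_mono[OF F(2)] b(1) vU by blast
  then have cU: "card U = card (F \<inter> cut G U)" using covers_once_count[OF finU F(1)] b(2) by simp
  have "F \<inter> cut G U = (\<Union>D\<in>Q. F \<inter> cut G D)"
    using cut_comps_Union[of G "verts G - U"] by (auto simp: Q_def cut_compl)
  then have "card (F \<inter> cut G U) = card (\<Union>D\<in>Q. F \<inter> cut G D)" by simp
  also have "\<dots> = (\<Sum>D\<in>Q. card (F \<inter> cut G D))"
  proof (rule card_UN_disjoint)
    show "\<forall>D\<in>Q. \<forall>D'\<in>Q. D \<noteq> D' \<longrightarrow> (F \<inter> cut G D) \<inter> (F \<inter> cut G D') = {}"
      using cut_comps_disjoint[of _ G "verts G - U"] by (auto simp: Q_def)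
  qed (auto simp: finQ finite_cut)
  also have "\<dots> = card (F \<inter> cut G {v}) + (\<Sum>D\<in>Q - {{v}}. card (F \<inter> cut G D))"
    using U(2) finQ by (subst sum.remove[of Q "{v}"]) (auto simp: Q_def)
  finally have sum: "card U = card (F \<inter> star G v) + (\<Sum>D\<in>Q - {{v}}. card (F \<inter> cut G D))"
    using cU by (simp add: cut_singleton)
  have one: "1 \<le> card (F \<inter> cut G D)" if D: "D \<in> Q - {{v}}" for D
  proof -
    have DQ: "D \<in> comps G (verts G - U)" using D by (simp add: Q_def)
    have vD: "v \<notin> D" using comps_disjoint[OF DQ U(2), of v] D by auto
    have DV: "D \<subseteq> verts G" using comps_subset[OF DQ] by blast
    have "covers_once G F D" using covers_once_mono[OF F(2)] DV vD by blast
    then have "card D = 2 * card (F \<inter> inside G D) + card (F \<inter> cut G D)"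
      using DV finite_verts F(1) by (intro covers_once_count) (auto intro: finite_subset)
    moreover have "odd (card D)" using even_cut_iff[OF DV] b(4)[OF DQ] by simp
    ultimately show ?thesis by presburger
  qed
  have "card (Q - {{v}}) \<le> (\<Sum>D\<in>Q - {{v}}. card (F \<inter> cut G D))"
    using sum_mono[of "Q - {{v}}" "\<lambda>_. 1" "\<lambda>D. card (F \<inter> cut G D)"] one by simp
  moreover have "card Q \<noteq> 0" using U(2) finQ by (auto simp: Q_def)
  moreover have "card (Q - {{v}}) = card Q - 1"
    using U(2) by (simp add: Q_def card_Diff_singleton)
  moreover have "card Q = card U" using b(3) by (simp add: Q_def)
  ultimately have le: "card (F \<inter> star G v) \<le> 1" using sum by linarith
  \<comment> \<open>At most one edge of \<open>F\<close> at \<open>v\<close> is possible by the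
    count; the odd order of \<open>verts G - {v}\<close> excludes that there is none.\<close>
  have "card (verts G - {v}) = 2 * card (F \<inter> inside G (verts G - {v})) + card (F \<inter> cut G (verts G - {v}))"
    by (rule covers_once_count) (use F finite_verts in auto)
  moreover have "odd (card (verts G - {v}))"
    using even_verts v finite_verts by (metis card_Suc_Diff1 even_Suc)
  ultimately have "odd (card (F \<inter> star G v))" by (simp add: cut_compl cut_singleton)
  then show ?thesis using le by (metis One_nat_def le_SucE le_zero_eq even_zero)
qed

end

locale three_sum = G: bridgeless_cubic G + K: bridgeless_cubic K
  for G :: "('v, 'e) graph" and K :: "('w, 'f) graph" +
  fixes u :: 'v and v :: 'w and G' :: "('v, 'e) graph" and \<sigma> :: "'e \<Rightarrow> 'f" and \<phi> :: "'w \<Rightarrow> 'v"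
    and \<psi> :: "'f \<Rightarrow> 'e"
  assumes u: "u \<in> verts G" and v: "v \<in> verts K"
    and \<sigma>: "bij_betw \<sigma> (star G u) (star K v)"
    and \<phi>: "inj_on \<phi> (verts K - {v})" "\<phi> ` (verts K - {v}) \<inter> verts G = {}"
    and \<psi>: "inj_on \<psi> (edges K - star K v)" "\<psi> ` (edges K - star K v) \<inter> edges G = {}"
    and verts': "verts G' = (verts G - {u}) \<union> \<phi> ` (verts K - {v})"
    and edges': "edges G' = edges G \<union> \<psi> ` (edges K - star K v)"
    and ends_old: "\<And>x. x \<in> edges G - star G u \<Longrightarrow> ends G' x = ends G x"
    and ends_att: "\<And>a. a \<in> star G u \<Longrightarrow> ends G' a = repl_end u (\<phi> (other_end K (\<sigma> a) v)) (ends G a)"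
    and ends_new: "\<And>x. x \<in> edges K - star K v \<Longrightarrow> ends G' (\<psi> x) = map_prod \<phi> \<phi> (ends K x)"
begin

lemma \<phi>_notin: "y \<in> verts K \<Longrightarrow> y \<noteq> v \<Longrightarrow> \<phi> y \<notin> verts G"
  using \<phi>(2) by blast

lemma attachment: "a \<in> star G u \<Longrightarrow> other_end K (\<sigma> a) v \<in> verts K - {v}"
  using K.endpts_other_end \<sigma> by (metis DiffI bij_betwE empty_iff insert_iff)

lemma endpts_old: "x \<in> edges G - star G u \<Longrightarrow> endpts G' x = endpts G x"
  by (simp add: endpts_def ends_old)

lemma endpts_att: "a \<in> star G u \<Longrightarrow> endpts G' a = {other_end G a u, \<phi> (other_end K (\<sigma> a) v)}"
  using ends_att[of a] by (auto simp: endpts_def repl_end_def other_end_def in_star_iff)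

lemma endpts_new: "x \<in> edges K - star K v \<Longrightarrow> endpts G' (\<psi> x) = \<phi> ` endpts K x"
  by (simp add: endpts_def ends_new)

lemma inner_endpts: "x \<in> edges K - star K v \<Longrightarrow> endpts K x \<subseteq> verts K - {v}"
  using K.endpts_subset by (auto simp: star_def)

lemma edge_cases:
  assumes "x \<in> edges G'"
  obtains "x \<in> edges G - star G u" | "x \<in> star G u" | z where "z \<in> edges K - star K v" "x = \<psi> z"
  using assms edges' by blast

lemma loopless': "loopless_graph G'"
proof
  have *: "fst (ends G' x) \<in> verts G' \<and> snd (ends G' x) \<in> verts G' \<and> fst (ends G' x) \<noteq> snd (ends G' x)"
    if "x \<in> edges G'" for x
    using that
  proof (cases rule: edge_cases)
    case 1
    then have "x \<in> edges G" "fst (ends G x) \<noteq> u" "snd (ends G x) \<noteq> u" by (auto simp: in_star_iff)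
    then show ?thesis using G.ends_in_verts[of x] G.loopless[of x] ends_old[OF 1] verts' by simp
  next
    case 2
    have w: "\<phi> (other_end K (\<sigma> x) v) \<in> verts G'" "\<phi> (other_end K (\<sigma> x) v) \<notin> verts G"
      using attachment[OF 2] verts' \<phi>_notin by auto
    have "x \<in> edges G" using 2 by (simp add: in_star_iff)
    then have "fst (ends G x) \<in> verts G" "snd (ends G x) \<in> verts G" "fst (ends G x) \<noteq> snd (ends G x)"
      using G.ends_in_verts G.loopless by auto
    moreover have "fst (ends G x) = u \<or> snd (ends G x) = u" using 2 by (auto simp: in_star_iff)
    ultimately show ?thesis using w ends_att[OF 2] verts' by (auto simp: repl_end_def)
  next
    case (3 z)
    have "fst (ends K z) \<in> verts K - {v}" "snd (ends K z) \<in> verts K - {v}" "fst (ends K z) \<noteq> snd (ends K z)"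
      using inner_endpts[OF 3(1)] K.loopless[of z] 3(1) by (auto simp: endpts_def)
    then show ?thesis using ends_new[OF 3(1)] verts' \<phi>(1) 3(2) by (simp add: inj_on_eq_iff)
  qed
  show "wf_graph G'" unfolding wf_graph_def
    using * G.finite_verts K.finite_verts G.finite_edges K.finite_edges verts' edges' by simp
  show "x \<in> edges G' \<Longrightarrow> fst (ends G' x) \<noteq> snd (ends G' x)" for x using * by blast
qed

sublocale G': loopless_graph G' by (rule loopless')

text \<open>The edges at \<open>v\<close> are identified via \<open>\<sigma>\<close> with the edges
  at \<open>u\<close>, which keep their names. So, unlike for 2-sums, one injective renaming of the
  edges of \<open>K\<close> serves all vertices of the copy.\<close>

definition rK :: "'f \<Rightarrow> 'e" where
  "rK z = (if z \<in> star K v then inv_into (star G u) \<sigma> z else \<psi> z)"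

lemma rK_att: "z \<in> star K v \<Longrightarrow> rK z \<in> star G u \<and> \<sigma> (rK z) = z"
  using \<sigma> bij_betw_inv_into_right[OF \<sigma>] by (auto simp: rK_def bij_betw_def inv_into_into)

lemma rK_\<sigma>: "a \<in> star G u \<Longrightarrow> \<sigma> a \<in> star K v \<and> rK (\<sigma> a) = a"
  using \<sigma> by (auto simp: rK_def bij_betw_def)

lemma rK_inner: "z \<in> edges K \<Longrightarrow> z \<notin> star K v \<Longrightarrow> rK z = \<psi> z \<and> rK z \<notin> edges G"
  using \<psi>(2) by (auto simp: rK_def)

lemma inj_rK: "inj_on rK (edges K)"
proof (rule inj_onI)
  fix x z assume xz: "x \<in> edges K" "z \<in> edges K" "rK x = rK z"
  have sub: "star G u \<subseteq> edges G" by (rule star_subset)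
  show "x = z"
  proof (cases "x \<in> star K v"; cases "z \<in> star K v")
    assume "x \<in> star K v" "z \<in> star K v"
    then show ?thesis using rK_att xz(3) by metis
  next
    assume "x \<notin> star K v" "z \<notin> star K v"
    then show ?thesis using rK_inner[OF xz(1)] rK_inner[OF xz(2)] xz inj_onD[OF \<psi>(1), of x z] by auto
  next
    assume "x \<in> star K v" "z \<notin> star K v"
    then show ?thesis using rK_att[of x] rK_inner[OF xz(2)] xz(3) sub by auto
  next
    assume "x \<notin> star K v" "z \<in> star K v"
    then show ?thesis using rK_att[of z] rK_inner[OF xz(1)] xz(3) sub by auto
  qed
qed

lemma rK_star: "rK ` star K v = star G u"
  using rK_att rK_\<sigma> by (auto simp: image_iff) metis

lemma star_old:
  assumes w: "w \<in> verts G" "w \<noteq> u"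
  shows "star G' w = star G w"
proof -
  have "w \<in> endpts G' x \<longleftrightarrow> w \<in> endpts G x" if "x \<in> edges G" for x
  proof (cases "x \<in> star G u")
    case True
    have "endpts G x = {u, other_end G x u}" using G.endpts_other_end[OF True] by blast
    moreover have "w \<noteq> \<phi> (other_end K (\<sigma> x) v)" using attachment[OF True] \<phi>_notin w by blast
    ultimately show ?thesis using endpts_att[OF True] w by simp
  next
    case False
    then show ?thesis using endpts_old that by simp
  qed
  moreover have "w \<notin> endpts G' (\<psi> z)" if "z \<in> edges K - star K v" for z
    using endpts_new[OF that] inner_endpts[OF that] \<phi>(2) w by auto
  ultimately show ?thesis using edges' by (auto simp: star_def)
qed

lemma star_new:
  assumes y: "y \<in> verts K" "y \<noteq> v"
  shows "star G' (\<phi> y) = rK ` star K y"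
proof (intro set_eqI iffI)
  have eq: "\<phi> z = \<phi> y \<longleftrightarrow> z = y" if "z \<in> verts K - {v}" for z
    using \<phi>(1) y that by (simp add: inj_on_eq_iff)
  {
  fix x assume x: "x \<in> star G' (\<phi> y)"
  then have "x \<in> edges G'" and xe: "\<phi> y \<in> endpts G' x" by (auto simp: star_def)
  then show "x \<in> rK ` star K y"
  proof (cases rule: edge_cases)
    case 1
    then show ?thesis using xe endpts_old[OF 1] G.endpts_subset[of x] \<phi>_notin[OF y] by auto
  next
    case 2
    have "other_end G x u \<in> verts G" using G.endpts_other_end[OF 2] by blast
    then have "\<phi> y = \<phi> (other_end K (\<sigma> x) v)" using xe endpts_att[OF 2] \<phi>_notin[OF y] by auto
    then have "y = other_end K (\<sigma> x) v" using eq attachment[OF 2] by metis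
    moreover have s: "\<sigma> x \<in> star K v" "rK (\<sigma> x) = x" using rK_\<sigma>[OF 2] by auto
    ultimately have "y \<in> endpts K (\<sigma> x)" using K.endpts_other_end by blast
    then have "\<sigma> x \<in> star K y" using s by (simp add: star_def)
    then show ?thesis using s(2) by (metis imageI)
  next
    case (3 z)
    then have "\<phi> y \<in> \<phi> ` endpts K z" using xe endpts_new by simp
    then obtain z' where z': "z' \<in> endpts K z" "\<phi> z' = \<phi> y" by (metis imageE)
    then have "z' = y" using eq[of z'] inner_endpts[OF 3(1)] by (metis subsetD)
    then have "y \<in> endpts K z" using z'(1) by simp
    then have "z \<in> star K y" using 3 by (simp add: star_def)
    moreover have "rK z = x" using 3 rK_inner by simp
    ultimately show ?thesis by blast
  qed
  }
  fix x assume "x \<in> rK ` star K y"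
  then obtain z where z: "z \<in> star K y" "x = rK z" by blast
  show "x \<in> star G' (\<phi> y)"
  proof (cases "z \<in> star K v")
    case True
    then have x: "x \<in> star G u" "\<sigma> x = z" using rK_att z by auto
    have "endpts K z = {v, other_end K z v}" using K.endpts_other_end[OF True] by blast
    then have "y = other_end K z v" using z y by (auto simp: star_def)
    then have "\<phi> y \<in> endpts G' x" using endpts_att[OF x(1)] x(2) by simp
    then show ?thesis using x(1) edges' by (auto simp: star_def)
  next
    case False
    then have z': "z \<in> edges K - star K v" using z by (simp add: star_def)
    then have "x = \<psi> z" using rK_inner z by simp
    moreover have "y \<in> endpts K z" using z by (simp add: star_def)
    ultimately show ?thesis using endpts_new[OF z'] z' edges' by (auto simp: star_def)
  qed
qed

text \<open>Pulled back to \<open>K\<close>, the matching covers every vertex other than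
  \<open>v\<close> once. Correctness then forces exactly one edge at \<open>v\<close>, that is,
  exactly one edge at \<open>u\<close>.\<close>

lemma project:
  assumes M': "perfect_matching G' M'" and corr: "correct_for K v"
  shows "perfect_matching G {x\<in>edges G. x \<in> M'}"
  unfolding G.perfect_matching_iff covers_once_def
proof (intro conjI ballI)
  have M: "card (M' \<inter> star G' w) = 1" if "w \<in> verts G'" for w
    using M' that by (simp add: G'.perfect_matching_iff covers_once_def)
  define F where "F = {z\<in>edges K. rK z \<in> M'}"
  have F: "card (M' \<inter> rK ` star K y) = card (F \<inter> star K y)" for y
    by (rule card_image_Int) (auto simp: F_def star_def intro: inj_on_subset[OF inj_rK])
  fix w assume w: "w \<in> verts G"
  have eq: "{x\<in>edges G. x \<in> M'} \<inter> star G w = M' \<inter> star G w" by (auto simp: star_def)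
  show "card ({x\<in>edges G. x \<in> M'} \<inter> star G w) = 1"
  proof (cases "w = u")
    case True
    have "covers_once K F (verts K - {v})"
      unfolding covers_once_def
    proof
      fix y assume y: "y \<in> verts K - {v}"
      then have "card (F \<inter> star K y) = card (M' \<inter> star G' (\<phi> y))" using F star_new by simp
      then show "card (F \<inter> star K y) = 1" using M y verts' by simp
    qed
    then have "card (F \<inter> star K v) = 1"
      by (intro K.correct_meets_once[OF corr v]) (auto simp: F_def)
    then show ?thesis using F[of v] eq True by (simp add: rK_star)
  next
    case False
    then show ?thesis using eq star_old[OF w] M[of w] w verts' by simp
  qed
qed auto

definition lift_matching :: "('f \<Rightarrow> nat) \<Rightarrow> nat \<Rightarrow> 'e set \<Rightarrow> 'e set" where
  "lift_matching c j M = M \<union> \<psi> ` {x\<in>edges K - star K v. c x = j}"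

lemma lift_mem:
  assumes "M \<subseteq> edges G"
  shows "x \<in> edges G \<Longrightarrow> x \<in> lift_matching c j M \<longleftrightarrow> x \<in> M"
    and "z \<in> edges K - star K v \<Longrightarrow> \<psi> z \<in> lift_matching c j M \<longleftrightarrow> c z = j"
proof -
  show "x \<in> edges G \<Longrightarrow> x \<in> lift_matching c j M \<longleftrightarrow> x \<in> M"
    using \<psi>(2) by (auto simp: lift_matching_def)
  assume z: "z \<in> edges K - star K v"
  then have "\<psi> z \<notin> M" using \<psi>(2) assms by blast
  then show "\<psi> z \<in> lift_matching c j M \<longleftrightarrow> c z = j"
    using inj_onD[OF \<psi>(1), of z] z unfolding lift_matching_def by auto
qed

lemma lift_perfect:
  assumes M: "perfect_matching G M" and c: "proper_on K c (verts K)" "j < 3"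
    and att: "\<And>a. a \<in> star G u \<Longrightarrow> a \<in> M \<longleftrightarrow> c (\<sigma> a) = j"
  shows "perfect_matching G' (lift_matching c j M)"
  unfolding G'.perfect_matching_iff covers_once_def
proof (intro conjI ballI)
  have ME: "M \<subseteq> edges G" and M1: "covers_once G M (verts G)" using M by (auto simp: G.perfect_matching_iff)
  then show "lift_matching c j M \<subseteq> edges G'" using edges' by (auto simp: lift_matching_def)
  fix w assume "w \<in> verts G'"
  then consider "w \<in> verts G" "w \<noteq> u" | y where "y \<in> verts K" "y \<noteq> v" "w = \<phi> y" using verts' by blast
  then show "card (lift_matching c j M \<inter> star G' w) = 1"
  proof cases
    case 1
    have "lift_matching c j M \<inter> star G w = M \<inter> star G w" using lift_mem(1)[OF ME] by (auto simp: star_def)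
    then show ?thesis using star_old[OF 1] M1 1 by (simp add: covers_once_def)
  next
    case 2
    have mem: "rK z \<in> lift_matching c j M \<longleftrightarrow> z \<in> {z\<in>edges K. c z = j}" if z: "z \<in> star K y" for z
    proof (cases "z \<in> star K v")
      case True
      then have r: "rK z \<in> star G u" "\<sigma> (rK z) = z" using rK_att by auto
      then have "rK z \<in> edges G" by (simp add: star_def)
      then have "rK z \<in> lift_matching c j M \<longleftrightarrow> rK z \<in> M" by (rule lift_mem(1)[OF ME])
      also have "\<dots> \<longleftrightarrow> c z = j" using att[OF r(1)] r(2) by simp
      finally show ?thesis using z by (simp add: star_def)
    next
      case False
      then have z': "z \<in> edges K - star K v" using z by (simp add: star_def)
      then show ?thesis using lift_mem(2)[OF ME z'] rK_inner[of z] by simp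
    qed
    have "card (lift_matching c j M \<inter> star G' w) = card ({z\<in>edges K. c z = j} \<inter> star K y)"
      unfolding 2(3) star_new[OF 2(1,2)]
      by (rule card_image_Int[OF inj_on_subset[OF inj_rK star_subset] mem])
    also have "\<dots> = 1" using K.colour_class_covers_once[OF c] 2(1) by (simp add: covers_once_def)
    finally show ?thesis .
  qed
qed

end

lemma substitution_three_sum:
  assumes "substitution G u K v G'" "bridgeless_cubic G" "bridgeless_cubic K"
  shows "\<exists>\<sigma> \<phi> \<psi>. three_sum G K u v G' \<sigma> \<phi> \<psi>"
proof -
  have st: "{a\<in>edges G. u \<in> endpts G a} = star G u" "{b\<in>edges K. v \<in> endpts K b} = star K v"
    by (auto simp: star_def)
  obtain \<sigma> \<phi> \<psi> where *: "u \<in> verts G" "v \<in> verts K" "bij_betw \<sigma> (star G u) (star K v)"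
    "inj_on \<phi> (verts K - {v})" "\<phi> ` (verts K - {v}) \<inter> verts G = {}"
    "inj_on \<psi> (edges K - star K v)" "\<psi> ` (edges K - star K v) \<inter> edges G = {}"
    "verts G' = (verts G - {u}) \<union> \<phi> ` (verts K - {v})"
    "edges G' = edges G \<union> \<psi> ` (edges K - star K v)"
    "\<forall>x\<in>edges G - star G u. ends G' x = ends G x"
    "\<forall>a\<in>star G u. ends G' a = repl_end u (\<phi> (other_end K (\<sigma> a) v)) (ends G a)"
    "\<forall>x\<in>edges K - star K v. ends G' (\<psi> x) = map_prod \<phi> \<phi> (ends K x)"
    using assms(1) unfolding substitution_def Let_def st by (elim conjE exE) (rule that)
  have "three_sum G K u v G' \<sigma> \<phi> \<psi>"
    by (intro three_sum.intro three_sum_axioms.intro assms(2,3) *(1-9) *(10-12)[rule_format])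
  then show ?thesis by blast
qed

lemma petersen_like_substitution:
  fixes K :: "(nat, nat) graph"
  assumes G: "petersen_like G" "bridgeless_cubic G" and K: "bridgeless_cubic K" "three_edge_colourable K"
    and corr: "correct_for K v"
    and uPg: "u \<in> verts Pg - C_verts" and subst: "substitution G u K v G'"
    and new: "(edges G' - edges G) \<inter> edges Pg = {}"
  shows "petersen_like G'"
proof -
  obtain \<sigma> \<phi> \<psi> where "three_sum G K u v G' \<sigma> \<phi> \<psi>"
    using substitution_three_sum[OF subst G(2) K(1)] by blast
  then interpret three_sum G K u v G' \<sigma> \<phi> \<psi> .
  obtain c where c: "proper_on K c (verts K)" using three_edge_colourable_proper[OF K] .
  have cv: "bij_betw c (star K v) {..<3}" using c v by (simp add: proper_on_def)
  have c\<sigma>: "bij_betw (c \<circ> \<sigma>) (star G u) {..<3}" using bij_betw_trans[OF \<sigma> cv] .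
  have cK: "c x < 3" if "x \<in> edges K" for x
  proof -
    have "x \<in> star K (fst (ends K x))" "fst (ends K x) \<in> verts K"
      using that K.ends_in_verts by (auto simp: in_star_iff)
    then show ?thesis using c by (auto simp: proper_on_def bij_betw_def)
  qed
  note low = petersen_like_lower_bounds[OF G(1) G'.finite_edges, where \<iota> = "\<lambda>x. x"]
  have sub: "(\<lambda>x. x) ` edges G \<subseteq> edges G'" using edges' by auto
  have CG: "C_edges \<subseteq> edges G" "\<forall>e\<in>C_edges. endpts G e \<subseteq> C_verts" using petersen_likeD(2,3)[OF G(1)] .
  have uC: "star G u \<inter> C_edges = {}" using CG uPg by (auto simp: star_def)
  have C0: "{0, 7, 9} \<subseteq> C_edges" by (simp add: C_edges_def)
  \<comment> \<open>A perfect matching has one edge at \<open>u\<close>; its colour in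
    \<open>K\<close> singles out the colour class that continues the matching.\<close>
  have att: "\<exists>j<3. \<forall>a\<in>star G u. a \<in> M \<longleftrightarrow> c (\<sigma> a) = j" if M: "perfect_matching G M" for M
  proof -
    have M1: "covers_once G M (verts G)" using M by (simp add: G.perfect_matching_iff)
    obtain a where a: "a \<in> M" "a \<in> star G u" using G.covers_once_ex[OF M1 u] .
    have "b \<in> M \<longleftrightarrow> c (\<sigma> b) = c (\<sigma> a)" if b: "b \<in> star G u" for b
    proof
      assume "b \<in> M"
      then show "c (\<sigma> b) = c (\<sigma> a)" using G.covers_once_unique[OF M1 u _ a(1) b a(2)] by simp
    next
      assume "c (\<sigma> b) = c (\<sigma> a)"
      then have "b = a" using inj_onD[OF bij_betw_imp_inj_on[OF c\<sigma>], of b a] a(2) b by simp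
      then show "b \<in> M" using a(1) by simp
    qed
    moreover have "c (\<sigma> a) < 3" using c\<sigma> a(2) by (auto simp: bij_betw_def)
    ultimately show ?thesis by blast
  qed
  define \<kappa> where "\<kappa> M = (SOME j. j < 3 \<and> (\<forall>a\<in>star G u. a \<in> M \<longleftrightarrow> c (\<sigma> a) = j))" for M
  have \<kappa>: "\<kappa> M < 3" "a \<in> star G u \<Longrightarrow> a \<in> M \<longleftrightarrow> c (\<sigma> a) = \<kappa> M" if "perfect_matching G M" for M a
    using someI_ex[of "\<lambda>j. j < 3 \<and> (\<forall>a\<in>star G u. a \<in> M \<longleftrightarrow> c (\<sigma> a) = j)"] att[OF that]
    unfolding \<kappa>_def[symmetric] by blast+
  let ?l = "\<lambda>M. lift_matching c (\<kappa> M) M"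
  have lift: "perfect_matching G' (?l M)" if "perfect_matching G M" for M
    using lift_perfect[OF that c \<kappa>(1)[OF that]] \<kappa>(2)[OF that] by blast
  have mem: "x \<in> ?l M \<longleftrightarrow> x \<in> M" if "perfect_matching G M" "x \<in> edges G" for M x
    using lift_mem(1)[of M x] that by (simp add: perfect_matching_def)
  \<comment> \<open>A new edge is in the lift of \<open>M\<close> exactly when the edge at
    \<open>u\<close> of the same colour is in \<open>M\<close>. So its multiplicity in the array,
    and its being covered by five matchings, are copied from that edge.\<close>
  have new_mem: "\<exists>a\<in>star G u. \<forall>M. perfect_matching G M \<longrightarrow> (\<psi> z \<in> ?l M \<longleftrightarrow> a \<in> M)"
    if z: "z \<in> edges K - star K v" for z
  proof -
    have "c z \<in> (c \<circ> \<sigma>) ` star G u" using c\<sigma> cK[of z] z by (simp add: bij_betw_def)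
    then obtain a where a: "a \<in> star G u" "c (\<sigma> a) = c z" by auto
    have "\<psi> z \<in> ?l M \<longleftrightarrow> a \<in> M" if M: "perfect_matching G M" for M
    proof -
      have "M \<subseteq> edges G" using M by (simp add: perfect_matching_def)
      then have "\<psi> z \<in> ?l M \<longleftrightarrow> c z = \<kappa> M" using lift_mem(2) z by blast
      then show ?thesis using \<kappa>(2)[OF M a(1)] a(2) by simp
    qed
    then show ?thesis using a(1) by blast
  qed
  obtain m where m: "hexagon_array G m" using petersen_likeD(6)[OF G(1)] by blast
  have m: "\<And>i. i < 3 \<Longrightarrow> perfect_matching G (m i)" "\<And>x. x \<in> edges G \<Longrightarrow> card {i. i < (3::nat) \<and> x \<in> m i} =
       (if x \<in> {0, 7, 9} then 0 else if x \<in> C_edges then 2 else 1)"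
    using m unfolding hexagon_array_def by blast+
  have "hexagon_array G' (\<lambda>i. ?l (m i))"
    unfolding hexagon_array_def
  proof (intro conjI allI impI ballI)
    show "i < 3 \<Longrightarrow> perfect_matching G' (?l (m i))" for i using lift m(1) by blast
    fix x assume "x \<in> edges G'"
    then consider "x \<in> edges G" | z where "z \<in> edges K - star K v" "x = \<psi> z" using edges' by blast
    then show "card {i. i < 3 \<and> x \<in> ?l (m i)} = (if x \<in> {0, 7, 9} then 0 else if x \<in> C_edges then 2 else 1)"
    proof cases
      case 1
      have "{i. i < 3 \<and> x \<in> ?l (m i)} = {i. i < 3 \<and> x \<in> m i}" using mem[OF m(1) 1] by blast
      then show ?thesis using m(2)[OF 1] by simp
    next
      case 2
      obtain a where a: "a \<in> star G u" "\<And>M. perfect_matching G M \<Longrightarrow> \<psi> z \<in> ?l M \<longleftrightarrow> a \<in> M"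
        using new_mem[OF 2(1)] by blast
      have "{i. i < 3 \<and> x \<in> ?l (m i)} = {i. i < 3 \<and> a \<in> m i}" using a(2)[OF m(1)] 2(2) by blast
      moreover have "a \<in> edges G" "a \<notin> C_edges" using a(1) uC by (auto simp: star_def)
      moreover have "x \<notin> C_edges" using 2 \<psi>(2) CG(1) by blast
      moreover have "x \<notin> {0, 7, 9}" "a \<notin> {0, 7, 9}" using calculation(3,4) C0 by blast+
      ultimately show ?thesis using m(2)[of a] by simp
    qed
  qed
  moreover obtain m5 where m5: "five_cover G m5" using petersen_likeD(7)[OF G(1)] by blast
  have m5: "\<And>i. i < 5 \<Longrightarrow> perfect_matching G (m5 i)" "\<And>x. x \<in> edges G \<Longrightarrow> \<exists>i<5::nat. x \<in> m5 i"
    "\<And>e. e \<in> edges G \<inter> edges Pg - C_edges \<Longrightarrow> \<exists>i<5. \<exists>j<5. i \<noteq> j \<and> e \<notin> m5 i \<and> e \<notin> m5 j"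
    using m5 unfolding five_cover_def by blast+
  have "five_cover G' (\<lambda>i. ?l (m5 i))"
    unfolding five_cover_def
  proof (intro conjI allI impI ballI)
    show "i < 5 \<Longrightarrow> perfect_matching G' (?l (m5 i))" for i using lift m5(1) by blast
    fix x assume "x \<in> edges G'"
    then consider "x \<in> edges G" | z where "z \<in> edges K - star K v" "x = \<psi> z" using edges' by blast
    then show "\<exists>i<5. x \<in> ?l (m5 i)"
    proof cases
      case 1
      then obtain i where "i < 5" "x \<in> m5 i" using m5(2) by blast
      then show ?thesis using mem[OF m5(1) 1] by blast
    next
      case 2
      obtain a where a: "a \<in> star G u" "\<And>M. perfect_matching G M \<Longrightarrow> \<psi> z \<in> ?l M \<longleftrightarrow> a \<in> M"
        using new_mem[OF 2(1)] by blast
      have "a \<in> edges G" using a(1) by (simp add: star_def)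
      then obtain i where i: "i < 5" "a \<in> m5 i" using m5(2) by blast
      then show ?thesis using a(2)[OF m5(1)[OF i(1)]] 2(2) by blast
    qed
  next
    fix x assume x: "x \<in> edges G' \<inter> edges Pg - C_edges"
    then have xG: "x \<in> edges G" using new by blast
    then obtain i j where ij: "i < 5" "j < 5" "i \<noteq> j" "x \<notin> m5 i" "x \<notin> m5 j"
      using m5(3)[of x] x by blast
    then have "x \<notin> ?l (m5 i)" "x \<notin> ?l (m5 j)" using mem[OF m5(1) xG] by blast+
    then show "\<exists>i<5. \<exists>j<5. i \<noteq> j \<and> x \<notin> ?l (m5 i) \<and> x \<notin> ?l (m5 j)" using ij by blast
  qed
  moreover have "C_edges \<subseteq> edges G'" using CG edges' by auto
  moreover have "\<forall>x\<in>C_edges. endpts G' x \<subseteq> C_verts"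
  proof
    fix x assume x: "x \<in> C_edges"
    then have "x \<in> edges G - star G u" using CG(1) uC by blast
    then have "endpts G' x = endpts G x" by (rule endpts_old)
    then show "endpts G' x \<subseteq> C_verts" using CG(2) x by simp
  qed
  moreover have "\<forall>m. (\<forall>i<3. perfect_matching G' (m i)) \<longrightarrow> 3 \<le> card {e\<in>edges G'. \<forall>i<3::nat. e \<notin> m i}"
    using low(1)[OF inj_on_id2 sub project[OF _ corr]] by blast
  moreover have "\<forall>m. (\<forall>i<4. perfect_matching G' (m i)) \<longrightarrow> (\<exists>e\<in>edges G'. \<forall>i<4::nat. e \<notin> m i)"
    using low(2)[OF inj_on_id2 sub project[OF _ corr]] by blast
  ultimately show ?thesis unfolding petersen_like_def using G'.finite_edges by blast
qed

theorem petersen_like_constr: "pg_constr H \<Longrightarrow> petersen_like H"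
proof (induction rule: pg_constr.induct)
  case base
  show ?case by (rule petersen_like_Pg)
next
  case (O1 G e K f G')
  then show ?case
    by (intro petersen_like_insertion[of G K e f G'] bridgeless_cubicI) auto
next
  case (O2 G u K v G')
  then show ?case
    by (intro petersen_like_substitution[of G K v u G'] bridgeless_cubicI) auto
qed

section \<open>The hexagonal core\<close>

lemma less_6_cases: "(i::nat) < 6 \<Longrightarrow> i = 0 \<or> i = 1 \<or> i = 2 \<or> i = 3 \<or> i = 4 \<or> i = 5"
  by presburger

lemma card_ge_2E:
  assumes "2 \<le> card S"
  obtains x y where "x \<in> S" "y \<in> S" "x \<noteq> y"
proof -
  obtain P where "P \<subseteq> S" "card P = 2" using obtain_subset_with_card_n[OF assms] by blast
  moreover then obtain x y where "P = {x, y}" "x \<noteq> y" by (meson card_2_iff)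
  ultimately show ?thesis using that by blast
qed

text \<open>Two fixed-point-free involutions that nowhere agree generate alternating cycles of even
  length at least four, so six elements must form a single cycle.\<close>

lemma hexagon_cycle:
  assumes T: "card T = 6"
    and u: "\<And>v. v \<in> T \<Longrightarrow> u v \<in> T \<and> u (u v) = v \<and> u v \<noteq> v"
    and d: "\<And>v. v \<in> T \<Longrightarrow> d v \<in> T \<and> d (d v) = v \<and> d v \<noteq> v"
    and ud: "\<And>v. v \<in> T \<Longrightarrow> u v \<noteq> d v"
  obtains h0 h1 h2 h3 h4 h5 where "T = {h0, h1, h2, h3, h4, h5}" "distinct [h0, h1, h2, h3, h4, h5]"
    "d h0 = h1" "u h1 = h2" "d h2 = h3" "u h3 = h4" "d h4 = h5" "u h5 = h0"
proof -
  have fin: "finite T" using T by (metis card.infinite zero_neq_numeral)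
  obtain h0 where h0: "h0 \<in> T" using T by fastforce
  define h1 where "h1 = d h0"
  define h2 where "h2 = u h1"
  define h3 where "h3 = d h2"
  define h4 where "h4 = u h3"
  define h5 where "h5 = d h4"
  have h1: "h1 \<in> T" using d[OF h0] by (simp add: h1_def)
  have h2: "h2 \<in> T" using u[OF h1] by (simp add: h2_def)
  have h3: "h3 \<in> T" using d[OF h2] by (simp add: h3_def)
  have h4: "h4 \<in> T" using u[OF h3] by (simp add: h4_def)
  have h5: "h5 \<in> T" using d[OF h4] by (simp add: h5_def)
  have inv: "d h0 = h1" "d h1 = h0" "u h1 = h2" "u h2 = h1" "d h2 = h3" "d h3 = h2" "u h3 = h4" "u h4 = h3"
    "d h4 = h5" "d h5 = h4"
    using d[OF h0] u[OF h1] d[OF h2] u[OF h3] d[OF h4]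
    by (simp_all add: h1_def h2_def h3_def h4_def h5_def)
  have n1: "h1 \<noteq> h0" using d[OF h0] inv by auto
  have n2: "h2 \<noteq> h1" "h2 \<noteq> h0" using u[OF h1] ud[OF h0] inv by auto
  have n3: "h3 \<noteq> h2" "h3 \<noteq> h1" "h3 \<noteq> h0" using d[OF h2] inv n1 n2 by auto
  have n4: "h4 \<noteq> h3" "h4 \<noteq> h2" "h4 \<noteq> h1" using u[OF h3] inv n1 n2 n3 by auto
  \<comment> \<open>A cycle of length four would leave two elements, and on these both involutions
    would be the transposition.\<close>
  have n40: "h4 \<noteq> h0"
  proof
    assume e: "h4 = h0"
    let ?S = "{h0, h1, h2, h3}"
    have "card (T - ?S) = 2" using T n1 n2 n3 h0 h1 h2 h3 fin by (subst card_Diff_subset) auto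
    then obtain x y where xy: "T - ?S = {x, y}" by (metis card_2_iff)
    then have x: "x \<in> T" "x \<notin> ?S" by auto
    have "u x \<notin> ?S" using x u[OF x(1)] inv e by auto
    moreover have "d x \<notin> ?S" using x d[OF x(1)] inv by auto
    ultimately have "u x \<in> {x, y}" "d x \<in> {x, y}" using xy u[OF x(1)] d[OF x(1)] by blast+
    then show False using u[OF x(1)] d[OF x(1)] ud[OF x(1)] by auto
  qed
  have n5: "h5 \<noteq> h4" "h5 \<noteq> h3" "h5 \<noteq> h2" "h5 \<noteq> h1" "h5 \<noteq> h0" using d[OF h4] inv n1 n2 n3 n4 n40 by auto
  have dist: "distinct [h0, h1, h2, h3, h4, h5]" using n1 n2 n3 n4 n40 n5 by auto
  have "{h0, h1, h2, h3, h4, h5} = T"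
    using h0 h1 h2 h3 h4 h5 dist T fin by (intro card_subset_eq) auto
  moreover have "u h5 = h0"
  proof -
    have "u h5 \<in> {h0, h1, h2, h3, h4, h5}" using u[OF h5] calculation by simp
    moreover have "u h5 \<noteq> h5" "u h5 \<noteq> h1" "u h5 \<noteq> h2" "u h5 \<noteq> h3" "u h5 \<noteq> h4"
      using u[OF h5] inv dist by auto
    ultimately show ?thesis by blast
  qed
  ultimately show ?thesis using that[OF _ dist] inv by simp
qed

text \<open>The vertices \<open>h i\<close> form an induced 6-cycle with edges \<open>k i\<close>; \<open>out i\<close> is the third edge at \<open>h i\<close>.\<close>

definition hexagon :: "('v,'e) graph \<Rightarrow> (nat \<Rightarrow> 'v) \<Rightarrow> (nat \<Rightarrow> 'e) \<Rightarrow> (nat \<Rightarrow> 'e) \<Rightarrow> bool" where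
  "hexagon G h k out \<longleftrightarrow> h ` {..<6} \<subseteq> verts G \<and> inj_on h {..<6} \<and>
     (\<forall>i<6. star G (h i) = {k i, k ((i + 5) mod 6), out i}) \<and>
     (\<forall>i<6. endpts G (k i) = {h i, h ((i + 1) mod 6)}) \<and>
     (\<forall>i<6. endpts G (out i) \<inter> h ` {..<6} = {h i})"

text \<open>\<open>m\<close> is an optimal array, and \<open>no_four_cover\<close> carries what is
  needed of \<open>\<pi> = 5\<close>. Stated through matchings alone, these conditions are easy to
  transport along an isomorphism.\<close>

locale defect_three = bridgeless_cubic G for G :: "('v, 'e) graph" +
  fixes m :: "nat \<Rightarrow> 'e set"
  assumes defect_ge3: "\<And>m'. \<forall>i<3. perfect_matching G (m' i) \<Longrightarrow> 3 \<le> card {e\<in>edges G. \<forall>i<3::nat. e \<notin> m' i}"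
    and pm: "\<And>i. i < 3 \<Longrightarrow> perfect_matching G (m i)"
    and card_unc: "card {e\<in>edges G. \<forall>i<3::nat. e \<notin> m i} = 3"
    and no_four_cover: "\<And>m'. \<forall>i<4. perfect_matching G (m' i) \<Longrightarrow> \<exists>e\<in>edges G. \<forall>i<4::nat. e \<notin> m' i"
begin

lemma not_colourable: "\<not> proper_on G c (verts G)"
proof
  assume c: "proper_on G c (verts G)"
  let ?m = "\<lambda>i. {e\<in>edges G. c e = i}"
  have "\<forall>i<3. perfect_matching G (?m i)"
    using colour_class_covers_once[OF c] by (simp add: perfect_matching_iff)
  then have "3 \<le> card {e\<in>edges G. \<forall>i<3::nat. e \<notin> ?m i}" by (rule defect_ge3)
  moreover have "{e\<in>edges G. \<forall>i<3::nat. e \<notin> ?m i} = {}"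
  proof -
    have "c e < 3" if "e \<in> edges G" for e
    proof -
      have "e \<in> star G (fst (ends G e))" "fst (ends G e) \<in> verts G"
        using that ends_in_verts by (auto simp: in_star_iff)
      then show ?thesis using c by (auto simp: proper_on_def bij_betw_def)
    qed
    then show ?thesis by blast
  qed
  ultimately show False by (metis card.empty not_numeral_le_zero)
qed

definition "unc = {e\<in>edges G. \<forall>i<3::nat. e \<notin> m i}"
definition "cnt e = card {i. i < (3::nat) \<and> e \<in> m i}"
definition "dbl = {e\<in>edges G. cnt e = 2}"
definition "T = {v\<in>verts G. unc \<inter> star G v \<noteq> {}}"

lemma m_sub: "i < 3 \<Longrightarrow> m i \<subseteq> edges G" and m_once: "i < 3 \<Longrightarrow> covers_once G (m i) (verts G)"
  using pm by (auto simp: perfect_matching_iff)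

lemma unc_iff: "e \<in> unc \<longleftrightarrow> e \<in> edges G \<and> cnt e = 0"
  by (auto simp: unc_def cnt_def)

lemma dbl_sub: "dbl \<subseteq> edges G" and unc_sub: "unc \<subseteq> edges G"
  by (auto simp: dbl_def unc_def)

lemma finite_unc: "finite unc" and finite_dbl: "finite dbl"
  using finite_edges dbl_sub unc_sub by (auto intro: finite_subset)

text \<open>Exchanging \<open>X\<close> for \<open>Y\<close> in the matching \<open>m i\<close>
  yields another array, so minimality of the defect applies to it. The set in the conclusion
  contains all edges that the new array leaves uncovered.\<close>

lemma swap_bound:
  assumes i: "i < 3" and X: "X \<subseteq> m i" and Y: "Y \<subseteq> edges G" "Y \<inter> m i = {}"
    and eq: "\<And>v. v \<in> verts G \<Longrightarrow> card (X \<inter> star G v) = card (Y \<inter> star G v)"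
  shows "3 \<le> card ((unc - Y) \<union> {x\<in>X. \<forall>j<3. j \<noteq> i \<longrightarrow> x \<notin> m j})"
proof -
  let ?M = "(m i - X) \<union> Y"
  have "perfect_matching G ?M"
    unfolding perfect_matching_iff covers_once_def
  proof (intro conjI ballI)
    show "?M \<subseteq> edges G" using m_sub[OF i] Y by blast
    fix v assume v: "v \<in> verts G"
    have "?M \<inter> star G v = (m i \<inter> star G v - X \<inter> star G v) \<union> (Y \<inter> star G v)" by blast
    moreover have "card ((m i \<inter> star G v - X \<inter> star G v) \<union> (Y \<inter> star G v))
        = card (m i \<inter> star G v - X \<inter> star G v) + card (Y \<inter> star G v)"
      using Y finite_star by (intro card_Un_disjoint) auto
    moreover have "card (m i \<inter> star G v - X \<inter> star G v) = card (m i \<inter> star G v) - card (X \<inter> star G v)"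
      using X finite_star by (intro card_Diff_subset) auto
    moreover have "card (X \<inter> star G v) \<le> card (m i \<inter> star G v)"
      using X finite_star by (intro card_mono) auto
    ultimately show "card (?M \<inter> star G v) = 1"
      using m_once[OF i] v eq[OF v] by (simp add: covers_once_def)
  qed
  then have "\<forall>j<3. perfect_matching G ((m(i := ?M)) j)" using pm by simp
  then have "3 \<le> card {e\<in>edges G. \<forall>j<3::nat. e \<notin> (m(i := ?M)) j}" by (rule defect_ge3)
  also have "\<dots> \<le> card ((unc - Y) \<union> {x\<in>X. \<forall>j<3. j \<noteq> i \<longrightarrow> x \<notin> m j})"
  proof (rule card_mono)
    show "finite ((unc - Y) \<union> {x\<in>X. \<forall>j<3. j \<noteq> i \<longrightarrow> x \<notin> m j})"
      using finite_unc finite_subset[OF X finite_subset[OF m_sub[OF i] finite_edges]] by auto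
    show "{e\<in>edges G. \<forall>j<3::nat. e \<notin> (m(i := ?M)) j} \<subseteq> (unc - Y) \<union> {x\<in>X. \<forall>j<3. j \<noteq> i \<longrightarrow> x \<notin> m j}"
    proof
      fix e assume "e \<in> {e\<in>edges G. \<forall>j<3::nat. e \<notin> (m(i := ?M)) j}"
      then have e: "e \<in> edges G" "e \<notin> ?M" "\<And>j. j < 3 \<Longrightarrow> j \<noteq> i \<Longrightarrow> e \<notin> m j"
        using i by (auto dest: spec[of _ i])
      show "e \<in> (unc - Y) \<union> {x\<in>X. \<forall>j<3. j \<noteq> i \<longrightarrow> x \<notin> m j}"
      proof (cases "e \<in> X")
        case True then show ?thesis using e(3) by blast
      next
        case False
        then have "e \<notin> m i" "e \<notin> Y" using e(2) by auto
        then have "\<forall>j<3. e \<notin> m j" using e(3) by metis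
        then show ?thesis using e(1) \<open>e \<notin> Y\<close> by (simp add: unc_def)
      qed
    qed
  qed
  finally show ?thesis .
qed

text \<open>Exchange \<open>g\<close> for \<open>e\<close> in one of the matchings through
  \<open>g\<close>: the edge \<open>g\<close> stays covered by another matching and \<open>e\<close>
  becomes covered, so only two uncovered edges would remain.\<close>

lemma no_parallel:
  assumes e: "e \<in> unc" and g: "g \<in> edges G" "endpts G e = endpts G g" "2 \<le> cnt g"
  shows False
proof -
  obtain i j where ij: "i \<in> {i. i < (3::nat) \<and> g \<in> m i}" "j \<in> {i. i < (3::nat) \<and> g \<in> m i}" "i \<noteq> j"
    using card_ge_2E[OF g(3)[unfolded cnt_def]] .
  have eE: "e \<in> edges G" "e \<notin> m i" using e ij by (auto simp: unc_def)
  have "3 \<le> card ((unc - {e}) \<union> {x\<in>{g}. \<forall>j<3. j \<noteq> i \<longrightarrow> x \<notin> m j})"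
  proof (rule swap_bound)
    fix v
    have "e \<in> star G v \<longleftrightarrow> g \<in> star G v" using g eE by (auto simp: star_def)
    then show "card ({g} \<inter> star G v) = card ({e} \<inter> star G v)" by (simp add: Int_insert_left)
  qed (use ij eE in auto)
  moreover have "{x\<in>{g}. \<forall>j<3. j \<noteq> i \<longrightarrow> x \<notin> m j} = {}" using ij by auto
  moreover have "card (unc - {e}) = 2" using card_unc e finite_unc by (simp add: unc_def[symmetric])
  ultimately show False by (simp only: Un_empty_right)
qed

lemma sum_cnt:
  assumes "v \<in> verts G"
  shows "(\<Sum>e\<in>star G v. cnt e) = 3"
proof -
  have "(\<Sum>e\<in>star G v. cnt e) = (\<Sum>e\<in>star G v. \<Sum>i<3. if e \<in> m i then 1 else 0)"
  proof (rule sum.cong[OF refl])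
    fix e
    have "{i. i < (3::nat) \<and> e \<in> m i} = {..<3} \<inter> {i. e \<in> m i}" by auto
    then show "cnt e = (\<Sum>i<3. if e \<in> m i then 1 else 0)" unfolding cnt_def by (simp add: sum.If_cases)
  qed
  also have "\<dots> = (\<Sum>i<3. \<Sum>e\<in>star G v. if e \<in> m i then 1 else 0)" by (rule sum.swap)
  also have "\<dots> = (\<Sum>i<(3::nat). 1)"
  proof (rule sum.cong[OF refl])
    fix i :: nat assume "i \<in> {..<3}"
    then have "card (m i \<inter> star G v) = 1" using m_once assms by (simp add: covers_once_def)
    moreover have "(\<Sum>e\<in>star G v. if e \<in> m i then 1 else 0) = card (star G v \<inter> {e. e \<in> m i})"
      using finite_star by (simp add: sum.If_cases)
    moreover have "star G v \<inter> {e. e \<in> m i} = m i \<inter> star G v" by blast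
    ultimately show "(\<Sum>e\<in>star G v. if e \<in> m i then 1 else 0) = (1::nat)" by simp
  qed
  finally show ?thesis by simp
qed

lemma star3:
  assumes v: "v \<in> verts G" and e: "e \<in> star G v"
  obtains a b where "star G v = {e, a, b}" "e \<noteq> a" "e \<noteq> b" "a \<noteq> b" "cnt e + cnt a + cnt b = 3"
proof -
  have "card (star G v - {e}) = 2" using card_star[OF v] e by simp
  then obtain a b where ab: "star G v - {e} = {a, b}" "a \<noteq> b" by (metis card_2_iff)
  then have "star G v = {e, a, b}" "e \<noteq> a" "e \<noteq> b" using e by auto
  then show ?thesis using sum_cnt[OF v] ab that by simp
qed

text \<open>With two uncovered edges at \<open>v\<close>, the third edge \<open>g\<close> is covered
  three times, so the other end of \<open>g\<close> also has two uncovered edges. There are only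
  three uncovered edges in all, so one of them joins the ends of \<open>g\<close>, against
  \<open>no_parallel\<close>.\<close>

lemma unc_matching:
  assumes v: "v \<in> verts G" and e: "e1 \<in> unc" "e2 \<in> unc" "e1 \<in> star G v" "e2 \<in> star G v"
  shows "e1 = e2"
proof (rule ccontr)
  assume ne: "e1 \<noteq> e2"
  obtain a b where ab: "star G v = {e1, a, b}" "e1 \<noteq> a" "e1 \<noteq> b" "a \<noteq> b" "cnt e1 + cnt a + cnt b = 3"
    using star3[OF v e(3)] .
  have "e2 = a \<or> e2 = b" using e(4) ne unfolding ab(1) by blast
  then have "cnt a = 3 \<or> cnt b = 3" using ab(5) e(1,2) by (auto simp: unc_iff)
  then obtain g where g: "g \<in> star G v" "cnt g = 3" using ab(1) by blast
  define w where "w = other_end G g v"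
  have ends: "endpts G g = {v, w}" "w \<in> verts G" using endpts_other_end[OF g(1)] by (auto simp: w_def)
  have gE: "g \<in> edges G" using g by (simp add: star_def)
  then have "g \<in> star G w" using ends by (simp add: star_def)
  then obtain f1 f2 where f: "star G w = {g, f1, f2}" "f1 \<noteq> f2" "cnt g + cnt f1 + cnt f2 = 3"
    using star3[OF ends(2)] by metis
  then have fu: "f1 \<in> unc" "f2 \<in> unc" using g(2) star_subset[of G w] by (auto simp: unc_iff)
  have "card ({e1, e2} \<union> {f1, f2}) \<le> 3"
    using card_mono[OF finite_unc, of "{e1, e2} \<union> {f1, f2}"] e fu card_unc by (simp add: unc_def[symmetric])
  then have "{e1, e2} \<inter> {f1, f2} \<noteq> {}"
    using ne f(2) by (auto simp: card_insert_if split: if_splits)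
  then obtain x where x: "x \<in> unc" "x \<in> star G v" "x \<in> star G w" using e fu f(1) by auto
  have "v \<noteq> w" using endpts_other_end[OF g(1)] by (auto simp: w_def)
  then have "endpts G x = {v, w}" using x endpts_other_end[OF x(2)] by (auto simp: star_def)
  then show False using no_parallel[OF x(1) gE] ends g(2) by simp
qed

lemma finite_T: "finite T" and T_sub: "T \<subseteq> verts G"
  using finite_verts by (auto simp: T_def)

lemma card_T: "card T = 6"
proof -
  have "matching_in G (verts G) unc"
    unfolding matching_in_def
  proof (intro conjI ballI)
    show "unc \<subseteq> inside G (verts G)" using unc_sub endpts_subset by (auto simp: inside_def)
    fix v assume v: "v \<in> verts G"
    have "card (unc \<inter> star G v) \<le> Suc 0"
      using unc_matching[OF v] finite_star by (subst card_le_Suc0_iff_eq) auto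
    then show "card (unc \<inter> star G v) \<le> 1" by simp
  qed
  then show ?thesis using card_covered[OF finite_verts] card_unc by (simp add: T_def unc_def[symmetric])
qed

lemma T_star:
  assumes "v \<in> T"
  shows "\<exists>e d x. star G v = {e, d, x} \<and> e \<noteq> d \<and> e \<noteq> x \<and> d \<noteq> x \<and> cnt e = 0 \<and> cnt d = 2 \<and> cnt x = 1"
proof -
  have v: "v \<in> verts G" using assms by (simp add: T_def)
  obtain e where e: "e \<in> unc" "e \<in> star G v" using assms by (auto simp: T_def)
  obtain a b where ab: "star G v = {e, a, b}" "e \<noteq> a" "e \<noteq> b" "a \<noteq> b" "cnt e + cnt a + cnt b = 3"
    using star3[OF v e(2)] .
  have ab': "a \<in> star G v" "b \<in> star G v" using ab(1) by auto
  have "a \<notin> unc" "b \<notin> unc" using unc_matching[OF v e(1) _ e(2)] ab ab' by metis+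
  then have "cnt a \<noteq> 0" "cnt b \<noteq> 0" using ab' by (auto simp: unc_iff star_def)
  moreover have "cnt e = 0" using e by (simp add: unc_iff)
  ultimately have "cnt e = 0" "cnt a = 2 \<and> cnt b = 1 \<or> cnt a = 1 \<and> cnt b = 2" using ab(5) by linarith+
  moreover have ba: "star G v = {e, b, a}" using ab(1) by blast
  ultimately show ?thesis
  proof (elim disjE)
    assume "cnt e = 0" "cnt a = 2 \<and> cnt b = 1"
    then show ?thesis by (intro exI[of _ e] exI[of _ a] exI[of _ b]) (use ab in simp)
  next
    assume "cnt e = 0" "cnt a = 1 \<and> cnt b = 2"
    then show ?thesis by (intro exI[of _ e] exI[of _ b] exI[of _ a]) (use ab ba in simp)
  qed
qed

lemma not_T_star:
  assumes "v \<in> verts G" "v \<notin> T" "e \<in> star G v"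
  shows "cnt e = 1"
proof -
  obtain a b where ab: "star G v = {e, a, b}" "cnt e + cnt a + cnt b = 3"
    using star3[OF assms(1,3)] by metis
  have "x \<notin> unc" if "x \<in> star G v" for x using assms that by (auto simp: T_def)
  then have "cnt x \<noteq> 0" if "x \<in> star G v" for x using that by (auto simp: unc_iff star_def)
  then have "cnt e \<noteq> 0" "cnt a \<noteq> 0" "cnt b \<noteq> 0" using ab(1) by auto
  then show ?thesis using ab(2) by linarith
qed

lemma cnt_not1_ends: "e \<in> edges G \<Longrightarrow> cnt e \<noteq> 1 \<Longrightarrow> endpts G e \<subseteq> T"
  using not_T_star endpts_subset by (fastforce simp: star_def)

text \<open>At a vertex of \<open>T\<close> the three edges are covered 0, 2 and 1 times
  (\<open>T_star\<close>), so there the choice is unique.\<close>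

definition "uE v = (SOME e. e \<in> star G v \<and> cnt e = 0)"
definition "dE v = (SOME e. e \<in> star G v \<and> cnt e = 2)"
definition "oE v = (SOME e. e \<in> star G v \<and> cnt e = 1)"

lemma T_edges:
  assumes "v \<in> T"
  shows "star G v = {uE v, dE v, oE v}" "cnt (uE v) = 0" "cnt (dE v) = 2" "cnt (oE v) = 1"
proof -
  obtain e d x where s: "star G v = {e, d, x}" "cnt e = 0" "cnt d = 2" "cnt x = 1"
    using T_star[OF assms] by blast
  have "uE v = e" "dE v = d" "oE v = x" unfolding uE_def dE_def oE_def
    by (rule some_equality; use s in auto)+
  then show "star G v = {uE v, dE v, oE v}" "cnt (uE v) = 0" "cnt (dE v) = 2" "cnt (oE v) = 1" using s by auto
qed

lemma T_edge_unique:
  assumes "v \<in> T" "e \<in> star G v"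
  shows "cnt e = 0 \<Longrightarrow> e = uE v" "cnt e = 2 \<Longrightarrow> e = dE v" "cnt e = 1 \<Longrightarrow> e = oE v"
  using T_edges[OF assms(1)] assms(2) by auto

lemma dbl_star: "v \<in> T \<Longrightarrow> dbl \<inter> star G v = {dE v}" and unc_star: "v \<in> T \<Longrightarrow> unc \<inter> star G v = {uE v}"
proof -
  assume v: "v \<in> T"
  show "dbl \<inter> star G v = {dE v}" using T_edges[OF v] star_subset[of G v] by (auto simp: dbl_def)
  show "unc \<inter> star G v = {uE v}" using T_edges[OF v] star_subset[of G v] by (auto simp: unc_iff)
qed

lemma dbl_star_out: "v \<notin> T \<Longrightarrow> dbl \<inter> star G v = {}" and unc_star_out: "v \<notin> T \<Longrightarrow> unc \<inter> star G v = {}"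
  using cnt_not1_ends by (fastforce simp: dbl_def star_def unc_iff)+

lemma card_dbl: "card dbl = 3"
proof -
  have "covers_once G dbl T" by (simp add: covers_once_def dbl_star)
  then have "card T = 2 * card (dbl \<inter> inside G T) + card (dbl \<inter> cut G T)"
    using covers_once_count[OF finite_T dbl_sub] by blast
  moreover have "dbl \<subseteq> inside G T" using cnt_not1_ends by (fastforce simp: dbl_def inside_def)
  then have "dbl \<inter> inside G T = dbl" "dbl \<inter> cut G T = {}" using cut_inside_disjoint[of G T] by blast+
  ultimately show ?thesis using card_T by simp
qed

lemma dbl_other: "d \<in> dbl \<Longrightarrow> i < 3 \<Longrightarrow> \<exists>j<3. j \<noteq> i \<and> d \<in> m j"
proof (rule ccontr)
  assume d: "d \<in> dbl" and "\<not> (\<exists>j<3. j \<noteq> i \<and> d \<in> m j)"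
  then have "{j. j < 3 \<and> d \<in> m j} \<subseteq> {i}" by blast
  then have "card {j. j < 3 \<and> d \<in> m j} \<le> 1" using card_mono[of "{i}"] by fastforce
  then show False using d by (simp add: dbl_def cnt_def)
qed

lemma dbl_misses_one:
  assumes "d \<in> dbl" "i < 3" "j < 3" "d \<notin> m i" "d \<notin> m j"
  shows "i = j"
proof (rule ccontr)
  assume "i \<noteq> j"
  have "{l. l < 3 \<and> d \<in> m l} \<subseteq> {..<3} - {i, j}" using assms by auto
  then have "card {l. l < 3 \<and> d \<in> m l} \<le> card ({..<3::nat} - {i, j})" by (intro card_mono) auto
  also have "\<dots> = 1" using assms \<open>i \<noteq> j\<close> by (subst card_Diff_subset) auto
  finally show False using assms(1) by (simp add: dbl_def cnt_def)
qed

text \<open>The doubly covered and the uncovered edges both match \<open>T\<close> perfectly. If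
  \<open>m i\<close> contained all of the former, exchanging them for the latter would leave no edge
  uncovered.\<close>

lemma miss_ex:
  assumes i: "i < 3"
  shows "\<exists>d\<in>dbl. d \<notin> m i"
proof (rule ccontr)
  assume "\<not> ?thesis"
  then have sub: "dbl \<subseteq> m i" by blast
  have "3 \<le> card ((unc - unc) \<union> {x\<in>dbl. \<forall>j<3. j \<noteq> i \<longrightarrow> x \<notin> m j})"
  proof (rule swap_bound[OF i sub unc_sub])
    show "unc \<inter> m i = {}" using i by (auto simp: unc_def)
    show "card (dbl \<inter> star G v) = card (unc \<inter> star G v)" for v
      by (cases "v \<in> T") (simp_all add: dbl_star unc_star dbl_star_out unc_star_out)
  qed
  moreover have "{x\<in>dbl. \<forall>j<3. j \<noteq> i \<longrightarrow> x \<notin> m j} = {}" using dbl_other[OF _ i] by blast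
  ultimately show False by simp
qed

text \<open>Each of the three doubly covered edges is missed by just one of the three matchings, and
  each matching misses one; hence this is a bijection.\<close>

lemma miss_unique:
  assumes "d \<in> dbl" "d' \<in> dbl" "i < 3" "d \<notin> m i" "d' \<notin> m i"
  shows "d = d'"
proof -
  obtain f where f: "\<And>i. i < 3 \<Longrightarrow> f i \<in> dbl \<and> f i \<notin> m i" using miss_ex by metis
  have "inj_on f {..<3}"
  proof (rule inj_onI)
    fix x y assume "x \<in> {..<3}" "y \<in> {..<3}" "f x = f y"
    then show "x = y" using f[of x] f[of y] dbl_misses_one[of "f x" x y] by simp
  qed
  then have "card (f ` {..<3}) = 3" by (simp add: card_image)
  then have im: "f ` {..<3} = dbl" using f card_dbl finite_dbl by (intro card_subset_eq) auto
  have "x = f i" if x: "x \<in> dbl" "x \<notin> m i" for x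
  proof -
    obtain l where l: "l < 3" "x = f l" using im x(1) by blast
    then have "l = i" using dbl_misses_one[OF x(1) l(1) assms(3)] f[OF l(1)] x(2) by simp
    then show ?thesis using l by simp
  qed
  then show ?thesis using assms by metis
qed

text \<open>Suppose \<open>oE v\<close> joins \<open>v\<close> to \<open>w\<close> in
  \<open>T\<close>, and let \<open>m i\<close> contain it. Then \<open>m i\<close> misses the doubly
  covered edges at \<open>v\<close> and at \<open>w\<close>, so these coincide by
  \<open>miss_unique\<close>, and an exchange leaves only \<open>oE v\<close> uncovered.\<close>

lemma no_chord:
  assumes v: "v \<in> T"
  shows "endpts G (oE v) \<inter> T = {v}"
proof (rule ccontr)
  assume n: "endpts G (oE v) \<inter> T \<noteq> {v}"
  let ?o = "oE v"
  have o: "?o \<in> star G v" "cnt ?o = 1" using T_edges[OF v] by auto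
  define w where "w = other_end G ?o v"
  have ends: "endpts G ?o = {v, w}" "v \<noteq> w" using endpts_other_end[OF o(1)] by (auto simp: w_def)
  then have w: "w \<in> T" using n v by auto
  have oE: "?o \<in> edges G" using o by (simp add: star_def)
  then have ow: "?o \<in> star G w" using ends by (simp add: star_def)
  have "{i. i < 3 \<and> ?o \<in> m i} \<noteq> {}" using o(2) by (metis card.empty cnt_def zero_neq_one)
  then obtain i where i: "i < 3" "?o \<in> m i" by blast
  have dv: "dE v \<in> star G v" "dE w \<in> star G w" "dE v \<in> dbl" "dE w \<in> dbl" using dbl_star v w by auto
  have ne: "dE v \<noteq> ?o" "dE w \<noteq> ?o" using T_edges[OF v] T_edges[OF w] by auto
  have VV: "v \<in> verts G" "w \<in> verts G" using v w T_sub by auto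
  have miss: "dE v \<notin> m i" "dE w \<notin> m i"
    using covers_once_unique[OF m_once[OF i(1)] VV(1) i(2) _ o(1) dv(1)]
      covers_once_unique[OF m_once[OF i(1)] VV(2) i(2) _ ow dv(2)] ne by auto
  have dd: "dE v = dE w" using miss_unique[OF dv(3,4) i(1) miss] .
  \<comment> \<open>The chord and the two doubly covered edges other than \<open>dE v\<close> match
    \<open>T\<close> perfectly and lie in \<open>m i\<close>; they are exchanged for the uncovered
    edges.\<close>
  define X where "X = insert ?o (dbl - {dE v})"
  have "3 \<le> card ((unc - unc) \<union> {x\<in>X. \<forall>j<3. j \<noteq> i \<longrightarrow> x \<notin> m j})"
  proof (rule swap_bound[OF i(1) _ unc_sub])
    have "x \<in> m i" if "x \<in> dbl - {dE v}" for x
      using miss_unique[OF dv(3) _ i(1) miss(1)] that by blast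
    then show "X \<subseteq> m i" using i(2) by (auto simp: X_def)
    show "unc \<inter> m i = {}" using i by (auto simp: unc_def)
    fix x assume x: "x \<in> verts G"
    show "card (X \<inter> star G x) = card (unc \<inter> star G x)"
    proof (cases "x \<in> T")
      case False
      then have "?o \<notin> star G x" using ends v w by (auto simp: star_def)
      then have "X \<inter> star G x = {}" using dbl_star_out[OF False] by (auto simp: X_def)
      then show ?thesis using unc_star_out[OF False] by simp
    next
      case True
      have "X \<inter> star G x = (if x = v \<or> x = w then {?o} else {dE x})"
      proof (cases "x = v \<or> x = w")
        case True
        then have "dbl \<inter> star G x = {dE v}" using dbl_star[OF v] dbl_star[OF w] dd by auto
        moreover have "?o \<in> star G x" using True o(1) ow by blast
        ultimately have "dbl \<inter> star G x = {dE v}" "?o \<in> star G x" by blast+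
        then have "X \<inter> star G x = {?o}" by (auto simp: X_def)
        then show ?thesis using True by simp
      next
        case False
        have o': "?o \<notin> star G x" using ends False by (auto simp: star_def)
        have "dE v \<notin> star G x"
        proof
          assume "dE v \<in> star G x"
          then have "{v, w, x} \<subseteq> endpts G (dE v)" using dv(1,2) unfolding dd by (simp add: star_def)
          then have "card {v, w, x} \<le> card (endpts G (dE v))" by (rule card_mono[rotated]) (simp add: endpts_def)
          moreover have "card (endpts G (dE v)) = 2" using card_endpts dv(3) dbl_sub by blast
          ultimately show False using ends(2) False by (auto simp: card_insert_if)
        qed
        moreover have "X \<inter> star G x = (dbl \<inter> star G x) - {dE v}" using o' unfolding X_def by auto
        moreover have "dE x \<in> star G x" using T_edges(1)[OF True] by blast
        moreover have "dE x \<noteq> dE v" using calculation(1,3) by metis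
        ultimately have "X \<inter> star G x = {dE x}" by (simp add: dbl_star[OF True])
        then show ?thesis using False by simp
      qed
      then show ?thesis using unc_star[OF True] by simp
    qed
  qed
  moreover have "(unc - unc) \<union> {x\<in>X. \<forall>j<3. j \<noteq> i \<longrightarrow> x \<notin> m j} \<subseteq> {?o}"
  proof
    fix x assume "x \<in> (unc - unc) \<union> {x\<in>X. \<forall>j<3. j \<noteq> i \<longrightarrow> x \<notin> m j}"
    then have "x \<in> X" "\<not> (\<exists>j<3. j \<noteq> i \<and> x \<in> m j)" by auto
    then have "x \<in> X" "x \<notin> dbl" using dbl_other[OF _ i(1)] by blast+
    then show "x \<in> {?o}" by (simp add: X_def)
  qed
  then have "card ((unc - unc) \<union> {x\<in>X. \<forall>j<3. j \<noteq> i \<longrightarrow> x \<notin> m j}) \<le> card {?o}"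
    by (rule card_mono[rotated]) simp
  ultimately show False by simp
qed

definition "uo v = other_end G (uE v) v"
definition "do v = other_end G (dE v) v"

lemma T_partner:
  assumes v: "v \<in> T"
  shows "endpts G (uE v) = {v, uo v}" "uo v \<in> T" "uo v \<noteq> v" "uE (uo v) = uE v" "uo (uo v) = v"
    and "endpts G (dE v) = {v, do v}" "do v \<in> T" "do v \<noteq> v" "dE (do v) = dE v" "do (do v) = v"
    and "uo v \<noteq> do v"
proof -
  have s: "uE v \<in> star G v" "dE v \<in> star G v" using T_edges[OF v] by auto
  have E: "uE v \<in> edges G" "dE v \<in> edges G" using s by (auto simp: star_def)
  have c: "cnt (uE v) = 0" "cnt (dE v) = 2" using T_edges[OF v] by auto
  show u: "endpts G (uE v) = {v, uo v}" "uo v \<noteq> v" using endpts_other_end[OF s(1)] by (auto simp: uo_def)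
  show d: "endpts G (dE v) = {v, do v}" "do v \<noteq> v" using endpts_other_end[OF s(2)] by (auto simp: do_def)
  show T: "uo v \<in> T" "do v \<in> T" using cnt_not1_ends[OF E(1)] cnt_not1_ends[OF E(2)] c u d by auto
  have s': "uE v \<in> star G (uo v)" "dE v \<in> star G (do v)" using u d E by (auto simp: star_def)
  show e: "uE (uo v) = uE v" "dE (do v) = dE v" using T_edge_unique[OF T(1) s'(1)] T_edge_unique[OF T(2) s'(2)] c by auto
  have "endpts G (uE v) = {uo v, uo (uo v)} \<and> uo (uo v) \<noteq> uo v"
    using endpts_other_end[OF s'(1)] e by (auto simp: uo_def)
  then show "uo (uo v) = v" using u by (metis doubleton_eq_iff)
  have "endpts G (dE v) = {do v, do (do v)} \<and> do (do v) \<noteq> do v"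
    using endpts_other_end[OF s'(2)] e by (auto simp: do_def)
  then show "do (do v) = v" using d by (metis doubleton_eq_iff)
  show "uo v \<noteq> do v"
  proof
    assume "uo v = do v"
    moreover have "uE v \<in> unc" using E c by (simp add: unc_iff)
    ultimately show False using no_parallel[of "uE v" "dE v"] u d E c by simp
  qed
qed

lemma T_hexagon: "\<exists>h k out. hexagon G h k out \<and> h ` {..<6} = T"
proof -
  obtain h0 h1 h2 h3 h4 h5 where h: "T = {h0, h1, h2, h3, h4, h5}" "distinct [h0, h1, h2, h3, h4, h5]"
    "do h0 = h1" "uo h1 = h2" "do h2 = h3" "uo h3 = h4" "do h4 = h5" "uo h5 = h0"
  proof (rule hexagon_cycle[OF card_T])
    show "uo v \<in> T \<and> uo (uo v) = v \<and> uo v \<noteq> v" "do v \<in> T \<and> do (do v) = v \<and> do v \<noteq> v" "uo v \<noteq> do v"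
      if "v \<in> T" for v using T_partner[OF that] by simp_all
  qed
  define h where "h i = [h0, h1, h2, h3, h4, h5] ! i" for i
  define k where "k i = [dE h0, uE h1, dE h2, uE h3, dE h4, uE h5] ! i" for i
  have T: "h0 \<in> T" "h1 \<in> T" "h2 \<in> T" "h3 \<in> T" "h4 \<in> T" "h5 \<in> T" using h by auto
  have six: "{..<6::nat} = {0, 1, 2, 3, 4, 5}" by auto
  have im: "h ` {..<6} = T" unfolding six h(1) by (simp add: h_def)
  have eqs: "dE h1 = dE h0" "uE h2 = uE h1" "dE h3 = dE h2" "uE h4 = uE h3" "dE h5 = dE h4" "uE h0 = uE h5"
    using T_partner(4,9)[OF T(1)] T_partner(4,9)[OF T(2)] T_partner(4,9)[OF T(3)] T_partner(4,9)[OF T(4)]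
      T_partner(4,9)[OF T(5)] T_partner(4,9)[OF T(6)] h by auto
  have "hexagon G h k (\<lambda>i. oE (h i))"
    unfolding hexagon_def im
  proof (intro conjI allI impI)
    show "T \<subseteq> verts G" by (rule T_sub)
    show "inj_on h {..<6}" unfolding h_def using h(2) by (intro inj_on_nth) auto
    show "endpts G (oE (h i)) \<inter> T = {h i}" if "i < 6" for i
      using no_chord[of "h i"] im that by blast
    show "endpts G (k i) = {h i, h ((i + 1) mod 6)}" if "i < 6" for i
      using less_6_cases[OF that] T_partner(1,6)[OF T(1)] T_partner(1,6)[OF T(2)] T_partner(1,6)[OF T(3)]
        T_partner(1,6)[OF T(4)] T_partner(1,6)[OF T(5)] T_partner(1,6)[OF T(6)] h(3-)
      by (elim disjE) (simp_all add: k_def h_def)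
    show "star G (h i) = {k i, k ((i + 5) mod 6), oE (h i)}" if "i < 6" for i
      using less_6_cases[OF that] T_edges(1)[OF T(1)] T_edges(1)[OF T(2)] T_edges(1)[OF T(3)]
        T_edges(1)[OF T(4)] T_edges(1)[OF T(5)] T_edges(1)[OF T(6)] eqs
      by (elim disjE) (auto simp: k_def h_def)
  qed
  then show ?thesis using im by blast
qed

text \<open>Every edge at a vertex outside \<open>T\<close> is covered exactly once, so the index of
  its matching serves as its colour.\<close>

lemma colouring_off_T: "\<exists>c. proper_on G c (verts G - T)"
proof
  define c where "c e = (SOME i. i < 3 \<and> e \<in> m i)" for e
  show "proper_on G c (verts G - T)"
    unfolding proper_on_def
  proof
    fix v assume v: "v \<in> verts G - T"
    have c: "c e < 3 \<and> e \<in> m (c e)" if "e \<in> star G v" for e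
    proof -
      have "cnt e = 1" using not_T_star v that by blast
      then have "{i. i < 3 \<and> e \<in> m i} \<noteq> {}" by (metis card.empty cnt_def zero_neq_one)
      then have "\<exists>i. i < 3 \<and> e \<in> m i" by blast
      then show ?thesis unfolding c_def by (rule someI_ex)
    qed
    have inj: "inj_on c (star G v)"
    proof (rule inj_onI)
      fix x y assume xy: "x \<in> star G v" "y \<in> star G v" "c x = c y"
      then show "x = y"
        using covers_once_unique[OF m_once[of "c x"], of v x y] c[of x] c[of y] v by simp
    qed
    moreover have "c ` star G v \<subseteq> {..<3}" using c by auto
    moreover have "card (c ` star G v) = 3" using inj card_star v by (simp add: card_image)
    ultimately show "bij_betw c (star G v) {..<3}"
      unfolding bij_betw_def using card_subset_eq[of "{..<3::nat}" "c ` star G v"] by simp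
  qed
qed

lemma no_matching_off_T: "\<nexists>F. F \<subseteq> inside G (verts G - T) \<and> covers_once G F (verts G - T)"
proof
  assume "\<exists>F. F \<subseteq> inside G (verts G - T) \<and> covers_once G F (verts G - T)"
  then obtain F where F: "F \<subseteq> inside G (verts G - T)" "covers_once G F (verts G - T)" by blast
  have "perfect_matching G (F \<union> unc)"
    unfolding perfect_matching_iff covers_once_def
  proof (intro conjI ballI)
    show "F \<union> unc \<subseteq> edges G" using F(1) inside_subset[of G "verts G - T"] unc_sub by blast
    fix v assume v: "v \<in> verts G"
    show "card ((F \<union> unc) \<inter> star G v) = 1"
    proof (cases "v \<in> T")
      case True
      then have "F \<inter> star G v = {}" using F(1) by (auto simp: inside_def star_def)
      then have "(F \<union> unc) \<inter> star G v = {uE v}" using unc_star[OF True] by blast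
      then show ?thesis by simp
    next
      case False
      then have "(F \<union> unc) \<inter> star G v = F \<inter> star G v" using unc_star_out by blast
      then show ?thesis using F(2) v False by (simp add: covers_once_def)
    qed
  qed
  then have "\<forall>i<4. perfect_matching G ((m(3 := F \<union> unc)) i)" using pm by auto
  then obtain e where e: "e \<in> edges G" "\<forall>i<4. e \<notin> (m(3 := F \<union> unc)) i" using no_four_cover by blast
  have "e \<notin> m i" if "i < 3" for i using e(2)[rule_format, of i] that by simp
  then have "e \<in> unc" using e(1) by (simp add: unc_def)
  then show False using e(2)[rule_format, of 3] by simp
qed

theorem hexagon_structure:
  "\<exists>h k out c. hexagon G h k out \<and> proper_on G c (verts G - h ` {..<6}) \<and>
    (\<nexists>F. F \<subseteq> inside G (verts G - h ` {..<6}) \<and> covers_once G F (verts G - h ` {..<6}))"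
  using T_hexagon colouring_off_T no_matching_off_T by metis

end

section \<open>Three-edge cuts around the hexagon\<close>

lemma cut_endpts_iff:
  "e \<in> edges G \<Longrightarrow> endpts G e = {v, w} \<Longrightarrow> e \<in> cut G W \<longleftrightarrow> (v \<in> W) \<noteq> (w \<in> W)"
  by (auto simp: in_cut_iff endpts_def doubleton_eq_iff)

lemma pair_Int_singleton:
  assumes "a \<noteq> b" "\<exists>e. {a, b} \<inter> N = {e}"
  shows "a \<in> N \<longleftrightarrow> b \<notin> N"
proof -
  have "card ({a, b} \<inter> N) = 1" using assms(2) by (metis is_singletonI is_singleton_altdef)
  then show ?thesis using assms(1) by (cases "a \<in> N"; cases "b \<in> N") simp_all
qed

lemma lessThan_3: "{..<3::nat} = {0, 1, 2}"
  by auto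

text \<open>Two disjoint edge sets that each meet \<open>A\<close> once serve as colour classes 0
  and 1; what they leave of \<open>A\<close> is a single edge of colour 2.\<close>

lemma bij_betw_three_colours:
  assumes A: "card A = 3" and a: "A \<inter> N = {a}" and b: "A \<inter> N' = {b}" and d: "N \<inter> N' = {}"
    and g: "\<And>e. e \<in> A \<Longrightarrow> g e = (if e \<in> N then 0 else if e \<in> N' then 1 else (2::nat))"
  shows "bij_betw g A {..<3}"
proof -
  have ab: "a \<in> A" "a \<in> N" "b \<in> A" "b \<in> N'" using a b by auto
  then have ne: "a \<noteq> b" using d by auto
  have fin: "finite A" using A by (metis card.infinite zero_neq_numeral)
  have "card (A - {a, b}) = 1" using A ab ne fin by (subst card_Diff_subset) auto
  then obtain x where x: "A - {a, b} = {x}" by (metis card_1_singletonE)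
  then have xA: "x \<in> A" "x \<noteq> a" "x \<noteq> b" by auto
  then have "x \<notin> N" "x \<notin> N'" using a b by auto
  then have gx: "g x = 2" "g a = 0" "g b = 1" using g xA ab d by auto
  then have "{..<3} \<subseteq> g ` A" unfolding lessThan_3 using xA ab by (auto intro: rev_image_eqI)
  moreover have "g ` A \<subseteq> {..<3}" using g by (auto simp: lessThan_3)
  ultimately have im: "g ` A = {..<3}" by (rule subset_antisym[rotated])
  then have "inj_on g A" using A fin by (intro eq_card_imp_inj_on) auto
  then show ?thesis using im by (simp add: bij_betw_def)
qed

context bridgeless_cubic
begin

lemma proper_onI:
  assumes "\<And>v. v \<in> W \<Longrightarrow> c ` star G v = {..<3}" "W \<subseteq> verts G"
  shows "proper_on G c W"
  unfolding proper_on_def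
proof
  fix v assume v: "v \<in> W"
  then have "card (c ` star G v) = card (star G v)" using assms card_star by auto
  then have "inj_on c (star G v)" using finite_star by (simp add: eq_card_imp_inj_on)
  then show "bij_betw c (star G v) {..<3}" using assms(1)[OF v] by (simp add: bij_betw_def)
qed

text \<open>A part with a 3-edge cut shows all three colours on the cut, so its colours can be permuted to
  match any prescribed bijective colouring of the cut.\<close>

lemma glue_colourings:
  assumes sub: "\<And>D. D \<in> \<D> \<Longrightarrow> D \<subseteq> verts G" and disj: "\<And>D D' x. D \<in> \<D> \<Longrightarrow> D' \<in> \<D> \<Longrightarrow> x \<in> D \<Longrightarrow> x \<in> D' \<Longrightarrow> D = D'"
    and cut3: "\<And>D. D \<in> \<D> \<Longrightarrow> card (cut G D) = 3"
    and c: "\<And>D. D \<in> \<D> \<Longrightarrow> proper_on G c D"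
    and g: "\<And>D. D \<in> \<D> \<Longrightarrow> bij_betw g (cut G D) {..<3}"
  shows "\<exists>c'. (\<forall>D\<in>\<D>. proper_on G c' D) \<and> (\<forall>e. (\<forall>D\<in>\<D>. e \<notin> inside G D) \<longrightarrow> c' e = g e)"
proof -
  \<comment> \<open>The permutation of colours that turns \<open>c\<close> into \<open>g\<close> on
    the cut of \<open>D\<close>.\<close>
  define \<pi> where "\<pi> D = g \<circ> inv_into (cut G D) c" for D
  define part where "part e = (SOME D. D \<in> \<D> \<and> e \<in> inside G D)" for e
  define c' where "c' e = (if \<exists>D\<in>\<D>. e \<in> inside G D then \<pi> (part e) (c e) else g e)" for e
  have part: "part e = D" if "D \<in> \<D>" "e \<in> inside G D" for e D
    unfolding part_def
  proof (rule some_equality)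
    show "D \<in> \<D> \<and> e \<in> inside G D" using that by blast
    fix D' assume D': "D' \<in> \<D> \<and> e \<in> inside G D'"
    show "D' = D" by (rule disj[of D' D "fst (ends G e)"]) (use D' that in \<open>auto simp: in_inside_iff\<close>)
  qed
  have "proper_on G c' D" if D: "D \<in> \<D>" for D
    unfolding proper_on_def
  proof
    fix v assume v: "v \<in> D"
    have bc: "bij_betw c (cut G D) {..<3}" by (rule cut3_bij[OF c[OF D] sub[OF D] cut3[OF D]])
    have "bij_betw (\<pi> D) {..<3} {..<3}"
      unfolding \<pi>_def by (rule bij_betw_trans[OF bij_betw_inv_into[OF bc] g[OF D]])
    moreover have "bij_betw c (star G v) {..<3}" using c[OF D] v by (simp add: proper_on_def)
    ultimately have "bij_betw (\<pi> D \<circ> c) (star G v) {..<3}" by (rule bij_betw_trans[rotated])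
    moreover have "c' e = (\<pi> D \<circ> c) e" if e: "e \<in> star G v" for e
    proof (cases "e \<in> inside G D")
      case True
      then have "part e = D" "\<exists>D\<in>\<D>. e \<in> inside G D" using part D by auto
      then show ?thesis by (simp add: c'_def)
    next
      case False
      then have ec: "e \<in> cut G D" using star_subset_cut_inside[OF v, of G] e by blast
      have "e \<notin> inside G D'" if D': "D' \<in> \<D>" for D'
      proof
        assume eD': "e \<in> inside G D'"
        then have "v \<in> D'" using e by (auto simp: in_inside_iff in_star_iff)
        then show False using disj[OF D D' v] eD' False by simp
      qed
      then have "c' e = g e" by (auto simp: c'_def)
      also have "g e = \<pi> D (c e)" using bc ec by (simp add: \<pi>_def bij_betw_def)
      finally show ?thesis by simp
    qed
    then have "bij_betw c' (star G v) {..<3} \<longleftrightarrow> bij_betw (\<pi> D \<circ> c) (star G v) {..<3}"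
      by (rule bij_betw_cong)
    ultimately show "bij_betw c' (star G v) {..<3}" by blast
  qed
  moreover have "\<forall>e. (\<forall>D\<in>\<D>. e \<notin> inside G D) \<longrightarrow> c' e = g e" by (auto simp: c'_def)
  ultimately show ?thesis by blast
qed

end

text \<open>Results about the opposite edges \<open>out 0\<close> and \<open>out 3\<close> pass to
  the two other opposite pairs by rotation.\<close>

lemma hexagon_rotate:
  assumes "hexagon G h k out"
  shows "hexagon G (\<lambda>i. h ((i + 1) mod 6)) (\<lambda>i. k ((i + 1) mod 6)) (\<lambda>i. out ((i + 1) mod 6))"
    and "(\<lambda>i. h ((i + 1) mod 6)) ` {..<6} = h ` {..<6}"
proof -
  have im: "(\<lambda>i. (i + 1) mod 6) ` {..<6} = {..<6::nat}"
  proof -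
    have six: "{..<6::nat} = {0, 1, 2, 3, 4, 5}" by auto
    show ?thesis unfolding six by auto
  qed
  then show him: "(\<lambda>i. h ((i + 1) mod 6)) ` {..<6} = h ` {..<6}" by (metis image_image)
  have inj: "inj_on (\<lambda>i. (i + 1) mod 6) {..<6::nat}" using im by (intro eq_card_imp_inj_on) auto
  have m: "(i + 1) mod 6 < 6" for i :: nat by simp
  have e1: "((i + 5) mod 6 + 1) mod 6 = ((i + 1) mod 6 + 5) mod (6::nat)"
    "((i + 1) mod 6 + 1) mod 6 = ((i + 1) mod 6 + 1) mod (6::nat)" for i
    by presburger+
  show "hexagon G (\<lambda>i. h ((i + 1) mod 6)) (\<lambda>i. k ((i + 1) mod 6)) (\<lambda>i. out ((i + 1) mod 6))"
    unfolding hexagon_def him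
  proof (intro conjI allI impI)
    show "inj_on (\<lambda>i. h ((i + 1) mod 6)) {..<6}"
      using comp_inj_on[OF inj, of h] im assms by (simp add: hexagon_def comp_def)
    fix i :: nat assume "i < 6"
    show "star G (h ((i + 1) mod 6)) = {k ((i + 1) mod 6), k (((i + 5) mod 6 + 1) mod 6), out ((i + 1) mod 6)}"
      unfolding e1 using assms m unfolding hexagon_def by blast
    show "endpts G (k ((i + 1) mod 6)) = {h ((i + 1) mod 6), h (((i + 1) mod 6 + 1) mod 6)}"
      using assms m unfolding hexagon_def by blast
    show "endpts G (out ((i + 1) mod 6)) \<inter> h ` {..<6} = {h ((i + 1) mod 6)}"
      using assms m unfolding hexagon_def by blast
  qed (use assms in \<open>simp add: hexagon_def\<close>)
qed

text \<open>The data found so far: a hexagon, a proper colouring of everything off it that cannot be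
  replaced by one of the whole graph, and a tight barrier \<open>S\<close> as in
  \<open>tight_barrier\<close>, with the hexagon as \<open>T\<close>.\<close>

locale hex_graph = bridgeless_cubic G for G :: "('v, 'e) graph" +
  fixes h :: "nat \<Rightarrow> 'v" and k out :: "nat \<Rightarrow> 'e" and c :: "'e \<Rightarrow> nat" and S :: "'v set"
  assumes hex: "hexagon G h k out"
    and col: "proper_on G c (verts G - h ` {..<6})"
    and notcol: "\<And>c. \<not> proper_on G c (verts G)"
    and S: "S \<subseteq> verts G - h ` {..<6}" "inside G S = {}" "cut G S \<inter> cut G (h ` {..<6}) = {}"
    and Q3: "\<And>D. D \<in> comps G (verts G - h ` {..<6} - S) \<Longrightarrow> card (cut G D) = 3"
    and cardQ: "card (comps G (verts G - h ` {..<6} - S)) = card S + 2"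
begin

abbreviation "H \<equiv> h ` {..<6}"
definition "X = verts G - H - S"
definition "Q = comps G X"

lemma hexD:
  "H \<subseteq> verts G" "inj_on h {..<6}"
  "i < 6 \<Longrightarrow> star G (h i) = {k i, k ((i + 5) mod 6), out i}"
  "i < 6 \<Longrightarrow> endpts G (k i) = {h i, h ((i + 1) mod 6)}"
  "i < 6 \<Longrightarrow> endpts G (out i) \<inter> H = {h i}"
proof -
  note d = hex[unfolded hexagon_def]
  show "H \<subseteq> verts G" by (rule d[THEN conjunct1])
  show "inj_on h {..<6}" by (rule d[THEN conjunct2, THEN conjunct1])
  note d' = d[THEN conjunct2, THEN conjunct2]
  assume "i < 6"
  then show "star G (h i) = {k i, k ((i + 5) mod 6), out i}" "endpts G (k i) = {h i, h ((i + 1) mod 6)}"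
    "endpts G (out i) \<inter> H = {h i}"
    by (rule d'[THEN conjunct1, rule_format] d'[THEN conjunct2, THEN conjunct1, rule_format]
        d'[THEN conjunct2, THEN conjunct2, rule_format])+
qed

lemma h_verts: "i < 6 \<Longrightarrow> h i \<in> verts G"
  using hexD(1) by blast

lemma out_star: "i < 6 \<Longrightarrow> out i \<in> star G (h i)" and k_star: "i < 6 \<Longrightarrow> k i \<in> star G (h i)"
  using hexD(3) by auto

lemma out_edges: "i < 6 \<Longrightarrow> out i \<in> edges G" and k_edges: "i < 6 \<Longrightarrow> k i \<in> edges G"
  using out_star[of i] k_star[of i] by (simp_all add: star_def)

lemma k_inside: "i < 6 \<Longrightarrow> k i \<in> inside G H"
  using hexD(4)[of i] k_edges[of i] by (auto simp: inside_def)

lemma out_not_inside: "i < 6 \<Longrightarrow> out i \<in> cut G H"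
proof -
  assume i: "i < 6"
  let ?w = "other_end G (out i) (h i)"
  have e: "endpts G (out i) = {h i, ?w}" "?w \<noteq> h i" using endpts_other_end[OF out_star[OF i]] by auto
  then have "?w \<notin> H" using hexD(5)[OF i] by blast
  then show ?thesis using cut_endpts_iff[OF out_edges[OF i] e(1), of H] i by blast
qed

lemma inj_out: "inj_on out {..<6}"
proof (rule inj_onI)
  fix i j assume ij: "i \<in> {..<6}" "j \<in> {..<6}" "out i = out j"
  then have "{h i} = {h j}" using hexD(5)[of i] hexD(5)[of j] by simp
  then show "i = j" using ij hexD(2) by (simp add: inj_on_eq_iff)
qed

lemma out_eq_iff: "i < 6 \<Longrightarrow> j < 6 \<Longrightarrow> out i = out j \<longleftrightarrow> i = j"
  using inj_out by (simp add: inj_on_eq_iff)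

lemma cut_H: "cut G H = out ` {..<6}"
proof
  show "out ` {..<6} \<subseteq> cut G H" using out_not_inside by auto
  show "cut G H \<subseteq> out ` {..<6}"
  proof
    fix e assume e: "e \<in> cut G H"
    then obtain v w where vw: "v \<in> H" "w \<notin> H" "e \<in> star G v" by (metis cut_starE)
    then obtain i where i: "i < 6" "v = h i" by blast
    have "k j \<notin> cut G H" if "j < 6" for j
      using k_inside[OF that] by (simp add: in_cut_iff in_inside_iff)
    then have "k i \<notin> cut G H" "k ((i + 5) mod 6) \<notin> cut G H" using i(1) by simp_all
    then show "e \<in> out ` {..<6}" using vw(3) e hexD(3)[OF i(1)] i by auto
  qed
qed

lemma out_notin_inside: "D \<inter> H = {} \<Longrightarrow> i < 6 \<Longrightarrow> out i \<notin> inside G D"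
  using out_star[of i] by (auto simp: inside_def star_def)

lemma inj_k: "inj_on k {..<6}"
proof (rule inj_onI)
  fix i j assume ij: "i \<in> {..<6}" "j \<in> {..<6}" "k i = k j"
  have hh: "h a = h b \<longleftrightarrow> a = b" if "a < 6" "b < 6" for a b using hexD(2) that by (simp add: inj_on_eq_iff)
  have "{h i, h ((i + 1) mod 6)} = {h j, h ((j + 1) mod 6)}" using hexD(4)[of i] hexD(4)[of j] ij by simp
  then have "i = j \<or> (i = (j + 1) mod 6 \<and> (i + 1) mod 6 = j)"
    using hh[of i j] hh[of i "(j + 1) mod 6"] hh[of "(i + 1) mod 6" j] ij by (auto simp: doubleton_eq_iff)
  moreover have i6: "i < 6" and j6: "j < 6" using ij by simp_all
  have "\<not> (i = (j + 1) mod 6 \<and> (i + 1) mod 6 = j)"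
    using less_6_cases[OF j6] by (elim disjE) auto
  ultimately show "i = j" by blast
qed

lemma colour_hexagon:
  assumes c': "proper_on G c' (verts G - H)"
    and kc: "\<And>i. i < 6 \<Longrightarrow> {kc i, kc ((i + 5) mod 6), c' (out i)} = {..<3}"
  shows False
proof -
  define d where "d e = (if e \<in> k ` {..<6} then kc (inv_into {..<6} k e) else c' e)" for e
  have dk: "d (k i) = kc i" if "i < 6" for i using that inj_k by (simp add: d_def)
  have k6: "k ` {..<6} \<subseteq> inside G H" using k_inside by blast
  have dout: "d e = c' e" if "e \<notin> inside G H" for e using that k6 by (auto simp: d_def)
  have "proper_on G d (verts G)"
  proof (rule proper_onI)
    fix v assume v: "v \<in> verts G"
    show "d ` star G v = {..<3}"
    proof (cases "v \<in> H")
      case True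
      then obtain i where i: "i < 6" "v = h i" by blast
      have "out i \<notin> inside G H" using out_not_inside[OF i(1)] cut_inside_disjoint[of G H] by blast
      then show ?thesis using hexD(3)[OF i(1)] dk i dout kc[OF i(1)] by simp
    next
      case False
      then have "d e = c' e" if "e \<in> star G v" for e
        using dout that by (auto simp: inside_def star_def)
      then have "d ` star G v = c' ` star G v" by (intro image_cong) auto
      then show ?thesis using c' v False by (simp add: proper_on_def bij_betw_def)
    qed
  qed simp
  then show False using notcol by blast
qed

text \<open>The form in which contradictions are reached: \<open>x0\<close> to \<open>x5\<close> are
  the colours on the edges leaving the hexagon, and \<open>y0\<close> to \<open>y5\<close> are
  explicit colours for the hexagon edges \<open>k 0\<close> to \<open>k 5\<close>.\<close>

lemma colour_hexagon_pattern:
  assumes c': "proper_on G c' (verts G - H)"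
    and x: "c' (out 0) = x0" "c' (out 1) = x1" "c' (out 2) = x2" "c' (out 3) = x3" "c' (out 4) = x4" "c' (out 5) = x5"
    and sets: "{y0, y5, x0} = {..<3}" "{y1, y0, x1} = {..<3}" "{y2, y1, x2} = {..<3}"
      "{y3, y2, x3} = {..<3}" "{y4, y3, x4} = {..<3}" "{y5, y4, x5} = {..<3}"
  shows False
proof (rule colour_hexagon[OF c', of "\<lambda>i. [y0, y1, y2, y3, y4, y5] ! i"])
  fix i :: nat assume "i < 6"
  then have "i = 0 \<or> i = 1 \<or> i = 2 \<or> i = 3 \<or> i = 4 \<or> i = 5" by presburger
  then show "{[y0, y1, y2, y3, y4, y5] ! i, [y0, y1, y2, y3, y4, y5] ! ((i + 5) mod 6), c' (out i)} = {..<3}"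
    using x sets by (elim disjE) simp_all
qed

text \<open>Otherwise the vertices off the hexagon split into two parts, each attached to the
  hexagon by three of its outgoing edges and not joined to each other. Their colours can be permuted
  independently, which makes a colouring extend to the hexagon.\<close>

lemma hexagon_cut_not_out:
  assumes W: "W \<subseteq> verts G - H" "cut G W = {out 0, out 3, t}" "t \<noteq> out 0" "t \<noteq> out 3"
  shows "t \<notin> cut G H"
proof
  assume "t \<in> cut G H"
  then obtain j where j: "j < 6" "t = out j" unfolding cut_H by blast
  define W' where "W' = verts G - H - W"
  \<comment> \<open>Chosen so that the triple \<open>0, 3, j\<close> and the complementary triple
    both carry all three colours and the resulting sequence extends around the hexagon; one choice
    serves \<open>j = 1, 4\<close>, the other \<open>j = 2, 5\<close>.\<close>
  define g where "g = (if j = 1 \<or> j = 4 then (\<lambda>e. if e \<in> {out 1, out 4} then 0 else if e \<in> {out 2, out 3} then 1 else 2)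
    else (\<lambda>e. if e \<in> {out 2, out 5} then 0 else if e \<in> {out 3, out 4} then 1 else (2::nat)))"
  have six: "{..<6::nat} = {0, 1, 2, 3, 4, 5}" by auto
  have j': "j = 1 \<or> j = 2 \<or> j = 4 \<or> j = 5"
    using j W(3,4) by (metis less_6_cases)
  have sub: "cut G W \<subseteq> cut G H" using W(2) j out_not_inside[of 0] out_not_inside[of 3] out_not_inside[of j] by auto
  \<comment> \<open>All edges of \<open>cut G W\<close> lead to the hexagon, so no edge joins
    \<open>W\<close> and \<open>W'\<close>.\<close>
  have "cut G W' = cut G H - cut G W"
  proof (intro set_eqI iffI)
    fix e assume e: "e \<in> cut G W'"
    then obtain v w where vw: "v \<in> W'" "w \<notin> W'" "endpts G e = {v, w}" by (metis cut_starE)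
    have eE: "e \<in> edges G" using e by (simp add: in_cut_iff)
    have vW: "v \<notin> W" "v \<notin> H" using vw(1) by (auto simp: W'_def)
    have "w \<in> verts G" using endpts_subset[OF eE] vw(3) by simp
    then have "w \<in> H \<or> w \<in> W" using vw(2) by (auto simp: W'_def)
    moreover have "w \<notin> W"
    proof
      assume "w \<in> W"
      then have "e \<in> cut G W" using vW vw(3) eE by (auto simp: in_cut_iff endpts_def doubleton_eq_iff)
      then have "e \<in> cut G H" using sub by blast
      then show False using vW vw(3) \<open>w \<in> W\<close> W(1) by (auto simp: in_cut_iff endpts_def doubleton_eq_iff)
    qed
    ultimately show "e \<in> cut G H - cut G W"
      using vW vw(3) eE W(1) by (auto simp: in_cut_iff endpts_def doubleton_eq_iff)
  next
    fix e assume e: "e \<in> cut G H - cut G W"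
    then obtain v w where vw: "v \<in> H" "w \<notin> H" "endpts G e = {v, w}" by (metis DiffD1 cut_starE)
    have eE: "e \<in> edges G" using e by (simp add: in_cut_iff)
    have "w \<in> verts G" using endpts_subset[OF eE] vw(3) by simp
    moreover have "v \<notin> W" using vw(1) W(1) by blast
    then have "w \<notin> W" using vw(3) e by (auto simp: in_cut_iff endpts_def doubleton_eq_iff)
    ultimately have "w \<in> W'" using vw(2) by (simp add: W'_def)
    moreover have "v \<notin> W'" using vw(1) by (simp add: W'_def)
    ultimately show "e \<in> cut G W'" using vw(3) eE by (auto simp: in_cut_iff endpts_def doubleton_eq_iff)
  qed
  then have cW': "cut G W' = out ` ({..<6} - {0, 3, j})"
    using W(2) j inj_on_image_set_diff[OF inj_out, of "{..<6}" "{0, 3, j}"] by (simp add: cut_H)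
  have ne: "out a \<noteq> out b" if "a \<noteq> b" "a < 6" "b < 6" for a b using out_eq_iff that by simp
  have cuts: "card (cut G W) = 3" "card (cut G W') = 3" "bij_betw g (cut G W) {..<3}" "bij_betw g (cut G W') {..<3}"
  proof -
    have d: "{..<6} - {0, 3, j} = (if j = 1 then {2, 4, 5} else if j = 2 then {1, 4, 5} else if j = 4 then {1, 2, 5} else {1, 2, 4})"
      unfolding six using j' by (elim disjE) auto
    show "card (cut G W) = 3" "card (cut G W') = 3" "bij_betw g (cut G W) {..<3}" "bij_betw g (cut G W') {..<3}"
      unfolding cW' d W(2) j(2) using j'
      by (elim disjE; simp add: ne out_eq_iff bij_betw_def lessThan_3 g_def insert_commute)+
  qed
  have WW': "W \<subseteq> verts G" "W' \<subseteq> verts G" "W \<inter> W' = {}" "verts G - H = W \<union> W'" using W(1) by (auto simp: W'_def)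
  have "\<exists>c'. (\<forall>D\<in>{W, W'}. proper_on G c' D) \<and> (\<forall>e. (\<forall>D\<in>{W, W'}. e \<notin> inside G D) \<longrightarrow> c' e = g e)"
  proof (rule glue_colourings[where c = c])
    show "D \<in> {W, W'} \<Longrightarrow> proper_on G c D" for D using col WW'(4) by (auto intro: proper_on_mono)
  qed (use cuts WW' in auto)
  then obtain c' where c': "proper_on G c' W" "proper_on G c' W'"
    "\<And>e. e \<notin> inside G W \<Longrightarrow> e \<notin> inside G W' \<Longrightarrow> c' e = g e" by auto
  have "proper_on G c' (verts G - H)" using c'(1,2) unfolding WW'(4) proper_on_def by blast
  moreover have "c' (out i) = g (out i)" if "i < 6" for i
  proof (rule c'(3))
    show "out i \<notin> inside G W" using W(1) by (intro out_notin_inside[OF _ that]) blast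
    show "out i \<notin> inside G W'" by (intro out_notin_inside[OF _ that]) (auto simp: W'_def)
  qed
  then have x: "c' (out 0) = g (out 0)" "c' (out 1) = g (out 1)" "c' (out 2) = g (out 2)"
      "c' (out 3) = g (out 3)" "c' (out 4) = g (out 4)" "c' (out 5) = g (out 5)" by simp_all
  show False
  proof (cases "j = 1 \<or> j = 4")
    case True
    then have "g (out 0) = 2" "g (out 1) = 0" "g (out 2) = 1" "g (out 3) = 1" "g (out 4) = 0" "g (out 5) = 2"
      by (simp_all add: g_def ne)
    then show False
      by (intro colour_hexagon_pattern[OF \<open>proper_on G c' (verts G - H)\<close> x, where ?y0.0 = 1 and ?y1.0 = 2 and ?y2.0 = 0
          and ?y3.0 = 2 and ?y4.0 = 1 and ?y5.0 = 0]) (auto simp: lessThan_3)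
  next
    case False
    then have "g (out 0) = 2" "g (out 1) = 2" "g (out 2) = 0" "g (out 3) = 1" "g (out 4) = 1" "g (out 5) = 0"
      by (auto simp: g_def ne)
    then show False
      by (intro colour_hexagon_pattern[OF \<open>proper_on G c' (verts G - H)\<close> x, where ?y0.0 = 0 and ?y1.0 = 1 and ?y2.0 = 2
          and ?y3.0 = 0 and ?y4.0 = 2 and ?y5.0 = 1]) (auto simp: lessThan_3)
  qed
qed

lemma QD:
  assumes "D \<in> Q"
  shows "card (cut G D) = 3" "D \<subseteq> X" "D \<noteq> {}"
proof -
  have D: "D \<in> comps G (verts G - H - S)" using assms by (simp add: Q_def X_def)
  show "card (cut G D) = 3" by (rule Q3[OF D])
  show "D \<subseteq> X" unfolding X_def by (rule comps_subset[OF D])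
  show "D \<noteq> {}" by (rule comps_nonempty[OF D])
qed

lemma finite_Q: "finite Q" and finite_S: "finite S" and card_Q: "card Q = card S + 2"
proof -
  have "finite X" unfolding X_def using finite_verts by simp
  then show "finite Q" unfolding Q_def by (rule finite_comps)
  show "finite S" using S(1) finite_verts by (meson finite_Diff finite_subset)
  show "card Q = card S + 2" using cardQ by (simp add: Q_def X_def)
qed

lemma verts_split: "verts G = X \<union> S \<union> H" and disjoint_split: "X \<inter> S = {}" "X \<inter> H = {}" "S \<inter> H = {}"
  using S(1) hexD(1) by (auto simp: X_def)

lemma cut_X_ends:
  assumes e: "e \<in> edges G" "endpts G e = {v, w}" and v: "v \<in> S \<union> H" and eH: "e \<notin> inside G H"
  shows "w \<in> X"
proof (rule ccontr)
  assume "w \<notin> X"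
  moreover have "w \<in> verts G" using endpts_subset[OF e(1)] e(2) by simp
  ultimately have w: "w \<in> S \<or> w \<in> H" using verts_split by blast
  have "v \<in> S \<Longrightarrow> w \<in> S \<Longrightarrow> False" using S(2) e by (auto simp: inside_def)
  moreover have "v \<in> H \<Longrightarrow> w \<in> H \<Longrightarrow> False" using eH e by (auto simp: inside_def)
  moreover have False if "v \<in> S" "w \<in> H"
  proof -
    have "v \<notin> H" "w \<notin> S" using that disjoint_split(3) by blast+
    then have "e \<in> cut G S \<inter> cut G H" using that cut_endpts_iff[OF e] by blast
    then show False using S(3) by blast
  qed
  moreover have False if "v \<in> H" "w \<in> S"
  proof -
    have "v \<notin> S" "w \<notin> H" using that disjoint_split(3) by blast+
    then have "e \<in> cut G S \<inter> cut G H" using that cut_endpts_iff[OF e] by blast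
    then show False using S(3) by blast
  qed
  ultimately show False using w v by blast
qed

text \<open>Contracting the components turns \<open>cut G X\<close> into the edges of a bipartite graph; \<open>yend\<close> is the end
  outside \<open>X\<close> and \<open>qend\<close> the component at the other end.\<close>

definition "yend e = (if fst (ends G e) \<in> X then snd (ends G e) else fst (ends G e))"
definition "qend e = (SOME D. D \<in> Q \<and> e \<in> cut G D)"

lemma qend:
  assumes "e \<in> cut G X"
  shows "qend e \<in> Q" "e \<in> cut G (qend e)" "D \<in> Q \<Longrightarrow> e \<in> cut G D \<Longrightarrow> D = qend e"
proof -
  have "\<exists>D. D \<in> Q \<and> e \<in> cut G D" using assms cut_comps_Union[of G X] by (auto simp: Q_def)
  then have *: "qend e \<in> Q \<and> e \<in> cut G (qend e)" unfolding qend_def by (rule someI_ex)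
  then show "qend e \<in> Q" "e \<in> cut G (qend e)" by blast+
  show "D \<in> Q \<Longrightarrow> e \<in> cut G D \<Longrightarrow> D = qend e"
    using * cut_comps_disjoint[of D G X "qend e" e] by (simp add: Q_def)
qed

lemma cut_Q_sub: "D \<in> Q \<Longrightarrow> cut G D \<subseteq> cut G X"
  using cut_comps_subset by (simp add: Q_def)

lemma yend:
  assumes "e \<in> cut G X"
  shows "yend e \<in> S \<union> H" "e \<in> star G (yend e)" "v \<notin> X \<Longrightarrow> e \<in> star G v \<Longrightarrow> v = yend e"
proof -
  have e: "e \<in> edges G" using assms by (simp add: in_cut_iff)
  have "yend e \<notin> X" "e \<in> star G (yend e)" using assms by (auto simp: yend_def in_cut_iff in_star_iff)
  moreover have "yend e \<in> verts G" using ends_in_verts[OF e] by (simp add: yend_def)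
  ultimately show "yend e \<in> S \<union> H" "e \<in> star G (yend e)" using verts_split by blast+
  show "v \<notin> X \<Longrightarrow> e \<in> star G v \<Longrightarrow> v = yend e"
    using assms by (auto simp: yend_def in_cut_iff in_star_iff)
qed

lemma star_S_cut:
  assumes "s \<in> S"
  shows "star G s \<subseteq> cut G X"
proof
  fix e assume e: "e \<in> star G s"
  have ends: "endpts G e = {s, other_end G e s}" using endpts_other_end[OF e] by blast
  have eE: "e \<in> edges G" using e by (simp add: star_def)
  have sX: "s \<notin> X" "s \<notin> H" using assms disjoint_split by blast+
  have "e \<notin> inside G H" using sX ends by (simp add: inside_def)
  then have "other_end G e s \<in> X" using cut_X_ends[OF eE ends] assms by blast
  then show "e \<in> cut G X" using cut_endpts_iff[OF eE ends] sX by blast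
qed

lemma out_cut_X:
  assumes "i < 6"
  shows "out i \<in> cut G X" "yend (out i) = h i"
proof -
  let ?e = "out i"
  have e: "?e \<in> star G (h i)" by (rule out_star[OF assms])
  have ends: "endpts G ?e = {h i, other_end G ?e (h i)}" using endpts_other_end[OF e] by blast
  have hi: "h i \<in> H" "h i \<notin> X" using assms disjoint_split by blast+
  have "?e \<notin> inside G H" using out_not_inside[OF assms] by (auto simp: in_cut_iff in_inside_iff)
  then have "other_end G ?e (h i) \<in> X" using cut_X_ends[OF out_edges[OF assms] ends] hi by blast
  then show "?e \<in> cut G X" using cut_endpts_iff[OF out_edges[OF assms] ends] hi by blast
  then show "yend ?e = h i" using yend(3)[OF _ hi(2) e] by simp
qed

lemma cut_X_cases:
  assumes "e \<in> cut G X"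
  obtains s where "s \<in> S" "e \<in> star G s" "yend e = s" | i where "i < 6" "e = out i"
proof (cases "yend e \<in> S")
  case True
  then show ?thesis using that(1) yend(2)[OF assms] by blast
next
  case False
  then have yH: "yend e \<in> H" using yend(1)[OF assms] by blast
  have e: "e \<in> edges G" using assms by (simp add: in_cut_iff)
  have "e \<in> cut G H"
  proof -
    obtain v w where vw: "v \<in> X" "w \<notin> X" "e \<in> star G w" "endpts G e = {v, w}"
      using assms by (metis cut_starE)
    then have "w \<in> H" "v \<notin> H" using yend(3)[OF assms vw(2,3)] yH disjoint_split by auto
    then show ?thesis using cut_endpts_iff[OF e vw(4)] by blast
  qed
  then show ?thesis unfolding cut_H using that(2) by blast
qed

lemma qend_fibre: "D \<in> Q \<Longrightarrow> {e\<in>cut G X. qend e = D} = cut G D"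
  using qend cut_Q_sub by blast

lemma star_fibre: "s \<in> S \<Longrightarrow> {e\<in>cut G X. yend e = s} = star G s"
proof -
  assume s: "s \<in> S"
  then have "s \<notin> X" using disjoint_split by blast
  then show ?thesis using star_S_cut[OF s] yend(2,3) by blast
qed

text \<open>Take a violator \<open>J\<close> together with the set \<open>N\<close> of all
  components adjacent to it. Every edge at \<open>J\<close> ends in \<open>N\<close>, so this union
  has a cut of size \<open>3 * (card N - card J)\<close>, and the violation leaves room only for
  \<open>card N = card J + 1\<close>.\<close>

lemma hall_violator_cut:
  assumes J: "J \<subseteq> S" "card (\<Union>s\<in>J. qend ` star G s - {q0, q3}) < card J"
    and q: "q0 = qend (out 0)" "q3 = qend (out 3)"
  shows "\<exists>W\<subseteq>verts G - H. card (cut G W) = 3 \<and> out 0 \<in> cut G W \<and> out 3 \<in> cut G W"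
proof -
  define N where "N = (\<Union>s\<in>J. qend ` star G s)"
  define W where "W = J \<union> \<Union>N"
  define EN where "EN = (\<Union>D\<in>N. cut G D)"
  define EJ where "EJ = (\<Union>s\<in>J. star G s)"
  have finJ: "finite J" using J(1) finite_S finite_subset by blast
  have NQ: "N \<subseteq> Q"
  proof
    fix D assume "D \<in> N"
    then obtain s e where "s \<in> J" "e \<in> star G s" "D = qend e" by (auto simp: N_def)
    moreover then have "e \<in> cut G X" using star_S_cut J(1) by blast
    ultimately show "D \<in> Q" using qend(1) by simp
  qed
  have finN: "finite N" using NQ finite_Q finite_subset by blast
  have NX: "\<Union>N \<subseteq> X" using NQ QD(2) by blast
  have EJN: "EJ \<subseteq> EN"
  proof
    fix e assume "e \<in> EJ"
    then obtain s where s: "s \<in> J" "e \<in> star G s" by (auto simp: EJ_def)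
    then have "e \<in> cut G X" using star_S_cut J(1) by blast
    then have "e \<in> cut G (qend e)" by (rule qend(2))
    moreover have "qend e \<in> N" using s by (auto simp: N_def)
    ultimately show "e \<in> EN" by (auto simp: EN_def)
  qed
  have EX: "EN \<subseteq> cut G X" using NQ cut_Q_sub by (auto simp: EN_def)
  have inW: "v \<in> W \<longleftrightarrow> v \<in> \<Union>N" if "v \<in> X" for v using that J(1) disjoint_split by (auto simp: W_def)
  have outW: "v \<in> W \<longleftrightarrow> v \<in> J" if "v \<notin> X" for v using that NX by (auto simp: W_def)
  have cutW: "cut G W = EN - EJ"
  proof (intro set_eqI iffI)
    fix e assume e: "e \<in> EN - EJ"
    then obtain D where D: "D \<in> N" "e \<in> cut G D" by (auto simp: EN_def)
    have eX: "e \<in> cut G X" and eE: "e \<in> edges G" using e EX by (auto simp: in_cut_iff)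
    obtain v w where vw: "v \<in> X" "w \<notin> X" "e \<in> star G w" "endpts G e = {v, w}"
      using eX by (metis cut_starE)
    have "v \<in> D" using D(2) cut_endpts_iff[OF eE vw(4), of D] vw(2) QD(2) NQ D(1) by blast
    then have "v \<in> W" using D(1) by (auto simp: W_def)
    moreover have "w \<notin> J" using e vw(3) by (auto simp: EJ_def)
    ultimately show "e \<in> cut G W" using cut_endpts_iff[OF eE vw(4), of W] outW[OF vw(2)] by blast
  next
    fix e assume e: "e \<in> cut G W"
    then obtain v w where vw: "v \<in> W" "w \<notin> W" "e \<in> star G v" "endpts G e = {v, w}"
      by (metis cut_starE)
    have eE: "e \<in> edges G" using e by (simp add: in_cut_iff)
    show "e \<in> EN - EJ"
    proof (cases "v \<in> J")
      case True
      then have eX: "e \<in> cut G X" using star_S_cut J(1) vw(3) by blast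
      have vX: "v \<notin> X" using True J(1) disjoint_split by blast
      have "w \<in> X" using cut_endpts_iff[OF eE vw(4), of X] eX vX by blast
      moreover have "qend e \<in> N" using True vw(3) by (auto simp: N_def)
      moreover have "v \<notin> qend e" using QD(2)[OF qend(1)[OF eX]] vX by blast
      then have "w \<in> qend e" using cut_endpts_iff[OF eE vw(4), of "qend e"] qend(2)[OF eX] by blast
      ultimately have "w \<in> W" by (auto simp: W_def)
      then show ?thesis using vw(2) by blast
    next
      case False
      then obtain D where D: "D \<in> N" "v \<in> D" using vw(1) by (auto simp: W_def)
      have "w \<notin> D" using vw(2) D(1) by (auto simp: W_def)
      then have "e \<in> cut G D" using D(2) cut_endpts_iff[OF eE vw(4), of D] by blast
      then have "e \<in> EN" using D(1) by (auto simp: EN_def)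
      moreover have "e \<notin> EJ"
      proof
        assume "e \<in> EJ"
        then obtain s where s: "s \<in> J" "s \<in> endpts G e" by (auto simp: EJ_def star_def)
        then show False using vw(2,4) False by (auto simp: W_def)
      qed
      ultimately show ?thesis by blast
    qed
  qed
  have "card EN = (\<Sum>D\<in>N. card (cut G D))" unfolding EN_def
  proof (rule card_UN_disjoint[OF finN])
    show "\<forall>D\<in>N. \<forall>D'\<in>N. D \<noteq> D' \<longrightarrow> cut G D \<inter> cut G D' = {}"
      using NQ cut_comps_disjoint[of _ G X] unfolding Q_def by blast
  qed (simp add: finite_cut)
  also have "\<dots> = 3 * card N" using QD(1) NQ by (simp add: subset_iff)
  finally have cEN: "card EN = 3 * card N" .
  have "card EJ = (\<Sum>s\<in>J. card (star G s))" unfolding EJ_def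
  proof (rule card_UN_disjoint[OF finJ])
    have "s = s'" if "s \<in> J" "s' \<in> J" "e \<in> star G s" "e \<in> star G s'" for s s' e
    proof -
      have "{e\<in>cut G X. yend e = s} = star G s" "{e\<in>cut G X. yend e = s'} = star G s'"
        using star_fibre that(1,2) J(1) by blast+
      then have "yend e = s" "yend e = s'" using that(3,4) by (metis (mono_tags, lifting) mem_Collect_eq)+
      then show ?thesis by simp
    qed
    then show "\<forall>s\<in>J. \<forall>s'\<in>J. s \<noteq> s' \<longrightarrow> star G s \<inter> star G s' = {}" by blast
  qed (simp add: finite_star)
  also have "\<dots> = 3 * card J"
  proof -
    have "card (star G s) = 3" if "s \<in> J" for s using that J(1) S(1) by (intro card_star) blast
    then show ?thesis by simp
  qed
  finally have cEJ: "card EJ = 3 * card J" .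
  have finEN: "finite EN" using EX finite_cut finite_subset by blast
  have cW: "card (cut G W) = 3 * card N - 3 * card J"
    unfolding cutW using EJN finEN cEN cEJ by (simp add: card_Diff_subset finite_subset)
  have "J \<noteq> {}" using J(2) by auto
  moreover have WXS: "W \<subseteq> X \<union> S" using J(1) NX unfolding W_def by blast
  moreover have WV: "W \<subseteq> verts G - H"
    using WXS verts_split disjoint_split(2,3) by blast
  moreover have "h 0 \<in> H" by simp
  moreover have "h 0 \<in> verts G" using h_verts by simp
  ultimately have "W \<noteq> {}" "W \<noteq> verts G" "W \<subseteq> verts G" unfolding W_def by blast+
  then have "2 \<le> card (cut G W)" by (intro cut_ge2)
  then have NJ: "card J < card N" using cW by simp
  define A where "A = (\<Union>s\<in>J. qend ` star G s - {q0, q3})"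
  \<comment> \<open>Without \<open>q0\<close> and \<open>q3\<close> there are fewer than
    \<open>card J\<close> components, but with them more than \<open>card J\<close>. So both belong
    to \<open>N\<close>, and \<open>out 0\<close> and \<open>out 3\<close> are in the cut.\<close>
  have "N = A \<union> (N \<inter> {q0, q3})" by (auto simp: N_def A_def)
  then have "card N \<le> card A + card (N \<inter> {q0, q3})" using card_Un_le[of A "N \<inter> {q0, q3}"] by simp
  then have two: "card N < card J + card (N \<inter> {q0, q3})" using J(2) by (simp add: A_def)
  have "card (N \<inter> {q0, q3}) \<le> card {q0, q3}" by (intro card_mono) auto
  moreover have "card {q0, q3} \<le> 2" by (simp add: card_insert_if)
  ultimately have c2: "card (N \<inter> {q0, q3}) = 2" "card N = card J + 1" using two NJ by linarith+
  have sub2: "N \<inter> {q0, q3} = {q0, q3}"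
    using c2(1) \<open>card {q0, q3} \<le> 2\<close> by (intro card_seteq) simp_all
  then have qN: "q0 \<in> N" "q3 \<in> N" by auto
  have "out i \<in> cut G W" if "i < 6" "qend (out i) \<in> N" for i
  proof -
    have "out i \<in> EN" using qend(2)[OF out_cut_X(1)[OF that(1)]] that(2) by (auto simp: EN_def)
    moreover have "out i \<notin> EJ"
    proof
      assume "out i \<in> EJ"
      then obtain s where s: "s \<in> J" "out i \<in> star G s" by (auto simp: EJ_def)
      have "s \<notin> X" using s(1) J(1) disjoint_split by blast
      then have "s = h i" using yend(3)[OF out_cut_X(1)[OF that(1)] _ s(2)] out_cut_X(2)[OF that(1)] by simp
      then show False using s(1) J(1) disjoint_split that(1) by blast
    qed
    ultimately show ?thesis by (simp add: cutW)
  qed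
  then have "out 0 \<in> cut G W" "out 3 \<in> cut G W" using qN q by auto
  moreover have "card (cut G W) = 3" using cW c2(2) by simp
  ultimately show ?thesis using WV by blast
qed

text \<open>The representatives with \<open>out 0\<close> and \<open>out 3\<close> form a colour
  class \<open>N0\<close> that meets each barrier vertex and each component once. The remaining
  edges of \<open>cut G X\<close> split into two further classes, the components are recoloured to
  match, and the colouring extends to the hexagon.\<close>

lemma matching_colours:
  assumes n: "\<And>s. s \<in> S \<Longrightarrow> n s \<in> star G s" and inj: "inj_on (\<lambda>s. qend (n s)) S"
    and img: "\<And>s. s \<in> S \<Longrightarrow> qend (n s) \<notin> {q0, q3}"
    and q: "q0 = qend (out 0)" "q3 = qend (out 3)" "q0 \<noteq> q3"
  shows False
proof -
  have o6: "out i \<in> cut G X" "yend (out i) = h i" if "i < 6" for i using out_cut_X[OF that] .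
  have hh: "h a = h b \<longleftrightarrow> a = b" if "a < 6" "b < 6" for a b using hexD(2) that by (simp add: inj_on_eq_iff)
  have hS: "h i \<notin> S" if "i < 6" for i using that disjoint_split by blast
  have six: "{..<6::nat} = {0, 1, 2, 3, 4, 5}" by auto
  define N0 where "N0 = n ` S \<union> {out 0, out 3}"
  have nX: "n s \<in> cut G X" "yend (n s) = s" if "s \<in> S" for s
  proof -
    show "n s \<in> cut G X" using star_S_cut[OF that] n[OF that] by blast
    have "{e\<in>cut G X. yend e = s} = star G s" by (rule star_fibre[OF that])
    then show "yend (n s) = s" using n[OF that] by (metis (mono_tags, lifting) mem_Collect_eq)
  qed
  have N0X: "N0 \<subseteq> cut G X" using nX o6 by (auto simp: N0_def)
  have qQ: "q0 \<in> Q" "q3 \<in> Q" using qend(1) o6 q by auto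
  have "(\<lambda>s. qend (n s)) ` S = Q - {q0, q3}"
  proof (rule card_subset_eq)
    show "finite (Q - {q0, q3})" using finite_Q by simp
    show "(\<lambda>s. qend (n s)) ` S \<subseteq> Q - {q0, q3}" using qend(1) nX img by blast
    show "card ((\<lambda>s. qend (n s)) ` S) = card (Q - {q0, q3})"
      using card_image[OF inj] card_Q qQ q(3) finite_Q by (simp add: card_Diff_subset)
  qed
  then have N0q: "\<exists>e. cut G D \<inter> N0 = {e}" if D: "D \<in> Q" for D
  proof -
    have cD: "e \<in> cut G D \<longleftrightarrow> qend e = D" if "e \<in> cut G X" for e using qend[OF that] D by blast
    consider "D = q0" | "D = q3" | s where "s \<in> S" "D = qend (n s)" "D \<notin> {q0, q3}"
      using D \<open>(\<lambda>s. qend (n s)) ` S = Q - {q0, q3}\<close> by blast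
    then show ?thesis
    proof cases
      case 1
      have "e = out 0" if "e \<in> N0" "qend e = q0" for e using that q img unfolding N0_def by auto
      then have "cut G D \<inter> N0 = {out 0}" using cD N0X o6[of 0] q 1 by (auto simp: N0_def)
      then show ?thesis by blast
    next
      case 2
      have "e = out 3" if "e \<in> N0" "qend e = q3" for e using that q img unfolding N0_def by auto
      then have "cut G D \<inter> N0 = {out 3}" using cD N0X o6[of 3] q 2 by (auto simp: N0_def)
      then show ?thesis by blast
    next
      case 3
      have "e = n s" if e: "e \<in> N0" "qend e = D" for e
      proof -
        have "e \<noteq> out 0" "e \<noteq> out 3" using e(2) 3(3) q by auto
        then obtain s' where s': "s' \<in> S" "e = n s'" using e(1) by (auto simp: N0_def)
        then have "s' = s" using inj_onD[OF inj, of s' s] e(2) 3 by simp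
        then show ?thesis using s'(2) by simp
      qed
      then have "cut G D \<inter> N0 = {n s}" using cD N0X nX[OF 3(1)] 3 by (auto simp: N0_def)
      then show ?thesis by blast
    qed
  qed
  have N0s: "star G s \<inter> N0 = {n s}" if s: "s \<in> S" for s
  proof (intro set_eqI iffI)
    fix e assume e: "e \<in> star G s \<inter> N0"
    then have "e \<in> cut G X" using star_S_cut[OF s] by blast
    moreover have "s \<notin> X" using s disjoint_split by blast
    ultimately have "yend e = s" using yend(3)[of e s] e by simp
    then show "e \<in> {n s}" using e nX(2) o6(2)[of 0] o6(2)[of 3] hS[of 0] hS[of 3] s by (auto simp: N0_def)
  qed (use n[OF s] s in \<open>auto simp: N0_def\<close>)
  define F where "F = cut G X - N0"
  \<comment> \<open>To make the rest 2-regular, \<open>out 5\<close> is attached to the vertex of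
    \<open>out 1\<close> and \<open>out 4\<close> to that of \<open>out 2\<close>. A factor then
    separates \<open>out 1\<close> from \<open>out 5\<close> and \<open>out 2\<close> from
    \<open>out 4\<close>.\<close>
  define l where "l e = (if e = out 5 then h 1 else if e = out 4 then h 2 else yend e)" for e
  have finF: "finite F" using finite_cut by (simp add: F_def)
  have outF: "out i \<in> F \<longleftrightarrow> i \<noteq> 0 \<and> i \<noteq> 3" if i: "i < 6" for i
  proof -
    have "out i \<in> n ` S \<longleftrightarrow> False" using nX(2) o6(2)[OF i] hS[OF i] by auto
    then show ?thesis using o6[OF i] out_eq_iff[OF i, of 0] out_eq_iff[OF i, of 3] by (auto simp: F_def N0_def)
  qed
  have lS: "{e\<in>F. l e = s} = star G s - {n s}" if s: "s \<in> S" for s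
  proof -
    have "l e = s \<longleftrightarrow> yend e = s" for e
      using hS[of 1] hS[of 2] hS[of 4] hS[of 5] o6(2)[of 4] o6(2)[of 5] s by (auto simp: l_def)
    then have "{e\<in>F. l e = s} = {e\<in>cut G X. yend e = s} - N0" by (auto simp: F_def)
    also have "\<dots> = star G s - (star G s \<inter> N0)" unfolding star_fibre[OF s] by blast
    finally show ?thesis unfolding N0s[OF s] .
  qed
  have Fcases: "(\<exists>s\<in>S. yend e = s \<and> l e = s) \<or> (\<exists>i\<in>{1, 2, 4, 5}. e = out i)" if e: "e \<in> F" for e
  proof -
    have "e \<in> cut G X" using e by (simp add: F_def)
    then show ?thesis
    proof (cases rule: cut_X_cases)
      case (1 s)
      then have "e \<noteq> out 4" "e \<noteq> out 5" using o6(2)[of 4] o6(2)[of 5] hS[of 4] hS[of 5] by auto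
      then show ?thesis using 1 by (simp add: l_def)
    next
      case (2 i)
      then have "i \<noteq> 0 \<and> i \<noteq> 3" using outF e by blast
      then have "i \<in> {1, 2, 4, 5}" using less_6_cases[OF 2(1)] by auto
      then show ?thesis using 2(2) by blast
    qed
  qed
  have lout: "l (out 1) = h 1" "l (out 5) = h 1" "l (out 2) = h 2" "l (out 4) = h 2"
    using o6(2) out_eq_iff by (auto simp: l_def)
  have hl: "{e\<in>F. l e = h 1} = {out 1, out 5}" "{e\<in>F. l e = h 2} = {out 2, out 4}"
  proof -
    have "e = out 1 \<or> e = out 5" if "e \<in> F" "l e = h 1" for e
      using Fcases[OF that(1)] that(2) lout hS[of 1] hh[of 1 2] by auto
    moreover have "e = out 2 \<or> e = out 4" if "e \<in> F" "l e = h 2" for e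
      using Fcases[OF that(1)] that(2) lout hS[of 2] hh[of 1 2] by auto
    moreover have "out 1 \<in> F" "out 2 \<in> F" "out 4 \<in> F" "out 5 \<in> F" using outF by simp_all
    ultimately show "{e\<in>F. l e = h 1} = {out 1, out 5}" "{e\<in>F. l e = h 2} = {out 2, out 4}"
      using lout by auto
  qed
  have "\<exists>N\<subseteq>F. bij_betw l N (l ` F) \<and> bij_betw qend N (qend ` F)"
  proof (rule regular_bipartite_factor[OF finF, of 2])
    fix e assume e: "e \<in> F"
    have "l e \<in> S \<or> l e = h 1 \<or> l e = h 2" using Fcases[OF e] lout by auto
    then show "card {e'\<in>F. l e' = l e} = 2"
    proof (elim disjE)
      assume s: "l e \<in> S"
      then have "card (star G (l e)) = 3" using S(1) by (intro card_star) blast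
      then show ?thesis unfolding lS[OF s] using n[OF s] by simp
    next
      assume 1: "l e = h 1"
      show ?thesis unfolding 1 hl using out_eq_iff[of 1 5] by simp
    next
      assume 2: "l e = h 2"
      show ?thesis unfolding 2 hl using out_eq_iff[of 2 4] by simp
    qed
    have eX: "e \<in> cut G X" using e by (simp add: F_def)
    then have D: "qend e \<in> Q" by (rule qend(1))
    obtain e0 where e0: "cut G (qend e) \<inter> N0 = {e0}" using N0q[OF D] by blast
    have "{e'\<in>F. qend e' = qend e} = {e'\<in>cut G X. qend e' = qend e} - N0" by (auto simp: F_def)
    also have "\<dots> = cut G (qend e) - (cut G (qend e) \<inter> N0)" unfolding qend_fibre[OF D] by blast
    also have "\<dots> = cut G (qend e) - {e0}" unfolding e0 ..
    finally show "card {e'\<in>F. qend e' = qend e} = 2"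
      using QD(1)[OF D] e0 by (simp add: card_Diff_singleton_if) auto
  qed simp
  then obtain N1 where N1: "N1 \<subseteq> F" "bij_betw l N1 (l ` F)" "bij_betw qend N1 (qend ` F)" by blast
  have uniq: "\<exists>e. A \<inter> N1 = {e}" if A: "A \<inter> F = {e\<in>F. p e = y}" "A \<inter> F \<noteq> {}" and p: "bij_betw p N1 (p ` F)" for A p y
  proof -
    have "y \<in> p ` F" using A by auto
    then have "y \<in> p ` N1" using p by (simp add: bij_betw_def)
    then obtain e where e: "e \<in> N1" "p e = y" by blast
    have "e' = e" if "e' \<in> A \<inter> N1" for e'
    proof -
      have "e' \<in> A \<inter> F" using that N1(1) by blast
      then have "p e' = y" unfolding A(1) by blast
      then show ?thesis using p e that by (auto simp: bij_betw_def dest: inj_onD)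
    qed
    moreover have "e \<in> {e\<in>F. p e = y}" using e N1(1) by blast
    then have "e \<in> A" using A(1) by blast
    ultimately have "A \<inter> N1 = {e}" using e by blast
    then show ?thesis by blast
  qed
  define g where "g e = (if e \<in> N0 then 0 else if e \<in> N1 then 1 else (2::nat))" for e
  have NN: "N0 \<inter> N1 = {}" using N1(1) by (auto simp: F_def)
  have gD: "bij_betw g (cut G D) {..<3}" if D: "D \<in> Q" for D
  proof -
    obtain e0 where e0: "cut G D \<inter> N0 = {e0}" using N0q[OF D] by blast
    have "cut G D \<inter> F = {e\<in>F. qend e = D}"
      using qend_fibre[OF D] cut_Q_sub[OF D] by (auto simp: F_def)
    moreover have "cut G D \<inter> F \<noteq> {}"
    proof
      assume "cut G D \<inter> F = {}"
      then have "cut G D \<subseteq> {e0}" using e0 cut_Q_sub[OF D] by (auto simp: F_def)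
      then have "card (cut G D) \<le> card {e0}" by (intro card_mono) auto
      then show False using QD(1)[OF D] by simp
    qed
    ultimately obtain e1 where "cut G D \<inter> N1 = {e1}" using uniq N1(3) by metis
    then show ?thesis by (intro bij_betw_three_colours[OF QD(1)[OF D] e0 _ NN]) (auto simp: g_def)
  qed
  have gS: "bij_betw g (star G s) {..<3}" if s: "s \<in> S" for s
  proof -
    have c3: "card (star G s) = 3" using s S(1) by (intro card_star) blast
    have "star G s \<inter> F = star G s - (star G s \<inter> N0)" using star_S_cut[OF s] by (auto simp: F_def)
    then have sF: "star G s \<inter> F = star G s - {n s}" by (simp add: N0s[OF s])
    then have "star G s \<inter> F = {e\<in>F. l e = s}" by (simp add: lS[OF s])
    moreover have "card (star G s - {n s}) = 2" using c3 n[OF s] by simp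
    then have "star G s \<inter> F \<noteq> {}" unfolding sF by (metis card.empty zero_neq_numeral)
    ultimately obtain e1 where "star G s \<inter> N1 = {e1}" using uniq N1(2) by metis
    then show ?thesis by (intro bij_betw_three_colours[OF c3 N0s[OF s] _ NN]) (auto simp: g_def)
  qed
  have "\<exists>e. {out 1, out 5} \<inter> N1 = {e}"
  proof (rule uniq[OF _ _ N1(2)])
    show "{out 1, out 5} \<inter> F = {e\<in>F. l e = h 1}" unfolding hl(1) using outF by auto
    show "{out 1, out 5} \<inter> F \<noteq> {}" using outF[of 1] by simp
  qed
  then have o15: "out 1 \<in> N1 \<longleftrightarrow> out 5 \<notin> N1" by (rule pair_Int_singleton[rotated]) (simp add: out_eq_iff)
  have "\<exists>e. {out 2, out 4} \<inter> N1 = {e}"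
  proof (rule uniq[OF _ _ N1(2)])
    show "{out 2, out 4} \<inter> F = {e\<in>F. l e = h 2}" unfolding hl(2) using outF by auto
    show "{out 2, out 4} \<inter> F \<noteq> {}" using outF[of 2] by simp
  qed
  then have o24: "out 2 \<in> N1 \<longleftrightarrow> out 4 \<notin> N1" by (rule pair_Int_singleton[rotated]) (simp add: out_eq_iff)
  have "\<exists>c'. (\<forall>D\<in>Q. proper_on G c' D) \<and> (\<forall>e. (\<forall>D\<in>Q. e \<notin> inside G D) \<longrightarrow> c' e = g e)"
  proof (rule glue_colourings[where c = c])
    have XV: "X \<subseteq> verts G - H" by (auto simp: X_def)
    show "D \<subseteq> verts G" if "D \<in> Q" for D using QD(2)[OF that] XV by blast
    show "proper_on G c D" if "D \<in> Q" for D
      by (rule proper_on_mono[OF col]) (use QD(2)[OF that] XV in blast)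
    show "D = D'" if "D \<in> Q" "D' \<in> Q" "x \<in> D" "x \<in> D'" for D D' x
      using comps_disjoint that by (simp add: Q_def)
  qed (use QD(1) gD in auto)
  then obtain c' where c'0: "(\<forall>D\<in>Q. proper_on G c' D) \<and> (\<forall>e. (\<forall>D\<in>Q. e \<notin> inside G D) \<longrightarrow> c' e = g e)" ..
  then have c': "\<And>D. D \<in> Q \<Longrightarrow> proper_on G c' D"
    "\<And>e. (\<And>D. D \<in> Q \<Longrightarrow> e \<notin> inside G D) \<Longrightarrow> c' e = g e" by simp_all
  have c'X: "c' e = g e" if "e \<in> cut G X" for e
  proof (rule c'(2))
    show "e \<notin> inside G D" if "D \<in> Q" for D
      using QD(2)[OF that] \<open>e \<in> cut G X\<close> by (auto simp: in_cut_iff in_inside_iff)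
  qed
  have c'prop: "proper_on G c' (verts G - H)"
    unfolding proper_on_def
  proof
    fix v assume v: "v \<in> verts G - H"
    show "bij_betw c' (star G v) {..<3}"
    proof (cases "v \<in> S")
      case True
      have "c' e = g e" if "e \<in> star G v" for e using c'X star_S_cut[OF True] that by blast
      then have "bij_betw c' (star G v) {..<3} \<longleftrightarrow> bij_betw g (star G v) {..<3}" by (rule bij_betw_cong)
      then show ?thesis using gS[OF True] by simp
    next
      case False
      then have "v \<in> \<Union>Q" using v unfolding Q_def Union_comps by (simp add: X_def)
      then show ?thesis using c'(1) by (auto simp: proper_on_def)
    qed
  qed
  have gout: "c' (out i) = (if i = 0 \<or> i = 3 then 0 else if out i \<in> N1 then 1 else 2)" if i: "i < 6" for i
    using c'X[OF o6(1)[OF i]] outF[OF i] o6(1)[OF i] NN by (auto simp: g_def F_def)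
  have x: "c' (out 0) = 0" "c' (out 3) = 0" using gout by simp_all
  show False
  \<comment> \<open>Whichever edge the factor picks from each of the two pairs, the hexagon edges
    can be coloured.\<close>
  proof (cases "out 1 \<in> N1"; cases "out 2 \<in> N1")
    assume "out 1 \<in> N1" "out 2 \<in> N1"
    then have y: "c' (out 1) = 1" "c' (out 2) = 1" "c' (out 4) = 2" "c' (out 5) = 2" using gout o15 o24 by auto
    show False
      by (rule colour_hexagon_pattern[OF c'prop x(1) y(1,2) x(2) y(3,4), where ?y0.0 = 2 and ?y1.0 = 0 and ?y2.0 = 2
          and ?y3.0 = 1 and ?y4.0 = 0 and ?y5.0 = 1]) (auto simp: lessThan_3)
  next
    assume "out 1 \<in> N1" "out 2 \<notin> N1"
    then have y: "c' (out 1) = 1" "c' (out 2) = 2" "c' (out 4) = 1" "c' (out 5) = 2" using gout o15 o24 by auto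
    show False
      by (rule colour_hexagon_pattern[OF c'prop x(1) y(1,2) x(2) y(3,4), where ?y0.0 = 2 and ?y1.0 = 0 and ?y2.0 = 1
          and ?y3.0 = 2 and ?y4.0 = 0 and ?y5.0 = 1]) (auto simp: lessThan_3)
  next
    assume "out 1 \<notin> N1" "out 2 \<in> N1"
    then have y: "c' (out 1) = 2" "c' (out 2) = 1" "c' (out 4) = 2" "c' (out 5) = 1" using gout o15 o24 by auto
    show False
      by (rule colour_hexagon_pattern[OF c'prop x(1) y(1,2) x(2) y(3,4), where ?y0.0 = 1 and ?y1.0 = 0 and ?y2.0 = 2
          and ?y3.0 = 1 and ?y4.0 = 0 and ?y5.0 = 2]) (auto simp: lessThan_3)
  next
    assume "out 1 \<notin> N1" "out 2 \<notin> N1"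
    then have y: "c' (out 1) = 2" "c' (out 2) = 2" "c' (out 4) = 1" "c' (out 5) = 1" using gout o15 o24 by auto
    show False
      by (rule colour_hexagon_pattern[OF c'prop x(1) y(1,2) x(2) y(3,4), where ?y0.0 = 1 and ?y1.0 = 0 and ?y2.0 = 1
          and ?y3.0 = 2 and ?y4.0 = 0 and ?y5.0 = 2]) (auto simp: lessThan_3)
  qed
qed

text \<open>If one component receives both \<open>out 0\<close> and \<open>out 3\<close>, it is the
  required set. Otherwise Hall's condition for the barrier vertices, with the two receiving
  components removed, either fails and gives the cut, or holds and gives a forbidden
  colouring.\<close>

theorem hexagon_cut_exists:
  "\<exists>W\<subseteq>verts G - H. card (cut G W) = 3 \<and> out 0 \<in> cut G W \<and> out 3 \<in> cut G W"
proof (rule ccontr)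
  assume no: "\<not> ?thesis"
  define q0 where "q0 = qend (out 0)"
  define q3 where "q3 = qend (out 3)"
  have o: "out 0 \<in> cut G X" "out 3 \<in> cut G X" using out_cut_X by simp_all
  have XV: "X \<subseteq> verts G - H" by (auto simp: X_def)
  have q: "q0 \<in> Q" "q3 \<in> Q" "out 0 \<in> cut G q0" "out 3 \<in> cut G q3"     unfolding q0_def q3_def by (rule qend(1,2)[OF o(1)] qend(1,2)[OF o(2)])+
  have ne: "q0 \<noteq> q3"
  proof
    assume e: "q0 = q3"
    then have "out 0 \<in> cut G q0" "out 3 \<in> cut G q0" using q(3,4) by auto
    moreover have "q0 \<subseteq> verts G - H" using QD(2)[OF q(1)] XV by blast
    ultimately show False using no QD(1)[OF q(1)] by blast
  qed
  have "\<exists>R. (\<forall>s\<in>S. R s \<in> qend ` star G s - {q0, q3}) \<and> inj_on R S"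
  proof (rule hall[OF finite_S])
    show "finite (qend ` star G s - {q0, q3})" for s using finite_star by simp
    fix J assume J: "J \<subseteq> S"
    show "card J \<le> card (\<Union>s\<in>J. qend ` star G s - {q0, q3})"
      using hall_violator_cut[OF J _ q0_def q3_def] no by (meson not_le)
  qed
  then obtain R where R: "\<And>s. s \<in> S \<Longrightarrow> R s \<in> qend ` star G s - {q0, q3}" "inj_on R S" by blast
  have "\<forall>s\<in>S. \<exists>e. e \<in> star G s \<and> qend e = R s" using R(1) by blast
  then obtain n where n: "\<And>s. s \<in> S \<Longrightarrow> n s \<in> star G s \<and> qend (n s) = R s" by metis
  show False
  proof (rule matching_colours[of n q0 q3])
    show "inj_on (\<lambda>s. qend (n s)) S" using R(2) n by (simp cong: inj_on_cong)
    show "qend (n s) \<notin> {q0, q3}" if "s \<in> S" for s using n[OF that] R(1)[OF that] by simp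
  qed (use n ne q0_def q3_def in auto)
qed

end

section \<open>Decomposition along the Petersen graph\<close>

lemma hex_graph_rotate:
  assumes "hex_graph G h k out c S"
  shows "hex_graph G (\<lambda>i. h ((i + 1) mod 6)) (\<lambda>i. k ((i + 1) mod 6)) (\<lambda>i. out ((i + 1) mod 6)) c S"
proof -
  have hex: "hexagon G h k out" using assms by (simp add: hex_graph_def hex_graph_axioms_def)
  note r = hexagon_rotate[OF hex]
  show ?thesis using assms unfolding hex_graph_def hex_graph_axioms_def r(2) using r(1) by blast
qed

definition hexagon_part :: "('v,'e) graph \<Rightarrow> 'v set \<Rightarrow> 'e \<Rightarrow> 'e \<Rightarrow> 'v set \<Rightarrow> bool" where
  "hexagon_part G H a b W \<longleftrightarrow> W \<subseteq> verts G - H \<and> card (cut G W) = 3 \<and> a \<in> cut G W \<and> b \<in> cut G W"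

lemma hex_graph_parts:
  assumes "hex_graph G h k out c S"
  shows "\<exists>W. hexagon_part G (h ` {..<6}) (out 0) (out 3) W"
    and "hexagon_part G (h ` {..<6}) (out 0) (out 3) W \<Longrightarrow> cut G W \<inter> cut G (h ` {..<6}) = {out 0, out 3}"
proof -
  interpret hex_graph G h k out c S by fact
  show "\<exists>W. hexagon_part G H (out 0) (out 3) W" using hexagon_cut_exists unfolding hexagon_part_def by blast
  assume W: "hexagon_part G H (out 0) (out 3) W"
  have ne: "out 0 \<noteq> out 3" by (simp add: out_eq_iff)
  have "card (cut G W - {out 0, out 3}) = 1" using W ne by (simp add: hexagon_part_def)
  then obtain t where t: "cut G W - {out 0, out 3} = {t}" by (metis card_1_singletonE)
  then have tt: "cut G W = {out 0, out 3, t}" "t \<noteq> out 0" "t \<noteq> out 3" using W by (auto simp: hexagon_part_def)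
  then have "t \<notin> cut G H" using hexagon_cut_not_out[of W t] W by (simp add: hexagon_part_def)
  then show "cut G W \<inter> cut G H = {out 0, out 3}" using tt(1) out_not_inside[of 0] out_not_inside[of 3] by auto
qed

context bridgeless_cubic
begin

lemma card_cut_sum: "card (cut G W) = (\<Sum>e\<in>edges G. if e \<in> cut G W then 1 else 0)"
proof -
  have "edges G \<inter> {e. e \<in> cut G W} = cut G W" using cut_subset[of G W] by blast
  then show ?thesis using finite_edges by (simp add: sum.If_cases)
qed

lemma cut_submodular: "card (cut G (A \<union> B)) + card (cut G (A \<inter> B)) \<le> card (cut G A) + card (cut G B)"
  unfolding card_cut_sum sum.distrib[symmetric]
  by (intro sum_mono) (auto simp: in_cut_iff)

lemma cut_posimodular: "card (cut G (A - B)) + card (cut G (B - A)) \<le> card (cut G A) + card (cut G B)"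
  unfolding card_cut_sum sum.distrib[symmetric]
  by (intro sum_mono) (auto simp: in_cut_iff)

text \<open>Uncrossing: two crossing parts of minimum size with different hexagon edges would contradict
  sub- or posimodularity of the cut function.\<close>

lemma hexagon_parts_disjoint:
  assumes A: "hexagon_part G H a a' A" "cut G A \<inter> cut G H = {a, a'}"
    and B: "hexagon_part G H b b' B" "cut G B \<inter> cut G H = {b, b'}"
    and dist: "distinct [a, a', b, b']"
    and minA: "\<And>W. hexagon_part G H a a' W \<Longrightarrow> card A \<le> card W"
  shows "A \<inter> B = {}"
proof (rule ccontr)
  assume ne: "A \<inter> B \<noteq> {}"
  have AV: "A \<subseteq> verts G - H" "card (cut G A) = 3" and BV: "B \<subseteq> verts G - H" "card (cut G B) = 3"
    using A B by (auto simp: hexagon_part_def)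
  have fin: "finite A" "finite B" using AV BV finite_verts by (auto intro: finite_subset)
  have odd: "odd (card A)" "odd (card B)" using even_cut_iff[of A] even_cut_iff[of B] AV BV by auto
  have cut_diff: "x \<in> cut G (P - R) \<and> x \<in> cut G (P \<union> R)"
    if x: "x \<in> cut G P" "x \<in> cut G H" "x \<notin> cut G R" "P \<subseteq> verts G - H" "R \<subseteq> verts G - H" for x P R
  proof -
    have xE: "x \<in> edges G" using x(1) by (simp add: in_cut_iff)
    obtain v w where vw: "v \<in> P" "w \<notin> P" "endpts G x = {v, w}" using x(1) by (metis cut_starE)
    have c: "x \<in> cut G Y \<longleftrightarrow> (v \<in> Y) \<noteq> (w \<in> Y)" for Y by (rule cut_endpts_iff[OF xE vw(3)])
    have "w \<in> H" using c[of H] x(2,4) vw(1) by blast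
    then have "w \<notin> R" using x(5) by blast
    then have "v \<notin> R" using c[of R] x(3) by blast
    then show ?thesis using c[of "P - R"] c[of "P \<union> R"] vw \<open>w \<notin> R\<close> by blast
  qed
  have mem: "a \<in> cut G A" "a' \<in> cut G A" "a \<in> cut G H" "a' \<in> cut G H" "b \<in> cut G B" "b' \<in> cut G B" "b \<in> cut G H" "b' \<in> cut G H"
    using A(2) B(2) by auto
  have "x \<notin> cut G B" if "x = a \<or> x = a'" for x
  proof
    assume "x \<in> cut G B"
    then have "x \<in> {b, b'}" using B(2) mem that by blast
    then show False using dist that by auto
  qed
  then have a: "a \<in> cut G (A - B) \<and> a \<in> cut G (A \<union> B)" "a' \<in> cut G (A - B) \<and> a' \<in> cut G (A \<union> B)"
    using cut_diff[OF _ _ _ AV(1) BV(1)] mem by blast+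
  have "x \<notin> cut G A" if "x = b \<or> x = b'" for x
  proof
    assume "x \<in> cut G A"
    then have "x \<in> {a, a'}" using A(2) mem that by blast
    then show False using dist that by auto
  qed
  then have b: "b \<in> cut G (B - A) \<and> b \<in> cut G (B \<union> A)" "b' \<in> cut G (B - A) \<and> b' \<in> cut G (B \<union> A)"
    using cut_diff[OF _ _ _ BV(1) AV(1)] mem by blast+
  have cA: "card A = card (A \<inter> B) + card (A - B)" and cB: "card B = card (A \<inter> B) + card (B - A)"
    using fin by (metis card_Int_Diff, metis card_Int_Diff Int_commute)
  have sub: "A \<inter> B \<subseteq> verts G" "A \<union> B \<subseteq> verts G" "A - B \<subseteq> verts G" "B - A \<subseteq> verts G" using AV BV by auto
  show False
  \<comment> \<open>Odd intersection: the union has an odd cut containing four given edges, so at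
    least five, and the intersection has at least three, which exceeds 3 + 3. Even intersection:
    both differences have cuts of size exactly three, so \<open>A - B\<close> is a smaller part for
    the same pair.\<close>
  proof (cases "odd (card (A \<inter> B))")
    case True
    have "card (A \<union> B) + card (A \<inter> B) = card A + card B" using card_Un_Int[OF fin] by simp
    then have "odd (card (A \<union> B))" using odd True by presburger
    then have "odd (card (cut G (A \<union> B)))" using even_cut_iff[OF sub(2)] by simp
    moreover have "card {a, a', b, b'} \<le> card (cut G (A \<union> B))"
      using a b finite_cut by (intro card_mono) (auto simp: Un_commute)
    then have "4 \<le> card (cut G (A \<union> B))" using dist by simp
    moreover have "3 \<le> card (cut G (A \<inter> B))" by (rule odd_cut_ge3[OF sub(1) True])
    ultimately show False using cut_submodular[of A B] AV BV by presburger
  next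
    case False
    have "odd (card (A - B))" "odd (card (B - A))" using cA cB odd False by presburger+
    then have "3 \<le> card (cut G (A - B))" "3 \<le> card (cut G (B - A))" using odd_cut_ge3 sub by blast+
    then have "card (cut G (A - B)) = 3" using cut_posimodular[of A B] AV BV by linarith
    then have "hexagon_part G H a a' (A - B)" using a AV(1) by (auto simp: hexagon_part_def)
    then have "card A \<le> card (A - B)" by (rule minA)
    moreover have "card (A \<inter> B) \<noteq> 0" using ne fin by simp
    ultimately show False using cA by simp
  qed
qed

end

text \<open>Contracting each part to a vertex yields \<open>Pg\<close>; \<open>\<eta>\<close> sends
  an edge of \<open>Pg\<close> to the edge of \<open>G\<close> between the corresponding
  parts.\<close>

locale petersen_parts = bridgeless_cubic G for G :: "('v, 'e) graph" +
  fixes part :: "nat \<Rightarrow> 'v set" and \<eta> :: "nat \<Rightarrow> 'e" and c :: "'e \<Rightarrow> nat"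
  assumes part_nonempty: "i < 10 \<Longrightarrow> part i \<noteq> {}"
    and part_disjoint: "i < 10 \<Longrightarrow> j < 10 \<Longrightarrow> x \<in> part i \<Longrightarrow> x \<in> part j \<Longrightarrow> i = j"
    and part_Union: "(\<Union>i<10. part i) = verts G"
    and inj_\<eta>: "inj_on \<eta> {0..<15}"
    and cut_part: "i < 10 \<Longrightarrow> cut G (part i) = \<eta> ` (Pg_stars ! i)"
    and single: "i \<in> C_verts \<Longrightarrow> \<exists>x. part i = {x}"
    and colour: "i < 10 \<Longrightarrow> i \<notin> C_verts \<Longrightarrow> proper_on G c (part i)"

text \<open>The parts 3, 5, 6 are the leaves of the claw \<open>Pg - C\<close>, with two edges to \<open>C\<close> each.\<close>

definition minimal_leaves :: "('v,'e) graph \<Rightarrow> (nat \<Rightarrow> 'v set) \<Rightarrow> (nat \<Rightarrow> 'e) \<Rightarrow> bool" where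
  "minimal_leaves G part \<eta> \<longleftrightarrow> (\<forall>i\<in>{3, 5, 6}. \<forall>x\<in>part i. \<forall>e\<in>Pg_stars ! i - Pg_stars ! 8. \<forall>e'\<in>Pg_stars ! i - Pg_stars ! 8.
     e \<noteq> e' \<longrightarrow> \<eta> e \<in> star G x \<longrightarrow> \<eta> e' \<in> star G x \<longrightarrow> part i = {x})"

theorem (in hex_graph) petersen_parts_exist:
  "\<exists>part \<eta>. petersen_parts G part \<eta> c \<and> minimal_leaves G part \<eta>"
proof -
  have hg: "hex_graph G h k out c S" by unfold_locales
  note hg1 = hex_graph_rotate[OF hg]
  note hg2 = hex_graph_rotate[OF hg1]
  have H1: "(\<lambda>i. h ((i + 1) mod 6)) ` {..<6} = H" by (rule hexagon_rotate(2)[OF hex])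
  have H2: "(\<lambda>i. h (((i + 1) mod 6 + 1) mod 6)) ` {..<6} = H"
    using hexagon_rotate(2)[OF hexagon_rotate(1)[OF hex]] H1 by simp
  note p1 = hex_graph_parts[OF hg1, unfolded H1, simplified]
  note p2 = hex_graph_parts[OF hg2, unfolded H2, simplified]
  note p0 = hex_graph_parts[OF hg]
  have ex: "\<exists>W. hexagon_part G H (out i) (out (i + 3)) W"
    and both: "\<And>W. hexagon_part G H (out i) (out (i + 3)) W \<Longrightarrow> cut G W \<inter> cut G H = {out i, out (i + 3)}"
    if "i < 3" for i
  proof -
    have i: "i = 0 \<or> i = 1 \<or> i = 2" using that by presburger
    show "\<exists>W. hexagon_part G H (out i) (out (i + 3)) W"
      using i p0(1) p1(1) p2(1) by (elim disjE) (simp_all add: eval_nat_numeral)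
    show "hexagon_part G H (out i) (out (i + 3)) W \<Longrightarrow> cut G W \<inter> cut G H = {out i, out (i + 3)}" for W
      using i p0(2)[of W] p1(2)[of W] p2(2)[of W] by (elim disjE) (simp_all add: eval_nat_numeral)
  qed
  have "\<exists>W. hexagon_part G H (out i) (out (i + 3)) W \<and>
      (\<forall>W'. hexagon_part G H (out i) (out (i + 3)) W' \<longrightarrow> card W \<le> card W')" if i: "i < 3" for i
  proof -
    obtain W0 where "hexagon_part G H (out i) (out (i + 3)) W0" using ex[OF i] by blast
    from ex_has_least_nat[of "hexagon_part G H (out i) (out (i + 3))", OF this, of card]
    show ?thesis by blast
  qed
  \<comment> \<open>Minimum size is used twice: for the uncrossing and for
    \<open>minimal_leaves\<close>.\<close>
  then obtain W where W: "\<And>i. i < 3 \<Longrightarrow> hexagon_part G H (out i) (out (i + 3)) (W i)"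
    and Wmin: "\<And>i W'. i < 3 \<Longrightarrow> hexagon_part G H (out i) (out (i + 3)) W' \<Longrightarrow> card (W i) \<le> card W'"
    by metis
  note Wout = both[OF _ W]
  have WV: "W i \<subseteq> verts G - H" "card (cut G (W i)) = 3" if "i < 3" for i using W[OF that] by (auto simp: hexagon_part_def)
  have disjW: "W i \<inter> W j = {}" if "i < 3" "j < 3" "i \<noteq> j" for i j
    by (rule hexagon_parts_disjoint[OF W[OF that(1)] Wout[OF that(1)] W[OF that(2)] Wout[OF that(2)]])
      (use that Wmin in \<open>simp_all add: out_eq_iff\<close>)
  have "\<exists>t. cut G (W i) = {out i, out (i + 3), t} \<and> t \<notin> cut G H" if i: "i < 3" for i
  proof -
    have o: "{out i, out (i + 3)} \<subseteq> cut G (W i)" "out i \<noteq> out (i + 3)" using W[OF i] i by (auto simp: hexagon_part_def out_eq_iff)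
    then have "card (cut G (W i) - {out i, out (i + 3)}) = 1"
      using WV(2)[OF i] by (subst card_Diff_subset) auto
    then obtain t where t: "cut G (W i) - {out i, out (i + 3)} = {t}" by (metis card_1_singletonE)
    then have "t \<in> cut G (W i)" "t \<notin> {out i, out (i + 3)}" by auto
    then have "t \<notin> cut G H" using Wout[OF i i] by blast
    moreover have "cut G (W i) = {out i, out (i + 3), t}" using t o by auto
    ultimately show ?thesis by blast
  qed
  then obtain t where t: "\<And>i. i < 3 \<Longrightarrow> cut G (W i) = {out i, out (i + 3), t i}" "\<And>i. i < 3 \<Longrightarrow> t i \<notin> cut G H"
    by metis
  \<comment> \<open>What is left becomes the centre of the claw. Its cut consists of at most the
    third edges \<open>t i\<close> of the other three cuts, and parity forces all three of
    them.\<close>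
  define Z where "Z = verts G - H - W 0 - W 1 - W 2"
  have three: "i = 0 \<or> i = 1 \<or> i = 2" if "i < 3" for i :: nat using that by presburger
  have cutZ_sub: "cut G Z \<subseteq> {t 0, t 1, t 2}"
  proof
    fix e assume e: "e \<in> cut G Z"
    then obtain z w where zw: "z \<in> Z" "w \<notin> Z" "endpts G e = {z, w}" by (metis cut_starE)
    have eE: "e \<in> edges G" using e by (simp add: in_cut_iff)
    note ce = cut_endpts_iff[OF eE zw(3)]
    have zn: "z \<notin> H" "z \<notin> W i" if "i < 3" for i using zw(1) three[OF that] by (auto simp: Z_def)
    have "w \<in> verts G" using endpts_subset[OF eE] zw(3) by simp
    then consider "w \<in> H" | i where "i < 3" "w \<in> W i" using zw(2) unfolding Z_def by fastforce
    then show "e \<in> {t 0, t 1, t 2}"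
    proof cases
      case 1
      \<comment> \<open>Every edge leaving the hexagon ends in one of the \<open>W i\<close>, so
        none of them reaches \<open>Z\<close>.\<close>
      then have "e \<in> cut G H" using ce[of H] zn[of 0] by simp
      then obtain j where j: "j < 6" "e = out j" unfolding cut_H by blast
      define i where "i = j mod 3"
      have i: "i < 3" "j = i \<or> j = i + 3"
        using less_6_cases[OF j(1)] unfolding i_def by (simp, elim disjE) simp_all
      have "e \<in> cut G (W i)" using t(1)[OF i(1)] i(2) j(2) by auto
      then have "w \<in> W i" using ce[of "W i"] zn(2)[OF i(1)] by blast
      then show ?thesis using 1 WV(1)[OF i(1)] by blast
    next
      case (2 i)
      then have "e \<in> cut G (W i)" using ce[of "W i"] zn(2)[OF 2(1)] by blast
      moreover have "w \<notin> H" using WV(1)[OF 2(1)] 2(2) by blast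
      then have "e \<notin> cut G H" using ce[of H] zn[of 0] by simp
      then have "e \<noteq> out i" "e \<noteq> out (i + 3)" using out_not_inside 2(1) by auto
      ultimately have "e = t i" using t(1)[OF 2(1)] by simp
      then show ?thesis using three[OF 2(1)] by blast
    qed
  qed
  have W3: "W 0 \<subseteq> verts G - H" "W 1 \<subseteq> verts G - H" "W 2 \<subseteq> verts G - H" using WV(1) by simp_all
  have dW: "W 0 \<inter> W 1 = {}" "W 0 \<inter> W 2 = {}" "W 1 \<inter> W 2 = {}" using disjW by simp_all
  have ZV: "Z \<subseteq> verts G" by (auto simp: Z_def)
  have oddW: "odd (card (W i))" if "i < 3" for i
    using even_cut_iff[of "W i"] WV[OF that] by auto
  have cZ: "card (cut G Z) = 3" "cut G Z = {t 0, t 1, t 2}"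
  proof -
    have fin: "finite Z" "finite (W 0)" "finite (W 1)" "finite (W 2)" "finite H"
      using ZV W3 finite_verts by (auto intro: finite_subset)
    have "verts G = H \<union> (W 0 \<union> (W 1 \<union> (W 2 \<union> Z)))" using hexD(1) W3 by (auto simp: Z_def)
    moreover have "card (W 2 \<union> Z) = card (W 2) + card Z"
      by (rule card_Un_disjoint[OF fin(4,1)]) (auto simp: Z_def)
    moreover have "card (W 1 \<union> (W 2 \<union> Z)) = card (W 1) + card (W 2 \<union> Z)"
      by (rule card_Un_disjoint) (use fin dW in \<open>auto simp: Z_def\<close>)
    moreover have "card (W 0 \<union> (W 1 \<union> (W 2 \<union> Z))) = card (W 0) + card (W 1 \<union> (W 2 \<union> Z))"
      by (rule card_Un_disjoint) (use fin dW in \<open>auto simp: Z_def\<close>)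
    moreover have "card (H \<union> (W 0 \<union> (W 1 \<union> (W 2 \<union> Z)))) = card H + card (W 0 \<union> (W 1 \<union> (W 2 \<union> Z)))"
      by (rule card_Un_disjoint) (use fin W3 in \<open>auto simp: Z_def\<close>)
    moreover have "card H = 6" using hexD(2) by (simp add: card_image)
    ultimately have "card (verts G) = 6 + (card (W 0) + (card (W 1) + (card (W 2) + card Z)))" by simp
    then have "odd (card Z)" using even_verts oddW[of 0] oddW[of 1] oddW[of 2] by presburger
    then have ge: "3 \<le> card (cut G Z)" by (rule odd_cut_ge3[OF ZV])
    have "card {t 0, t 1, t 2} \<le> 3" by (simp add: card_insert_if)
    then show eq: "cut G Z = {t 0, t 1, t 2}" using ge cutZ_sub by (intro card_seteq) auto
    show "card (cut G Z) = 3" using ge \<open>card {t 0, t 1, t 2} \<le> 3\<close> eq by simp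
  qed
  have td: "t 0 \<noteq> t 1" "t 0 \<noteq> t 2" "t 1 \<noteq> t 2" using cZ by (auto simp: card_insert_if split: if_splits)
  \<comment> \<open>The hexagon \<open>h 0, ..., h 5\<close> is placed on the cycle 0, 1, 2, 7, 9, 4
    of \<open>Pg\<close>. The common neighbours of its opposite vertices are 5, 6 and 3, the places
    of \<open>W 0\<close>, \<open>W 1\<close> and \<open>W 2\<close>, and 8 is adjacent to these
    three. The list for \<open>\<eta>\<close> follows the edge numbers of \<open>Pg\<close>.\<close>
  define part where "part i = [{h 0}, {h 1}, {h 2}, W 2, {h 5}, W 0, W 1, {h 3}, Z, {h 4}] ! i" for i
  define \<eta> where "\<eta> i = [k 0, k 1, out 2, out 5, k 5, out 0, out 1, k 2, t 2, k 4, out 3, t 1, k 3, t 0, out 4] ! i" for i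
  have kk: "k i = k j \<longleftrightarrow> i = j" if "i < 6" "j < 6" for i j using inj_k that by (simp add: inj_on_eq_iff)
  have ko: "k i \<noteq> out j" if "i < 6" "j < 6" for i j
    using k_inside[OF that(1)] out_not_inside[OF that(2)] cut_inside_disjoint[of G H] by auto
  have to: "t i \<noteq> out j" if "i < 3" "j < 6" for i j using t(2)[OF that(1)] out_not_inside[OF that(2)] by auto
  have tZ: "t i \<in> cut G Z" if "i < 3" for i using cZ(2) three[OF that] by auto
  have tk: "t i \<noteq> k j" if "i < 3" "j < 6" for i j
  proof
    assume "t i = k j"
    then have "t i \<in> inside G H" using k_inside[OF that(2)] by simp
    moreover have "Z \<inter> H = {}" by (auto simp: Z_def)
    ultimately show False using tZ[OF that(1)] by (auto simp: in_cut_iff in_inside_iff)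
  qed
  have parts_H: "part 0 = {h 0}" "part 1 = {h 1}" "part 2 = {h 2}" "part 4 = {h 5}" "part 7 = {h 3}" "part 9 = {h 4}"
    and parts_W: "part 3 = W 2" "part 5 = W 0" "part 6 = W 1" "part 8 = Z" by (simp_all add: part_def)
  have hh: "h i = h j \<longleftrightarrow> i = j" if "i < 6" "j < 6" for i j using hexD(2) that by (simp add: inj_on_eq_iff)
  have Z0: "Z \<noteq> {}"
  proof
    assume "Z = {}"
    then show False using cZ(1) by (simp add: cut_def)
  qed
  have "petersen_parts G part \<eta> c"
  proof unfold_locales
    fix i j :: nat assume i: "i < 10"
    have Wne: "W i \<noteq> {}" if "i < 3" for i using WV(2)[OF that] by (auto simp: cut_def)
    show "part i \<noteq> {}"
      using less_10_cases[OF i] Wne[of 0] Wne[of 1] Wne[of 2] Z0 by (elim disjE) (auto simp: part_def)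
    show "cut G (part i) = \<eta> ` (Pg_stars ! i)"
    proof -
      have s: "cut G {h i} = {k i, k ((i + 5) mod 6), out i}" if "i < 6" for i
        using hexD(3)[OF that] by (simp add: cut_singleton)
      show ?thesis using less_10_cases[OF i] s[of 0] s[of 1] s[of 2] s[of 3] s[of 4] s[of 5] t(1)[of 0] t(1)[of 1] t(1)[of 2] cZ(2)
        by (elim disjE) (simp_all add: part_def \<eta>_def Pg_stars_def, auto)
    qed
    show "proper_on G c (part i)" if "i \<notin> C_verts"
    proof (rule proper_on_mono[OF col])
      have "i = 3 \<or> i = 5 \<or> i = 6 \<or> i = 8" using less_10_cases[OF i] that by (auto simp: C_verts_def)
      then show "part i \<subseteq> verts G - H" using W3 parts_W by (auto simp: Z_def)
    qed
  next
    fix i j x assume ij: "i < 10" "j < (10::nat)" and x: "x \<in> part i" "x \<in> part j"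
    define idx where "idx x = (if x = h 0 then 0 else if x = h 1 then 1 else if x = h 2 then 2 else if x = h 3 then 7
      else if x = h 4 then 9 else if x = h 5 then 4 else if x \<in> W 0 then 5 else if x \<in> W 1 then 6 else if x \<in> W 2 then 3 else (8::nat))" for x
    have hW: "h i \<notin> W j" "h i \<notin> Z" if "i < 6" "j < 3" for i j using WV(1)[OF that(2)] that(1) by (auto simp: Z_def)
    have "idx x = i" if i: "i < 10" "x \<in> part i" for i
    proof -
      have ne: "x \<noteq> h l" if "x \<in> W 0 \<or> x \<in> W 1 \<or> x \<in> W 2 \<or> x \<in> Z" "l < 6" for l
        using that hW[of l 0] hW[of l 1] hW[of l 2] by auto
      have d: "x \<in> W 1 \<Longrightarrow> x \<notin> W 0" "x \<in> W 2 \<Longrightarrow> x \<notin> W 0" "x \<in> W 2 \<Longrightarrow> x \<notin> W 1"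
        "x \<in> Z \<Longrightarrow> x \<notin> W 0 \<and> x \<notin> W 1 \<and> x \<notin> W 2" using dW by (auto simp: Z_def)
      show ?thesis using less_10_cases[OF i(1)] i(2) ne d
        by (elim disjE) (simp_all add: part_def idx_def hh)
    qed
    then show "i = j" using ij x by metis
  next
    have "{..<10::nat} = {0,1,2,3,4,5,6,7,8,9}" by auto
    then have "(\<Union>i<10. part i) = {h 0, h 1, h 2, h 3, h 4, h 5} \<union> W 0 \<union> W 1 \<union> W 2 \<union> Z"
      by (simp add: part_def) blast
    moreover have "H = {h 0, h 1, h 2, h 3, h 4, h 5}"
    proof -
      have six: "{..<6::nat} = {0, 1, 2, 3, 4, 5}" by auto
      show ?thesis unfolding six by simp
    qed
    ultimately show "(\<Union>i<10. part i) = verts G" using W3 hexD(1) by (auto simp: Z_def)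
  next
    have "distinct [k 0, k 1, out 2, out 5, k 5, out 0, out 1, k 2, t 2, k 4, out 3, t 1, k 3, t 0, out 4]"
      using td by (auto simp: kk ko to tk out_eq_iff ko[symmetric] to[symmetric] tk[symmetric])
    then show "inj_on \<eta> {0..<15}" unfolding \<eta>_def by (intro inj_on_nth) auto
  next
    fix i assume "i \<in> C_verts"
    then show "\<exists>x. part i = {x}" by (auto simp: C_verts_def part_def)
  qed
  moreover have "minimal_leaves G part \<eta>"
  proof -
    \<comment> \<open>A vertex that carries both hexagon edges of \<open>W i\<close> is itself a
      part for this pair, so minimality leaves nothing else in \<open>W i\<close>.\<close>
    have main: "W i = {x}" if i: "i < 3" and x: "x \<in> W i" "out i \<in> star G x" "out (i + 3) \<in> star G x" for i x
    proof -
      have xV: "x \<in> verts G - H" using x(1) WV(1)[OF i] by blast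
      have "hexagon_part G H (out i) (out (i + 3)) {x}"
        using xV x card_star[of x] by (simp add: hexagon_part_def cut_singleton)
      then have "card (W i) \<le> card {x}" by (rule Wmin[OF i])
      then have "card (W i) \<le> 1" by simp
      moreover have "finite (W i)" using WV(1)[OF i] finite_verts by (auto intro: finite_subset)
      ultimately show ?thesis using x(1) by (metis One_nat_def card_le_Suc0_iff_eq is_singletonI' is_singleton_the_elem singletonD empty_iff)
    qed
    have d: "Pg_stars ! 3 - Pg_stars ! 8 = {2, 3}" "Pg_stars ! 5 - Pg_stars ! 8 = {5, 10}"
      "Pg_stars ! 6 - Pg_stars ! 8 = {6, 14}" by (auto simp: Pg_stars_def)
    show ?thesis
      unfolding minimal_leaves_def
      using main[of 0] main[of 1] main[of 2] by (simp add: d part_def \<eta>_def)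
  qed
  ultimately show ?thesis by blast
qed

section \<open>Extending Petersen matchings\<close>

lemma Pg_stars_less: "i < 10 \<Longrightarrow> a \<in> Pg_stars ! i \<Longrightarrow> a < 15"
  using star_Pg[of i] star_subset[of Pg i] by auto

lemma Pg_stars_cover: "a < 15 \<Longrightarrow> \<exists>i<10. a \<in> Pg_stars ! i"
proof -
  assume a: "a < 15"
  interpret loopless_graph Pg by (rule loopless_Pg)
  have "a \<in> star Pg (fst (ends Pg a))" "fst (ends Pg a) < 10" using a ends_in_verts[of a] by (auto simp: in_star_iff)
  then show ?thesis using star_Pg by metis
qed

context petersen_parts
begin

lemma part_sub: "i < 10 \<Longrightarrow> part i \<subseteq> verts G"
  using part_Union by blast

lemma part_ex:
  assumes "v \<in> verts G"
  obtains i where "i < 10" "v \<in> part i"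
  using assms part_Union by blast

lemma \<eta>_eq_iff: "a < 15 \<Longrightarrow> b < 15 \<Longrightarrow> \<eta> a = \<eta> b \<longleftrightarrow> a = b"
  using inj_\<eta> by (simp add: inj_on_eq_iff)

lemma card_cut_part: "i < 10 \<Longrightarrow> card (cut G (part i)) = 3"
proof -
  assume i: "i < 10"
  have "Pg_stars ! i \<subseteq> {0..<15}" using Pg_stars_less[OF i] by auto
  then have "card (\<eta> ` (Pg_stars ! i)) = card (Pg_stars ! i)" using inj_\<eta> by (metis card_image inj_on_subset)
  moreover have "card (Pg_stars ! i) = 3" using less_10_cases[OF i] by (elim disjE) (simp_all add: Pg_stars_def)
  ultimately show ?thesis by (simp add: cut_part[OF i])
qed

lemma \<eta>_not_inside:
  assumes a: "a < 15" and j: "j < 10"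
  shows "\<eta> a \<notin> inside G (part j)"
proof
  assume e: "\<eta> a \<in> inside G (part j)"
  obtain i where i: "i < 10" "a \<in> Pg_stars ! i" using Pg_stars_cover[OF a] by blast
  then have c: "\<eta> a \<in> cut G (part i)" using cut_part by blast
  then obtain v where "v \<in> part i" "v \<in> part j" using e by (auto simp: in_cut_iff in_inside_iff)
  then have "i = j" using part_disjoint i(1) j by blast
  then show False using c e by (auto simp: in_cut_iff in_inside_iff)
qed

lemma edge_cases:
  assumes "e \<in> edges G"
  obtains a where "a < 15" "e = \<eta> a" | i where "i < 10" "i \<notin> C_verts" "e \<in> inside G (part i)"
proof -
  have V: "fst (ends G e) \<in> verts G" using ends_in_verts[OF assms] by blast
  obtain i where i: "i < 10" "fst (ends G e) \<in> part i" using part_ex[OF V] .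
  show ?thesis
  proof (cases "snd (ends G e) \<in> part i")
    case True
    then have "e \<in> inside G (part i)" using i assms by (simp add: in_inside_iff)
    moreover have "i \<notin> C_verts"
    proof
      assume "i \<in> C_verts"
      then obtain x where "part i = {x}" using single by blast
      then show False using True i(2) loopless[OF assms] by simp
    qed
    ultimately show ?thesis using that(2) i(1) by blast
  next
    case False
    then have "e \<in> cut G (part i)" using i assms by (simp add: in_cut_iff)
    then show ?thesis using that(1) cut_part[OF i(1)] Pg_stars_less[OF i(1)] by blast
  qed
qed

definition extension :: "nat set \<Rightarrow> 'e set \<Rightarrow> 'e set" where
  "extension N F = \<eta> ` N \<union> {e. \<exists>i<10. i \<notin> C_verts \<and> e \<in> inside G (part i) \<and>
     (\<exists>b. N \<inter> Pg_stars ! i = {b} \<and> c e = c (\<eta> b))} \<union> F"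

text \<open>Where the pattern \<open>N\<close> enters a part through a single edge \<open>b\<close>,
  the colour class of \<open>\<eta> b\<close> continues it: the cut shows each colour once, so this
  class leaves the part only through \<open>\<eta> b\<close>. Part \<open>s\<close> may instead be
  entered through all three edges, if \<open>F\<close> fills it.\<close>

lemma extension_perfect:
  assumes N: "N \<subseteq> {0..<15}" and one: "\<And>i. i < 10 \<Longrightarrow> i \<noteq> s \<Longrightarrow> \<exists>b. N \<inter> Pg_stars ! i = {b}"
    and s: "s < 10" "s \<notin> C_verts"
    and F: "(\<exists>b. N \<inter> Pg_stars ! s = {b}) \<and> F = {} \<or>
      Pg_stars ! s \<subseteq> N \<and> (\<exists>F'\<subseteq>edges G. F = F' \<inter> inside G (part s) \<and> covers_once G F' (part s) \<and> cut G (part s) \<subseteq> F')"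
  shows "perfect_matching G (extension N F)"
  unfolding perfect_matching_iff covers_once_def
proof (intro conjI ballI)
  have FE: "F \<subseteq> inside G (part s)" using F by blast
  show "extension N F \<subseteq> edges G"
  proof
    fix e assume "e \<in> extension N F"
    then consider a where "a \<in> N" "e = \<eta> a" | i where "e \<in> inside G (part i)"
      using FE unfolding extension_def by blast
    then show "e \<in> edges G"
    proof cases
      case 1
      then have "a < 15" using N by auto
      then obtain i where "i < 10" "a \<in> Pg_stars ! i" using Pg_stars_cover by blast
      then have "e \<in> cut G (part i)" using cut_part 1 by blast
      then show ?thesis by (simp add: in_cut_iff)
    next
      case 2 then show ?thesis by (simp add: in_inside_iff)
    qed
  qed
  fix v assume "v \<in> verts G"
  then obtain i where i: "i < 10" "v \<in> part i" by (rule part_ex)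
  have st: "star G v \<subseteq> cut G (part i) \<union> inside G (part i)" by (rule star_subset_cut_inside[OF i(2)])
  have other: "j = i" if "j < 10" "e \<in> star G v" "e \<in> inside G (part j)" for j e
    using that part_disjoint[OF that(1) i(1), of v] i(2) by (auto simp: star_def inside_def)
  have cutmem: "\<eta> a \<in> extension N F \<longleftrightarrow> a \<in> N" if a: "a < 15" for a
  proof -
    have "\<eta> a \<in> \<eta> ` N \<longleftrightarrow> a \<in> N" using N a \<eta>_eq_iff by auto
    moreover have "\<eta> a \<notin> F" using FE \<eta>_not_inside[OF a s(1)] by blast
    ultimately show ?thesis using \<eta>_not_inside[OF a] unfolding extension_def by blast
  qed
  have inmem: "e \<in> extension N F \<longleftrightarrow> (i \<notin> C_verts \<and> (\<exists>b. N \<inter> Pg_stars ! i = {b} \<and> c e = c (\<eta> b))) \<or> e \<in> F"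
    if e: "e \<in> star G v" "e \<in> inside G (part i)" for e
  proof -
    have "e \<notin> \<eta> ` N" using \<eta>_not_inside[OF _ i(1)] e(2) N by auto
    then show ?thesis using other[OF _ e(1)] e(2) i(1) unfolding extension_def by blast
  qed
  have cutE: "\<exists>a. a \<in> Pg_stars ! i \<and> a < 15 \<and> e = \<eta> a" if "e \<in> cut G (part i)" for e
    using that cut_part[OF i(1)] Pg_stars_less[OF i(1)] by auto
  show "card (extension N F \<inter> star G v) = 1"
  proof (cases "i \<in> C_verts")
    case True
    then have "part i = {v}" using single[OF True] i(2) by auto
    then have sv: "star G v = \<eta> ` (Pg_stars ! i)" using cut_part[OF i(1)] by (simp add: cut_singleton)
    obtain b where b: "N \<inter> Pg_stars ! i = {b}" using one[OF i(1)] True s(2) by metis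
    have "extension N F \<inter> star G v = {\<eta> b}"
    proof (intro set_eqI iffI)
      fix e assume e: "e \<in> extension N F \<inter> star G v"
      then obtain a where a: "a \<in> Pg_stars ! i" "e = \<eta> a" using sv by blast
      then have "a \<in> N" using cutmem[OF Pg_stars_less[OF i(1) a(1)]] e by simp
      then have "a \<in> {b}" unfolding b[symmetric] using a(1) by simp
      then show "e \<in> {\<eta> b}" using a(2) by simp
    next
      fix e assume "e \<in> {\<eta> b}"
      moreover have "b \<in> N \<inter> Pg_stars ! i" unfolding b by simp
      ultimately show "e \<in> extension N F \<inter> star G v" using cutmem[of b] Pg_stars_less[OF i(1), of b] sv by simp
    qed
    then show ?thesis by simp
  next
    case False
    note col = colour[OF i(1) False]
    show ?thesis
    proof (cases "\<exists>b. N \<inter> Pg_stars ! i = {b}")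
      case True
      then obtain b where b: "N \<inter> Pg_stars ! i = {b}" by blast
      have bb: "b \<in> N" "b \<in> Pg_stars ! i" using b by auto
      have noF: "e \<notin> F" if e: "e \<in> star G v" "e \<in> inside G (part i)" for e
      proof
        assume eF: "e \<in> F"
        then have "s = i" using FE other[OF s(1) e(1)] by blast
        moreover have "Pg_stars ! s \<subseteq> N" using F eF by blast
        ultimately have "Pg_stars ! i = {b}" using b by blast
        then have "card (Pg_stars ! i) = 1" by simp
        then show False using less_10_cases[OF i(1)] by (elim disjE) (simp_all add: Pg_stars_def)
      qed
      have bij: "bij_betw c (cut G (part i)) {..<3}"
        by (rule cut3_bij[OF col part_sub[OF i(1)] card_cut_part[OF i(1)]])
      have \<eta>b: "\<eta> b \<in> cut G (part i)" using bb cut_part[OF i(1)] by blast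
      have "e \<in> extension N F \<longleftrightarrow> c e = c (\<eta> b)" if e: "e \<in> star G v" for e
      proof (cases "e \<in> inside G (part i)")
        case True
        have "(\<exists>b'. N \<inter> Pg_stars ! i = {b'} \<and> c e = c (\<eta> b')) \<longleftrightarrow> c e = c (\<eta> b)" unfolding b by auto
        then show ?thesis using inmem[OF e True] noF[OF e True] False by simp
      next
        case False
        then have ec: "e \<in> cut G (part i)" using st e by blast
        then obtain a where a: "a \<in> Pg_stars ! i" "a < 15" "e = \<eta> a" using cutE by blast
        have "e \<in> extension N F \<longleftrightarrow> a \<in> N \<inter> Pg_stars ! i" using cutmem[OF a(2)] a by simp
        also have "\<dots> \<longleftrightarrow> a = b" unfolding b by simp
        also have "\<dots> \<longleftrightarrow> \<eta> a = \<eta> b" using \<eta>_eq_iff[OF a(2) Pg_stars_less[OF i(1) bb(2)]] by simp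
        also have "\<dots> \<longleftrightarrow> c e = c (\<eta> b)"
          using inj_on_eq_iff[OF bij_betw_imp_inj_on[OF bij] ec \<eta>b] a(3) by simp
        finally show ?thesis .
      qed
      then have "extension N F \<inter> star G v = {e\<in>edges G. c e = c (\<eta> b)} \<inter> star G v" by (auto simp: star_def)
      moreover have "c (\<eta> b) < 3" using bij \<eta>b by (auto simp: bij_betw_def)
      ultimately show ?thesis using colour_class_covers_once[OF col] i(2) by (simp add: covers_once_def)
    next
      case nb: False
      then have is_s: "i = s" using one[OF i(1)] by blast
      then obtain F' where F': "F' \<subseteq> edges G" "F = F' \<inter> inside G (part i)" "covers_once G F' (part i)"
        "cut G (part i) \<subseteq> F'" "Pg_stars ! i \<subseteq> N" using F nb by blast
      have "e \<in> extension N F \<longleftrightarrow> e \<in> F'" if e: "e \<in> star G v" for e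
      proof (cases "e \<in> inside G (part i)")
        case True
        then show ?thesis using inmem[OF e True] nb F'(2) by blast
      next
        case False
        then have ec: "e \<in> cut G (part i)" using st e by blast
        then obtain a where a: "a \<in> Pg_stars ! i" "a < 15" "e = \<eta> a" using cutE by blast
        then have "e \<in> extension N F" using cutmem[OF a(2)] F'(5) by blast
        then show ?thesis using ec F'(4) by blast
      qed
      then have "extension N F \<inter> star G v = F' \<inter> star G v" by blast
      then show ?thesis using F'(3) i(2) by (simp add: covers_once_def)
    qed
  qed
qed

text \<open>Three perfect matchings of \<open>Pg\<close> that cover the star of \<open>s\<close>.
  The fourth set consists of the star of \<open>s\<close> and the three edges which these matchings
  miss; it covers every vertex other than \<open>s\<close> once.\<close>

definition cover_patterns :: "nat \<Rightarrow> nat set list" where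
  "cover_patterns s = (if s = 3 then [Pg_matchings ! 2, Pg_matchings ! 4, Pg_matchings ! 5, {0, 2, 3, 8, 10, 14}]
     else if s = 5 then [Pg_matchings ! 0, Pg_matchings ! 4, Pg_matchings ! 5, {1, 3, 5, 10, 13, 14}]
     else if s = 6 then [Pg_matchings ! 1, Pg_matchings ! 2, Pg_matchings ! 5, {2, 4, 6, 10, 11, 14}]
     else [Pg_matchings ! 2, Pg_matchings ! 3, Pg_matchings ! 4, {0, 7, 8, 9, 11, 13}])"

lemma cover_patterns:
  assumes s: "s < 10" "s \<notin> C_verts"
  shows "j < 4 \<Longrightarrow> cover_patterns s ! j \<subseteq> {0..<15}"
    and "j < 4 \<Longrightarrow> i < 10 \<Longrightarrow> i \<noteq> s \<or> j < 3 \<Longrightarrow> \<exists>b. cover_patterns s ! j \<inter> Pg_stars ! i = {b}"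
    and "Pg_stars ! s \<subseteq> cover_patterns s ! 3"
    and "a < 15 \<Longrightarrow> \<exists>j<4. a \<in> cover_patterns s ! j"
    and "a \<in> Pg_stars ! s \<Longrightarrow> \<exists>j<3. a \<in> cover_patterns s ! j"
proof -
  have sc: "s = 3 \<or> s = 5 \<or> s = 6 \<or> s = 8" using less_10_cases[OF s(1)] s(2) by (auto simp: C_verts_def)
  have j4: "j = 0 \<or> j = 1 \<or> j = 2 \<or> j = 3" if "j < 4" for j :: nat using that by presburger
  have ex4: "(\<exists>j<4. P j) \<longleftrightarrow> P 0 \<or> P 1 \<or> P 2 \<or> P (3::nat)" for P by (auto simp: eval_nat_numeral less_Suc_eq)
  have ex3: "(\<exists>j<3. P j) \<longleftrightarrow> P 0 \<or> P 1 \<or> P (2::nat)" for P by (auto simp: eval_nat_numeral less_Suc_eq)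
  show "cover_patterns s ! j \<subseteq> {0..<15}" if "j < 4"
    using sc j4[OF that] by (elim disjE) (simp_all add: cover_patterns_def Pg_matchings_def)
  show "Pg_stars ! s \<subseteq> cover_patterns s ! 3"
    using sc by (elim disjE) (simp_all add: cover_patterns_def Pg_stars_def)
  show "\<exists>j<4. a \<in> cover_patterns s ! j" if "a < 15"
    unfolding ex4 using sc less_15_cases[OF that] by (elim disjE) (simp_all add: cover_patterns_def Pg_matchings_def)
  show "\<exists>j<3. a \<in> cover_patterns s ! j" if "a \<in> Pg_stars ! s"
    unfolding ex3 using sc that by (elim disjE) (auto simp: cover_patterns_def Pg_stars_def Pg_matchings_def)
  assume j: "j < 4" and i: "i < 10" and ij: "i \<noteq> s \<or> j < 3"
  have "card (cover_patterns s ! j \<inter> Pg_stars ! i) = 1"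
  proof (cases "j < 3")
    case True
    then have "\<exists>k<6. cover_patterns s ! j = Pg_matchings ! k"
    proof -
      have "j = 0 \<or> j = 1 \<or> j = 2" using True by presburger
      then show ?thesis using sc
        by (elim disjE) (simp_all add: cover_patterns_def, (rule exI, rule conjI[rotated], rule refl, simp)+)
    qed
    then have "perfect_matching Pg (cover_patterns s ! j)" using Pg_matchings_perfect by auto
    moreover have "Pg_stars ! i \<in> set Pg_stars" using i by (intro nth_mem) (simp add: Pg_stars_def)
    ultimately show ?thesis by (simp add: perfect_matching_Pg_iff)
  next
    case False
    then have "j = 3" "i \<noteq> s" using j ij by auto
    then show ?thesis using sc less_10_cases[OF i]
      by (elim disjE) (simp_all add: cover_patterns_def Pg_stars_def card_Int_triple_eq_1[simplified])
  qed
  then show "\<exists>b. cover_patterns s ! j \<inter> Pg_stars ! i = {b}" by (metis card_1_singletonE)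
qed

text \<open>\<open>F\<close> is what the fourth pattern needs inside part \<open>s\<close>, where it
  enters through all three edges. The other parts are filled with colour classes.\<close>

theorem four_cover:
  assumes s: "s < 10" "s \<notin> C_verts"
    and F: "F \<subseteq> edges G" "covers_once G F (part s)" "cut G (part s) \<subseteq> F"
  shows "\<exists>m. (\<forall>j<4. perfect_matching G (m j)) \<and> (\<forall>e\<in>edges G. \<exists>j<4::nat. e \<in> m j)"
proof -
  define m where "m j = extension (cover_patterns s ! j) (if j = 3 then F \<inter> inside G (part s) else {})" for j
  have m: "perfect_matching G (m j)" if j: "j < 4" for j
    unfolding m_def
  proof (rule extension_perfect[OF cover_patterns(1)[OF s j] _ s])
    show "\<exists>b. cover_patterns s ! j \<inter> Pg_stars ! i = {b}" if "i < 10" "i \<noteq> s" for i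
      using cover_patterns(2)[OF s j that(1)] that(2) by blast
    show "(\<exists>b. cover_patterns s ! j \<inter> Pg_stars ! s = {b}) \<and> (if j = 3 then F \<inter> inside G (part s) else {}) = {} \<or>
      Pg_stars ! s \<subseteq> cover_patterns s ! j \<and> (\<exists>F'\<subseteq>edges G. (if j = 3 then F \<inter> inside G (part s) else {}) = F' \<inter> inside G (part s)
        \<and> covers_once G F' (part s) \<and> cut G (part s) \<subseteq> F')"
    proof (cases "j = 3")
      case True
      then show ?thesis using cover_patterns(3)[OF s] F by auto
    next
      case False
      then have "j < 3" using j by simp
      then show ?thesis using cover_patterns(2)[OF s j s(1)] False by simp
    qed
  qed
  have "\<exists>j<4. e \<in> m j" if "e \<in> edges G" for e
    using that
  proof (cases rule: edge_cases)
    case (1 a)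
    then obtain j where "j < 4" "a \<in> cover_patterns s ! j" using cover_patterns(4)[OF s] by blast
    then show ?thesis using 1(2) unfolding m_def extension_def by blast
  next
    case (2 i)
    note col = colour[OF 2(1,2)]
    have bij: "bij_betw c (cut G (part i)) {..<3}"
      by (rule cut3_bij[OF col part_sub[OF 2(1)] card_cut_part[OF 2(1)]])
    have "fst (ends G e) \<in> part i" "e \<in> star G (fst (ends G e))" using 2(3) by (auto simp: in_inside_iff in_star_iff)
    then have "c e < 3" using col by (auto simp: proper_on_def bij_betw_def)
    then have "c e \<in> c ` cut G (part i)" using bij by (simp add: bij_betw_def)
    then obtain b where b: "b \<in> Pg_stars ! i" "c e = c (\<eta> b)" using cut_part[OF 2(1)] by auto
    \<comment> \<open>Inside part \<open>s\<close> the fourth matching follows \<open>F\<close> and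
      not a colour class, so edges there have to be covered by the first three.\<close>
    have "\<exists>j<4. b \<in> cover_patterns s ! j \<and> (i \<noteq> s \<or> j < 3)"
    proof (cases "i = s")
      case True
      then obtain j where "j < 3" "b \<in> cover_patterns s ! j" using cover_patterns(5)[OF s] b(1) by blast
      then show ?thesis by (intro exI[of _ j]) simp
    next
      case False
      then show ?thesis using cover_patterns(4)[OF s Pg_stars_less[OF 2(1) b(1)]] by blast
    qed
    then obtain j where j: "j < 4" "b \<in> cover_patterns s ! j" "i \<noteq> s \<or> j < 3" by blast
    obtain b' where "cover_patterns s ! j \<inter> Pg_stars ! i = {b'}" using cover_patterns(2)[OF s j(1) 2(1) j(3)] by blast
    moreover then have "b = b'" using b(1) j(2) by blast
    ultimately have "e \<in> m j" unfolding m_def extension_def using 2 b(2) by blast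
    then show ?thesis using j(1) by blast
  qed
  then show ?thesis using m by blast
qed

end

section \<open>Contracting a part to a vertex\<close>

text \<open>Edges keep their names, and so do vertices off \<open>P\<close>. It is applied to a
  part, contracted to one of its own vertices, and to the complement of a part, which produces the
  graph \<open>K\<close> of a substitution.\<close>

definition shrink :: "('v,'e) graph \<Rightarrow> 'v set \<Rightarrow> 'v \<Rightarrow> ('v,'e) graph" where
  "shrink G P x = \<lparr>verts = (verts G - P) \<union> {x}, edges = edges G - inside G P,
     ends = (\<lambda>e. map_prod (\<lambda>v. if v \<in> P then x else v) (\<lambda>v. if v \<in> P then x else v) (ends G e))\<rparr>"

context bridgeless_cubic
begin

context
  fixes P :: "'v set" and x :: 'v
  assumes P: "P \<subseteq> verts G" "card (cut G P) = 3" and x: "x \<in> P \<or> x \<notin> verts G"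
begin

lemma shrink_simps [simp]:
  "verts (shrink G P x) = (verts G - P) \<union> {x}" "edges (shrink G P x) = edges G - inside G P"
  by (simp_all add: shrink_def)

lemma ends_shrink:
  "fst (ends (shrink G P x) e) = (if fst (ends G e) \<in> P then x else fst (ends G e))"
  "snd (ends (shrink G P x) e) = (if snd (ends G e) \<in> P then x else snd (ends G e))"
  by (simp_all add: shrink_def)

lemma ends_shrink_eq_x:
  assumes "e \<in> edges G"
  shows "fst (ends (shrink G P x) e) = x \<longleftrightarrow> fst (ends G e) \<in> P" "snd (ends (shrink G P x) e) = x \<longleftrightarrow> snd (ends G e) \<in> P"
  using x ends_in_verts[OF assms] by (auto simp: ends_shrink)

lemma shrink_star_x: "star (shrink G P x) x = cut G P"
proof (rule set_eqI)
  show "e \<in> star (shrink G P x) x \<longleftrightarrow> e \<in> cut G P" for e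
    using ends_shrink_eq_x[of e] by (auto simp: in_star_iff in_cut_iff in_inside_iff)
qed

lemma shrink_star_other:
  assumes "w \<in> verts G - P" "w \<noteq> x"
  shows "star (shrink G P x) w = star G w"
  using assms by (auto simp: in_star_iff ends_shrink in_inside_iff split: if_splits)

text \<open>A cut of the contracted graph is a cut of \<open>G\<close> with \<open>P\<close> on one
  side, so the lower bound on cuts is inherited.\<close>

lemma shrink_cut:
  assumes W: "W \<subseteq> verts (shrink G P x)"
  shows "cut (shrink G P x) W = cut G (if x \<in> W then (W - {x}) \<union> P else W)"
proof (rule set_eqI)
  fix e
  let ?W = "if x \<in> W then (W - {x}) \<union> P else W"
  have r: "(if v \<in> P then x else v) \<in> W \<longleftrightarrow> v \<in> ?W" if "v \<in> verts G" for v
    using that W x by auto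
  show "e \<in> cut (shrink G P x) W \<longleftrightarrow> e \<in> cut G ?W"
  proof (cases "e \<in> edges G")
    case True
    note v = ends_in_verts[OF True]
    have "fst (ends (shrink G P x) e) \<in> W \<longleftrightarrow> fst (ends G e) \<in> ?W" "snd (ends (shrink G P x) e) \<in> W \<longleftrightarrow> snd (ends G e) \<in> ?W"
      unfolding ends_shrink using r v by blast+
    moreover have "e \<notin> cut G ?W" if "e \<in> inside G P"
    proof -
      have "?W \<inter> P = {} \<or> P \<subseteq> ?W" using W by auto
      then show ?thesis using that by (auto simp: in_cut_iff in_inside_iff)
    qed
    ultimately show ?thesis using True by (auto simp: in_cut_iff)
  qed (simp add: in_cut_iff)
qed

lemma shrink_proper:
  assumes "proper_on G c W" "W \<subseteq> verts G" "W \<inter> P = {}" "x \<notin> W"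
  shows "proper_on (shrink G P x) c W"
  unfolding proper_on_def
proof
  fix v assume "v \<in> W"
  then have "star (shrink G P x) v = star G v" using assms by (intro shrink_star_other) auto
  then show "bij_betw c (star (shrink G P x) v) {..<3}" using assms(1) \<open>v \<in> W\<close> by (simp add: proper_on_def)
qed

lemma bridgeless_cubic_shrink: "bridgeless_cubic (shrink G P x)"
proof
  let ?G = "shrink G P x"
  have wf: "wf_graph ?G"
    unfolding wf_graph_def using finite_verts finite_edges ends_in_verts by (auto simp: ends_shrink)
  have "degree ?G w = 3" if w: "w \<in> verts ?G" for w
  proof (cases "w = x")
    case True
    let ?A = "{e\<in>edges ?G. fst (ends ?G e) = x}" and ?B = "{e\<in>edges ?G. snd (ends ?G e) = x}"
    have mem: "e \<in> ?A \<longleftrightarrow> e \<in> edges G \<and> fst (ends G e) \<in> P \<and> snd (ends G e) \<notin> P"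
      "e \<in> ?B \<longleftrightarrow> e \<in> edges G \<and> fst (ends G e) \<notin> P \<and> snd (ends G e) \<in> P" for e
      using ends_shrink_eq_x[of e] by (auto simp: in_inside_iff)
    have "?A \<union> ?B = cut G P"
    proof (rule set_eqI)
      show "e \<in> ?A \<union> ?B \<longleftrightarrow> e \<in> cut G P" for e unfolding Un_iff mem in_cut_iff by blast
    qed
    moreover have "?A \<inter> ?B = {}" using mem by blast
    then have "card (?A \<union> ?B) = card ?A + card ?B" using finite_edges by (intro card_Un_disjoint) auto
    ultimately show ?thesis using P(2) True by (simp add: degree_def)
  next
    case False
    then have w': "w \<in> verts G" "w \<notin> P" using w by auto
    have "{e\<in>edges ?G. fst (ends ?G e) = w} = {e\<in>edges G. fst (ends G e) = w}"
      "{e\<in>edges ?G. snd (ends ?G e) = w} = {e\<in>edges G. snd (ends G e) = w}"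
      using w' False by (auto simp: ends_shrink in_inside_iff split: if_splits)
    then have "degree ?G w = degree G w" by (simp add: degree_def)
    then show ?thesis using cubic w'(1) by (simp add: cubic_def)
  qed
  then show "cubic ?G" using wf by (simp add: cubic_def)
  show "verts ?G \<noteq> {}" by simp
  fix W assume W: "W \<subseteq> verts ?G" "W \<noteq> {}" "W \<noteq> verts ?G"
  have Pne: "P \<noteq> {}" using P(2) by (auto simp: cut_def)
  show "2 \<le> card (cut ?G W)"
    unfolding shrink_cut[OF W(1)]
  proof (rule cut_ge2)
    show "(if x \<in> W then W - {x} \<union> P else W) \<subseteq> verts G" using W(1) P(1) by auto
    show "(if x \<in> W then W - {x} \<union> P else W) \<noteq> {}" using W(2) Pne by auto
    show "(if x \<in> W then W - {x} \<union> P else W) \<noteq> verts G"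
    proof (cases "x \<in> W")
      case True
      then obtain w where "w \<in> verts G - P" "w \<notin> W" using W by auto
      then have "w \<notin> W - {x} \<union> P" "w \<in> verts G" by auto
      then show ?thesis using True by auto
    next
      case False
      then have "W \<inter> P = {}" using W(1) by auto
      then show ?thesis using Pne P(1) False by auto
    qed
  qed
qed

end

section \<open>Bipartising sets from tight barriers\<close>

lemma comps_insert_isolated:
  assumes v: "v \<notin> A" and iso: "\<And>e y. e \<in> edges G \<Longrightarrow> endpts G e = {v, y} \<Longrightarrow> y \<notin> insert v A"
  shows "comps G (insert v A) = insert {v} (comps G A)"
proof -
  have adj: "adj (induced G (insert v A)) = adj (induced G A)"
  proof (rule set_eqI, clarify)
    fix x y
    show "(x, y) \<in> adj (induced G (insert v A)) \<longleftrightarrow> (x, y) \<in> adj (induced G A)"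
    proof
      assume "(x, y) \<in> adj (induced G (insert v A))"
      then obtain e where e: "e \<in> edges G" "endpts G e = {x, y}" "x \<in> insert v A" "y \<in> insert v A"
        by (auto simp: adj_induced)
      have "x \<noteq> v" using iso[of e y] e by blast
      moreover have "endpts G e = {y, x}" using e(2) by blast
      then have "y \<noteq> v" using iso[of e x] e by blast
      ultimately show "(x, y) \<in> adj (induced G A)" using e by (auto simp: adj_induced)
    qed (auto simp: adj_induced)
  qed
  let ?R = "(adj (induced G A))\<^sup>*"
  have out: "y \<in> A" if "(x, y) \<in> ?R" "x \<in> A" for x y using rtrancl_induced_mem[OF that] .
  have vv: "y = v" if "(v, y) \<in> ?R" for y
    using that by (rule converse_rtranclE) (use v in \<open>auto simp: adj_induced\<close>)
  have 1: "{y\<in>insert v A. (x, y) \<in> ?R} = {y\<in>A. (x, y) \<in> ?R}" if "x \<in> A" for x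
    using out[OF _ that] by blast
  have 2: "{y\<in>insert v A. (v, y) \<in> ?R} = {v}" using vv by blast
  have "comps G (insert v A) = (\<lambda>x. {y\<in>insert v A. (x, y) \<in> ?R}) ` insert v A"
    unfolding comps_def adj by blast
  also have "\<dots> = insert {v} ((\<lambda>x. {y\<in>A. (x, y) \<in> ?R}) ` A)"
  proof -
    have "(\<lambda>x. {y\<in>insert v A. (x, y) \<in> ?R}) ` A = (\<lambda>x. {y\<in>A. (x, y) \<in> ?R}) ` A"
      by (rule image_cong[OF refl 1])
    then show ?thesis unfolding image_insert 2 by (rule arg_cong)
  qed
  also have "(\<lambda>x. {y\<in>A. (x, y) \<in> ?R}) ` A = comps G A" unfolding comps_def by blast
  finally show ?thesis .
qed

lemma bipartising_setI:
  assumes U: "U \<subseteq> verts G" "inside G U = {}" "2 \<le> card U"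
    and c3: "\<And>D. D \<in> comps G (verts G - U) \<Longrightarrow> card (cut G D) = 3"
  shows "bipartising_set G U"
  unfolding bipartising_set_def bipartite_cubic_parts_def
proof (intro conjI)
  let ?K = "contract G U"
  let ?Q = "comps G (verts G - U)"
  have blockU: "block G U w = {w}" if "w \<in> U" for w using that by (simp add: block_def)
  have blockQ: "block G U w \<in> ?Q" "w \<in> block G U w" if "w \<in> verts G" "w \<notin> U" for w
    using that by (auto simp: block_def comps_def)
  have QU: "D \<inter> U = {}" if "D \<in> ?Q" for D using comps_subset[OF that] by blast
  have notU: "w \<notin> U" if "e \<in> edges G" "endpts G e = {v, w}" "v \<in> U" for e v w
    using U(2) that by (auto simp: inside_def)
  have block_edge: "block G U v = block G U w"
    if e: "e \<in> edges G" "endpts G e = {v, w}" "v \<notin> U" "w \<notin> U" for e v w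
  proof -
    have V: "v \<in> verts G" "w \<in> verts G" using endpts_subset[OF e(1)] e(2) by auto
    have "w \<in> block G U v"
      by (rule comps_closed[OF blockQ(1)[OF V(1) e(3)] e(1,2) blockQ(2)[OF V(1) e(3)]]) (use V e in blast)
    then show ?thesis
      using comps_disjoint[OF blockQ(1)[OF V(1) e(3)] blockQ(1)[OF V(2) e(4)]] blockQ(2)[OF V(2) e(4)] by blast
  qed
  show "independent G U" "2 \<le> card U" using U by (simp_all add: independent_iff_inside)
  show "(\<lambda>u. {u}) ` U \<inter> ?Q = {}" using QU by auto
  show "(\<lambda>u. {u}) ` U \<union> ?Q = verts ?K" by (simp add: contract_def)
  show "\<forall>e\<in>edges ?K. fst (ends ?K e) \<in> (\<lambda>u. {u}) ` U \<and> snd (ends ?K e) \<in> ?Q \<or>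
      fst (ends ?K e) \<in> ?Q \<and> snd (ends ?K e) \<in> (\<lambda>u. {u}) ` U"
  proof
    fix e assume e: "e \<in> edges ?K"
    define a where "a = fst (ends G e)"
    define b where "b = snd (ends G e)"
    have eG: "e \<in> edges G" "block G U a \<noteq> block G U b" using e by (auto simp: contract_def a_def b_def)
    have ends: "endpts G e = {a, b}" by (simp add: endpts_def a_def b_def)
    have ab: "a \<in> verts G" "b \<in> verts G" using ends_in_verts[OF eG(1)] by (auto simp: a_def b_def)
    have K: "fst (ends ?K e) = block G U a" "snd (ends ?K e) = block G U b" by (simp_all add: contract_def a_def b_def)
    have "a \<in> U \<Longrightarrow> b \<notin> U" by (rule notU[OF eG(1) ends])
    moreover have "\<not> (a \<notin> U \<and> b \<notin> U)" using block_edge[OF eG(1) ends] eG(2) by blast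
    ultimately consider "a \<in> U" "b \<notin> U" | "a \<notin> U" "b \<in> U" by blast
    then show "fst (ends ?K e) \<in> (\<lambda>u. {u}) ` U \<and> snd (ends ?K e) \<in> ?Q \<or>
      fst (ends ?K e) \<in> ?Q \<and> snd (ends ?K e) \<in> (\<lambda>u. {u}) ` U"
      unfolding K by cases (use blockU blockQ ab in simp_all)
  qed
  have wf: "wf_graph ?K"
    unfolding wf_graph_def
  proof (intro conjI ballI)
    have "finite U" using U(1) finite_verts finite_subset by blast
    then show "finite (verts ?K)" using finite_comps[of "verts G - U" G] finite_verts by (simp add: contract_def)
    show "finite (edges ?K)" using finite_edges by (simp add: contract_def)
    fix e assume "e \<in> edges ?K"
    then have "e \<in> edges G" by (simp add: contract_def)
    note v = ends_in_verts[OF this]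
    have "block G U w \<in> verts ?K" if "w \<in> verts G" for w
      using blockU blockQ(1)[OF that] by (cases "w \<in> U") (auto simp: contract_def)
    then show "fst (ends ?K e) \<in> verts ?K" "snd (ends ?K e) \<in> verts ?K" using v by (simp_all add: contract_def)
  qed
  have "degree ?K D = 3" if D: "D \<in> verts ?K" for D
  proof (cases "D \<in> ?Q")
    case True
    then show ?thesis using degree_contract c3 by simp
  next
    case False
    then have "D \<in> (\<lambda>u. {u}) ` U" using D by (simp add: contract_def)
    then obtain u where u: "u \<in> U" "D = {u}" by blast
    have bu: "block G U w = {u} \<longleftrightarrow> w = u" if "w \<in> verts G" for w
    proof (cases "w \<in> U")
      case True then show ?thesis by (simp add: blockU)
    next
      case False
      then have "block G U w \<noteq> {u}" using blockQ(1)[OF that False] QU u(1) by auto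
      then show ?thesis using False u(1) by auto
    qed
    let ?A = "{e\<in>edges ?K. fst (ends ?K e) = D}" and ?B = "{e\<in>edges ?K. snd (ends ?K e) = D}"
    have "?A \<union> ?B = star G u"
    proof (rule set_eqI)
      fix e
      show "e \<in> ?A \<union> ?B \<longleftrightarrow> e \<in> star G u"
      proof (cases "e \<in> edges G")
        case True
        note v = ends_in_verts[OF True]
        have b: "block G U (fst (ends G e)) = {u} \<longleftrightarrow> fst (ends G e) = u"
          "block G U (snd (ends G e)) = {u} \<longleftrightarrow> snd (ends G e) = u"
          by (rule bu[OF v[THEN conjunct1]], rule bu[OF v[THEN conjunct2]])
        have "block G U (fst (ends G e)) \<noteq> block G U (snd (ends G e)) \<and>
            (block G U (fst (ends G e)) = {u} \<or> block G U (snd (ends G e)) = {u}) \<longleftrightarrow>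
            fst (ends G e) = u \<or> snd (ends G e) = u" using b loopless[OF True] by metis
        then show ?thesis using True by (simp add: contract_def in_star_iff u(2)) blast
      qed (simp add: contract_def in_star_iff)
    qed
    moreover have "?A \<inter> ?B = {}" by (auto simp: contract_def)
    then have "card (?A \<union> ?B) = card ?A + card ?B" using finite_edges by (intro card_Un_disjoint) (auto simp: contract_def)
    moreover have "card (star G u) = 3" using card_star u(1) U(1) by blast
    ultimately show ?thesis unfolding degree_def by simp
  qed
  then show "cubic ?K" using wf by (simp add: cubic_def)
qed

text \<open>Let \<open>T\<close> consist of \<open>v\<close> and its three neighbours. The three
  edges at \<open>v\<close> lie inside \<open>T\<close>, so at most six edges leave \<open>T\<close>
  and \<open>tight_barrier\<close> gives a set \<open>S\<close>. Adding the neighbours of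
  \<open>v\<close> to \<open>S\<close> gives the bipartising set, with \<open>{v}\<close> as a new
  component.\<close>

theorem correct_forI:
  assumes v: "v \<in> verts G" and nb: "card ((\<lambda>e. other_end G e v) ` star G v) = 3"
    and no: "\<nexists>F. F \<subseteq> inside G (verts G - insert v ((\<lambda>e. other_end G e v) ` star G v)) \<and>
      covers_once G F (verts G - insert v ((\<lambda>e. other_end G e v) ` star G v))"
  shows "correct_for G v" "quasi_bipartite G"
proof -
  define N where "N = (\<lambda>e. other_end G e v) ` star G v"
  define T where "T = insert v N"
  have "other_end G e v \<in> verts G - {v}" if "e \<in> star G v" for e using endpts_other_end[OF that] by simp
  then have "N \<subseteq> verts G - {v}" unfolding N_def by (rule image_subsetI)
  then have NV: "N \<subseteq> verts G" "v \<notin> N" by auto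
  have finN: "finite N" using finite_star by (simp add: N_def)
  have cN: "card N = 3" using nb by (simp add: N_def)
  have T: "T \<subseteq> verts G" "card T = 4" using NV v finN cN by (simp_all add: T_def)
  have sT: "star G v \<subseteq> inside G T"
  proof
    fix e assume e: "e \<in> star G v"
    then have "other_end G e v \<in> N" by (simp add: N_def)
    then have "endpts G e \<subseteq> T" using endpts_other_end[OF e] by (simp add: T_def)
    then show "e \<in> inside G T" using e by (simp add: inside_def star_def)
  qed
  then have ge3: "3 \<le> card (inside G T)" using card_mono[OF finite_inside sT] card_star[OF v] by simp
  have dc: "12 = 2 * card (inside G T) + card (cut G T)" using degree_count[OF T(1)] T(2) by simp
  have "card (cut G T) = 6 \<and> (\<exists>S. S \<subseteq> verts G - T \<and>
    (\<forall>D\<in>comps G (verts G - T - S). card (cut G D) = 3) \<and>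
    card (comps G (verts G - T - S)) = card S + 2 \<and> inside G S = {} \<and> cut G S \<inter> cut G T = {})"
  proof (rule tight_barrier[OF T(1)])
    show "even (card T)" "card (cut G T) \<le> 6" using T(2) ge3 dc by simp_all
    show "\<nexists>F. F \<subseteq> inside G (verts G - T) \<and> covers_once G F (verts G - T)" using no by (simp add: T_def N_def)
  qed
  then obtain S where c6: "card (cut G T) = 6" and S: "S \<subseteq> verts G - T"
    "\<forall>D\<in>comps G (verts G - T - S). card (cut G D) = 3" "inside G S = {}" "cut G S \<inter> cut G T = {}" by blast
  \<comment> \<open>Exactly six edges leave \<open>T\<close>, so there are none inside
    \<open>T\<close> besides those at \<open>v\<close>; in particular the neighbours of
    \<open>v\<close> are independent.\<close>
  have inT: "inside G T = star G v"
    using card_seteq[OF finite_inside sT] c6 dc card_star[OF v] by simp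
  define U where "U = S \<union> N"
  have U: "U \<subseteq> verts G" using S(1) NV by (auto simp: U_def)
  have "inside G U = {}"
  proof (rule ccontr)
    assume "inside G U \<noteq> {}"
    then obtain e where e: "e \<in> edges G" "fst (ends G e) \<in> U" "snd (ends G e) \<in> U" by (auto simp: in_inside_iff)
    have "\<not> (fst (ends G e) \<in> S \<and> snd (ends G e) \<in> S)" using S(3) e(1) by (auto simp: in_inside_iff)
    moreover have "\<not> (fst (ends G e) \<in> N \<and> snd (ends G e) \<in> N)"
    proof
      assume n: "fst (ends G e) \<in> N \<and> snd (ends G e) \<in> N"
      then have "e \<in> inside G T" using e(1) by (auto simp: in_inside_iff T_def)
      then show False using inT n NV(2) by (auto simp: in_star_iff)
    qed
    moreover have "S \<inter> T = {}" using S(1) by blast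
    ultimately have "e \<in> cut G S \<inter> cut G T" using e unfolding U_def T_def by (auto simp: in_cut_iff)
    then show False using S(4) by blast
  qed
  moreover have "2 \<le> card U"
  proof -
    have "finite S" using S(1) finite_verts by (meson finite_Diff finite_subset)
    then have "card N \<le> card U" using finN by (intro card_mono) (auto simp: U_def)
    then show ?thesis using nb by (simp add: N_def)
  qed
  moreover have cm: "comps G (verts G - U) = insert {v} (comps G (verts G - T - S))"
  proof -
    have eq: "verts G - U = insert v (verts G - T - S)" using v NV S(1) by (auto simp: U_def T_def)
    show ?thesis
      unfolding eq
    proof (rule comps_insert_isolated)
      fix e y assume e: "e \<in> edges G" "endpts G e = {v, y}"
      then have es: "e \<in> star G v" by (simp add: star_def)
      then have "endpts G e = {v, other_end G e v}" "other_end G e v \<noteq> v" using endpts_other_end by blast+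
      then have "y = other_end G e v" using e(2) by (metis doubleton_eq_iff)
      then have "y \<in> N" using es by (auto simp: N_def)
      then show "y \<notin> insert v (verts G - T - S)" using NV(2) by (auto simp: T_def)
    qed (simp add: T_def)
  qed
  moreover have "card (cut G D) = 3" if "D \<in> comps G (verts G - U)" for D
  proof -
    have "D = {v} \<or> D \<in> comps G (verts G - T - S)" using that unfolding cm by blast
    then show ?thesis using S(2) card_star[OF v] by (auto simp: cut_singleton)
  qed
  ultimately have b: "bipartising_set G U" "{v} \<in> comps G (verts G - U)"
    using bipartising_setI[OF U] by auto
  then show "correct_for G v" by (auto simp: correct_for_def)
  show "quasi_bipartite G" using b cubic two_connected by (auto simp: quasi_bipartite_def)
qed

end

lemma proper_three_edge_colourable:
  assumes "loopless_graph G" "proper_on G c (verts G)"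
  shows "three_edge_colourable G"
proof -
  interpret loopless_graph G by fact
  have c3: "c e < 3" if "e \<in> edges G" for e
  proof -
    have "e \<in> star G (fst (ends G e))" "fst (ends G e) \<in> verts G" using that ends_in_verts by (auto simp: in_star_iff)
    then show ?thesis using assms(2) by (auto simp: proper_on_def bij_betw_def)
  qed
  moreover have "c e \<noteq> c e'" if e: "e \<in> edges G" "e' \<in> edges G" "e \<noteq> e'" "endpts G e \<inter> endpts G e' \<noteq> {}" for e e'
  proof -
    obtain v where v: "v \<in> endpts G e" "v \<in> endpts G e'" using e(4) by blast
    then have "v \<in> verts G" using endpts_subset[OF e(1)] by blast
    then have "inj_on c (star G v)" using assms(2) by (auto simp: proper_on_def bij_betw_def)
    moreover have "e \<in> star G v" "e' \<in> star G v" using v e by (auto simp: star_def)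
    ultimately show ?thesis using e(3) by (auto dest: inj_onD)
  qed
  ultimately show ?thesis unfolding three_edge_colourable_def using loopless by blast
qed

section \<open>Undoing a contraction by one of the operations\<close>

lemma bij_betw_if:
  assumes a: "bij_betw a A A'" and b: "bij_betw b B B'" and d: "A \<inter> B = {}" "A' \<inter> B' = {}"
  shows "bij_betw (\<lambda>x. if x \<in> B then b x else a x) (A \<union> B) (A' \<union> B')"
proof (rule bij_betw_combine)
  show "bij_betw (\<lambda>x. if x \<in> B then b x else a x) A A'"
    by (rule bij_betw_cong[THEN iffD1, OF _ a]) (use d in auto)
  show "bij_betw (\<lambda>x. if x \<in> B then b x else a x) B B'"
    by (rule bij_betw_cong[THEN iffD1, OF _ b]) simp
  show "A' \<inter> B' = {}" by (rule d(2))
qed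

lemma bij_betw_remove:
  assumes "bij_betw f A B" "x \<in> A"
  shows "bij_betw f (A - {x}) (B - {f x})"
  using assms by (auto simp: bij_betw_def inj_on_def)

text \<open>The bound 15 keeps shifted names apart from all vertices and edges of \<open>Pg\<close>,
  as \<open>pg_constr\<close> demands for new elements.\<close>

lemma finite_nat_fresh:
  assumes "finite (A :: nat set)"
  shows "\<exists>n\<ge>15. \<forall>a\<in>A. a < n"
proof -
  obtain k where "\<forall>a\<in>A. a \<le> k" using assms finite_nat_set_iff_bounded_le by blast
  then show ?thesis by (intro exI[of _ "max 15 (Suc k)"]) (auto simp: less_Suc_eq_le less_max_iff_disj)
qed

lemma iso_by_ends_cases:
  assumes "iso_by f g G H" "e \<in> edges G" "ends G e = (p, q)"
  shows "ends H (g e) = (f p, f q) \<or> ends H (g e) = (f q, f p)"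
  using assms by (fastforce simp: iso_by_def)

text \<open>\<open>K\<close> is obtained from \<open>G\<close> by contracting the complement of
  \<open>P\<close>, so substituting it for the image of \<open>x\<close> rebuilds \<open>G\<close>.
  The last two clauses record that nothing outside \<open>P\<close> is renamed, so that further
  operations may still refer to elements of \<open>Pg\<close>.\<close>

lemma substitution_step:
  fixes G :: "(nat, nat) graph"
  assumes G: "bridgeless_cubic G" and P: "P \<subseteq> verts G" "card (cut G P) = 3" "x \<in> P" and v: "v \<in> verts G" "v \<notin> P"
    and K: "correct_for (shrink G (verts G - P) v) v" "quasi_bipartite (shrink G (verts G - P) v)"
      "three_edge_colourable (shrink G (verts G - P) v)"
    and iso: "iso_by f1 g1 (shrink G P x) H1" and H1: "pg_constr H1" and i: "f1 x \<in> verts Pg - C_verts"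
  shows "\<exists>H f g. pg_constr H \<and> iso_by f g G H \<and> (\<forall>y\<in>verts G - P. f y = f1 y) \<and> (\<forall>e\<in>edges G - inside G P. g e = g1 e)"
proof -
  interpret G: bridgeless_cubic G by fact
  let ?G1 = "shrink G P x" and ?K = "shrink G (verts G - P) v"
  have P': "P \<subseteq> verts G" "card (cut G P) = 3" "x \<in> P \<or> x \<notin> verts G" using P by auto
  have C': "verts G - P \<subseteq> verts G" "card (cut G (verts G - P)) = 3" "v \<in> verts G - P \<or> v \<notin> verts G"
    using P(2) v by (auto simp: G.cut_compl)
  have b1: "bridgeless_cubic ?G1" by (rule G.bridgeless_cubic_shrink[OF P'])
  have bK: "bridgeless_cubic ?K" by (rule G.bridgeless_cubic_shrink[OF C'])
  interpret G1: bridgeless_cubic ?G1 by (rule b1)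
  interpret K: bridgeless_cubic ?K by (rule bK)
  have bH: "bridgeless_cubic H1" by (rule bridgeless_cubic_iso[OF b1 iso])
  interpret H1: bridgeless_cubic H1 by (rule bH)
  define u where "u = f1 x"
  have vertsK: "verts ?K = P \<union> {v}" using P(1) by (auto simp: shrink_def)
  have starK: "star ?K v = cut G P" using G.shrink_star_x[OF C'] by (simp add: G.cut_compl)
  have edgesK: "edges ?K - star ?K v = inside G P"
  proof (rule set_eqI)
    fix e
    show "e \<in> edges ?K - star ?K v \<longleftrightarrow> e \<in> inside G P"
      unfolding starK using G.ends_in_verts[of e] by (auto simp: shrink_def in_inside_iff in_cut_iff)
  qed
  have edges1: "edges ?G1 = edges G - inside G P" by (simp add: shrink_def)
  have verts1: "verts ?G1 = (verts G - P) \<union> {x}" by (simp add: shrink_def)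
  have bf: "bij_betw f1 ((verts G - P) \<union> {x}) (verts H1)" and bg: "bij_betw g1 (edges G - inside G P) (edges H1)"
    using iso by (auto simp: iso_by_def verts1 edges1)
  have uH: "u \<in> verts H1" using bf by (auto simp: u_def bij_betw_def)
  have f1u: "f1 y \<noteq> u" if "y \<in> verts G - P" for y
    using bf that P(3) inj_onD[of f1 "(verts G - P) \<union> {x}" y x] by (auto simp: u_def bij_betw_def)
  have cutE: "cut G P \<subseteq> edges G - inside G P" using cut_inside_disjoint[of G P] cut_subset[of G P] by blast
  have starH: "star H1 u = g1 ` cut G P"
    unfolding u_def using iso_by_star[OF iso G1.wf, of x] by (simp add: verts1 G.shrink_star_x[OF P'])
  \<comment> \<open>The edges of \<open>cut G P\<close> have the same names in both contracted
    graphs, so the bijection between the two stars is just the inverse of \<open>g1\<close>.\<close>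
  define \<sigma> where "\<sigma> = inv_into (edges G - inside G P) g1"
  have \<sigma>g: "\<sigma> (g1 e) = e" if "e \<in> edges G - inside G P" for e
    using bg that by (simp add: \<sigma>_def bij_betw_def)
  have b\<sigma>: "bij_betw \<sigma> (star H1 u) (star ?K v)"
    unfolding starH starK
  proof (rule bij_betw_byWitness[where f' = g1])
    show "\<forall>a\<in>g1 ` cut G P. g1 (\<sigma> a) = a" "\<sigma> ` g1 ` cut G P \<subseteq> cut G P" "\<forall>a'\<in>cut G P. \<sigma> (g1 a') = a'"
      using \<sigma>g cutE by (auto simp: subset_iff)
  qed simp
  obtain n where n: "n \<ge> 15" "\<And>a. a \<in> verts H1 \<Longrightarrow> a < n" using finite_nat_fresh[OF H1.finite_verts] by blast
  obtain m where m: "m \<ge> 15" "\<And>a. a \<in> edges H1 \<Longrightarrow> a < m" using finite_nat_fresh[OF H1.finite_edges] by blast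
  define \<phi> where "\<phi> y = n + y" for y
  define \<psi> where "\<psi> e = m + e" for e
  have \<phi>new: "\<phi> y \<notin> verts H1" for y using n(2)[of "\<phi> y"] by (auto simp: \<phi>_def)
  have \<psi>new: "\<psi> e \<notin> edges H1" for e using m(2)[of "\<psi> e"] by (auto simp: \<psi>_def)
  have inj: "inj_on \<phi> A" "inj_on \<psi> A" for A by (auto simp: \<phi>_def \<psi>_def inj_on_def)
  define H where "H = \<lparr>verts = (verts H1 - {u}) \<union> \<phi> ` P, edges = edges H1 \<union> \<psi> ` inside G P,
    ends = (\<lambda>e. if e \<in> edges H1 then (if e \<in> star H1 u then repl_end u (\<phi> (other_end ?K (\<sigma> e) v)) (ends H1 e) else ends H1 e)
      else map_prod \<phi> \<phi> (ends ?K (e - m)))\<rparr>"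
  have PK: "verts ?K - {v} = P" using vertsK v by auto
  have subst: "substitution H1 u ?K v H"
  proof -
    have st: "{a\<in>edges H1. u \<in> endpts H1 a} = star H1 u" "{b\<in>edges ?K. v \<in> endpts ?K b} = star ?K v"
      by (auto simp: star_def)
    have "\<exists>\<sigma> \<phi> \<psi>. bij_betw \<sigma> (star H1 u) (star ?K v) \<and>
        inj_on \<phi> (verts ?K - {v}) \<and> \<phi> ` (verts ?K - {v}) \<inter> verts H1 = {} \<and>
        inj_on \<psi> (edges ?K - star ?K v) \<and> \<psi> ` (edges ?K - star ?K v) \<inter> edges H1 = {} \<and>
        verts H = (verts H1 - {u}) \<union> \<phi> ` (verts ?K - {v}) \<and>
        edges H = edges H1 \<union> \<psi> ` (edges ?K - star ?K v) \<and>
        (\<forall>x\<in>edges H1 - star H1 u. ends H x = ends H1 x) \<and>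
        (\<forall>a\<in>star H1 u. ends H a = repl_end u (\<phi> (other_end ?K (\<sigma> a) v)) (ends H1 a)) \<and>
        (\<forall>x\<in>edges ?K - star ?K v. ends H (\<psi> x) = map_prod \<phi> \<phi> (ends ?K x))"
    proof (intro exI conjI)
      show "bij_betw \<sigma> (star H1 u) (star ?K v)" by (rule b\<sigma>)
      show "inj_on \<phi> (verts ?K - {v})" "inj_on \<psi> (edges ?K - star ?K v)" by (rule inj)+
      show "\<phi> ` (verts ?K - {v}) \<inter> verts H1 = {}" using \<phi>new by blast
      show "\<psi> ` (edges ?K - star ?K v) \<inter> edges H1 = {}" using \<psi>new by blast
      show "verts H = (verts H1 - {u}) \<union> \<phi> ` (verts ?K - {v})" unfolding PK by (simp add: H_def)
      show "edges H = edges H1 \<union> \<psi> ` (edges ?K - star ?K v)" unfolding edgesK by (simp add: H_def)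
      show "\<forall>x\<in>edges H1 - star H1 u. ends H x = ends H1 x" by (simp add: H_def)
      show "\<forall>a\<in>star H1 u. ends H a = repl_end u (\<phi> (other_end ?K (\<sigma> a) v)) (ends H1 a)"
        using star_subset[of H1 u] by (auto simp: H_def)
      show "\<forall>x\<in>edges ?K - star ?K v. ends H (\<psi> x) = map_prod \<phi> \<phi> (ends ?K x)"
        using \<psi>new by (simp add: H_def) (simp add: \<psi>_def)
    qed
    moreover have "card (star H1 u) = 3" by (rule H1.card_star[OF uH])
    moreover have "card (star ?K v) = 3" unfolding starK by (rule P(2))
    moreover have "\<forall>a\<in>star H1 u. fst (ends H1 a) \<noteq> snd (ends H1 a)"
      using H1.loopless star_subset by (metis subsetD)
    moreover have "\<forall>b\<in>star ?K v. fst (ends ?K b) \<noteq> snd (ends ?K b)"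
      using K.loopless star_subset by (metis subsetD)
    ultimately show ?thesis unfolding substitution_def Let_def st using uH vertsK by (intro conjI) simp_all
  qed
  have pg: "pg_constr H"
  proof (rule pg_constr.O2[OF H1 H1.cubic H1.two_connected _ K.cubic K.two_connected _ K(3,2,1) subst])
    show "u \<in> verts Pg - C_verts" using i by (simp add: u_def)
    show "connected ?K" using K.two_connected by (simp add: two_connected_def)
    show "(verts H - verts H1) \<inter> verts Pg = {}" using n(1) by (auto simp: H_def \<phi>_def)
    show "(edges H - edges H1) \<inter> edges Pg = {}" using m(1) by (auto simp: H_def \<psi>_def)
  qed
  define f where "f y = (if y \<in> P then \<phi> y else f1 y)" for y
  define g where "g e = (if e \<in> inside G P then \<psi> e else g1 e)" for e
  have "iso_by f g G H"
    unfolding iso_by_def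
  proof (intro conjI ballI)
    have "bij_betw f1 ((verts G - P) \<union> {x} - {x}) (verts H1 - {f1 x})" by (rule bij_betw_remove[OF bf]) simp
    moreover have "(verts G - P) \<union> {x} - {x} = verts G - P" using P(3) by blast
    ultimately have "bij_betw f1 (verts G - P) (verts H1 - {u})" by (simp add: u_def)
    moreover have "bij_betw \<phi> P (\<phi> ` P)" using inj by (simp add: bij_betw_def)
    ultimately have "bij_betw f ((verts G - P) \<union> P) ((verts H1 - {u}) \<union> \<phi> ` P)"
      unfolding f_def using \<phi>new by (intro bij_betw_if) blast+
    moreover have "(verts G - P) \<union> P = verts G" using P(1) by blast
    ultimately show "bij_betw f (verts G) (verts H)" by (simp add: H_def)
    have "bij_betw \<psi> (inside G P) (\<psi> ` inside G P)" using inj by (simp add: bij_betw_def)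
    then have "bij_betw g ((edges G - inside G P) \<union> inside G P) (edges H1 \<union> \<psi> ` inside G P)"
      unfolding g_def using bg \<psi>new by (intro bij_betw_if) blast+
    moreover have "(edges G - inside G P) \<union> inside G P = edges G" using inside_subset[of G P] by blast
    ultimately show "bij_betw g (edges G) (edges H)" by (simp add: H_def)
    fix e assume e: "e \<in> edges G"
    obtain p q where pq: "ends G e = (p, q)" by fastforce
    have V: "p \<in> verts G" "q \<in> verts G" using G.ends_in_verts[OF e] pq by auto
    show "ends H (g e) = map_prod f f (ends G e) \<or> ends H (g e) = prod.swap (map_prod f f (ends G e))"
    proof (cases "e \<in> inside G P")
      case True
      then have "p \<in> P" "q \<in> P" using pq by (auto simp: in_inside_iff)
      moreover have "ends ?K e = (p, q)" using calculation pq by (simp add: shrink_def)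
      moreover have "ends H (\<psi> e) = map_prod \<phi> \<phi> (ends ?K e)"
        using \<psi>new by (simp add: H_def) (simp add: \<psi>_def)
      ultimately show ?thesis using True pq by (simp add: g_def f_def)
    next
      case False
      then have ge: "g e = g1 e" "g1 e \<in> edges H1" and e1: "e \<in> edges ?G1"
        using e bg by (auto simp: g_def bij_betw_def edges1)
      have ends1: "ends ?G1 e = (if p \<in> P then x else p, if q \<in> P then x else q)" using pq by (simp add: shrink_def)
      note cs = iso_by_ends_cases[OF iso e1 ends1]
      have star_iff: "g1 e \<in> star H1 u \<longleftrightarrow> e \<in> cut G P"
        unfolding starH
      proof (rule inj_on_image_mem_iff[OF _ _ cutE])
        show "inj_on g1 (edges G - inside G P)" using bg by (simp add: bij_betw_def)
        show "e \<in> edges G - inside G P" using e False by blast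
      qed
      show ?thesis
      proof (cases "e \<in> cut G P")
        case True
        have \<sigma>e: "\<sigma> (g1 e) = e" using \<sigma>g e False by blast
        have endsH: "ends H (g e) = repl_end u (\<phi> (other_end ?K e v)) (ends H1 (g1 e))"
          using ge True star_iff \<sigma>e by (simp add: H_def)
        have "p \<in> P \<and> q \<notin> P \<or> p \<notin> P \<and> q \<in> P" using True pq by (auto simp: in_cut_iff)
        then show ?thesis
        proof (elim disjE conjE)
          assume pP: "p \<in> P" "q \<notin> P"
          have "p \<noteq> v" using pP v by blast
          then have oe: "other_end ?K e v = p" using pP pq V by (simp add: other_end_def shrink_def)
          have nu: "f1 q \<noteq> u" using f1u pP V by blast
          have "ends H1 (g1 e) = (u, f1 q) \<or> ends H1 (g1 e) = (f1 q, u)" using cs pP by (simp add: u_def)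
          then have "ends H (g e) = (\<phi> p, f1 q) \<or> ends H (g e) = (f1 q, \<phi> p)"
            by (elim disjE) (simp_all add: endsH oe nu repl_end_def)
          then show ?thesis using pq pP by (auto simp: f_def)
        next
          assume pP: "p \<notin> P" "q \<in> P"
          then have oe: "other_end ?K e v = q" using pq V v by (simp add: other_end_def shrink_def)
          have nu: "f1 p \<noteq> u" using f1u pP V by blast
          have "ends H1 (g1 e) = (u, f1 p) \<or> ends H1 (g1 e) = (f1 p, u)" using cs pP by (auto simp: u_def)
          then have "ends H (g e) = (\<phi> q, f1 p) \<or> ends H (g e) = (f1 p, \<phi> q)"
            by (elim disjE) (simp_all add: endsH oe nu repl_end_def)
          then show ?thesis using pq pP by (auto simp: f_def)
        qed
      next
        case nc: False
        then have "p \<notin> P" "q \<notin> P" using False e pq by (auto simp: in_cut_iff in_inside_iff)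
        moreover have "ends H (g e) = ends H1 (g1 e)" using ge star_iff nc by (simp add: H_def)
        ultimately show ?thesis using cs pq by (auto simp: f_def)
      qed
    qed
  qed
  moreover have "\<forall>y\<in>verts G - P. f y = f1 y" by (simp add: f_def)
  moreover have "\<forall>e\<in>edges G - inside G P. g e = g1 e" by (simp add: g_def)
  ultimately show ?thesis using pg by blast
qed

text \<open>Here \<open>P\<close> consists of a vertex \<open>x\<close> carrying two edges of the cut and a part \<open>Y\<close> with a 2-edge cut,
  which is inserted into the third edge \<open>eb\<close> of the cut.\<close>

locale insertion_part = bridgeless_cubic G for G :: "(nat, nat) graph" +
  fixes P :: "nat set" and x :: nat and f0 eb :: nat and c :: "nat \<Rightarrow> nat"
  assumes P: "P \<subseteq> verts G" "card (cut G P) = 3" "x \<in> P"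
    and cutY: "cut G (P - {x}) = {f0, eb}" "f0 \<noteq> eb"
    and f0: "f0 \<in> star G x" "f0 \<in> inside G P" and eb: "eb \<in> cut G P"
    and col: "proper_on G c (P - {x})"
begin

definition "Y = P - {x}"
definition "yf = other_end G f0 x"
definition "yb = (if fst (ends G eb) \<in> P then fst (ends G eb) else snd (ends G eb))"
definition "w = (if fst (ends G eb) \<in> P then snd (ends G eb) else fst (ends G eb))"
text \<open>The two edges \<open>f0\<close> and \<open>eb\<close> leaving \<open>Y\<close> are
  merged into one edge, named \<open>f0\<close>, which joins their ends in \<open>Y\<close>. This is
  the graph whose edge-deleted form is inserted.\<close>

definition "K = \<lparr>verts = Y, edges = inside G Y \<union> {f0}, ends = (ends G)(f0 := (yf, yb))\<rparr>"

lemma K_simps: "verts K = Y" "edges K = inside G Y \<union> {f0}" "ends K f0 = (yf, yb)"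
  "e \<noteq> f0 \<Longrightarrow> ends K e = ends G e"
  by (simp_all add: K_def)

lemma YV: "Y \<subseteq> verts G" "x \<notin> Y" "finite Y"
  using P finite_verts by (auto simp: Y_def intro: finite_subset)

lemma f0_ends: "f0 \<in> edges G" "endpts G f0 = {x, yf}" "yf \<in> Y"
proof -
  show e: "f0 \<in> edges G" using f0(1) by (simp add: star_def)
  show "endpts G f0 = {x, yf}" using endpts_other_end[OF f0(1)] by (simp add: yf_def)
  then show "yf \<in> Y" using endpts_other_end[OF f0(1)] f0(2) by (auto simp: Y_def yf_def inside_def)
qed

lemma eb_ends: "eb \<in> edges G" "endpts G eb = {yb, w}" "yb \<in> Y" "w \<in> verts G" "w \<notin> P" "yb \<in> P"
proof -
  show e: "eb \<in> edges G" using eb by (simp add: in_cut_iff)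
  show ends: "endpts G eb = {yb, w}" by (auto simp: endpts_def yb_def w_def)
  show w: "w \<in> verts G" "w \<notin> P" "yb \<in> P" using eb ends_in_verts[OF e] by (auto simp: in_cut_iff w_def yb_def)
  have "eb \<in> cut G Y" using cutY by (simp add: Y_def)
  moreover have "w \<notin> Y" using w by (simp add: Y_def)
  ultimately show "yb \<in> Y" using cut_endpts_iff[OF e ends, of Y] by blast
qed

lemma f0_notin: "f0 \<notin> inside G Y" and eb_notin: "eb \<notin> inside G Y" "eb \<notin> inside G P"
  using f0_ends YV eb_ends by (auto simp: inside_def Y_def)

lemma inside_P: "inside G P = inside G Y \<union> {f0}"
proof (intro set_eqI iffI)
  fix e assume e: "e \<in> inside G P"
  show "e \<in> inside G Y \<union> {f0}"
  proof (cases "e \<in> inside G Y")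
    case False
    have eE: "e \<in> edges G" "fst (ends G e) \<noteq> snd (ends G e)" using e loopless by (auto simp: in_inside_iff)
    then have "e \<in> cut G Y" using e False by (auto simp: in_inside_iff in_cut_iff Y_def)
    then have "e = f0 \<or> e = eb" using cutY by (simp add: Y_def)
    then show ?thesis using e eb_notin(2) by blast
  qed simp
next
  fix e assume "e \<in> inside G Y \<union> {f0}"
  then show "e \<in> inside G P" using f0(2) by (auto simp: in_inside_iff Y_def)
qed

lemma star_Y:
  assumes y: "y \<in> Y"
  shows "star G y - inside G Y = (if yf = y then {f0} else {}) \<union> (if yb = y then {eb} else {})"
proof -
  have s: "star G y \<subseteq> {f0, eb} \<union> inside G Y" using star_subset_cut_inside[OF y, of G] cutY by (simp add: Y_def)
  have a: "f0 \<in> star G y \<longleftrightarrow> yf = y" using f0_ends y YV by (auto simp: star_def)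
  have b: "eb \<in> star G y \<longleftrightarrow> yb = y" using eb_ends y by (auto simp: star_def Y_def)
  show ?thesis
  proof (intro set_eqI iffI)
    fix e assume "e \<in> star G y - inside G Y"
    then show "e \<in> (if yf = y then {f0} else {}) \<union> (if yb = y then {eb} else {})"
      using s a b by auto
  next
    fix e assume "e \<in> (if yf = y then {f0} else {}) \<union> (if yb = y then {eb} else {})"
    then show "e \<in> star G y - inside G Y" using a b f0_notin eb_notin by (auto split: if_splits)
  qed
qed

lemma cut_W:
  assumes W: "W \<subseteq> Y"
  shows "cut G W - inside G Y = (if yf \<in> W then {f0} else {}) \<union> (if yb \<in> W then {eb} else {})"
proof -
  have a: "f0 \<in> cut G W \<longleftrightarrow> yf \<in> W" using cut_endpts_iff[OF f0_ends(1,2), of W] YV W by blast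
  have "w \<notin> W" using W eb_ends by (auto simp: Y_def)
  then have b: "eb \<in> cut G W \<longleftrightarrow> yb \<in> W" using cut_endpts_iff[OF eb_ends(1,2), of W] by blast
  have s: "cut G W \<subseteq> {f0, eb} \<union> inside G Y"
  proof
    fix e assume "e \<in> cut G W"
    then obtain v where "v \<in> Y" "e \<in> star G v" using W by (metis cut_starE subsetD)
    then show "e \<in> {f0, eb} \<union> inside G Y" using star_subset_cut_inside[of v Y G] cutY by (auto simp: Y_def)
  qed
  show ?thesis
  proof (intro set_eqI iffI)
    fix e assume "e \<in> cut G W - inside G Y"
    then show "e \<in> (if yf \<in> W then {f0} else {}) \<union> (if yb \<in> W then {eb} else {})" using s a b by auto
  next
    fix e assume "e \<in> (if yf \<in> W then {f0} else {}) \<union> (if yb \<in> W then {eb} else {})"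
    then show "e \<in> cut G W - inside G Y" using a b f0_notin eb_notin by (auto split: if_splits)
  qed
qed

lemma cut_K_W:
  "cut K W \<inter> inside G Y = cut G W \<inter> inside G Y" "cut K W - inside G Y = (if (yf \<in> W) \<noteq> (yb \<in> W) then {f0} else {})"
proof -
  have "e \<in> cut K W \<longleftrightarrow> e \<in> cut G W" if "e \<in> inside G Y" for e
    using that f0_notin inside_subset[of G Y] by (cases "e = f0") (auto simp: in_cut_iff K_simps)
  then show "cut K W \<inter> inside G Y = cut G W \<inter> inside G Y" by blast
  have "e \<in> cut K W - inside G Y \<longleftrightarrow> e = f0 \<and> (yf \<in> W) \<noteq> (yb \<in> W)" for e
    using f0_notin by (cases "e = f0") (simp_all add: in_cut_iff K_simps)
  then show "cut K W - inside G Y = (if (yf \<in> W) \<noteq> (yb \<in> W) then {f0} else {})" by auto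
qed

lemma card_split: "finite A \<Longrightarrow> card A = card (A \<inter> B) + card (A - B)"
  by (rule card_Int_Diff)

lemma bridgeless_cubic_K: "bridgeless_cubic K"
proof
  have ends: "fst (ends K e) \<in> Y \<and> snd (ends K e) \<in> Y" if "e \<in> edges K" for e
    using that f0_ends eb_ends by (cases "e = f0") (auto simp: K_simps in_inside_iff)
  have finE: "finite (inside G Y)" by (rule finite_inside)
  have wf: "wf_graph K" unfolding wf_graph_def using ends YV finE by (simp add: K_simps)
  have "degree K y = 3" if y: "y \<in> Y" for y
  proof -
    let ?A = "{e\<in>inside G Y. fst (ends G e) = y}" and ?B = "{e\<in>inside G Y. snd (ends G e) = y}"
    have dA: "{e\<in>edges K. fst (ends K e) = y} = ?A \<union> (if yf = y then {f0} else {})"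
      "{e\<in>edges K. snd (ends K e) = y} = ?B \<union> (if yb = y then {f0} else {})"
      using f0_notin by (auto simp: K_simps split: if_splits) (auto simp: K_def split: if_splits)
    have fin: "finite ?A" "finite ?B" using finE by simp_all
    have notin: "f0 \<notin> ?A" "f0 \<notin> ?B" using f0_notin by simp_all
    have "degree K y = card ?A + (if yf = y then 1 else 0) + (card ?B + (if yb = y then 1 else 0))"
      unfolding degree_def dA using fin notin by simp
    moreover have "inside G Y \<inter> star G y = ?A \<union> ?B" using inside_subset[of G Y] by (auto simp: in_star_iff in_inside_iff)
    moreover have "?A \<inter> ?B = {}" using loopless inside_subset[of G Y] by fastforce
    then have "card (?A \<union> ?B) = card ?A + card ?B" using fin by (rule card_Un_disjoint[rotated 2])
    ultimately have d: "degree K y = card (inside G Y \<inter> star G y) + (if yf = y then 1 else 0) + (if yb = y then 1 else 0)"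
      by simp
    have "card (star G y - inside G Y) = (if yf = y then 1 else 0) + (if yb = y then 1 else 0)"
      unfolding star_Y[OF y] using cutY(2) by simp
    moreover have "card (star G y) = card (star G y \<inter> inside G Y) + card (star G y - inside G Y)"
      by (rule card_split[OF finite_star])
    moreover have "card (star G y) = 3" using card_star y YV by blast
    ultimately show ?thesis using d by (simp add: Int_commute)
  qed
  then show "cubic K" using wf by (simp add: cubic_def K_simps)
  show "verts K \<noteq> {}" using f0_ends by (auto simp: K_simps)
  fix W assume W: "W \<subseteq> verts K" "W \<noteq> {}" "W \<noteq> verts K"
  then have WY: "W \<subseteq> Y" "W \<noteq> Y" by (simp_all add: K_simps)
  have ge: "2 \<le> card (cut G W')" if "W' \<subseteq> Y" "W' \<noteq> {}" for W'
  proof (rule cut_ge2)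
    show "W' \<subseteq> verts G" using that YV by blast
    show "W' \<noteq> verts G" using that YV P(1,3) by blast
  qed (rule that(2))
  have cK: "card (cut K W') = card (cut G W' \<inter> inside G Y) + (if (yf \<in> W') \<noteq> (yb \<in> W') then 1 else 0)" for W'
  proof -
    have "finite (cut K W')" using finE cut_subset[of K W'] by (simp add: K_simps finite_subset)
    then have "card (cut K W') = card (cut K W' \<inter> inside G Y) + card (cut K W' - inside G Y)" by (rule card_split)
    then show ?thesis unfolding cut_K_W by simp
  qed
  have cG: "card (cut G W') = card (cut G W' \<inter> inside G Y) + (if yf \<in> W' then 1 else 0) + (if yb \<in> W' then 1 else 0)"
    if "W' \<subseteq> Y" for W'
  proof -
    have "card (cut G W') = card (cut G W' \<inter> inside G Y) + card (cut G W' - inside G Y)" by (rule card_split[OF finite_cut])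
    then show ?thesis unfolding cut_W[OF that] using cutY(2) by simp
  qed
  consider "yf \<notin> W" "yb \<notin> W" | "yf \<in> W" "yb \<in> W" | "yf \<in> W" "yb \<notin> W" | "yf \<notin> W" "yb \<in> W" by blast
  then show "2 \<le> card (cut K W)"
  proof cases
    case 1
    then have "card (cut K W) = card (cut G W)" using cK[of W] cG[OF WY(1)] by simp
    then show ?thesis using ge[OF WY(1) W(2)] by simp
  next
    case 2
    \<comment> \<open>If both ends of the merged edge lie in \<open>W\<close>, the cut of
      \<open>W\<close> in \<open>G\<close> has two edges that \<open>K\<close> does not see. The
      complement within \<open>Y\<close> has the same cut in \<open>K\<close> and contains neither
      end.\<close>
    have Z: "Y - W \<subseteq> Y" "Y - W \<noteq> {}" using WY by auto
    have "card (cut K (Y - W)) = card (cut G (Y - W))" using cK[of "Y - W"] cG[OF Z(1)] 2 by simp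
    moreover have "cut K (Y - W) = cut K W" using ends by (auto simp: in_cut_iff)
    ultimately show ?thesis using ge[OF Z] by simp
  next
    case 3
    then have "card (cut K W) = card (cut G W)" using cK[of W] cG[OF WY(1)] by simp
    then show ?thesis using ge[OF WY(1) W(2)] by simp
  next
    case 4
    then have "card (cut K W) = card (cut G W)" using cK[of W] cG[OF WY(1)] by simp
    then show ?thesis using ge[OF WY(1) W(2)] by simp
  qed
qed

text \<open>By parity the two edges of the cut have the same colour, which the merged edge takes
  over.\<close>

lemma K_colourable: "three_edge_colourable K"
proof -
  interpret K: bridgeless_cubic K by (rule bridgeless_cubic_K)
  have cY: "proper_on G c Y" using col by (simp add: Y_def)
  have cc: "c f0 = c eb" by (rule cut2_eq[OF cY YV(1)]) (use cutY in \<open>simp add: Y_def\<close>)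
  have "proper_on K c (verts K)"
  proof (rule K.proper_onI)
    fix y assume "y \<in> verts K"
    then have y: "y \<in> Y" by (simp add: K_simps)
    have sK: "star K y = (inside G Y \<inter> star G y) \<union> (if yf = y \<or> yb = y then {f0} else {})"
    proof (rule set_eqI)
      fix e
      show "e \<in> star K y \<longleftrightarrow> e \<in> (inside G Y \<inter> star G y) \<union> (if yf = y \<or> yb = y then {f0} else {})"
        using f0_notin inside_subset[of G Y] by (cases "e = f0") (auto simp: in_star_iff K_simps)
    qed
    have "star G y = (inside G Y \<inter> star G y) \<union> (star G y - inside G Y)" by blast
    then have "c ` star G y = c ` (inside G Y \<inter> star G y) \<union> c ` (star G y - inside G Y)" by (metis image_Un)
    also have "\<dots> = c ` (inside G Y \<inter> star G y) \<union> c ` (if yf = y \<or> yb = y then {f0} else {})"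
      unfolding star_Y[OF y] using cc by simp
    finally have "c ` star K y = c ` star G y" unfolding sK by (simp only: image_Un)
    then show "c ` star K y = {..<3}" using cY y by (simp add: proper_on_def bij_betw_def)
  qed simp
  then show ?thesis by (rule proper_three_edge_colourable[OF K.loopless_graph_axioms])
qed

theorem insertion_step:
  assumes iso: "iso_by f1 g1 (shrink G P x) H1" and H1: "pg_constr H1" and b: "g1 eb \<in> edges Pg - C_edges"
  shows "\<exists>H f g. pg_constr H \<and> iso_by f g G H \<and> (\<forall>y\<in>verts G - Y. f y = f1 y) \<and>
    (\<forall>e\<in>edges G - inside G P - {eb}. g e = g1 e)"
proof -
  let ?G1 = "shrink G P x"
  have P': "P \<subseteq> verts G" "card (cut G P) = 3" "x \<in> P \<or> x \<notin> verts G" using P by auto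
  have b1: "bridgeless_cubic ?G1" by (rule bridgeless_cubic_shrink[OF P'])
  interpret G1: bridgeless_cubic ?G1 by (rule b1)
  interpret H1: bridgeless_cubic H1 by (rule bridgeless_cubic_iso[OF b1 iso])
  interpret K: bridgeless_cubic K by (rule bridgeless_cubic_K)
  define u where "u = f1 x"
  define eH where "eH = g1 eb"
  have edges1: "edges ?G1 = edges G - inside G P" by (simp add: shrink_def)
  have verts1: "verts ?G1 = verts G - Y" using P by (auto simp: shrink_def Y_def)
  have bf: "bij_betw f1 (verts G - Y) (verts H1)" and bg: "bij_betw g1 (edges G - inside G P) (edges H1)"
    using iso by (auto simp: iso_by_def verts1 edges1)
  have eb1: "eb \<in> edges G - inside G P" using eb_ends eb_notin by blast
  have eHH: "eH \<in> edges H1" using bg eb1 by (auto simp: eH_def bij_betw_def)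
  have "ends ?G1 eb = (x, w) \<or> ends ?G1 eb = (w, x)"
    using eb_ends eb by (auto simp: shrink_def w_def in_cut_iff prod_eq_iff)
  then have ends_eH: "ends H1 eH = (u, f1 w) \<or> ends H1 eH = (f1 w, u)"
    using iso_by_ends_cases[OF iso, of eb] eb1 edges1 unfolding eH_def u_def by blast
  obtain n where n: "n \<ge> 15" "\<And>a. a \<in> verts H1 \<Longrightarrow> a < n" using finite_nat_fresh[OF H1.finite_verts] by blast
  obtain m where m: "m \<ge> 15" "\<And>a. a \<in> edges H1 \<Longrightarrow> a < m" using finite_nat_fresh[OF H1.finite_edges] by blast
  define \<phi> where "\<phi> y = n + y" for y
  define \<psi> where "\<psi> e = m + e" for e
  have \<phi>new: "\<phi> y \<notin> verts H1" for y using n(2)[of "\<phi> y"] by (auto simp: \<phi>_def)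
  have \<psi>new: "\<psi> e \<notin> edges H1" for e using m(2)[of "\<psi> e"] by (auto simp: \<psi>_def)
  have inj: "inj_on \<phi> A" "inj_on \<psi> A" for A by (auto simp: \<phi>_def \<psi>_def inj_on_def)
  have \<psi>eq: "\<psi> e = \<psi> e' \<longleftrightarrow> e = e'" for e e' by (simp add: \<psi>_def)
  define H where "H = \<lparr>verts = verts H1 \<union> \<phi> ` Y, edges = (edges H1 - {eH}) \<union> \<psi> ` inside G Y \<union> {\<psi> f0, \<psi> eb},
    ends = (\<lambda>e. if e \<in> edges H1 then ends H1 e else if e = \<psi> f0 then (u, \<phi> yf) else if e = \<psi> eb then (f1 w, \<phi> yb)
      else map_prod \<phi> \<phi> (ends G (e - m)))\<rparr>"
  have endsH: "e \<in> edges H1 \<Longrightarrow> ends H e = ends H1 e" "ends H (\<psi> f0) = (u, \<phi> yf)" "ends H (\<psi> eb) = (f1 w, \<phi> yb)"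
    "e \<noteq> f0 \<Longrightarrow> e \<noteq> eb \<Longrightarrow> ends H (\<psi> e) = map_prod \<phi> \<phi> (ends G e)" for e
    using \<psi>new cutY(2) by (simp_all add: H_def \<psi>eq) (simp add: \<psi>_def)
  have EK: "edges K - {f0} = inside G Y" using f0_notin by (auto simp: K_simps)
  have ins: "insertion H1 eH K f0 H"
    unfolding insertion_def
  proof (intro conjI)
    show "eH \<in> edges H1" by (rule eHH)
    show "f0 \<in> edges K" by (simp add: K_simps)
    \<comment> \<open>\<open>insertion\<close> attaches \<open>a\<close> to the first end of the
      distinguished edge, so the roles of \<open>\<psi> f0\<close> and \<open>\<psi> eb\<close>
      depend on how \<open>eH\<close> is oriented in \<open>H1\<close>.\<close>
    define a where "a = (if fst (ends H1 eH) = u then \<psi> f0 else \<psi> eb)"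
    define b where "b = (if fst (ends H1 eH) = u then \<psi> eb else \<psi> f0)"
    have ab: "{a, b} = {\<psi> f0, \<psi> eb}" by (auto simp: a_def b_def)
    show "\<exists>\<phi> \<psi> a b. inj_on \<phi> (verts K) \<and> \<phi> ` verts K \<inter> verts H1 = {} \<and>
       inj_on \<psi> (edges K - {f0}) \<and> \<psi> ` (edges K - {f0}) \<inter> edges H1 = {} \<and>
       a \<noteq> b \<and> a \<notin> edges H1 \<union> \<psi> ` (edges K - {f0}) \<and> b \<notin> edges H1 \<union> \<psi> ` (edges K - {f0}) \<and>
       verts H = verts H1 \<union> \<phi> ` verts K \<and>
       edges H = (edges H1 - {eH}) \<union> \<psi> ` (edges K - {f0}) \<union> {a, b} \<and>
       (\<forall>x\<in>edges H1 - {eH}. ends H x = ends H1 x) \<and>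
       (\<forall>x\<in>edges K - {f0}. ends H (\<psi> x) = map_prod \<phi> \<phi> (ends K x)) \<and>
       ((ends H a = (fst (ends H1 eH), \<phi> (fst (ends K f0))) \<and>
         ends H b = (snd (ends H1 eH), \<phi> (snd (ends K f0)))) \<or>
        (ends H a = (fst (ends H1 eH), \<phi> (snd (ends K f0))) \<and>
         ends H b = (snd (ends H1 eH), \<phi> (fst (ends K f0)))))"
    proof (rule exI[of _ \<phi>], rule exI[of _ \<psi>], rule exI[of _ a], rule exI[of _ b], intro conjI)
      show "inj_on \<phi> (verts K)" "inj_on \<psi> (edges K - {f0})" by (rule inj)+
      show "\<phi> ` verts K \<inter> verts H1 = {}" "\<psi> ` (edges K - {f0}) \<inter> edges H1 = {}" using \<phi>new \<psi>new by blast+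
      show "a \<noteq> b" using cutY(2) by (simp add: a_def b_def \<psi>eq)
      have "\<psi> f0 \<notin> edges H1 \<union> \<psi> ` (edges K - {f0})" "\<psi> eb \<notin> edges H1 \<union> \<psi> ` (edges K - {f0})"
        unfolding EK using \<psi>new f0_notin eb_notin \<psi>eq by auto
      then show "a \<notin> edges H1 \<union> \<psi> ` (edges K - {f0})" "b \<notin> edges H1 \<union> \<psi> ` (edges K - {f0})"
        by (simp_all add: a_def b_def)
      show "verts H = verts H1 \<union> \<phi> ` verts K" by (simp add: H_def K_simps)
      show "edges H = (edges H1 - {eH}) \<union> \<psi> ` (edges K - {f0}) \<union> {a, b}" unfolding EK ab by (simp add: H_def)
      show "\<forall>x\<in>edges H1 - {eH}. ends H x = ends H1 x" using endsH(1) by simp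
      show "\<forall>x\<in>edges K - {f0}. ends H (\<psi> x) = map_prod \<phi> \<phi> (ends K x)"
      proof
        fix e assume e: "e \<in> edges K - {f0}"
        then have "e \<noteq> f0" "e \<noteq> eb" using EK eb_notin by auto
        then show "ends H (\<psi> e) = map_prod \<phi> \<phi> (ends K e)" using endsH(4) by (simp add: K_simps)
      qed
      show "(ends H a = (fst (ends H1 eH), \<phi> (fst (ends K f0))) \<and>
         ends H b = (snd (ends H1 eH), \<phi> (snd (ends K f0)))) \<or>
        (ends H a = (fst (ends H1 eH), \<phi> (snd (ends K f0))) \<and>
         ends H b = (snd (ends H1 eH), \<phi> (fst (ends K f0))))"
      proof (cases "fst (ends H1 eH) = u")
        case True
        then have "ends H1 eH = (u, f1 w)" using ends_eH H1.loopless[OF eHH] by (cases "ends H1 eH") auto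
        then show ?thesis using True endsH(2,3) by (simp add: a_def b_def K_simps)
      next
        case False
        then have "ends H1 eH = (f1 w, u)" using ends_eH by (cases "ends H1 eH") auto
        then show ?thesis using False endsH(2,3) by (simp add: a_def b_def K_simps)
      qed
    qed
  qed
  have pg: "pg_constr H"
  proof (rule pg_constr.O1[OF H1 H1.cubic H1.two_connected _ K.cubic K.two_connected _ K_colourable ins])
    show "eH \<in> edges Pg - C_edges" using b by (simp add: eH_def)
    show "connected K" using K.two_connected by (simp add: two_connected_def)
    show "(verts H - verts H1) \<inter> verts Pg = {}" using n(1) by (auto simp: H_def \<phi>_def)
    show "(edges H - edges H1) \<inter> edges Pg = {}" using m(1) by (auto simp: H_def \<psi>_def)
  qed
  let ?N = "inside G Y \<union> {f0, eb}"
  define f where "f y = (if y \<in> Y then \<phi> y else f1 y)" for y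
  define g where "g e = (if e \<in> ?N then \<psi> e else g1 e)" for e
  have "iso_by f g G H"
    unfolding iso_by_def
  proof (intro conjI ballI)
    have "bij_betw \<phi> Y (\<phi> ` Y)" using inj by (simp add: bij_betw_def)
    then have "bij_betw f ((verts G - Y) \<union> Y) (verts H1 \<union> \<phi> ` Y)"
      unfolding f_def using bf \<phi>new by (intro bij_betw_if) blast+
    moreover have "(verts G - Y) \<union> Y = verts G" using YV by blast
    ultimately show "bij_betw f (verts G) (verts H)" by (simp add: H_def)
    have "bij_betw \<psi> ?N (\<psi> ` ?N)" by (rule inj_on_imp_bij_betw[OF inj(2)])
    moreover have "bij_betw g1 (edges G - inside G P - {eb}) (edges H1 - {eH})"
      unfolding eH_def by (rule bij_betw_remove[OF bg eb1])
    ultimately have "bij_betw g ((edges G - inside G P - {eb}) \<union> ?N) ((edges H1 - {eH}) \<union> \<psi> ` ?N)"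
      unfolding g_def using \<psi>new inside_P by (intro bij_betw_if) auto
    moreover have "(edges G - inside G P - {eb}) \<union> ?N = edges G"
      using inside_P inside_subset[of G P] eb_ends(1) by auto
    moreover have "(edges H1 - {eH}) \<union> \<psi> ` ?N = edges H"
      by (simp only: H_def graph.simps image_Un image_insert image_empty Un_assoc)
    ultimately show "bij_betw g (edges G) (edges H)" by simp
    fix e assume e: "e \<in> edges G"
    obtain p q where pq: "ends G e = (p, q)" by fastforce
    have epq: "endpts G e = {p, q}" using pq by (simp add: endpts_def)
    consider "e = f0" | "e = eb" | "e \<noteq> f0" "e \<noteq> eb" "e \<in> inside G Y" | "e \<noteq> f0" "e \<noteq> eb" "e \<notin> inside G Y" by blast
    then show "ends H (g e) = map_prod f f (ends G e) \<or> ends H (g e) = prod.swap (map_prod f f (ends G e))"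
    proof cases
      case 1
      then have "{p, q} = {x, yf}" using epq f0_ends(2) by simp
      then have "(p = x \<and> q = yf) \<or> (p = yf \<and> q = x)" unfolding doubleton_eq_iff .
      moreover have "f x = u" "f yf = \<phi> yf" using YV f0_ends by (simp_all add: f_def u_def)
      ultimately show ?thesis using 1 pq endsH(2) by (auto simp: g_def)
    next
      case 2
      then have "{p, q} = {yb, w}" using epq eb_ends(2) by simp
      then have "(p = yb \<and> q = w) \<or> (p = w \<and> q = yb)" unfolding doubleton_eq_iff .
      moreover have "f w = f1 w" "f yb = \<phi> yb" using eb_ends by (simp_all add: f_def Y_def)
      ultimately show ?thesis using 2 pq endsH(3) by (auto simp: g_def)
    next
      case 3
      then have "p \<in> Y" "q \<in> Y" using pq by (auto simp: in_inside_iff)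
      then show ?thesis using 3 pq endsH(4)[of e] by (simp add: g_def f_def)
    next
      case 4
      have ge: "g e = g1 e" using 4 by (simp add: g_def)
      have eP: "e \<in> edges G - inside G P" using e 4 inside_P by blast
      then have e1: "e \<in> edges ?G1" "g1 e \<in> edges H1" using bg by (auto simp: edges1 bij_betw_def)
      have "e \<notin> cut G Y" using 4 cutY by (simp add: Y_def)
      then have nY: "p \<notin> Y" "q \<notin> Y" using 4(3) e pq by (auto simp: in_cut_iff in_inside_iff)
      then have "ends ?G1 e = (p, q)" using pq by (auto simp: shrink_def Y_def)
      note cs = iso_by_ends_cases[OF iso e1(1) this]
      moreover have "f p = f1 p" "f q = f1 q" using nY by (simp_all add: f_def)
      ultimately show ?thesis using ge endsH(1)[OF e1(2)] pq by auto
    qed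
  qed
  moreover have "\<forall>y\<in>verts G - Y. f y = f1 y" by (simp add: f_def)
  moreover have "\<forall>e\<in>edges G - inside G P - {eb}. g e = g1 e" using inside_P by (simp add: g_def)
  ultimately show ?thesis using pg by blast
qed

end

text \<open>The consequence of \<open>\<pi> = 5\<close> that the induction carries. Being a
  condition on one part at a time, it passes to graphs in which parts have been contracted, without
  returning to perfect matchings of the whole graph.\<close>

definition no_full_cut_matching :: "('v,'e) graph \<Rightarrow> (nat \<Rightarrow> 'v set) \<Rightarrow> bool" where
  "no_full_cut_matching G part \<longleftrightarrow>
    (\<forall>i\<in>{3, 5, 6, 8}. \<nexists>F. F \<subseteq> edges G \<and> covers_once G F (part i) \<and> cut G (part i) \<subseteq> F)"

text \<open>The claw \<open>Pg - C\<close> has centre 8 and leaves 3, 5, 6; a 2-edge cut found in the part of the centre is inserted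
  into an edge of the claw, one found in the part of a leaf into an edge between this leaf and \<open>C\<close>.\<close>

definition owner :: "nat \<Rightarrow> nat" where
  "owner e = (if e \<in> {8, 11, 13} then 8 else if e \<in> {2, 3} then 3 else if e \<in> {5, 10} then 5 else 6)"

context bridgeless_cubic
begin

lemma other_end_shrink_compl:
  assumes "P \<subseteq> verts G" "v \<in> verts G" "v \<notin> P" "e \<in> cut G P" "p \<in> P" "e \<in> star G p"
  shows "other_end (shrink G (verts G - P) v) e v = p"
  using assms ends_in_verts[of e] by (auto simp: other_end_def shrink_def in_cut_iff in_star_iff)

text \<open>By \<open>one\<close>, the cut edges end at three distinct vertices of \<open>P\<close>,
  the neighbours of \<open>v\<close> in the contracted graph. A perfect matching of what remains
  after deleting \<open>v\<close> and these, joined with the whole cut, would cover \<open>P\<close>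
  once; so \<open>correct_forI\<close> applies.\<close>

lemma shrink_compl_correct:
  assumes P: "P \<subseteq> verts G" "card (cut G P) = 3" and v: "v \<in> verts G" "v \<notin> P"
    and one: "\<And>p e e'. \<lbrakk>p \<in> P; e \<in> cut G P; e' \<in> cut G P; e \<in> star G p; e' \<in> star G p\<rbrakk> \<Longrightarrow> e = e'"
    and no: "\<nexists>F. F \<subseteq> edges G \<and> covers_once G F P \<and> cut G P \<subseteq> F"
  shows "correct_for (shrink G (verts G - P) v) v" "quasi_bipartite (shrink G (verts G - P) v)"
proof -
  let ?K = "shrink G (verts G - P) v"
  have C: "verts G - P \<subseteq> verts G" "card (cut G (verts G - P)) = 3" "v \<in> verts G - P \<or> v \<notin> verts G"
    using P v by (auto simp: cut_compl)
  interpret K: bridgeless_cubic ?K by (rule bridgeless_cubic_shrink[OF C])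
  have vertsK: "verts ?K = insert v P" using P(1) by (auto simp: shrink_def)
  have edgesK: "edges ?K \<subseteq> edges G" by (auto simp: shrink_def)
  have starv: "star ?K v = cut G P" using shrink_star_x[OF C] by (simp add: cut_compl)
  have starp: "star ?K p = star G p" if "p \<in> P" for p
    by (rule shrink_star_other[OF C]) (use that v P in auto)
  define N where "N = (\<lambda>e. other_end ?K e v) ` star ?K v"
  note oe = other_end_shrink_compl[OF P(1) v]
  have pe: "\<exists>p\<in>P. e \<in> star G p" if "e \<in> cut G P" for e using cut_starE[OF that] by blast
  have "inj_on (\<lambda>e. other_end ?K e v) (cut G P)"
  proof (rule inj_onI)
    fix e e' assume e: "e \<in> cut G P" "e' \<in> cut G P" "other_end ?K e v = other_end ?K e' v"
    obtain p where p: "p \<in> P" "e \<in> star G p" using pe[OF e(1)] by blast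
    obtain p' where p': "p' \<in> P" "e' \<in> star G p'" using pe[OF e(2)] by blast
    have "p = p'" using oe[OF e(1) p] oe[OF e(2) p'] e(3) by simp
    then show "e = e'" using one p p' e by blast
  qed
  then have cN: "card N = 3" unfolding N_def starv using P(2) by (simp add: card_image)
  have "\<nexists>F. F \<subseteq> inside ?K (verts ?K - insert v N) \<and> covers_once ?K F (verts ?K - insert v N)"
  proof
    assume "\<exists>F. F \<subseteq> inside ?K (verts ?K - insert v N) \<and> covers_once ?K F (verts ?K - insert v N)"
    then obtain F where F: "F \<subseteq> inside ?K (verts ?K - insert v N)" "covers_once ?K F (verts ?K - insert v N)"
      by blast
    have "covers_once G (F \<union> cut G P) P"
      unfolding covers_once_def
    proof
      fix p assume p: "p \<in> P"
      show "card ((F \<union> cut G P) \<inter> star G p) = 1"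
      proof (cases "p \<in> N")
        case True
        then obtain e where e: "e \<in> cut G P" "p = other_end ?K e v" unfolding N_def starv by blast
        obtain q where q: "q \<in> P" "e \<in> star G q" using pe[OF e(1)] by blast
        have "e \<in> star G p" using oe[OF e(1) q] e(2) q by simp
        moreover have "f = e" if "f \<in> (F \<union> cut G P) \<inter> star G p" for f
        proof (cases "f \<in> F")
          case True
          then have "f \<in> inside ?K (verts ?K - insert v N)" using F(1) by blast
          moreover have "f \<in> star ?K p" using that starp[OF p] by blast
          ultimately show ?thesis using \<open>p \<in> N\<close> by (auto simp: in_inside_iff in_star_iff)
        next
          case False
          then show ?thesis using that one[OF p _ e(1) _ \<open>e \<in> star G p\<close>] by blast
        qed
        ultimately have "(F \<union> cut G P) \<inter> star G p = {e}" using e(1) by blast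
        then show ?thesis by simp
      next
        case False
        have "cut G P \<inter> star G p = {}"
        proof (rule ccontr)
          assume "cut G P \<inter> star G p \<noteq> {}"
          then obtain e where e: "e \<in> cut G P" "e \<in> star G p" by blast
          then have "other_end ?K e v = p" using oe p by blast
          then show False using False e(1) starv unfolding N_def by blast
        qed
        then have "(F \<union> cut G P) \<inter> star G p = F \<inter> star ?K p" using starp[OF p] by blast
        moreover have "p \<in> verts ?K - insert v N" using p False v vertsK by blast
        ultimately show ?thesis using F(2) by (simp add: covers_once_def)
      qed
    qed
    moreover have "F \<union> cut G P \<subseteq> edges G"
      using F(1) inside_subset[of ?K] edgesK cut_subset[of G P] by blast
    ultimately show False using no by blast
  qed
  then show "correct_for ?K v" "quasi_bipartite ?K"
    using K.correct_forI[of v] cN vertsK unfolding N_def by simp_all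
qed

lemma shrink_compl_colourable:
  assumes P: "P \<subseteq> verts G" "card (cut G P) = 3" and v: "v \<in> verts G" "v \<notin> P" and c: "proper_on G c P"
  shows "three_edge_colourable (shrink G (verts G - P) v)"
proof -
  let ?K = "shrink G (verts G - P) v"
  have C: "verts G - P \<subseteq> verts G" "card (cut G (verts G - P)) = 3" "v \<in> verts G - P \<or> v \<notin> verts G"
    using P v by (auto simp: cut_compl)
  interpret K: bridgeless_cubic ?K by (rule bridgeless_cubic_shrink[OF C])
  have vertsK: "verts ?K = insert v P" using P(1) by (auto simp: shrink_def)
  have "proper_on ?K c P" by (rule shrink_proper[OF C c P(1)]) (use v in auto)
  moreover have "bij_betw c (star ?K v) {..<3}"
    using cut3_bij[OF c P] shrink_star_x[OF C] by (simp add: cut_compl)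
  ultimately have "proper_on ?K c (verts ?K)" unfolding vertsK by (simp add: proper_on_def)
  then show ?thesis by (rule proper_three_edge_colourable[OF K.loopless_graph_axioms])
qed

text \<open>Without \<open>x\<close>, the edges \<open>a\<close> and \<open>a'\<close> disappear
  from the cut and only \<open>b\<close> and the third edge at \<open>x\<close> can remain; both
  must remain, since every cut has at least two edges.\<close>

lemma two_cut_of_double_attachment:
  assumes P: "P \<subseteq> verts G" "cut G P = {a, a', b}" "b \<noteq> a" "b \<noteq> a'" "a \<noteq> a'"
    and x: "x \<in> P" "P \<noteq> {x}" "a \<in> star G x" "a' \<in> star G x"
  shows "\<exists>f0. f0 \<noteq> b \<and> f0 \<in> star G x \<and> f0 \<in> inside G P \<and> cut G (P - {x}) = {f0, b}"
proof -
  have xV: "x \<in> verts G" using x P by blast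
  have "card (star G x - {a, a'}) = 1" using card_star[OF xV] x P(5) finite_star by simp
  then obtain f0 where f0: "star G x - {a, a'} = {f0}" by (auto simp: card_1_singleton_iff)
  have "e \<in> cut G (P - {x}) \<longleftrightarrow> e \<in> star G x \<and> e \<in> inside G P \<or> e \<in> cut G P \<and> e \<notin> star G x" for e
    using x(1) loopless[of e] by (auto simp: in_cut_iff in_star_iff in_inside_iff)
  then have c: "cut G (P - {x}) = (star G x \<inter> inside G P) \<union> (cut G P - star G x)" by blast
  have s: "star G x = {a, a', f0}" using f0 x by blast
  have "cut G P \<inter> inside G P = {}" by (rule cut_inside_disjoint)
  then have ni: "a \<notin> inside G P" "a' \<notin> inside G P" "b \<notin> inside G P" using P(2) by blast+
  have "P - {x} \<noteq> {}" "P - {x} \<subseteq> verts G" "P - {x} \<noteq> verts G" using x P(1) xV by blast+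
  then have ge: "2 \<le> card (cut G (P - {x}))" by (intro cut_ge2)
  have nb: "f0 \<noteq> b"
  proof
    assume "f0 = b"
    then have "cut G (P - {x}) = {}" unfolding c s P(2) using ni by auto
    then show False using ge by simp
  qed
  moreover have "f0 \<in> inside G P"
  proof (rule ccontr)
    assume "f0 \<notin> inside G P"
    then have "cut G (P - {x}) \<subseteq> {b}" unfolding c s P(2) using ni by auto
    then have "card (cut G (P - {x})) \<le> 1" using card_mono[of "{b}"] by fastforce
    then show False using ge by simp
  qed
  moreover have "cut G (P - {x}) = {f0, b}"
    unfolding c s P(2) using ni calculation P(3,4) by auto
  ultimately show ?thesis using s by blast
qed

end

lemma not_C_verts: "i < 10 \<Longrightarrow> i \<notin> C_verts \<longleftrightarrow> i \<in> {3, 5, 6, 8}"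
  by (drule less_10_cases, elim disjE) (simp_all add: C_verts_def)

context petersen_parts
begin

lemma iso_Pg:
  assumes s: "\<And>i. i < 10 \<Longrightarrow> is_singleton (part i)"
  shows "\<exists>f g. iso_by f g G Pg \<and> (\<forall>i<10. \<forall>x. part i = {x} \<longrightarrow> f x = i) \<and> (\<forall>e<15. g (\<eta> e) = e)"
proof -
  define f where "f v = (THE i. i < 10 \<and> v \<in> part i)" for v
  define g where "g = inv_into {0..<15} \<eta>"
  have f: "f v = i" if "i < 10" "v \<in> part i" for i v
    unfolding f_def by (rule the_equality) (use that part_disjoint in blast)+
  have g\<eta>: "g (\<eta> a) = a" if "a < 15" for a using inj_\<eta> that by (simp add: g_def)
  have E: "e \<in> edges G \<longleftrightarrow> (\<exists>a<15. e = \<eta> a)" for e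
  proof
    assume e: "e \<in> edges G"
    then show "\<exists>a<15. e = \<eta> a"
    proof (cases rule: edge_cases)
      case (2 i)
      then obtain x where "part i = {x}" using s by (metis is_singletonE)
      then show ?thesis using 2(3) loopless[OF e] by (simp add: in_inside_iff)
    qed blast
  next
    assume "\<exists>a<15. e = \<eta> a"
    then obtain a i where "a < 15" "e = \<eta> a" "i < 10" "a \<in> Pg_stars ! i" using Pg_stars_cover by blast
    then show "e \<in> edges G" using cut_part[of i] cut_subset[of G "part i"] by blast
  qed
  have "iso_by f g G Pg"
    unfolding iso_by_def verts_Pg edges_Pg
  proof (intro conjI ballI)
    show "bij_betw f (verts G) {0..<10}"
    proof (rule bij_betw_imageI)
      show "inj_on f (verts G)"
      proof (rule inj_onI)
        fix v w assume vw: "v \<in> verts G" "w \<in> verts G" "f v = f w"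
        obtain i where i: "i < 10" "v \<in> part i" by (rule part_ex[OF vw(1)])
        obtain j where j: "j < 10" "w \<in> part j" by (rule part_ex[OF vw(2)])
        have "i = j" using f[OF i] f[OF j] vw(3) by simp
        moreover obtain x where "part i = {x}" using s[OF i(1)] by (rule is_singletonE)
        ultimately show "v = w" using i j by simp
      qed
      show "f ` verts G = {0..<10}"
      proof (intro set_eqI iffI)
        fix i assume "i \<in> f ` verts G"
        then obtain v where v: "v \<in> verts G" "i = f v" by blast
        obtain j where "j < 10" "v \<in> part j" by (rule part_ex[OF v(1)])
        then show "i \<in> {0..<10}" using f v(2) by simp
      next
        fix i :: nat assume "i \<in> {0..<10}"
        then have i: "i < 10" by simp
        then obtain v where v: "v \<in> part i" using part_nonempty by blast
        then show "i \<in> f ` verts G" using f[OF i v] part_sub[OF i] by blast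
      qed
    qed
    show "bij_betw g (edges G) {0..<15}"
    proof (rule bij_betw_byWitness[where f' = \<eta>])
      show "\<forall>e\<in>edges G. \<eta> (g e) = e" using E g\<eta> by auto
      show "\<forall>a\<in>{0..<15}. g (\<eta> a) = a" using g\<eta> by simp
      show "g ` edges G \<subseteq> {0..<15}" using E g\<eta> by auto
      show "\<eta> ` {0..<15} \<subseteq> edges G" using E by auto
    qed
    fix e assume "e \<in> edges G"
    then obtain a where a: "a < 15" "e = \<eta> a" using E by blast
    interpret Pg: loopless_graph Pg by (rule loopless_Pg)
    obtain i j where ij: "ends Pg a = (i, j)" by fastforce
    have l: "i < 10" "j < 10" "i \<noteq> j" using Pg.ends_in_verts[of a] Pg.loopless[of a] a ij by auto
    have "a \<in> star Pg i" "a \<in> star Pg j" using a ij by (simp_all add: in_star_iff)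
    then have st: "a \<in> Pg_stars ! i" "a \<in> Pg_stars ! j" using star_Pg l by auto
    obtain x where x: "part i = {x}" using s[OF l(1)] by (rule is_singletonE)
    obtain y where y: "part j = {y}" using s[OF l(2)] by (rule is_singletonE)
    have xy: "x \<noteq> y" using part_disjoint[OF l(1,2)] x y l(3) by blast
    have "e \<in> cut G {x}" "e \<in> cut G {y}" using cut_part[OF l(1)] cut_part[OF l(2)] st x y a by auto
    then have "ends G e = (x, y) \<or> ends G e = (y, x)" using xy by (cases "ends G e") (auto simp: in_cut_iff)
    moreover have "f x = i" "f y = j" using f l x y by auto
    ultimately show "ends Pg (g e) = map_prod f f (ends G e) \<or> ends Pg (g e) = prod.swap (map_prod f f (ends G e))"
      using ij g\<eta>[OF a(1)] a(2) by auto
  qed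
  moreover have "\<forall>i<10. \<forall>x. part i = {x} \<longrightarrow> f x = i" using f by blast
  ultimately show ?thesis using g\<eta> by blast
qed

section \<open>Contracting one part of a decomposition along \<open>Pg\<close>\<close>

context
  fixes i x
  assumes i: "i < 10" "i \<notin> C_verts" and x: "x \<in> part i"
begin

lemma shrink_part_prems:
  "part i \<subseteq> verts G" "card (cut G (part i)) = 3" "x \<in> part i \<or> x \<notin> verts G"
  using part_sub[OF i(1)] card_cut_part[OF i(1)] x by auto

lemma notin_other: "j < 10 \<Longrightarrow> j \<noteq> i \<Longrightarrow> y \<in> part j \<Longrightarrow> y \<in> verts G - part i \<and> y \<noteq> x"
  using part_disjoint[OF i(1), of j y] part_sub[of j] x by blast

lemma shrink_part_cut: "j < 10 \<Longrightarrow> cut (shrink G (part i) x) ((part(i := {x})) j) = cut G (part j)"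
proof -
  assume j: "j < 10"
  have "(part(i := {x})) j \<subseteq> verts (shrink G (part i) x)"
    using notin_other[OF j] by (auto simp: shrink_def)
  note c = shrink_cut[OF shrink_part_prems this]
  show ?thesis
  proof (cases "j = i")
    case True
    then show ?thesis unfolding c by simp
  next
    case False
    then have "x \<notin> part j" using notin_other[OF j] by blast
    then show ?thesis unfolding c using False by simp
  qed
qed

lemma petersen_parts_shrink: "petersen_parts (shrink G (part i) x) (part(i := {x})) \<eta> c"
proof -
  let ?G = "shrink G (part i) x" and ?p = "part(i := {x})"
  interpret S: bridgeless_cubic ?G by (rule bridgeless_cubic_shrink[OF shrink_part_prems])
  show ?thesis
  proof unfold_locales
    show "?p j \<noteq> {}" if "j < 10" for j using part_nonempty[OF that] by simp
    show "j = k" if "j < 10" "k < 10" "y \<in> ?p j" "y \<in> ?p k" for j k y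
      using that part_disjoint[OF that(1,2), of y] notin_other[of j y] notin_other[of k y] by (auto split: if_splits)
    show "(\<Union>j<10. ?p j) = verts ?G"
    proof (intro set_eqI iffI)
      fix y assume "y \<in> (\<Union>j<10. ?p j)"
      then obtain j where j: "j < 10" "y \<in> ?p j" by blast
      then show "y \<in> verts ?G" using notin_other[of j y] by (cases "j = i") (auto simp: shrink_def)
    next
      fix y assume y: "y \<in> verts ?G"
      show "y \<in> (\<Union>j<10. ?p j)"
      proof (cases "y = x")
        case True
        then show ?thesis using i(1) by auto
      next
        case False
        then have yV: "y \<in> verts G" "y \<notin> part i" using y by (auto simp: shrink_def)
        obtain j where "j < 10" "y \<in> part j" by (rule part_ex[OF yV(1)])
        then show ?thesis using yV(2) by (intro UN_I[of j]) (auto split: if_splits)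
      qed
    qed
    show "inj_on \<eta> {0..<15}" by (rule inj_\<eta>)
    show "cut ?G (?p j) = \<eta> ` (Pg_stars ! j)" if "j < 10" for j
      using shrink_part_cut[OF that] cut_part[OF that] by simp
    show "\<exists>y. ?p j = {y}" if "j \<in> C_verts" for j using single[OF that] by simp
    show "proper_on ?G c (?p j)" if j: "j < 10" "j \<notin> C_verts" for j
    proof (cases "j = i")
      case True
      have "bij_betw c (cut G (part i)) {..<3}" by (rule cut3_bij[OF colour[OF i] shrink_part_prems(1,2)])
      then show ?thesis using True shrink_star_x[OF shrink_part_prems] by (simp add: proper_on_def)
    next
      case False
      have "part j \<inter> part i = {}" "x \<notin> part j" using notin_other[OF j(1) False] by blast+
      then show ?thesis using False shrink_proper[OF shrink_part_prems colour[OF j] part_sub[OF j(1)]] by simp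
    qed
  qed
qed

lemma minimal_leaves_shrink:
  assumes "minimal_leaves G part \<eta>"
  shows "minimal_leaves (shrink G (part i) x) (part(i := {x})) \<eta>"
  unfolding minimal_leaves_def
proof (intro ballI impI)
  fix j y e e' assume j: "j \<in> {3, 5, 6}" and y: "y \<in> (part(i := {x})) j"
    and e: "e \<in> Pg_stars ! j - Pg_stars ! 8" "e' \<in> Pg_stars ! j - Pg_stars ! 8" "e \<noteq> e'"
      "\<eta> e \<in> star (shrink G (part i) x) y" "\<eta> e' \<in> star (shrink G (part i) x) y"
  show "(part(i := {x})) j = {y}"
  proof (cases "j = i")
    case False
    have "j < 10" using j by auto
    then have yV: "y \<in> verts G - part i \<and> y \<noteq> x" using notin_other False y by simp
    then have "star (shrink G (part i) x) y = star G y"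
      by (intro shrink_star_other[OF shrink_part_prems]) auto
    then have "part j = {y}" using assms j y e False unfolding minimal_leaves_def by auto
    then show ?thesis using False by simp
  qed (use y in simp)
qed

lemma no_full_cut_matching_shrink:
  assumes "no_full_cut_matching G part"
  shows "no_full_cut_matching (shrink G (part i) x) (part(i := {x}))"
  unfolding no_full_cut_matching_def
proof (intro ballI notI)
  let ?G = "shrink G (part i) x" and ?p = "part(i := {x})"
  fix j :: nat assume j: "j \<in> {3, 5, 6, 8}" and "\<exists>F. F \<subseteq> edges ?G \<and> covers_once ?G F (?p j) \<and> cut ?G (?p j) \<subseteq> F"
  then obtain F where F: "F \<subseteq> edges ?G" "covers_once ?G F (?p j)" "cut ?G (?p j) \<subseteq> F" by blast
  have j10: "j < 10" using j by auto
  note ct = shrink_part_cut[OF j10]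
  show False
  proof (cases "j = i")
    case True
    \<comment> \<open>After the contraction the cut is the star of \<open>x\<close>; a set
      containing all of it meets this star in three edges, not in one.\<close>
    have "star ?G x = cut G (part i)" by (rule shrink_star_x[OF shrink_part_prems])
    then have "F \<inter> star ?G x = cut G (part i)" using F(3) ct True by auto
    moreover have "card (F \<inter> star ?G x) = 1" using F(2) True by (simp add: covers_once_def)
    ultimately show False using shrink_part_prems(2) by simp
  next
    case False
    have "star ?G y = star G y" if "y \<in> part j" for y
      by (rule shrink_star_other[OF shrink_part_prems]) (use notin_other[OF j10 False that] in auto)
    then have "covers_once G F (part j)" using F(2) False by (simp add: covers_once_def)
    moreover have "F \<subseteq> edges G" using F(1) by (auto simp: shrink_def)
    moreover have "cut G (part j) \<subseteq> F" using F(3) unfolding ct .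
    ultimately show False using assms j unfolding no_full_cut_matching_def by blast
  qed
qed

end

end

text \<open>Induction on the number of parts that are not single vertices; each of them costs one
  operation. The statement about names is what allows this operation: a contracted part carries its
  Petersen number, and the edges charged to a single-vertex part carry theirs.\<close>

theorem petersen_parts_construction:
  fixes G :: "(nat, nat) graph"
  assumes "petersen_parts G part \<eta> c" "minimal_leaves G part \<eta>" "no_full_cut_matching G part"
  shows "\<exists>H f g. pg_constr H \<and> iso_by f g G H \<and> (\<forall>i<10. \<forall>x. part i = {x} \<longrightarrow> f x = i) \<and>
    (\<forall>e<15. e \<notin> C_edges \<longrightarrow> is_singleton (part (owner e)) \<longrightarrow> g (\<eta> e) = e)"
  using assms
proof (induction "card {i\<in>{3, 5, 6, 8}. \<not> is_singleton (part i)}" arbitrary: G part rule: less_induct)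
  case less
  interpret petersen_parts G part \<eta> c by fact
  show ?case
  proof (cases "\<exists>i<10. \<not> is_singleton (part i)")
    case False
    then have "\<And>i. i < 10 \<Longrightarrow> is_singleton (part i)" by blast
    then obtain f g where "iso_by f g G Pg" "\<forall>i<10. \<forall>x. part i = {x} \<longrightarrow> f x = i" "\<forall>e<15. g (\<eta> e) = e"
      using iso_Pg by blast
    then show ?thesis using pg_constr.base by blast
  next
    case True
    then obtain i where i: "i < 10" "\<not> is_singleton (part i)" by blast
    have iC: "i \<notin> C_verts" using single[of i] i(2) by (auto simp: is_singleton_def)
    have i4: "i \<in> {3, 5, 6, 8}" using not_C_verts[OF i(1)] iC by simp
    define P where "P = part i"
    have PV: "P \<subseteq> verts G" "card (cut G P) = 3" "P \<noteq> {}"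
      using part_sub card_cut_part part_nonempty i(1) by (auto simp: P_def)
    have colP: "proper_on G c P" unfolding P_def by (rule colour[OF i(1) iC])
    have noP: "\<nexists>F. F \<subseteq> edges G \<and> covers_once G F P \<and> cut G P \<subseteq> F"
      using less.prems(3) i4 unfolding no_full_cut_matching_def P_def by blast
    have inP: "\<eta> e \<notin> inside G P" if "e < 15" for e using \<eta>_not_inside[OF that i(1)] by (simp add: P_def)
    have ow: "owner e < 10" for e by (simp add: owner_def)
    have \<eta>E: "\<eta> e \<in> edges G" if e: "e < 15" for e
    proof -
      obtain j where "j < 10" "e \<in> Pg_stars ! j" using Pg_stars_cover[OF e] by blast
      then show ?thesis using cut_part[of j] cut_subset[of G "part j"] by blast
    qed
    \<comment> \<open>Once part \<open>i\<close> is contracted, the induction hypothesis also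
      guarantees the names of the edges charged to \<open>i\<close>; one of these is available for
      an insertion.\<close>
    have IH: "\<exists>H f g. pg_constr H \<and> iso_by f g (shrink G P x) H \<and> f x = i \<and>
        (\<forall>j<10. \<forall>y. j \<noteq> i \<longrightarrow> part j = {y} \<longrightarrow> f y = j) \<and>
        (\<forall>e<15. e \<notin> C_edges \<longrightarrow> owner e = i \<or> is_singleton (part (owner e)) \<longrightarrow> g (\<eta> e) = e)"
      if x: "x \<in> P" for x
    proof -
      have xi: "x \<in> part i" using x by (simp add: P_def)
      have sub: "{j\<in>{3, 5, 6, 8}. \<not> is_singleton ((part(i := {x})) j)} = {j\<in>{3, 5, 6, 8}. \<not> is_singleton (part j)} - {i}"
        by auto
      have "card {j\<in>{3, 5, 6, 8}. \<not> is_singleton ((part(i := {x})) j)} < card {j\<in>{3, 5, 6, 8}. \<not> is_singleton (part j)}"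
        unfolding sub by (rule card_Diff1_less) (use i i4 in auto)
      from less.hyps[OF this petersen_parts_shrink[OF i(1) iC xi] minimal_leaves_shrink[OF i(1) iC xi less.prems(2)]
          no_full_cut_matching_shrink[OF i(1) iC xi less.prems(3)]]
      obtain H f g where H: "pg_constr H" "iso_by f g (shrink G P x) H"
        and f: "\<forall>j<10. \<forall>y. (part(i := {x})) j = {y} \<longrightarrow> f y = j"
        and g: "\<forall>e<15. e \<notin> C_edges \<longrightarrow> is_singleton ((part(i := {x})) (owner e)) \<longrightarrow> g (\<eta> e) = e"
        unfolding P_def by blast
      have "f x = i" using f[rule_format, of i x] i(1) by simp
      moreover have "f y = j" if "j < 10" "j \<noteq> i" "part j = {y}" for j y
        using f[rule_format, of j y] that by simp
      moreover have "g (\<eta> e) = e" if "e < 15" "e \<notin> C_edges" "owner e = i \<or> is_singleton (part (owner e))" for e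
        using g[rule_format, OF that(1,2)] that(3) by (cases "owner e = i") auto
      ultimately show ?thesis using H by blast
    qed
    have other: "y \<in> verts G - P" if "j < 10" "j \<noteq> i" "part j = {y}" for j y
      using notin_other[OF i(1) iC _ that(1,2), of _ y] that(3) PV(3) unfolding P_def by blast
    show ?thesis
    proof (cases "\<exists>x\<in>P. \<exists>a\<in>Pg_stars ! i. \<exists>a'\<in>Pg_stars ! i. a \<noteq> a' \<and> \<eta> a \<in> star G x \<and> \<eta> a' \<in> star G x")
      \<comment> \<open>No vertex of \<open>P\<close> carries two edges of the cut: the part is
        restored by a correct substitution.\<close>
      case False
      obtain x where x: "x \<in> P" using PV(3) by blast
      obtain v where v: "v \<in> verts G" "v \<notin> P"
      proof -
        have "P \<noteq> verts G" using PV(2) cut_verts by auto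
        then show thesis using that PV(1) by blast
      qed
      have one: "e = e'" if e: "p \<in> P" "e \<in> cut G P" "e' \<in> cut G P" "e \<in> star G p" "e' \<in> star G p" for p e e'
      proof -
        have "e \<in> \<eta> ` (Pg_stars ! i)" "e' \<in> \<eta> ` (Pg_stars ! i)" using e(2,3) cut_part[OF i(1)] by (simp_all add: P_def)
        then obtain a a' where a: "a \<in> Pg_stars ! i" "e = \<eta> a" "a' \<in> Pg_stars ! i" "e' = \<eta> a'" by blast
        have "a = a'" using False e(1,4,5) a by blast
        then show ?thesis using a by simp
      qed
      obtain H1 f1 g1 where H1: "pg_constr H1" "iso_by f1 g1 (shrink G P x) H1" "f1 x = i"
        and f1: "\<forall>j<10. \<forall>y. j \<noteq> i \<longrightarrow> part j = {y} \<longrightarrow> f1 y = j"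
        and g1: "\<forall>e<15. e \<notin> C_edges \<longrightarrow> owner e = i \<or> is_singleton (part (owner e)) \<longrightarrow> g1 (\<eta> e) = e"
        using IH[OF x] by blast
      have fx: "f1 x \<in> verts Pg - C_verts" using H1(3) i(1) iC by simp
      have K: "correct_for (shrink G (verts G - P) v) v" "quasi_bipartite (shrink G (verts G - P) v)"
        by (rule shrink_compl_correct[OF PV(1,2) v _ noP], erule one, assumption+)+
      from substitution_step[OF bridgeless_cubic_axioms PV(1,2) x v K
          shrink_compl_colourable[OF PV(1,2) v colP] H1(2,1) fx]
      obtain H f g where H: "pg_constr H" "iso_by f g G H" and f: "\<forall>y\<in>verts G - P. f y = f1 y"
        and g: "\<forall>e\<in>edges G - inside G P. g e = g1 e" by blast
      have "f y = j" if j: "j < 10" "part j = {y}" for j y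
      proof -
        have "j \<noteq> i" using j i(2) by (auto simp: is_singleton_def)
        then show ?thesis using f f1 j other[OF j(1) _ j(2)] by simp
      qed
      moreover have "g (\<eta> e) = e" if "e < 15" "e \<notin> C_edges" "is_singleton (part (owner e))" for e
        using g g1 that inP \<eta>E by simp
      ultimately show ?thesis using H by blast
    next
      case True
      then obtain x a a' where x: "x \<in> P" and a: "a \<in> Pg_stars ! i" "a' \<in> Pg_stars ! i" "a \<noteq> a'"
        and st: "\<eta> a \<in> star G x" "\<eta> a' \<in> star G x" by blast
      \<comment> \<open>In a leaf, the two edges meeting at \<open>x\<close> cannot both lead to
        \<open>C\<close>, by minimality. So one of them leads to the centre, and the third edge
        \<open>b\<close> leads to \<open>C\<close> and is charged to this leaf.\<close>
      have leaf: "\<not> (a \<notin> Pg_stars ! 8 \<and> a' \<notin> Pg_stars ! 8)" if "i \<in> {3, 5, 6}"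
      proof
        assume "a \<notin> Pg_stars ! 8 \<and> a' \<notin> Pg_stars ! 8"
        then have "part i = {x}" using less.prems(2) that x a st unfolding minimal_leaves_def P_def by blast
        then show False using i(2) by (simp add: is_singleton_def)
      qed
      have "\<exists>b. Pg_stars ! i = {a, a', b} \<and> b \<noteq> a \<and> b \<noteq> a' \<and> owner b = i \<and> b \<notin> C_edges \<and> b < 15"
      proof -
        consider "i = 3" | "i = 5" | "i = 6" | "i = 8" using i4 by blast
        then show ?thesis
        proof cases
          case 1
          then have "a \<in> {2,3,8}" "a' \<in> {2,3,8}" "a = 8 \<or> a' = 8" using a leaf by (auto simp: Pg_stars_def)
          \<comment> \<open>The third edge of the star is found from the sum of its edge numbers:
            13, 28, 31 and 32 for the vertices 3, 5, 6 and 8.\<close>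
          then show ?thesis using a(3) 1 by (intro exI[of _ "13 - (a + a')"]) (auto simp: Pg_stars_def owner_def C_edges_def)
        next
          case 2
          then have "a \<in> {5,10,13}" "a' \<in> {5,10,13}" "a = 13 \<or> a' = 13" using a leaf by (auto simp: Pg_stars_def)
          then show ?thesis using a(3) 2 by (intro exI[of _ "28 - (a + a')"]) (auto simp: Pg_stars_def owner_def C_edges_def)
        next
          case 3
          then have "a \<in> {6,11,14}" "a' \<in> {6,11,14}" "a = 11 \<or> a' = 11" using a leaf by (auto simp: Pg_stars_def)
          then show ?thesis using a(3) 3 by (intro exI[of _ "31 - (a + a')"]) (auto simp: Pg_stars_def owner_def C_edges_def)
        next
          case 4
          then have "a \<in> {8,11,13}" "a' \<in> {8,11,13}" using a by (auto simp: Pg_stars_def)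
          then show ?thesis using a(3) 4 by (intro exI[of _ "32 - (a + a')"]) (auto simp: Pg_stars_def owner_def C_edges_def)
        qed
      qed
      then obtain b where b: "Pg_stars ! i = {a, a', b}" "b \<noteq> a" "b \<noteq> a'" "owner b = i" "b \<notin> C_edges" "b < 15" by blast
      have cutP: "cut G P = {\<eta> a, \<eta> a', \<eta> b}" using cut_part[OF i(1)] b(1) by (simp add: P_def)
      have l15: "a < 15" "a' < 15" using Pg_stars_less[OF i(1)] a by blast+
      have "P \<noteq> {x}" using i(2) by (auto simp: P_def is_singleton_def)
      moreover have "\<eta> b \<noteq> \<eta> a" "\<eta> b \<noteq> \<eta> a'" "\<eta> a \<noteq> \<eta> a'" using \<eta>_eq_iff l15 b(2,3,6) a(3) by auto
      ultimately obtain f0 where f0: "f0 \<noteq> \<eta> b" "f0 \<in> star G x" "f0 \<in> inside G P" "cut G (P - {x}) = {f0, \<eta> b}"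
        using two_cut_of_double_attachment[OF PV(1) cutP _ _ _ x _ st] by blast
      have "insertion_part G P x f0 (\<eta> b) c"
      proof unfold_locales
        show "P \<subseteq> verts G" "card (cut G P) = 3" "x \<in> P" by (fact PV x)+
        show "cut G (P - {x}) = {f0, \<eta> b}" "f0 \<noteq> \<eta> b" "f0 \<in> star G x" "f0 \<in> inside G P" by (fact f0)+
        show "\<eta> b \<in> cut G P" by (simp add: cutP)
        show "proper_on G c (P - {x})" by (rule proper_on_mono[OF colP]) blast
      qed
      then interpret I: insertion_part G P x f0 "\<eta> b" c .
      obtain H1 f1 g1 where H1: "pg_constr H1" "iso_by f1 g1 (shrink G P x) H1" "f1 x = i"
        and f1: "\<forall>j<10. \<forall>y. j \<noteq> i \<longrightarrow> part j = {y} \<longrightarrow> f1 y = j"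
        and g1: "\<forall>e<15. e \<notin> C_edges \<longrightarrow> owner e = i \<or> is_singleton (part (owner e)) \<longrightarrow> g1 (\<eta> e) = e"
        using IH[OF x] by blast
      have "g1 (\<eta> b) \<in> edges Pg - C_edges" using g1 b by simp
      from I.insertion_step[OF H1(2,1) this]
      obtain H f g where H: "pg_constr H" "iso_by f g G H" and f: "\<forall>y\<in>verts G - I.Y. f y = f1 y"
        and g: "\<forall>e\<in>edges G - inside G P - {\<eta> b}. g e = g1 e" by blast
      have "f y = j" if j: "j < 10" "part j = {y}" for j y
      proof -
        have ji: "j \<noteq> i" using j i(2) by (auto simp: is_singleton_def)
        then have "y \<in> verts G - I.Y" using other[OF j(1) _ j(2)] by (auto simp: I.Y_def)
        then show ?thesis using f f1 j ji by simp
      qed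
      moreover have "g (\<eta> e) = e" if e: "e < 15" "e \<notin> C_edges" "is_singleton (part (owner e))" for e
      proof -
        \<comment> \<open>The insertion gives up the name of \<open>\<eta> b\<close>. No promise is
          broken, because \<open>b\<close> is charged to part \<open>i\<close>, which is not a
          single vertex.\<close>
        have "e \<noteq> b" using e(3) b(4) i(2) by auto
        then have "\<eta> e \<noteq> \<eta> b" using \<eta>_eq_iff e(1) b(6) by simp
        then have "g (\<eta> e) = g1 (\<eta> e)" using g inP \<eta>E e(1) by simp
        then show ?thesis using g1 e by simp
      qed
      ultimately show ?thesis using H by blast
    qed
  qed
qed

lemma hexagon_cut:
  assumes "hexagon G h k out"
  shows "cut G (h ` {..<6}) \<subseteq> out ` {..<6}"
proof
  note d = assms[unfolded hexagon_def]
  fix e assume e: "e \<in> cut G (h ` {..<6})"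
  then obtain v w where "v \<in> h ` {..<6}" "e \<in> star G v" by (rule cut_starE)
  then obtain i where i: "i < 6" "e \<in> star G (h i)" by blast
  have "e \<noteq> k j" if j: "j < 6" for j
  proof
    assume "e = k j"
    then have "endpts G e = {h j, h ((j + 1) mod 6)}" using d j by blast
    moreover have "(j + 1) mod 6 < 6" by simp
    ultimately have "endpts G e \<subseteq> h ` {..<6}" using j by blast
    then show False using e by (auto simp: in_cut_iff endpts_def)
  qed
  moreover have "(i + 5) mod 6 < 6" by simp
  ultimately have "e = out i" using d i by blast
  then show "e \<in> out ` {..<6}" using i by blast
qed

theorem defect_three_construction:
  fixes G :: "(nat, nat) graph"
  assumes "defect_three G m"
  shows "\<exists>H. pg_constr H \<and> isomorphic G H"
proof -
  interpret defect_three G m by fact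
  obtain h k out c where hex: "hexagon G h k out" and col: "proper_on G c (verts G - h ` {..<6})"
    and no: "\<nexists>F. F \<subseteq> inside G (verts G - h ` {..<6}) \<and> covers_once G F (verts G - h ` {..<6})"
    using hexagon_structure by blast
  have h: "h ` {..<6} \<subseteq> verts G" "card (h ` {..<6}) = 6" using hex by (auto simp: hexagon_def card_image)
  have "card (cut G (h ` {..<6})) \<le> card (out ` {..<6})" by (rule card_mono[OF _ hexagon_cut[OF hex]]) simp
  also have "\<dots> \<le> 6" using card_image_le[of "{..<6::nat}" out] by simp
  finally have "card (cut G (h ` {..<6})) \<le> 6" .
  then obtain S where S: "S \<subseteq> verts G - h ` {..<6}" "\<forall>D\<in>comps G (verts G - h ` {..<6} - S). card (cut G D) = 3"
      "card (comps G (verts G - h ` {..<6} - S)) = card S + 2" "inside G S = {}" "cut G S \<inter> cut G (h ` {..<6}) = {}"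
    using tight_barrier[OF h(1) _ _ no] h(2) by auto
  interpret hex_graph G h k out c S
    by unfold_locales (use hex col not_colourable S in blast)+
  obtain part \<eta> where pp: "petersen_parts G part \<eta> c" "minimal_leaves G part \<eta>"
    using petersen_parts_exist by blast
  interpret pp: petersen_parts G part \<eta> c by (rule pp(1))
  have "no_full_cut_matching G part"
    unfolding no_full_cut_matching_def
  proof (intro ballI notI)
    fix i :: nat assume "i \<in> {3, 5, 6, 8}"
    then have i: "i < 10" "i \<notin> C_verts" by (auto simp: C_verts_def)
    assume "\<exists>F. F \<subseteq> edges G \<and> covers_once G F (part i) \<and> cut G (part i) \<subseteq> F"
    then obtain F where "F \<subseteq> edges G" "covers_once G F (part i)" "cut G (part i) \<subseteq> F" by blast
    from pp.four_cover[OF i this] obtain m' where "\<forall>j<4. perfect_matching G (m' j)"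
      and "\<forall>e\<in>edges G. \<exists>j<4::nat. e \<in> m' j" by blast
    then show False using no_four_cover[of m'] by blast
  qed
  then show ?thesis using petersen_parts_construction[OF pp] by (auto simp: isomorphic_iff)
qed

text \<open>Used to pass to a copy over the natural numbers, the type over which
  \<open>pg_constr\<close> is defined.\<close>

lemma defect_three_iso:
  fixes G :: "('a, 'b) graph" and H :: "('c, 'd) graph"
  assumes "defect_three G m" "iso_by f g G H"
  shows "defect_three H (\<lambda>i. g ` m i)"
proof -
  interpret defect_three G m by fact
  have bH: "bridgeless_cubic H" by (rule bridgeless_cubic_iso[OF bridgeless_cubic_axioms assms(2)])
  interpret H: bridgeless_cubic H by (rule bH)
  have inj: "inj_on g (edges G)" and gE: "edges H = g ` edges G" using assms(2) by (auto simp: iso_by_def bij_betw_def)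
  note pmi = perfect_matching_iso[OF assms(2) loopless_graph_axioms H.loopless_graph_axioms]
  have unc: "{e\<in>edges H. \<forall>i<n. e \<notin> g ` M i} = g ` {e\<in>edges G. \<forall>i<n. e \<notin> M i}"
    if "\<forall>i<n. M i \<subseteq> edges G" for n :: nat and M
  proof -
    have "g e \<in> g ` M i \<longleftrightarrow> e \<in> M i" if "i < n" "e \<in> edges G" for i e
      using inj_on_image_mem_iff[OF inj that(2)] \<open>\<forall>i<n. M i \<subseteq> edges G\<close> that(1) by blast
    then show ?thesis unfolding gE by auto
  qed
  have pull: "\<exists>M. (\<forall>i<n. perfect_matching G (M i)) \<and> {e\<in>edges H. \<forall>i<n. e \<notin> m' i} = g ` {e\<in>edges G. \<forall>i<n. e \<notin> M i}"
    if m': "\<forall>i<n. perfect_matching H (m' i)" for n :: nat and m'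
  proof -
    define M where "M i = {e\<in>edges G. g e \<in> m' i}" for i
    have ME: "M i \<subseteq> edges G" for i by (auto simp: M_def)
    have gM: "g ` M i = m' i" if "i < n" for i
    proof -
      have "m' i \<subseteq> g ` edges G" using m' that unfolding H.perfect_matching_iff gE by blast
      then show ?thesis unfolding M_def by blast
    qed
    have "perfect_matching G (M i)" if "i < n" for i using pmi[OF ME] gM[OF that] m' that by metis
    moreover have "{e\<in>edges H. \<forall>i<n. e \<notin> m' i} = {e\<in>edges H. \<forall>i<n. e \<notin> g ` M i}" using gM by simp
    then have "{e\<in>edges H. \<forall>i<n. e \<notin> m' i} = g ` {e\<in>edges G. \<forall>i<n. e \<notin> M i}" unfolding unc[OF allI[OF impI[OF ME]]] .
    ultimately show ?thesis by blast
  qed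
  show ?thesis
  proof unfold_locales
    fix m' :: "nat \<Rightarrow> 'd set" assume "\<forall>i<3. perfect_matching H (m' i)"
    from pull[OF this] obtain M where M: "\<forall>i<3. perfect_matching G (M i)"
      "{e\<in>edges H. \<forall>i<3. e \<notin> m' i} = g ` {e\<in>edges G. \<forall>i<3::nat. e \<notin> M i}" by blast
    have "inj_on g {e\<in>edges G. \<forall>i<3::nat. e \<notin> M i}" by (rule inj_on_subset[OF inj]) blast
    then show "3 \<le> card {e\<in>edges H. \<forall>i<3::nat. e \<notin> m' i}"
      unfolding M(2) using defect_ge3[OF M(1)] by (simp add: card_image)
  next
    fix i :: nat assume i: "i < 3"
    then have "m i \<subseteq> edges G" using pm perfect_matching_iff by blast
    then show "perfect_matching H (g ` m i)" using pmi pm[OF i] by blast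
  next
    have "\<forall>i<3. m i \<subseteq> edges G" using pm perfect_matching_iff by blast
    note u = unc[OF this]
    have "inj_on g {e\<in>edges G. \<forall>i<3::nat. e \<notin> m i}" by (rule inj_on_subset[OF inj]) blast
    then show "card {e\<in>edges H. \<forall>i<3::nat. e \<notin> g ` m i} = 3"
      unfolding u using card_unc by (simp add: card_image)
  next
    fix m' :: "nat \<Rightarrow> 'd set" assume "\<forall>i<4. perfect_matching H (m' i)"
    from pull[OF this] obtain M where M: "\<forall>i<4. perfect_matching G (M i)"
      "{e\<in>edges H. \<forall>i<4. e \<notin> m' i} = g ` {e\<in>edges G. \<forall>i<4::nat. e \<notin> M i}" by blast
    then show "\<exists>e\<in>edges H. \<forall>i<4::nat. e \<notin> m' i" using no_four_cover[OF M(1)] by blast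
  qed
qed

text \<open>Petersen's theorem makes the set of 3-arrays nonempty, so the minimum that defines
  \<open>df\<close> is attained by some array.\<close>

lemma defect_three_exists:
  assumes G: "bridgeless_cubic G" and df: "df G = 3" and pi: "pm_index G = 5"
  shows "\<exists>m. defect_three G m"
proof -
  interpret bridgeless_cubic G by (rule G)
  let ?A = "(\<lambda>A. card (uncovered G A)) ` {A. three_array G A}"
  have fin: "finite ?A" by (rule finite_df_image[OF finite_edges])
  obtain M where "perfect_matching G M" using perfect_matching_exists by blast
  then have "three_array G (M, M, M)" by (simp add: three_array_def)
  then have "Min ?A \<in> ?A" using fin by (intro Min_in) blast+
  then obtain A where A: "three_array G A" "card (uncovered G A) = 3" using df by (auto simp: df_def)
  obtain m where m: "A = (m 0, m 1, m (2::nat))" "\<forall>i<3. perfect_matching G (m i)"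
    by (rule three_array_fun[OF A(1)])
  have "defect_three G m"
  proof unfold_locales
    fix m' :: "nat \<Rightarrow> 'b set" assume "\<forall>i<3. perfect_matching G (m' i)"
    then have "card (uncovered G (m' 0, m' 1, m' 2)) \<in> ?A" unfolding three_array_iff[symmetric] by blast
    then have "3 \<le> card (uncovered G (m' 0, m' 1, m' 2))" using Min_le[OF fin] df by (simp add: df_def)
    then show "3 \<le> card {e\<in>edges G. \<forall>i<3::nat. e \<notin> m' i}" unfolding uncovered_eq .
  next
    show "perfect_matching G (m i)" if "i < 3" for i using m(2) that by blast
    show "card {e\<in>edges G. \<forall>i<3::nat. e \<notin> m i} = 3" using A(2) unfolding m(1) uncovered_eq .
  next
    fix m' :: "nat \<Rightarrow> 'b set" assume m': "\<forall>i<4. perfect_matching G (m' i)"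
    show "\<exists>e\<in>edges G. \<forall>i<4::nat. e \<notin> m' i"
    proof (rule ccontr)
      assume n: "\<not> (\<exists>e\<in>edges G. \<forall>i<4::nat. e \<notin> m' i)"
      have s: "set (map m' [0..<4]) = m' ` {0..<4}" by simp
      have "\<Union>(set (map m' [0..<4])) = edges G"
        unfolding s using n m' unfolding perfect_matching_def by fastforce
      moreover have "\<forall>M\<in>set (map m' [0..<4]). perfect_matching G M" unfolding s using m' by simp
      moreover have "length (map m' [0..<4]) = 4" by simp
      ultimately have "pm_index G \<le> 4" unfolding pm_index_def by (intro Least_le) blast
      then show False using pi by simp
    qed
  qed
  then show ?thesis by blast
qed

lemma nat_copy:
  assumes "wf_graph G"
  shows "\<exists>f g. \<exists>H :: (nat, nat) graph. iso_by f g G H"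
proof -
  obtain f :: "_ \<Rightarrow> nat" where f: "inj_on f (verts G)"
    using assms finite_imp_inj_to_nat_seg unfolding wf_graph_def by metis
  obtain g :: "_ \<Rightarrow> nat" where g: "inj_on g (edges G)"
    using assms finite_imp_inj_to_nat_seg unfolding wf_graph_def by metis
  have "iso_by f g G \<lparr>verts = f ` verts G, edges = g ` edges G, ends = (\<lambda>e. map_prod f f (ends G (inv_into (edges G) g e)))\<rparr>"
    using f g by (simp add: iso_by_def bij_betw_def)
  then show ?thesis by blast
qed

theorem theorem6p10:
  fixes G :: "('v, 'e) graph"
  shows "(cubic G \<and> two_connected G \<and> df G = 3 \<and> pm_index G = 5 \<longrightarrow>
            (\<exists>H. pg_constr H \<and> isomorphic G H))
       \<and> (\<forall>H. pg_constr H \<longrightarrow> df H = 3 \<and> pm_index H = 5 \<and> hexagonal_core H C_edges)"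
proof (intro conjI impI allI)
  assume "cubic G \<and> two_connected G \<and> df G = 3 \<and> pm_index G = 5"
  then have G: "bridgeless_cubic G" "df G = 3" "pm_index G = 5" using bridgeless_cubicI by blast+
  then obtain m where m: "defect_three G m" using defect_three_exists by blast
  have "wf_graph G" using G(1) by (simp add: bridgeless_cubic_def cubic_def)
  then obtain f g and G' :: "(nat, nat) graph" where iso: "iso_by f g G G'" using nat_copy by blast
  obtain H where H: "pg_constr H" "isomorphic G' H"
    using defect_three_construction[OF defect_three_iso[OF m iso]] by blast
  then have "isomorphic G H" using iso_by_trans[OF iso] unfolding isomorphic_iff by blast
  then show "\<exists>H. pg_constr H \<and> isomorphic G H" using H by blast
qed (use petersen_like_result[OF petersen_like_constr] in blast)+

end
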